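(* Let $p\in(1,\infty)$, $\gamma\in\mathbb R\setminus\{0\}$, and let $(X,\rho,\mu)$ be a complete doubling and reverse doubling metric measure space. If $f\in L^1_{\mathrm{loc}}(\mu)$, then, for any $\phi\in\{\rho,V\}$, $$\|f\|_{\dot W^{1,p}(\mu)}\lesssim\Big\|\frac{m_f}{\rho\,\phi^\gamma}\Big\|_{L^{p,\infty}(\phi^{\gamma p}V^{-1})}\lesssim\|f\|_{\dot M^{1,p}(\mu)},$$ with implicit constants independent of $f$.
   Context: **Spaces.** A metric measure space $(X,\rho,\mu)$ is a metric space $(X,\rho)$ with a nontrivial Borel measure $\mu$. $B(x,r):=\{y:\rho(x,y)<r\}$, $V(x,r):=\mu(B(x,r))$, and for $x\ne y$, $V(x,y):=V(x,\rho(x,y))$. It is doubling if for some $C_\mu\in[1,\infty)$, $0<V(x,2r)\le C_\mu V(x,r)<\infty$ for all $x\in X$, $r\in(0,\infty)$. It is reverse doubling if there are $a,C_0\in(1,\infty)$ with $V(x,ar)\ge C_0V(x,r)$ for all $x\in X$ and $r\in(0,\operatorname{diam}(X)/a)$. $L^1_{\mathrm{loc}}(\mu)$ is the set of measurable $f:X\to\mathbb R$ with $\mathbf 1_Bf\in L^1(\mu)$ for all balls $B$. All quantities may be $+\infty$. **Oscillations.** $\langle f\rangle_B:=\mu(B)^{-1}\int_Bf\,d\mu$; $m_f(x,r):=\frac1{\mu(B(x,r))}\int_{B(x,r)}|f-\langle f\rangle_{B(x,r)}|\,d\mu$; $m_f(x,y):=m_f(x,\rho(x,y))$. **Weak norms.**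 For a function $G$ and a weight $w\ge0$ on $X\times X$, $\|G\|_{L^{p,\infty}(w)}:=\sup_{\lambda>0}\lambda\big[\iint_{\{|G(x,y)|>\lambda\}}w(x,y)\,d\mu(y)\,d\mu(x)\big]^{1/p}$, the integral being over pairs $x\neq y$. Here $\rho=\rho(x,y)$, $V=V(x,y)$, $m_f=m_f(x,y)$. **Curves and $\dot W^{1,p}$.** $C([0,1];X)$ is the space of continuous curves with the sup distance. $\gamma\in AC([0,1];X)$ if there is $h\in L^1(0,1)$ with $\rho(\gamma(s),\gamma(t))\le\int_s^th(u)\,du$ for all $0\le s<t\le1$; the minimal such $h$ is the metric speed $|\gamma'|$; $\int_\gamma g:=\int_0^1g(\gamma(t))|\gamma'|(t)\,dt$. $AC^q$ is the set of $\gamma\in AC([0,1];X)$ with $|\gamma'|\in L^q(0,1)$. Let $q:=p/(p-1)$. A Borel probability measure $\pi$ on $C([0,1];X)$ is a $q$-test plan if (a) there is a constant $C(\pi)$ with $\pi(\{\gamma:\gamma(t)\in A\})\le C(\pi)\mu(A)$ for all $t\in[0,1]$ and Borel $A\subset X$; (b) $\pi(AC^q)=1$; (c) $\int\int_0^1|\gamma'(t)|^q\,dt\,d\pi(\gamma)<\infty$. A Borel set $\Gamma\subset C([0,1];X)$ is $p$-negligible if $\pi(\Gamma)=0$ for every $q$-test plan $\pi$. A function $g:X\to[0,\infty]$ is a $p$-weak upper gradient of $f$ (in the sense of test plans) if $|f(\gamma(1))-f(\gamma(0))|\le\int_\gamma g$ for all $\gamma\in AC([0,1];X)\setminus\Gamma$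 with some $p$-negligible $\Gamma$. If $f$ has a $p$-weak upper gradient in $L^p(\mu)$, it has a minimal one in the $\mu$-a.e. order, denoted $|\nabla f|_{w,p}$, and $\|f\|_{\dot W^{1,p}(\mu)}:=\||\nabla f|_{w,p}\|_{L^p(\mu)}$; otherwise $\|f\|_{\dot W^{1,p}(\mu)}:=\infty$. **$\dot M^{1,p}$.** $h:X\to[0,\infty]$ is a Hajłasz upper gradient of $f$ if $|f(x)-f(y)|\le\rho(x,y)[h(x)+h(y)]$ for $\mu$-a.e. $x,y\in X$; $\|f\|_{\dot M^{1,p}(\mu)}$ is the infimum of $\|h\|_{L^p(\mu)}$ over all Hajłasz upper gradients $h$ of $f$. $A\lesssim B$ means $A\le CB$ with a positive constant $C$ independent of the main parameters (in particular of $f$). *)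

theory Defs
  imports "HOL-Analysis.Analysis" "HOL-Probability.Probability"
begin

section \<open>Metric measure spaces\<close>

definition metric_measure :: "'a::metric_space measure \<Rightarrow> bool" where
  "metric_measure M \<longleftrightarrow> sets M = sets borel \<and> emeasure M UNIV \<noteq> 0"

definition doubling :: "'a::metric_space measure \<Rightarrow> bool" where
  "doubling M \<longleftrightarrow> (\<exists>C\<ge>1. \<forall>x. \<forall>r>0.
     0 < emeasure M (ball x (2 * r)) \<and>
     emeasure M (ball x (2 * r)) \<le> ennreal C * emeasure M (ball x r) \<and>
     ennreal C * emeasure M (ball x r) < \<infinity>)"

text \<open>The library's \<^const>\<open>diameter\<close> is real-valued, hence meaningless for unbounded sets;
  the diameter is needed here as an element of \<open>[0, \<infinity>]\<close>.\<close>

definition ediam :: "'a::metric_space set \<Rightarrow> ennreal" where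
  "ediam S = (SUP x\<in>S. SUP y\<in>S. ennreal (dist x y))"

definition reverse_doubling :: "'a::metric_space measure \<Rightarrow> bool" where
  "reverse_doubling M \<longleftrightarrow> (\<exists>a>1. \<exists>C>1. \<forall>x::'a. \<forall>r>0.
     ennreal r < ediam (UNIV :: 'a set) / ennreal a \<longrightarrow>
     ennreal C * emeasure M (ball x r) \<le> emeasure M (ball x (a * r)))"

definition L1_loc :: "'a::metric_space measure \<Rightarrow> ('a \<Rightarrow> real) set" where
  "L1_loc M = {f \<in> borel_measurable M. \<forall>x. \<forall>r>0. set_integrable M (ball x r) f}"

text \<open>The volume of the ball centred at \<open>x\<close> with \<open>y\<close> on its boundary sphere. It is real-valued, as
  balls of positive radius have finite positive measure in a doubling space.\<close>

definition vol :: "'a::metric_space measure \<Rightarrow> 'a \<Rightarrow> 'a \<Rightarrow> real" where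
  "vol M x y = measure M (ball x (dist x y))"


section \<open>Oscillations and (weak) Lebesgue norms\<close>

definition average :: "'a measure \<Rightarrow> 'a set \<Rightarrow> ('a \<Rightarrow> real) \<Rightarrow> real" where
  "average M B f = (LINT x:B|M. f x) / measure M B"

definition mean_osc :: "'a::metric_space measure \<Rightarrow> ('a \<Rightarrow> real) \<Rightarrow> 'a \<Rightarrow> real \<Rightarrow> real" where
  "mean_osc M f x r = average M (ball x r) (\<lambda>y. \<bar>f y - average M (ball x r) f\<bar>)"

text \<open>Powers of extended non-negative reals, for exponents \<open>a > 0\<close> only.\<close>

definition epowr :: "ennreal \<Rightarrow> real \<Rightarrow> ennreal" where
  "epowr x a = (if x = \<infinity> then \<infinity> else ennreal (enn2real x powr a))"

definition Lp_norm :: "'a measure \<Rightarrow> real \<Rightarrow> ('a \<Rightarrow> ennreal) \<Rightarrow> ennreal" where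
  "Lp_norm M p g = epowr (\<integral>\<^sup>+ x. epowr (g x) p \<partial>M) (1 / p)"

definition weak_Lp_norm ::
  "'a measure \<Rightarrow> real \<Rightarrow> ('a \<Rightarrow> 'a \<Rightarrow> real) \<Rightarrow> ('a \<Rightarrow> 'a \<Rightarrow> real) \<Rightarrow> ennreal" where
  "weak_Lp_norm M p w G = (SUP l\<in>{0<..}. ennreal l *
     epowr (\<integral>\<^sup>+ x. (\<integral>\<^sup>+ y. ennreal (w x y) * indicator {y. y \<noteq> x \<and> \<bar>G x y\<bar> > l} y \<partial>M) \<partial>M) (1 / p))"


section \<open>Absolutely continuous curves\<close>

text \<open>\<open>C([0,1]; X)\<close> with the supremum distance. Its elements are functions on the real line that
  are \<^const>\<open>undefined\<close> outside \<open>[0,1]\<close>; boundedness is automatic by compactness.\<close>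

definition curve_metric :: "(real \<Rightarrow> 'a::metric_space) metric" where
  "curve_metric = cfunspace (top_of_set {0..1}) euclidean_metric"

definition curve_borel :: "(real \<Rightarrow> 'a::metric_space) measure" where
  "curve_borel = sigma (mspace curve_metric) {U. openin (mtopology_of curve_metric) U}"

definition speed_bound :: "(real \<Rightarrow> 'a::metric_space) \<Rightarrow> (real \<Rightarrow> real) \<Rightarrow> bool" where
  "speed_bound c h \<longleftrightarrow> set_integrable lborel {0<..<1} h \<and>
     (\<forall>s t. 0 \<le> s \<and> s < t \<and> t \<le> 1 \<longrightarrow> dist (c s) (c t) \<le> (LINT u:{s<..<t}|lborel. h u))"

definition AC_curves :: "(real \<Rightarrow> 'a::metric_space) set" where
  "AC_curves = {c \<in> mspace curve_metric. \<exists>h. speed_bound c h}"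

text \<open>The minimal \<open>h\<close> is unique up to a Lebesgue null set; the choice of a representative is
  immaterial, since it is only ever integrated.\<close>

definition metric_speed :: "(real \<Rightarrow> 'a::metric_space) \<Rightarrow> real \<Rightarrow> real" where
  "metric_speed c = (SOME h. speed_bound c h \<and>
     (\<forall>h'. speed_bound c h' \<longrightarrow> (AE u in lborel. u \<in> {0<..<1} \<longrightarrow> h u \<le> h' u)))"

definition curve_integral :: "(real \<Rightarrow> 'a::metric_space) \<Rightarrow> ('a \<Rightarrow> ennreal) \<Rightarrow> ennreal" where
  "curve_integral c g = (\<integral>\<^sup>+ t\<in>{0<..<1}. g (c t) * ennreal (metric_speed c t) \<partial>lborel)"

definition speed_energy :: "real \<Rightarrow> (real \<Rightarrow> 'a::metric_space) \<Rightarrow> ennreal" where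
  "speed_energy q c = (\<integral>\<^sup>+ t\<in>{0<..<1}. ennreal (\<bar>metric_speed c t\<bar> powr q) \<partial>lborel)"

definition ACq_curves :: "real \<Rightarrow> (real \<Rightarrow> 'a::metric_space) set" where
  "ACq_curves q = {c \<in> AC_curves. speed_energy q c < \<infinity>}"


section \<open>Test plans and the homogeneous Sobolev norm\<close>

definition test_plan ::
  "'a::metric_space measure \<Rightarrow> real \<Rightarrow> (real \<Rightarrow> 'a) measure \<Rightarrow> bool" where
  "test_plan M q \<pi> \<longleftrightarrow> prob_space \<pi> \<and> sets \<pi> = sets curve_borel \<and>
     (\<exists>C\<ge>0. \<forall>t\<in>{0..1}. \<forall>A\<in>sets borel.
        emeasure \<pi> {c \<in> space \<pi>. c t \<in> A} \<le> ennreal C * emeasure M A) \<and>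
     (AE c in \<pi>. c \<in> ACq_curves q) \<and>
     (\<integral>\<^sup>+ c. speed_energy q c \<partial>\<pi>) < \<infinity>"

definition negligible_curves ::
  "'a::metric_space measure \<Rightarrow> real \<Rightarrow> (real \<Rightarrow> 'a) set \<Rightarrow> bool" where
  "negligible_curves M p \<Gamma> \<longleftrightarrow> \<Gamma> \<in> sets curve_borel \<and>
     (\<forall>\<pi>. test_plan M (p / (p - 1)) \<pi> \<longrightarrow> emeasure \<pi> \<Gamma> = 0)"

text \<open>Borel measurability of \<open>g\<close> is what makes the integrals of \<open>g\<close> along all curves meaningful.\<close>

definition weak_upper_gradient ::
  "'a::metric_space measure \<Rightarrow> real \<Rightarrow> ('a \<Rightarrow> real) \<Rightarrow> ('a \<Rightarrow> ennreal) \<Rightarrow> bool" where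
  "weak_upper_gradient M p f g \<longleftrightarrow> g \<in> borel_measurable borel \<and>
     (\<exists>\<Gamma>. negligible_curves M p \<Gamma> \<and>
        (\<forall>c \<in> AC_curves - \<Gamma>. ennreal \<bar>f (c 1) - f (c 0)\<bar> \<le> curve_integral c g))"

definition Lp_weak_upper_gradients ::
  "'a::metric_space measure \<Rightarrow> real \<Rightarrow> ('a \<Rightarrow> real) \<Rightarrow> ('a \<Rightarrow> ennreal) set" where
  "Lp_weak_upper_gradients M p f = {g. weak_upper_gradient M p f g \<and> Lp_norm M p g < \<infinity>}"

text \<open>Again, a minimal element is unique only up to a null set.\<close>

definition min_weak_upper_gradient ::
  "'a::metric_space measure \<Rightarrow> real \<Rightarrow> ('a \<Rightarrow> real) \<Rightarrow> 'a \<Rightarrow> ennreal" where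
  "min_weak_upper_gradient M p f = (SOME g. g \<in> Lp_weak_upper_gradients M p f \<and>
     (\<forall>g' \<in> Lp_weak_upper_gradients M p f. AE x in M. g x \<le> g' x))"

definition Sobolev_norm :: "'a::metric_space measure \<Rightarrow> real \<Rightarrow> ('a \<Rightarrow> real) \<Rightarrow> ennreal" where
  "Sobolev_norm M p f =
     (if Lp_weak_upper_gradients M p f = {} then \<infinity>
      else Lp_norm M p (min_weak_upper_gradient M p f))"


section \<open>The homogeneous Hajlasz norm\<close>

definition Hajlasz_gradient ::
  "'a::metric_space measure \<Rightarrow> ('a \<Rightarrow> real) \<Rightarrow> ('a \<Rightarrow> ennreal) \<Rightarrow> bool" where
  "Hajlasz_gradient M f h \<longleftrightarrow> h \<in> borel_measurable M \<and>
     (\<exists>N\<in>null_sets M. \<forall>x\<in>-N. \<forall>y\<in>-N.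
        ennreal \<bar>f x - f y\<bar> \<le> ennreal (dist x y) * (h x + h y))"

definition Hajlasz_norm :: "'a::metric_space measure \<Rightarrow> real \<Rightarrow> ('a \<Rightarrow> real) \<Rightarrow> ennreal" where
  "Hajlasz_norm M p f = (INF h\<in>{h. Hajlasz_gradient M f h}. Lp_norm M p h)"

end

theory Submission
  imports Defs
begin

text \<open>Upper bound: if \<open>h\<close> is a Hajlasz gradient, the oscillation on a ball of radius \<open>r\<close> is at most
  \<open>4 r\<close> times the mean of \<open>h\<close>. On the superlevel set at height \<open>l\<close> the part of \<open>h\<close> below half of
  the relevant threshold may be discarded; Tonelli's theorem then moves the integral to \<open>h\<close>, and the
  remaining kernel is summed over dyadic layers of \<open>\<phi>\<close>. No maximal function is needed.

  Lower bound: by reverse doubling, an annulus of radius \<open>a\<^sup>-\<^sup>k\<close> carries a fixed proportion of the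
  volume, so the weak norm \<open>N\<close> at a single height \<open>l\<close> controls the sum over all scales \<open>k\<close> of the
  integrals of \<open>(l \<phi>\<^sup>\<gamma>)\<^sup>p\<close> over the sets where the oscillation quotient exceeds \<open>l \<phi>\<^sup>\<gamma>\<close>. Of the heights
  \<open>2\<^sup>j\<close> only \<open>O(L)\<close> many matter for the scales between \<open>L\<close> and \<open>2 L\<close>, since a truncated function has
  oscillation quotients between \<open>\<delta>\<close> and \<open>O(a\<^sup>k)\<close>; averaging over these \<open>L\<close> scales gives one at which
  the quotient is bounded in \<open>L\<^sup>p\<close> by a multiple of \<open>N\<close>. Along such scales the ball averages converge
  to \<open>f\<close> almost everywhere, and their increments along a curve are bounded by the integral of the
  quotients. A pointwise dominated sequence of convex combinations of the quotients (uniform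
  convexity in place of weak compactness) yields the weak upper gradient. Finally, weak upper
  gradients are stable under minima and decreasing limits modulo negligible families, so that a
  minimal one exists and its norm is at most that of any other.\<close>

section \<open>Arc length and minimal speed\<close>

text \<open>Passing from a weak to a strong norm normally loses a factor equal to the number of
  dyadic heights involved. Here the number of scales pays for it: one height already controls the
  sum over all scales, so J heights cost J times the bound in total, and for J = O(L) the best of L
  scales has bounded cost. The truncation, the threshold \<delta> and the restriction to a ball
  serve to force J = O(L). They are relaxed along the sequence of scales, while the constants do not
  depend on them.

  A second obstacle lies in the notions. The metric speed and the minimal weak upper gradient are
  picked by the choice operator, so nothing is known about them before a minimal element has been
  constructed. The energy of a curve is not known to be measurable; the class AC^q is shown to be
  Borel through discrete energies, and upper integrals of the energy are estimated through simple
  functions. Finally, the weak upper gradient inequality sees only the endpoints of a curve; to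
  localise it, test plans are pushed forward under restriction to subintervals.\<close>

lemma compact_in_open_mesh:
  fixes K U :: "real set"
  assumes "compact K" "open U" "K \<subseteq> U"
  shows "\<exists>d>0. \<forall>a b. b - a < d \<longrightarrow> {a..b} \<inter> K \<noteq> {} \<longrightarrow> {a..b} \<subseteq> U"
proof -
  obtain e where e: "e > 0" "(\<Union>x\<in>K. ball x e) \<subseteq> U"
    using compact_subset_open_imp_ball_epsilon_subset[OF assms] .
  have "{a..b} \<subseteq> U" if ab: "b - a < e" "{a..b} \<inter> K \<noteq> {}" for a b
  proof -
    obtain x where x: "x \<in> K" "a \<le> x" "x \<le> b" using ab by auto
    have "{a..b} \<subseteq> ball x e" using ab x by (auto simp: dist_real_def)
    then show ?thesis using e x by blast
  qed
  then show ?thesis using e(1) by blast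
qed

text \<open>Inner regularity of M and outer regularity of N reduce the claim to a compact K inside
  an open U. The half-open cells of a fine mesh that meet K cover K and stay in U, and on cells the
  comparison is assumed.\<close>

lemma measure_le_if_Ioc_le:
  fixes M N :: "real measure"
  assumes fin: "finite_measure M" "finite_measure N"
    and sets: "sets M = sets borel" "sets N = sets borel"
    and le: "\<And>a b. a < b \<Longrightarrow> emeasure M {a<..b} \<le> emeasure N {a<..b}"
    and A: "A \<in> sets borel"
  shows "emeasure M A \<le> emeasure N A"
proof -
  note [measurable_cong] = sets
  interpret M: finite_measure M by fact
  interpret N: finite_measure N by fact
  have KU: "emeasure M K \<le> emeasure N U" if K: "compact K" and U: "open U" "K \<subseteq> U" for K U
  proof -
    obtain d where d: "d > 0" "\<And>a b. b - a < d \<Longrightarrow> {a..b} \<inter> K \<noteq> {} \<Longrightarrow> {a..b} \<subseteq> U"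
      using compact_in_open_mesh[OF K U] by metis
    define e where "e = d / 2"
    have e: "e > 0" "e < d" using d by (auto simp: e_def)
    define J where "J = (\<lambda>i::int. {of_int i * e <.. (of_int i + 1) * e})"
    define I where "I = {i. J i \<inter> K \<noteq> {}}"
    obtain R where R: "\<And>x. x \<in> K \<Longrightarrow> \<bar>x\<bar> \<le> R"
      using compact_imp_bounded[OF K] by (auto simp: bounded_real)
    have fI: "finite I"
    proof (rule finite_subset)
      show "I \<subseteq> {\<lfloor>- R / e\<rfloor> - 1 .. \<lceil>R / e\<rceil>}"
      proof
        fix i assume "i \<in> I"
        then obtain x where x: "of_int i * e < x" "x \<le> (of_int i + 1) * e" "\<bar>x\<bar> \<le> R"
          unfolding I_def J_def using R by fastforce
        have "of_int i * e \<le> R" "- R \<le> (of_int i + 1) * e" using x by auto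
        then have "of_int i \<le> R / e" "- R / e \<le> of_int i + 1"
          using e by (auto simp: field_simps)
        then have "i \<le> \<lceil>R / e\<rceil>" "\<lfloor>- R / e\<rfloor> - 1 \<le> i" by linarith+
        then show "i \<in> {\<lfloor>- R / e\<rfloor> - 1 .. \<lceil>R / e\<rceil>}" by simp
      qed
    qed auto
    have disj: "disjoint_family_on J I"
      unfolding disjoint_family_on_def
    proof (intro ballI impI equals0I)
      fix m n :: int and x assume "m \<noteq> n" and "x \<in> J m \<inter> J n"
      then have x: "of_int m * e < x" "x \<le> (of_int m + 1) * e" "of_int n * e < x" "x \<le> (of_int n + 1) * e"
        by (auto simp: J_def)
      have *: "of_int m * e < (of_int n + 1) * e" "of_int n * e < (of_int m + 1) * e" using x by linarith+
      have "(of_int m::real) < of_int n + 1" "(of_int n::real) < of_int m + 1"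
        using mult_less_cancel_right_pos[OF e(1)] * by blast+
      then show False using \<open>m \<noteq> n\<close> by linarith
    qed
    have "K \<subseteq> (\<Union>i\<in>I. J i)"
    proof
      fix x assume x: "x \<in> K"
      define i where "i = \<lceil>x / e\<rceil> - 1"
      have "of_int i < x / e" "x / e \<le> of_int i + 1" unfolding i_def by linarith+
      then have "x \<in> J i" using e by (auto simp: J_def field_simps)
      then show "x \<in> (\<Union>i\<in>I. J i)" using x by (auto simp: I_def)
    qed
    then have "emeasure M K \<le> emeasure M (\<Union>i\<in>I. J i)"
      using fI by (intro emeasure_mono) (auto simp: J_def sets)
    also have "\<dots> = (\<Sum>i\<in>I. emeasure M (J i))"
      using fI disj by (subst sum_emeasure) (auto simp: J_def sets)
    also have "\<dots> \<le> (\<Sum>i\<in>I. emeasure N (J i))"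
      by (rule sum_mono) (auto simp: J_def e intro!: le)
    also have "\<dots> = emeasure N (\<Union>i\<in>I. J i)"
      using fI disj by (subst sum_emeasure) (auto simp: J_def sets)
    also have "\<dots> \<le> emeasure N U"
    proof (rule emeasure_mono)
      show "(\<Union>i\<in>I. J i) \<subseteq> U"
      proof (rule UN_least)
        fix i assume "i \<in> I"
        then have "{of_int i * e..(of_int i + 1) * e} \<inter> K \<noteq> {}"
          unfolding I_def J_def using greaterThanAtMost_subseteq_atLeastAtMost_iff[of "of_int i * e" "(of_int i + 1) * e" "of_int i * e" "(of_int i + 1) * e"] by blast
        moreover have "(of_int i + 1) * e - of_int i * e < d" using e by (simp add: algebra_simps)
        ultimately have "{of_int i * e..(of_int i + 1) * e} \<subseteq> U" using d by blast
        then show "J i \<subseteq> U" by (auto simp: J_def)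
      qed
    qed (use U sets in auto)
    finally show ?thesis .
  qed
  have K: "emeasure M K \<le> emeasure N K" if K: "compact K" for K
  proof -
    have "emeasure N K = (INF U \<in> {U. K \<subseteq> U \<and> open U}. emeasure N U)"
      using K by (intro outer_regular) (auto simp: sets compact_imp_closed)
    then show ?thesis using KU[OF K] by (auto intro: INF_greatest)
  qed
  have "emeasure M A = (SUP K \<in> {K. K \<subseteq> A \<and> compact K}. emeasure M K)"
    using A by (intro inner_regular) (auto simp: sets)
  also have "\<dots> \<le> emeasure N A"
    using A sets by (auto intro!: SUP_least order_trans[OF K] emeasure_mono)
  finally show ?thesis .
qed

text \<open>The measures whose densities are the negative and the positive part of k are compared on
  half-open intervals, hence on the set where k < 0. There the positive part has no mass, so neither
  has the negative one.\<close>

lemma AE_nonneg_if_integral_nonneg: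
  fixes k :: "real \<Rightarrow> real"
  assumes k: "integrable lborel k"
    and nn: "\<And>a b. a < b \<Longrightarrow> 0 \<le> (LINT u:{a<..b}|lborel. k u)"
  shows "AE u in lborel. 0 \<le> k u"
proof -
  have [measurable]: "k \<in> borel_measurable borel" using borel_measurable_integrable[OF k] by simp
  define P where "P = density lborel (\<lambda>u. ennreal (k u))"
  define Q where "Q = density lborel (\<lambda>u. ennreal (- k u))"
  have fP: "(\<integral>\<^sup>+u. ennreal (k u) \<partial>lborel) < \<infinity>" and fQ: "(\<integral>\<^sup>+u. ennreal (- k u) \<partial>lborel) < \<infinity>"
    using k by (auto elim!: integrableE)
  have "finite_measure P" "finite_measure Q"
    using fP fQ unfolding P_def Q_def
    by (auto intro!: finite_measureI simp: emeasure_density)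
  moreover have "emeasure Q {a<..b} \<le> emeasure P {a<..b}" if "a < b" for a b
  proof -
    have i: "integrable lborel (\<lambda>u. indicator {a<..b} u * k u)"
      using integrable_real_mult_indicator[OF _ k, of "{a<..b}"] by (simp add: mult.commute)
    have e: "(\<integral>\<^sup>+u. ennreal (k u) * indicator {a<..b} u \<partial>lborel) = (\<integral>\<^sup>+u. ennreal (indicator {a<..b} u * k u) \<partial>lborel)"
      "(\<integral>\<^sup>+u. ennreal (- k u) * indicator {a<..b} u \<partial>lborel) = (\<integral>\<^sup>+u. ennreal (- (indicator {a<..b} u * k u)) \<partial>lborel)"
      by (auto intro!: nn_integral_cong simp: indicator_def)
    obtain r q where rq: "r \<ge> 0" "q \<ge> 0"
       "(\<integral>\<^sup>+u. ennreal (indicator {a<..b} u * k u) \<partial>lborel) = ennreal r"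
       "(\<integral>\<^sup>+u. ennreal (- (indicator {a<..b} u * k u)) \<partial>lborel) = ennreal q"
       "(LINT u|lborel. indicator {a<..b} u * k u) = r - q"
      using i by (elim integrableE) auto
    have "r - q \<ge> 0" using nn[OF that] rq(5) by (simp add: set_lebesgue_integral_def)
    then show ?thesis
      unfolding P_def Q_def by (simp add: emeasure_density e rq ennreal_leI)
  qed
  ultimately have le: "emeasure Q {u. k u < 0} \<le> emeasure P {u. k u < 0}"
    by - (rule measure_le_if_Ioc_le, auto simp: P_def Q_def)
  have "emeasure P {u. k u < 0} = (\<integral>\<^sup>+u. ennreal (k u) * indicator {u. k u < 0} u \<partial>lborel)"
    unfolding P_def by (rule emeasure_density) auto
  also have "\<dots> = integral\<^sup>N (lborel :: real measure) (\<lambda>u. 0)"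
    by (rule nn_integral_cong) (auto simp: indicator_def ennreal_neg)
  finally have "emeasure P {u. k u < 0} = 0" by simp
  with le have "(\<integral>\<^sup>+u. ennreal (- k u) * indicator {u. k u < 0} u \<partial>lborel) = 0"
    unfolding Q_def by (subst (asm) emeasure_density) auto
  then have "AE u in lborel. ennreal (- k u) * indicator {u. k u < 0} u = 0"
    by (subst (asm) nn_integral_0_iff_AE) auto
  then show ?thesis
    by eventually_elim (auto simp: indicator_def ennreal_eq_0_iff split: if_splits)
qed

lemma grid_intervals:
  assumes "0 < n"
  shows "i < n \<Longrightarrow> {real i / real n<..<real (Suc i) / real n} \<subseteq> {0<..<1}"
    and "disjoint_family_on (\<lambda>i. {real i / real n<..<real (Suc i) / real n}) {..<n}"
proof -
  show "{real i / real n<..<real (Suc i) / real n} \<subseteq> {0<..<1}" if "i < n"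
  proof
    fix u assume u: "u \<in> {real i / real n<..<real (Suc i) / real n}"
    have "0 \<le> real i / real n" "real (Suc i) / real n \<le> 1" using that by (auto simp: field_simps)
    then show "u \<in> {0<..<1}" using u unfolding greaterThanLessThan_iff by linarith
  qed
  show "disjoint_family_on (\<lambda>i. {real i / real n<..<real (Suc i) / real n}) {..<n}"
    unfolding disjoint_family_on_def
  proof (intro ballI impI equals0I)
    fix i j x assume "i \<noteq> j" and "x \<in> {real i / real n<..<real (Suc i) / real n} \<inter> {real j / real n<..<real (Suc j) / real n}"
    then have "real i / real n < real (Suc j) / real n" "real j / real n < real (Suc i) / real n"
      unfolding Int_iff greaterThanLessThan_iff by linarith+
    then have "real i < real (Suc j)" "real j < real (Suc i)"
      using assms by (simp_all only: divide_less_cancel)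
    then show False using \<open>i \<noteq> j\<close> by linarith
  qed
qed

text \<open>The bound by the pointwise minimum is obtained by using, on the intervals of a fine partition,
  the first density where the partition meets a compact set approximating the region on which it
  is the smaller one, and the second density elsewhere.\<close>

lemma chain_bound_min:
  fixes D :: "real \<Rightarrow> real \<Rightarrow> ennreal" and G1 G2 :: "real \<Rightarrow> ennreal"
  assumes meas: "G1 \<in> borel_measurable borel" "G2 \<in> borel_measurable borel"
    and fin1: "(\<integral>\<^sup>+u\<in>{0<..<1}. G1 u \<partial>lborel) < \<infinity>" and fin2: "(\<integral>\<^sup>+u\<in>{0<..<1}. G2 u \<partial>lborel) < \<infinity>"
    and tri: "\<And>n. n > 0 \<Longrightarrow> D 0 1 \<le> (\<Sum>i<n. D (real i / real n) (real (Suc i) / real n))"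
    and le1: "\<And>n i. i < n \<Longrightarrow> D (real i / real n) (real (Suc i) / real n)
        \<le> (\<integral>\<^sup>+u\<in>{real i / real n<..<real (Suc i) / real n}. G1 u \<partial>lborel)"
    and le2: "\<And>n i. i < n \<Longrightarrow> D (real i / real n) (real (Suc i) / real n)
        \<le> (\<integral>\<^sup>+u\<in>{real i / real n<..<real (Suc i) / real n}. G2 u \<partial>lborel)"
  shows "D 0 1 \<le> (\<integral>\<^sup>+u\<in>{0<..<1}. min (G1 u) (G2 u) \<partial>lborel)"
proof (rule ennreal_le_epsilon)
  fix e :: real assume e: "e > 0"
  note [measurable] = meas
  define A where "A = {u. G1 u \<le> G2 u}"
  have [measurable]: "A \<in> sets borel" unfolding A_def by measurable
  define P where "P = density lborel (\<lambda>u. G1 u * indicator {0<..<1} u)"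
  define Q where "Q = density lborel (\<lambda>u. G2 u * indicator {0<..<1} u)"
  have sets [simp]: "sets P = sets borel" "sets Q = sets borel" by (auto simp: P_def Q_def)
  have "finite_measure P" "finite_measure Q"
    using fin1 fin2 unfolding P_def Q_def by (auto intro!: finite_measureI simp: emeasure_density)
  then interpret P: finite_measure P + Q: finite_measure Q .
  have "(INF U \<in> {U. A \<subseteq> U \<and> open U}. emeasure P U) = emeasure P A"
    by (subst outer_regular) (auto simp: P.emeasure_eq_measure)
  also have "\<dots> < emeasure P A + ennreal (e/2)"
    using e by (auto simp: P.emeasure_eq_measure ennreal_plus[symmetric] ennreal_less_iff simp del: ennreal_plus)
  finally obtain U where U: "A \<subseteq> U" "open U" "emeasure P U < emeasure P A + ennreal (e/2)"
    by (auto simp: INF_less_iff)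
  have "emeasure Q A < (SUP K \<in> {K. K \<subseteq> A \<and> compact K}. emeasure Q K) + ennreal (e/2)"
    by (subst inner_regular[symmetric]) (use e in \<open>auto simp: Q.emeasure_eq_measure ennreal_plus[symmetric] ennreal_less_iff simp del: ennreal_plus\<close>)
  then obtain K where K: "K \<subseteq> A" "compact K" "emeasure Q A < emeasure Q K + ennreal (e/2)"
    by (subst (asm) ennreal_SUP_add_left[symmetric]) (auto simp: less_SUP_iff)
  \<comment> \<open>Q is finite, so approximating A from inside by K approximates the complement of
    A from outside by the complement of K. The cells that miss K are charged to the latter.\<close>
  have "measure Q A < measure Q K + e/2"
    using K(3) e by (auto simp: Q.emeasure_eq_measure ennreal_plus[symmetric] ennreal_less_iff simp del: ennreal_plus)
  then have Kc: "measure Q (- K) < measure Q (- A) + e/2"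
    using Q.finite_measure_compl[of K] Q.finite_measure_compl[of A] K(2)
    by (simp add: compact_imp_closed Compl_eq_Diff_UNIV sets_eq_imp_space_eq[OF sets(2)])
  then have Kc: "emeasure Q (- K) \<le> emeasure Q (- A) + ennreal (e/2)"
    using e by (auto simp: Q.emeasure_eq_measure ennreal_plus[symmetric] intro!: ennreal_leI simp del: ennreal_plus)
  obtain d where d: "d > 0" "\<And>a b. b - a < d \<Longrightarrow> {a..b} \<inter> K \<noteq> {} \<Longrightarrow> {a..b} \<subseteq> U"
    using compact_in_open_mesh[OF K(2) U(2) order_trans[OF K(1) U(1)]] by metis
  obtain n where n: "n > 0" "1 / real n < d"
    using d(1) by (metis gr0I nat_approx_posE of_nat_0_less_iff zero_less_Suc)
  define J where "J = (\<lambda>i. {real i / real n<..<real (Suc i) / real n})"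
  have J01: "J i \<subseteq> {0<..<1}" if "i < n" for i unfolding J_def by (rule grid_intervals(1)[OF n(1) that])
  have disj: "disjoint_family_on J {..<n}" unfolding J_def by (rule grid_intervals(2)[OF n(1)])
  define I where "I = {i \<in> {..<n}. J i \<inter> K \<noteq> {}}"
  have I: "finite I" "I \<subseteq> {..<n}" by (auto simp: I_def)
  have JP: "(\<integral>\<^sup>+u\<in>J i. G1 u \<partial>lborel) = emeasure P (J i)" if "i < n" for i
    unfolding P_def using J01[OF that] by (subst emeasure_density) (auto simp: J_def indicator_def intro!: nn_integral_cong)
  have JQ: "(\<integral>\<^sup>+u\<in>J i. G2 u \<partial>lborel) = emeasure Q (J i)" if "i < n" for i
    unfolding Q_def using J01[OF that] by (subst emeasure_density) (auto simp: J_def indicator_def intro!: nn_integral_cong)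
  have "D 0 1 \<le> (\<Sum>i<n. D (real i / real n) (real (Suc i) / real n))" using tri n by simp
  also have "\<dots> = (\<Sum>i\<in>I. D (real i / real n) (real (Suc i) / real n)) + (\<Sum>i\<in>{..<n} - I. D (real i / real n) (real (Suc i) / real n))"
    using I by (subst sum.subset_diff[of I]) (auto simp: add.commute)
  also have "\<dots> \<le> (\<Sum>i\<in>I. emeasure P (J i)) + (\<Sum>i\<in>{..<n} - I. emeasure Q (J i))"
  proof (intro add_mono sum_mono)
    fix i assume "i \<in> I" then have "i < n" using I by auto
    then show "D (real i / real n) (real (Suc i) / real n) \<le> emeasure P (J i)"
      using le1[of i n] JP[of i] by (simp add: J_def)
  next
    fix i assume "i \<in> {..<n} - I" then have "i < n" by auto
    then show "D (real i / real n) (real (Suc i) / real n) \<le> emeasure Q (J i)"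
      using le2[of i n] JQ[of i] by (simp add: J_def)
  qed
  also have "\<dots> = emeasure P (\<Union>i\<in>I. J i) + emeasure Q (\<Union>i\<in>{..<n} - I. J i)"
    using I disj by (subst (1 2) sum_emeasure) (auto simp: J_def intro: disjoint_family_on_mono)
  also have "\<dots> \<le> emeasure P U + emeasure Q (- K)"
  proof (intro add_mono emeasure_mono)
    show "(\<Union>i\<in>I. J i) \<subseteq> U"
    proof (rule UN_least)
      fix i assume "i \<in> I"
      then have "{real i / real n..real (Suc i) / real n} \<inter> K \<noteq> {}" unfolding I_def J_def
        using greaterThanLessThan_subseteq_atLeastAtMost_iff[of "real i / real n" "real (Suc i) / real n" "real i / real n" "real (Suc i) / real n"] by blast
      moreover have "real (Suc i) / real n - real i / real n < d" using n by (simp add: diff_divide_distrib[symmetric])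
      ultimately have "{real i / real n..real (Suc i) / real n} \<subseteq> U" using d by blast
      then show "J i \<subseteq> U" by (auto simp: J_def)
    qed
    show "(\<Union>i\<in>{..<n} - I. J i) \<subseteq> - K" by (auto simp: I_def)
  qed (use U K in \<open>auto simp: compact_imp_closed\<close>)
  also have "\<dots> \<le> (emeasure P A + ennreal (e/2)) + (emeasure Q (- A) + ennreal (e/2))"
    using U Kc by (intro add_mono) auto
  also have "\<dots> = emeasure P A + emeasure Q (- A) + ennreal e"
    using e by (simp add: add.assoc add.left_commute ennreal_plus[symmetric] del: ennreal_plus)
  also have "emeasure P A + emeasure Q (- A) = (\<integral>\<^sup>+u\<in>{0<..<1}. min (G1 u) (G2 u) \<partial>lborel)"
  proof -
    have "emeasure P A + emeasure Q (- A) = (\<integral>\<^sup>+u. G1 u * indicator {0<..<1} u * indicator A u \<partial>lborel)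
        + (\<integral>\<^sup>+u. G2 u * indicator {0<..<1} u * indicator (- A) u \<partial>lborel)"
      unfolding P_def Q_def by (subst (1 2) emeasure_density) auto
    also have "\<dots> = (\<integral>\<^sup>+u. G1 u * indicator {0<..<1} u * indicator A u
        + G2 u * indicator {0<..<1} u * indicator (- A) u \<partial>lborel)"
      by (rule nn_integral_add[symmetric]) auto
    also have "\<dots> = (\<integral>\<^sup>+u\<in>{0<..<1}. min (G1 u) (G2 u) \<partial>lborel)"
      by (rule nn_integral_cong) (auto simp: A_def indicator_def min_def)
    finally show ?thesis .
  qed
  finally show "D 0 1 \<le> (\<integral>\<^sup>+u\<in>{0<..<1}. min (G1 u) (G2 u) \<partial>lborel) + ennreal e" .
qed

section \<open>Length of continuous curves\<close>

text \<open>Only whole cells of the uniform grid with n + 1 cells per unit are counted, so t is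
  rounded down to a grid point. The grid is the same for all t, which makes the difference of two
  values a sum over the cells in between.\<close>

definition variation_sum :: "(real \<Rightarrow> 'a::metric_space) \<Rightarrow> nat \<Rightarrow> real \<Rightarrow> real" where
  "variation_sum c n t = (\<Sum>i<nat \<lfloor>t * real (Suc n)\<rfloor>.
     dist (c (real i / real (Suc n))) (c (real (Suc i) / real (Suc n))))"

text \<open>For a continuous curve this is the usual length up to time t. A lower limit along fixed
  grids replaces the supremum over partitions, because the lower and the upper estimate of its
  increments then hold grid by grid, up to a rounding error.\<close>

definition arc_length :: "(real \<Rightarrow> 'a::metric_space) \<Rightarrow> real \<Rightarrow> ennreal" where
  "arc_length c t = liminf (\<lambda>n. ennreal (variation_sum c n t))"

abbreviation grid :: "nat \<Rightarrow> real \<Rightarrow> real" where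
  "grid n t \<equiv> real (nat \<lfloor>t * real (Suc n)\<rfloor>) / real (Suc n)"

lemma grid_bounds:
  assumes "0 \<le> t"
  shows "0 \<le> grid n t" "grid n t \<le> t" "t - 1 / real (Suc n) \<le> grid n t"
proof -
  have f: "0 \<le> \<lfloor>t * real (Suc n)\<rfloor>" using assms by simp
  then have e: "real (nat \<lfloor>t * real (Suc n)\<rfloor>) = of_int \<lfloor>t * real (Suc n)\<rfloor>" by simp
  show "0 \<le> grid n t" by simp
  show "grid n t \<le> t" unfolding e using of_int_floor_le[of "t * real (Suc n)"] by (simp add: field_simps)
  have "t * N - 1 \<le> x \<Longrightarrow> t - 1 / N \<le> x / N" if "N > 0" for N x :: real
    using that divide_right_mono[of "t * N - 1" x N] by (simp add: diff_divide_distrib)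
  moreover have "t * real (Suc n) - 1 \<le> of_int \<lfloor>t * real (Suc n)\<rfloor>" by linarith
  ultimately show "t - 1 / real (Suc n) \<le> grid n t" unfolding e by simp
qed

lemma grid_in_unit: "0 \<le> t \<Longrightarrow> t \<le> 1 \<Longrightarrow> grid n t \<in> {0..1}"
  unfolding atLeastAtMost_iff using grid_bounds(1)[of t n] order_trans[OF grid_bounds(2)[of t n], of 1] by blast

lemma grid_tendsto:
  assumes "0 \<le> t" shows "(\<lambda>n. grid n t) \<longlonglongrightarrow> t"
proof (rule tendsto_sandwich[where f = "\<lambda>n. t - 1 / real (Suc n)" and h = "\<lambda>_. t"])
  have "(\<lambda>n. t - inverse (real (Suc n))) \<longlonglongrightarrow> t - 0"
    by (intro tendsto_intros LIMSEQ_inverse_real_of_nat)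
  then show "(\<lambda>n. t - 1 / real (Suc n)) \<longlonglongrightarrow> t" by (simp add: inverse_eq_divide)
qed (use grid_bounds[OF assms] in \<open>auto intro!: always_eventually\<close>)

lemma variation_sum_diff:
  assumes "s \<le> t"
  shows "variation_sum c n t = variation_sum c n s +
    (\<Sum>i=nat \<lfloor>s * real (Suc n)\<rfloor>..<nat \<lfloor>t * real (Suc n)\<rfloor>.
      dist (c (real i / real (Suc n))) (c (real (Suc i) / real (Suc n))))"
proof -
  have "nat \<lfloor>s * real (Suc n)\<rfloor> \<le> nat \<lfloor>t * real (Suc n)\<rfloor>"
    using assms by (intro nat_mono floor_mono mult_right_mono) auto
  then show ?thesis unfolding variation_sum_def
    by (simp add: lessThan_atLeast0 sum.atLeastLessThan_concat)
qed

lemma dist_le_sum_dist: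
  fixes x :: "nat \<Rightarrow> 'a::metric_space"
  assumes "j \<le> m" shows "dist (x j) (x m) \<le> (\<Sum>i=j..<m. dist (x i) (x (Suc i)))"
  using assms
proof (induction m rule: dec_induct)
  case (step m)
  then show ?case using dist_triangle[of "x j" "x (Suc m)" "x m"] by simp
qed simp

lemma arc_length_0 [simp]: "arc_length c 0 = 0"
  by (simp add: arc_length_def variation_sum_def Liminf_const)

text \<open>By the triangle inequality the cells between the rounded times contribute at least the
  distance of the rounded endpoints; continuity of the curve removes the rounding in the
  limit.\<close>

lemma arc_length_lower:
  assumes c: "continuous_on {0..1} c" and st: "0 \<le> s" "s \<le> t" "t \<le> 1"
  shows "arc_length c s + ennreal (dist (c s) (c t)) \<le> arc_length c t"
proof (rule ennreal_le_epsilon)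
  fix e :: real assume e: "0 < e"
  define d where "d = dist (c s) (c t)"
  have lim: "(\<lambda>n. c (grid n u)) \<longlonglongrightarrow> c u" if "0 \<le> u" "u \<le> 1" for u
    using that grid_in_unit[of u]
    by (intro continuous_on_tendsto_compose[OF c grid_tendsto]) auto
  have "(\<lambda>n. dist (c (grid n s)) (c (grid n t))) \<longlonglongrightarrow> d"
    unfolding d_def using st by (intro tendsto_dist lim) auto
  then have "\<forall>\<^sub>F n in sequentially. d - e < dist (c (grid n s)) (c (grid n t))"
    by (rule order_tendstoD) (use e in auto)
  then have "\<forall>\<^sub>F n in sequentially. ennreal (variation_sum c n s) + ennreal (d - e) \<le> ennreal (variation_sum c n t)"
  proof eventually_elim
    case (elim n)
    have "nat \<lfloor>s * real (Suc n)\<rfloor> \<le> nat \<lfloor>t * real (Suc n)\<rfloor>"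
      using st by (intro nat_mono floor_mono mult_right_mono) auto
    from dist_le_sum_dist[OF this, of "\<lambda>i. c (real i / real (Suc n))"]
    have *: "variation_sum c n s + dist (c (grid n s)) (c (grid n t)) \<le> variation_sum c n t"
      by (subst variation_sum_diff[OF st(2)]) simp
    have nn: "0 \<le> variation_sum c n s" by (auto simp: variation_sum_def intro: sum_nonneg)
    have "ennreal (variation_sum c n s) + ennreal (d - e) \<le> ennreal (variation_sum c n s) + ennreal (dist (c (grid n s)) (c (grid n t)))"
      using elim by (intro add_mono ennreal_leI) auto
    also have "\<dots> = ennreal (variation_sum c n s + dist (c (grid n s)) (c (grid n t)))"
      using nn by simp
    also have "\<dots> \<le> ennreal (variation_sum c n t)" using * by (rule ennreal_leI)
    finally show ?case .
  qed
  then have *: "arc_length c s + ennreal (d - e) \<le> arc_length c t"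
    unfolding arc_length_def
    by (subst Liminf_add_const[symmetric]) (auto intro: Liminf_mono)
  have "ennreal d \<le> ennreal (d - e) + ennreal e"
  proof (cases "d \<le> e")
    case True then show ?thesis by (intro order_trans[OF ennreal_leI[OF True]]) simp
  qed (use e in \<open>simp add: ennreal_plus[symmetric] del: ennreal_plus\<close>)
  then have "arc_length c s + ennreal d \<le> arc_length c s + ennreal (d - e) + ennreal e"
    by (simp add: add.assoc add_left_mono)
  also have "\<dots> \<le> arc_length c t + ennreal e" using * by (rule add_right_mono)
  finally show "arc_length c s + ennreal (dist (c s) (c t)) \<le> arc_length c t + ennreal e"
    by (simp add: d_def)
qed

lemma AC_curves_continuous: "c \<in> mspace curve_metric \<Longrightarrow> continuous_on {0..1} c"
  by (simp add: curve_metric_def)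

text \<open>Bridge between three conventions: \<open>speed_bound\<close> integrates over open
  intervals, Stieltjes measures are given on half-open ones, and continuity of the primitive is a
  statement on the gauge integral over closed ones.\<close>

lemma set_integral_open_closed:
  fixes h :: "real \<Rightarrow> real"
  assumes h: "set_integrable lborel {0<..<1} h" and st: "0 \<le> s" "s \<le> t" "t \<le> 1"
  shows "set_integrable lborel {s<..<t} h"
    and "(LINT u:{s<..<t}|lborel. h u) = (LINT u:{s<..t}|lborel. indicator {0<..<1} u * h u)"
    and "(LINT u:{s<..<t}|lborel. h u) = integral {0..t} (\<lambda>u. indicator {0<..<1} u * h u)
           - integral {0..s} (\<lambda>u. indicator {0<..<1} u * h u)"
proof -
  define k where "k = (\<lambda>u. indicator {0<..<1} u * h u)"
  have k: "integrable lborel k" using h by (simp add: set_integrable_def k_def)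
  then have [measurable]: "k \<in> borel_measurable borel" by (auto dest: borel_measurable_integrable)
  have ki: "set_integrable lborel S k" if "S \<in> sets borel" for S
    unfolding set_integrable_def using integrable_real_mult_indicator[OF _ k, of S] that by (simp add: mult.commute)
  have e: "indicator {s<..<t} u * h u = indicator {s<..<t} u * k u" for u
    using st by (auto simp: k_def indicator_def)
  show "set_integrable lborel {s<..<t} h"
    using ki[of "{s<..<t}"] by (simp add: set_integrable_def e)
  have 1: "(LINT u:{s<..<t}|lborel. h u) = (LINT u:{s<..<t}|lborel. k u)"
    by (simp add: set_lebesgue_integral_def e)
  also have "\<dots> = (LINT u:{s..t}|lborel. k u)"
    unfolding set_lebesgue_integral_def
    using AE_lborel_singleton[of s] AE_lborel_singleton[of t]
    by (intro integral_cong_AE) (auto simp: indicator_def)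
  finally have 2: "(LINT u:{s<..<t}|lborel. h u) = (LINT u:{s..t}|lborel. k u)" .
  show "(LINT u:{s<..<t}|lborel. h u) = (LINT u:{s<..t}|lborel. indicator {0<..<1} u * h u)"
    unfolding 1 k_def[symmetric] unfolding set_lebesgue_integral_def
    using AE_lborel_singleton[of t]
    by (intro integral_cong_AE) (auto simp: indicator_def)
  have "integral {0..s} k + integral {s..t} k = integral {0..t} k"
    using st ki[of "{0..t}"] by (intro Henstock_Kurzweil_Integration.integral_combine)
     (auto dest: set_borel_integral_eq_integral)
  then show "(LINT u:{s<..<t}|lborel. h u) = integral {0..t} (\<lambda>u. indicator {0<..<1} u * h u)
           - integral {0..s} (\<lambda>u. indicator {0<..<1} u * h u)"
    unfolding 2 k_def[symmetric] using ki[of "{s..t}"] by (simp add: set_borel_integral_eq_integral)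
qed

lemma speed_bound_le:
  assumes "speed_bound c h" "0 \<le> s" "s \<le> t" "t \<le> 1"
  shows "dist (c s) (c t) \<le> (LINT u:{s<..<t}|lborel. h u)"
  using assms by (cases "s = t") (auto simp: speed_bound_def set_lebesgue_integral_def)

lemma indefinite_integral_speed_continuous:
  assumes "speed_bound c h"
  shows "continuous_on {0..1} (\<lambda>t. integral {0..t} (\<lambda>u. indicator {0<..<1} u * h u))"
proof (rule indefinite_integral_continuous_1)
  have "set_integrable lborel {0..1} (\<lambda>u. indicator {0<..<1} u * h u)"
    using assms unfolding speed_bound_def set_integrable_def
    by (elim conjE) (auto simp: mult.assoc[symmetric] indicator_inter_arith[symmetric] Int_absorb1 greaterThanLessThan_subseteq_atLeastAtMost_iff)
  then show "(\<lambda>u. indicator {0<..<1} u * h u) integrable_on {0..1}"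
    by (rule set_borel_integral_eq_integral)
qed

text \<open>On each grid cell the distance is at most the increment of the primitive of h, so the
  sum telescopes; the primitive is continuous, which removes the rounding.\<close>

lemma arc_length_upper:
  assumes h: "speed_bound c h" and st: "0 \<le> s" "s \<le> t" "t \<le> 1"
  shows "arc_length c t \<le> arc_length c s + ennreal (LINT u:{s<..<t}|lborel. h u)"
proof (rule ennreal_le_epsilon)
  fix e :: real assume e: "0 < e"
  define I where "I = (\<lambda>t. integral {0..t} (\<lambda>u. indicator {0<..<1} u * h u))"
  have hi: "set_integrable lborel {0<..<1} h" using h by (simp add: speed_bound_def)
  have I: "(LINT u:{s<..<t}|lborel. h u) = I t - I s" if "0 \<le> s" "s \<le> t" "t \<le> 1" for s t
    unfolding I_def by (rule set_integral_open_closed(3)[OF hi that])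
  have Ic: "continuous_on {0..1} I" unfolding I_def by (rule indefinite_integral_speed_continuous[OF h])
  have lim: "(\<lambda>n. I (grid n u)) \<longlonglongrightarrow> I u" if "0 \<le> u" "u \<le> 1" for u
    using that grid_in_unit[of u]
    by (intro continuous_on_tendsto_compose[OF Ic grid_tendsto]) auto
  have Imono: "I s \<le> I t" using speed_bound_le[OF h st] I[OF st] zero_le_dist[of "c s" "c t"] by linarith
  have "(\<lambda>n. I (grid n t) - I (grid n s)) \<longlonglongrightarrow> I t - I s"
    using st by (intro tendsto_diff lim) auto
  then have "\<forall>\<^sub>F n in sequentially. I (grid n t) - I (grid n s) < I t - I s + e"
    by (rule order_tendstoD) (use e in auto)
  then have "\<forall>\<^sub>F n in sequentially. ennreal (variation_sum c n t) \<le> ennreal (variation_sum c n s) + ennreal (I t - I s + e)"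
  proof eventually_elim
    case (elim n)
    let ?j = "nat \<lfloor>s * real (Suc n)\<rfloor>" and ?m = "nat \<lfloor>t * real (Suc n)\<rfloor>"
    have jm: "?j \<le> ?m" using st by (intro nat_mono floor_mono mult_right_mono) auto
    have m: "?m \<le> Suc n"
    proof -
      have "grid n t \<le> 1" using grid_in_unit[of t n] st by auto
      then have "real ?m \<le> real (Suc n)" by (subst (asm) divide_le_eq_1_pos) auto
      then show ?thesis by (simp only: of_nat_le_iff)
    qed
    have "(\<Sum>i=?j..<?m. dist (c (real i / real (Suc n))) (c (real (Suc i) / real (Suc n))))
      \<le> (\<Sum>i=?j..<?m. I (real (Suc i) / real (Suc n)) - I (real i / real (Suc n)))"
    proof (rule sum_mono)
      fix i assume "i \<in> {?j..<?m}"
      then have "Suc i \<le> Suc n" using m by auto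
      then have *: "0 \<le> real i / real (Suc n)" "real i / real (Suc n) \<le> real (Suc i) / real (Suc n)"
        "real (Suc i) / real (Suc n) \<le> 1" by (auto simp: field_simps)
      show "dist (c (real i / real (Suc n))) (c (real (Suc i) / real (Suc n))) \<le> I (real (Suc i) / real (Suc n)) - I (real i / real (Suc n))"
        using speed_bound_le[OF h *] I[OF *] by simp
    qed
    also have "\<dots> = I (grid n t) - I (grid n s)"
      by (rule sum_Suc_diff'[OF jm, of "\<lambda>i. I (real i / real (Suc n))"])
    finally have "variation_sum c n t \<le> variation_sum c n s + (I t - I s + e)"
      using elim by (subst variation_sum_diff[OF st(2)]) linarith
    moreover have "0 \<le> variation_sum c n s" by (auto simp: variation_sum_def intro: sum_nonneg)
    moreover have "0 \<le> I t - I s + e" using Imono e by simp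
    ultimately show ?case by (simp add: ennreal_plus[symmetric] ennreal_leI del: ennreal_plus)
  qed
  then have "arc_length c t \<le> arc_length c s + ennreal (I t - I s + e)"
    unfolding arc_length_def
    by (subst Liminf_add_const[symmetric]) (auto intro: Liminf_mono)
  also have "ennreal (I t - I s + e) = ennreal (I t - I s) + ennreal e" using Imono e by simp
  finally show "arc_length c t \<le> arc_length c s + ennreal (LINT u:{s<..<t}|lborel. h u) + ennreal e"
    unfolding I[OF st] by (simp add: add.assoc)
qed

lemma ennreal_integral_le_nn_integral:
  assumes "integrable M f"
  shows "ennreal (integral\<^sup>L M f) \<le> (\<integral>\<^sup>+x. ennreal (f x) \<partial>M)"
proof -
  obtain r q where rq: "0 \<le> r" "0 \<le> q" "(\<integral>\<^sup>+x. ennreal (f x) \<partial>M) = ennreal r" "integral\<^sup>L M f = r - q"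
    using assms by (rule integrableE)
  then show ?thesis by (simp add: ennreal_leI)
qed

text \<open>The minimal speed is the density of the Stieltjes measure of the arc length.\<close>

lemma minimal_speed_exists:
  assumes c: "c \<in> AC_curves"
  shows "\<exists>l. speed_bound c l \<and> (\<forall>u. 0 \<le> l u) \<and>
    (\<forall>h. speed_bound c h \<longrightarrow> (AE u in lborel. u \<in> {0<..<1} \<longrightarrow> l u \<le> h u))"
proof -
  obtain h where h: "speed_bound c h" and cm: "c \<in> mspace curve_metric"
    using c by (auto simp: AC_curves_def)
  define k where "k = (\<lambda>u. indicator {0<..<1} u * h u)"
  define I where "I = (\<lambda>t. integral {0..t} k)"
  \<comment> \<open>Clamping extends the length to the whole line, constant outside the unit
    interval, as a Stieltjes measure requires.\<close>
  define cl :: "real \<Rightarrow> real" where "cl = (\<lambda>t. max 0 (min 1 t))"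
  define L where "L = (\<lambda>t. enn2real (arc_length c (cl t)))"
  have hi: "set_integrable lborel {0<..<1} h" using h by (simp add: speed_bound_def)
  then have k: "integrable lborel k" by (simp add: set_integrable_def k_def)
  then have [measurable]: "k \<in> borel_measurable borel" by (auto dest: borel_measurable_integrable)
  have cl: "0 \<le> cl t" "cl t \<le> 1" "s \<le> t \<Longrightarrow> cl s \<le> cl t" for s t by (auto simp: cl_def)
  have I: "(LINT u:{s<..<t}|lborel. h u) = I t - I s" if "0 \<le> s" "s \<le> t" "t \<le> 1" for s t
    unfolding I_def k_def by (rule set_integral_open_closed(3)[OF hi that])
  have fin: "arc_length c t < \<infinity>" if "0 \<le> t" "t \<le> 1" for t
    using arc_length_upper[OF h order_refl that] by (rule le_less_trans) simp
  have Lc: "ennreal (L t) = arc_length c (cl t)" for t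
    using fin[OF cl(1,2)] unfolding L_def by simp
  have L0: "0 \<le> L t" for t by (simp add: L_def)
  have Imono: "I s \<le> I t" if "0 \<le> s" "s \<le> t" "t \<le> 1" for s t
    using speed_bound_le[OF h that] I[OF that] zero_le_dist[of "c s" "c t"] by linarith
  have up: "L t \<le> L s + (LINT u:{cl s<..<cl t}|lborel. h' u)" if h': "speed_bound c h'" "s \<le> t" for h' s t
  proof -
    have nn: "0 \<le> (LINT u:{cl s<..<cl t}|lborel. h' u)"
      using speed_bound_le[OF h'(1) cl(1) cl(3)[OF h'(2)] cl(2)] by (rule order_trans[OF zero_le_dist])
    have "ennreal (L t) \<le> ennreal (L s) + ennreal (LINT u:{cl s<..<cl t}|lborel. h' u)"
      unfolding Lc by (rule arc_length_upper[OF h'(1) cl(1) cl(3)[OF h'(2)] cl(2)])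
    then show ?thesis using nn L0 by (simp add: ennreal_plus[symmetric] del: ennreal_plus)
  qed
  have low: "L s + dist (c (cl s)) (c (cl t)) \<le> L t" if "s \<le> t" for s t
  proof -
    have "ennreal (L s) + ennreal (dist (c (cl s)) (c (cl t))) \<le> ennreal (L t)"
      unfolding Lc by (rule arc_length_lower[OF AC_curves_continuous[OF cm] cl(1) cl(3)[OF that] cl(2)])
    then show ?thesis using L0 by (simp add: ennreal_plus[symmetric] del: ennreal_plus)
  qed
  have Lmono: "L s \<le> L t" if "s \<le> t" for s t using low[OF that] zero_le_dist[of "c (cl s)" "c (cl t)"] by linarith
  have upI: "L t \<le> L s + (I (cl t) - I (cl s))" if "s \<le> t" for s t
    using up[OF h that] I[OF cl(1) cl(3)[OF that] cl(2)] by simp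
  \<comment> \<open>Sandwich between the constant L a and L a plus the increment of the continuous
    primitive of h.\<close>
  have Lcont: "continuous (at_right a) L" for a
  proof -
    have "continuous_on UNIV (\<lambda>t. I (cl t))"
      unfolding I_def k_def cl_def
      by (rule continuous_on_compose2[OF indefinite_integral_speed_continuous[OF h]]) (auto intro!: continuous_intros)
    then have "((\<lambda>t. I (cl t)) \<longlongrightarrow> I (cl a)) (at_right a)"
      by (simp add: continuous_on_eq_continuous_at isCont_def filterlim_at_split)
    then have "((\<lambda>t. L a + (I (cl t) - I (cl a))) \<longlongrightarrow> L a + (I (cl a) - I (cl a))) (at_right a)"
      by (intro tendsto_intros)
    then have lim: "((\<lambda>t. L a + (I (cl t) - I (cl a))) \<longlongrightarrow> L a) (at_right a)" by simp
    have ev: "\<forall>\<^sub>F t in at_right a. a < t" by (rule eventually_at_right_less)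
    have "(L \<longlongrightarrow> L a) (at_right a)"
      by (rule tendsto_sandwich[OF eventually_mono[OF ev] eventually_mono[OF ev] tendsto_const lim])
        (simp_all add: Lmono upI)
    then show ?thesis by (simp add: continuous_within)
  qed
  define N where "N = interval_measure L"
  have [simp]: "sets N = sets borel" "space N = UNIV" by (auto simp: N_def)
  have N: "emeasure N {a<..b} = ennreal (L b - L a)" if "a \<le> b" for a b
    unfolding N_def by (rule emeasure_interval_measure_Ioc[OF that Lmono Lcont])
  have "emeasure N (\<Union>n. {- real n<..real n}) = (SUP n. emeasure N {- real n<..real n})"
    by (rule SUP_emeasure_incseq[symmetric]) (auto simp: incseq_def)
  also have "(\<Union>n. {- real n<..real n}) = UNIV"
  proof (intro equalityI subset_UNIV subsetI)
    fix x :: real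
    obtain n where "\<bar>x\<bar> < real n" using reals_Archimedean2 by blast
    then show "x \<in> (\<Union>n. {- real n<..real n})" by (intro UN_I[of n]) auto
  qed
  also have "(SUP n. emeasure N {- real n<..real n}) \<le> ennreal (L 1)"
  proof (rule SUP_least)
    fix n :: nat
    have "L (real n) \<le> L (max 1 (real n))" by (rule Lmono) simp
    also have "L (max 1 (real n)) = L 1" by (simp add: L_def cl_def)
    finally show "emeasure N {- real n<..real n} \<le> ennreal (L 1)"
      using L0[of "- real n"] by (simp add: N ennreal_leI)
  qed
  finally have finN: "finite_measure N"
    by (intro finite_measureI) (auto simp: top_unique)
  define Q where "Q = density lborel (\<lambda>u. ennreal (k u))"
  have "(\<integral>\<^sup>+u. ennreal (k u) \<partial>lborel) < \<infinity>" using k by (auto elim!: integrableE)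
  then have finQ: "finite_measure Q"
    unfolding Q_def by (auto intro!: finite_measureI simp: emeasure_density)
  \<comment> \<open>The admissible h dominates the increments of the length, so the Stieltjes
    measure lies below a measure with a density and is therefore absolutely continuous.\<close>
  have NQ: "emeasure N A \<le> emeasure Q A" if "A \<in> sets borel" for A
  proof (rule measure_le_if_Ioc_le[OF finN finQ _ _ _ that])
    fix a b :: real assume ab: "a < b"
    have i: "integrable lborel (\<lambda>u. indicator {cl a<..cl b} u * k u)"
      using integrable_real_mult_indicator[OF _ k, of "{cl a<..cl b}"] by (simp add: mult.commute)
    have "L b - L a \<le> (LINT u:{cl a<..<cl b}|lborel. h u)" using up[OF h, of a b] ab by simp
    also have "\<dots> = (LINT u:{cl a<..cl b}|lborel. k u)" unfolding k_def
      using ab by (intro set_integral_open_closed(2)[OF hi cl(1) cl(3) cl(2)]) auto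
    finally have "emeasure N {a<..b} \<le> ennreal (LINT u:{cl a<..cl b}|lborel. k u)"
      using ab by (simp add: N ennreal_leI)
    also have "\<dots> \<le> (\<integral>\<^sup>+u. ennreal (indicator {cl a<..cl b} u * k u) \<partial>lborel)"
      using ennreal_integral_le_nn_integral[OF i] by (simp add: set_lebesgue_integral_def)
    also have "\<dots> \<le> (\<integral>\<^sup>+u\<in>{a<..b}. ennreal (k u) \<partial>lborel)"
      by (rule nn_integral_mono) (auto simp: indicator_def k_def cl_def)
    also have "\<dots> = emeasure Q {a<..b}" unfolding Q_def by (rule emeasure_density[symmetric]) auto
    finally show "emeasure N {a<..b} \<le> emeasure Q {a<..b}" .
  qed (auto simp: Q_def)
  have "absolutely_continuous lborel Q"
    unfolding Q_def by (rule absolutely_continuousI_density) simp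
  then have "absolutely_continuous lborel N"
  proof (unfold absolutely_continuous_def, intro subsetI)
    fix A :: "real set" assume Q: "null_sets lborel \<subseteq> null_sets Q" and A: "A \<in> null_sets lborel"
    have "emeasure Q A = 0" "A \<in> sets borel" using A Q by auto
    then show "A \<in> null_sets N" using NQ[of A] by auto
  qed
  then obtain f where f [measurable]: "f \<in> borel_measurable lborel" and dN: "density lborel f = N"
    using sigma_finite_measure.Radon_Nikodym[OF sigma_finite_lborel, of N] by auto
  have "(\<integral>\<^sup>+u. f u \<partial>lborel) = emeasure N UNIV"
    unfolding dN[symmetric] by (subst emeasure_density) auto
  also have "\<dots> < \<infinity>" using finite_measure.emeasure_finite[OF finN, of UNIV] by (simp add: less_top)
  finally have intf: "(\<integral>\<^sup>+u. f u \<partial>lborel) < \<infinity>" .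
  then have ffin: "AE u in lborel. f u \<noteq> \<infinity>" by (intro nn_integral_PInf_AE) auto
  define l where "l = (\<lambda>u. enn2real (f u))"
  have [measurable]: "l \<in> borel_measurable borel" unfolding l_def by simp
  have l0: "0 \<le> l u" for u by (simp add: l_def)
  have lf: "AE u in lborel. ennreal (l u) = f u" using ffin by eventually_elim (simp add: l_def less_top)
  have li: "integrable lborel l"
  proof (rule integrableI_nonneg)
    have "(\<integral>\<^sup>+u. ennreal (l u) \<partial>lborel) = (\<integral>\<^sup>+u. f u \<partial>lborel)" by (rule nn_integral_cong_AE) (use lf in auto)
    then show "(\<integral>\<^sup>+u. ennreal (l u) \<partial>lborel) < \<infinity>" using intf by simp
  qed (auto simp: l0)
  have lnn: "(\<integral>\<^sup>+u\<in>{a<..<b}. ennreal (l u) \<partial>lborel) = ennreal (L b - L a)" if "a \<le> b" for a b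
  proof -
    have "(\<integral>\<^sup>+u\<in>{a<..<b}. ennreal (l u) \<partial>lborel) = (\<integral>\<^sup>+u\<in>{a<..b}. f u \<partial>lborel)"
      using lf AE_lborel_singleton[of b] by (intro nn_integral_cong_AE; eventually_elim) (auto simp: indicator_def)
    also have "\<dots> = emeasure N {a<..b}" unfolding dN[symmetric] by (rule emeasure_density[symmetric]) auto
    finally show ?thesis using N[OF that] by simp
  qed
  have lset: "(LINT u:{a<..<b}|lborel. l u) = L b - L a" if "a \<le> b" for a b
  proof -
    have "(LINT u:{a<..<b}|lborel. l u) = enn2real (\<integral>\<^sup>+u. ennreal (indicator {a<..<b} u * l u) \<partial>lborel)"
      unfolding set_lebesgue_integral_def by (subst integral_eq_nn_integral) (auto simp: l0)
    also have "(\<integral>\<^sup>+u. ennreal (indicator {a<..<b} u * l u) \<partial>lborel) = (\<integral>\<^sup>+u\<in>{a<..<b}. ennreal (l u) \<partial>lborel)"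
      by (rule nn_integral_cong) (auto simp: indicator_def)
    finally show ?thesis using lnn[OF that] Lmono[OF that] by simp
  qed
  have lsi: "set_integrable lborel S l" if "S \<in> sets borel" for S
    unfolding set_integrable_def using integrable_real_mult_indicator[OF _ li, of S] that by (simp add: mult.commute)
  have "speed_bound c l"
    unfolding speed_bound_def
  proof (intro conjI allI impI lsi)
    fix s t :: real assume st: "0 \<le> s \<and> s < t \<and> t \<le> 1"
    then have "cl s = s" "cl t = t" by (auto simp: cl_def)
    then show "dist (c s) (c t) \<le> (LINT u:{s<..<t}|lborel. l u)"
      using low[of s t] lset[of s t] st by simp
  qed simp
  moreover have "AE u in lborel. u \<in> {0<..<1} \<longrightarrow> l u \<le> h' u" if h': "speed_bound c h'" for h'
  proof -
    define k' where "k' = (\<lambda>u. indicator {0<..<1} u * h' u)"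
    have hi': "set_integrable lborel {0<..<1} h'" using h' by (simp add: speed_bound_def)
    then have ik': "integrable lborel k'" by (simp add: set_integrable_def k'_def)
    have il: "integrable lborel (\<lambda>u. indicator {0<..<1} u * l u)" using lsi[of "{0<..<1}"] by (simp add: set_integrable_def)
    \<comment> \<open>Minimality: the length grows by at most the integral of any admissible h', so
      the difference of the two has a nonnegative integral over every half-open interval.\<close>
    have "AE u in lborel. 0 \<le> k' u - indicator {0<..<1} u * l u"
    proof (rule AE_nonneg_if_integral_nonneg)
      show "integrable lborel (\<lambda>u. k' u - indicator {0<..<1} u * l u)" using ik' il by simp
      fix a b :: real assume ab: "a < b"
      have 1: "(LINT u:{a<..b}|lborel. indicator {0<..<1} u * g u) = (LINT u:{cl a<..<cl b}|lborel. g u)"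
        if "set_integrable lborel {0<..<1} g" for g :: "real \<Rightarrow> real"
      proof -
        have "(LINT u:{a<..b}|lborel. indicator {0<..<1} u * g u) = (LINT u:{cl a<..cl b}|lborel. indicator {0<..<1} u * g u)"
          unfolding set_lebesgue_integral_def by (rule Bochner_Integration.integral_cong) (auto simp: indicator_def cl_def)
        then show ?thesis using set_integral_open_closed(2)[OF that cl(1) cl(3) cl(2), of a b] ab by simp
      qed
      have si: "set_integrable lborel {a<..b} g" if "integrable lborel g" for g :: "real \<Rightarrow> real"
        unfolding set_integrable_def using integrable_real_mult_indicator[OF _ that, of "{a<..b}"] by (simp add: mult.commute)
      have "(LINT u:{a<..b}|lborel. k' u - indicator {0<..<1} u * l u)
          = (LINT u:{cl a<..<cl b}|lborel. h' u) - (LINT u:{cl a<..<cl b}|lborel. l u)"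
        using 1[OF hi'] 1[OF lsi] set_integral_diff(2)[OF si[OF ik'] si[OF il]] by (simp add: k'_def)
      also have "(LINT u:{cl a<..<cl b}|lborel. l u) = L (cl b) - L (cl a)" using ab by (intro lset cl) auto
      also have "\<dots> = L b - L a" by (simp add: L_def cl_def)
      finally show "0 \<le> (LINT u:{a<..b}|lborel. k' u - indicator {0<..<1} u * l u)"
        using up[OF h', of a b] ab by simp
    qed
    then show ?thesis by eventually_elim (auto simp: k'_def indicator_def)
  qed
  ultimately show ?thesis using l0 by (intro exI[of _ l]) auto
qed

text \<open>The choice operator returns a minimal speed because one exists. Two minimal speeds agree
  almost everywhere, so nonnegativity passes from the density of the length to the chosen
  representative.\<close>

lemma metric_speed_props:
  assumes c: "c \<in> AC_curves"
  shows speed_bound_metric_speed: "speed_bound c (metric_speed c)"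
    and metric_speed_le: "\<And>h. speed_bound c h \<Longrightarrow> AE u in lborel. u \<in> {0<..<1} \<longrightarrow> metric_speed c u \<le> h u"
    and metric_speed_nonneg: "AE u in lborel. u \<in> {0<..<1} \<longrightarrow> 0 \<le> metric_speed c u"
proof -
  obtain l where l: "speed_bound c l" "\<forall>u. 0 \<le> l u"
    "\<And>h. speed_bound c h \<Longrightarrow> (AE u in lborel. u \<in> {0<..<1} \<longrightarrow> l u \<le> h u)"
    using minimal_speed_exists[OF c] by blast
  have "speed_bound c (metric_speed c) \<and>
     (\<forall>h'. speed_bound c h' \<longrightarrow> (AE u in lborel. u \<in> {0<..<1} \<longrightarrow> metric_speed c u \<le> h' u))"
    unfolding metric_speed_def by (rule someI[of _ l]) (use l in blast)
  then show 1: "speed_bound c (metric_speed c)"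
    and 2: "\<And>h. speed_bound c h \<Longrightarrow> AE u in lborel. u \<in> {0<..<1} \<longrightarrow> metric_speed c u \<le> h u" by auto
  have eq: "AE u in lborel. u \<in> {0<..<1} \<longrightarrow> metric_speed c u = l u"
    using 2[OF l(1)] l(3)[OF 1] by eventually_elim auto
  then show "AE u in lborel. u \<in> {0<..<1} \<longrightarrow> 0 \<le> metric_speed c u"
    by eventually_elim (use l in auto)
qed

lemma metric_speed_measurable:
  assumes c: "c \<in> AC_curves"
  shows "(\<lambda>u. indicator {0<..<1} u * metric_speed c u) \<in> borel_measurable borel"
  using speed_bound_metric_speed[OF c] unfolding speed_bound_def set_integrable_def
  by (auto dest: borel_measurable_integrable)

section \<open>Convex combinations in Lebesgue spaces\<close>

lemma epowr_ennreal [simp]: "0 \<le> x \<Longrightarrow> epowr (ennreal x) a = ennreal (x powr a)"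
  by (simp add: epowr_def)

lemma epowr_top [simp]: "epowr \<top> a = \<top>"
  by (simp add: epowr_def)

lemma epowr_0 [simp]: "epowr 0 a = 0"
  by (simp add: epowr_def)

lemma epowr_mono: "0 \<le> a \<Longrightarrow> x \<le> y \<Longrightarrow> epowr x a \<le> epowr y a"
  by (cases x; cases y) (auto intro!: ennreal_leI powr_mono2 simp: top_unique)

lemma epowr_measurable [measurable]: "(\<lambda>x. epowr x a) \<in> borel_measurable borel"
  unfolding epowr_def by measurable

lemma epowr_inverse: "a > 0 \<Longrightarrow> epowr (epowr x a) (1 / a) = x" "a > 0 \<Longrightarrow> epowr (epowr x (1 / a)) a = x"
  by (cases x; simp add: powr_powr)+

lemma epowr_mult: "0 \<le> c \<Longrightarrow> epowr (ennreal c * x) a = ennreal (c powr a) * epowr x a"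
  by (cases x; cases "c = 0") (auto simp: ennreal_mult[symmetric] powr_mult ennreal_mult_top)

lemma epowr_add_le:
  assumes "0 < a"
  shows "epowr (x + y) a \<le> ennreal (2 powr a) * (epowr x a + epowr y a)"
proof -
  have "x + y \<le> ennreal 2 * max x y"
    by (simp add: max_def mult_2 add_mono)
  then have "epowr (x + y) a \<le> ennreal (2 powr a) * epowr (max x y) a"
    using assms epowr_mono[of a "x + y" "ennreal 2 * max x y"] epowr_mult[of 2 "max x y" a] by simp
  also have "epowr (max x y) a \<le> epowr x a + epowr y a"
    by (simp add: max_def)
  finally show ?thesis by (simp add: mult_left_mono)
qed

section \<open>Strict and uniform convexity of the power function\<close>

text \<open>The function x^p - p x decreases strictly on [0, 1] and increases strictly beyond, so 1
  is its only minimum.\<close>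

lemma powr_gt_tangent:
  fixes p u :: real
  assumes p: "1 < p" and u: "0 \<le> u" "u \<noteq> 1"
  shows "1 + p * (u - 1) < u powr p"
proof -
  define g where "g = (\<lambda>x::real. x powr p - p * x)"
  have c: "continuous_on {0..} g" unfolding g_def using p
    by (intro continuous_intros continuous_on_powr') auto
  have d: "(g has_real_derivative p * (x powr (p - 1) - 1)) (at x)" if "0 < x" for x
    unfolding g_def using that by (auto intro!: derivative_eq_intros simp: right_diff_distrib)
  have "g 1 < g u"
  proof (cases "u < 1")
    case True
    show ?thesis
    proof (rule DERIV_neg_imp_decreasing_open[OF True])
      fix x assume x: "u < x" "x < 1"
      then have "x powr (p - 1) < 1 powr (p - 1)" using u p by (intro powr_less_mono2) auto
      then show "\<exists>y. (g has_real_derivative y) (at x) \<and> y < 0"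
        using d[of x] x u p by (intro exI[of _ "p * (x powr (p - 1) - 1)"]) (auto simp: mult_less_0_iff)
    qed (use u in \<open>auto intro: continuous_on_subset[OF c]\<close>)
  next
    case False
    then have "1 < u" using u by simp
    then show ?thesis
    proof (rule DERIV_pos_imp_increasing_open)
      fix x assume x: "1 < x" "x < u"
      then have "1 powr (p - 1) < x powr (p - 1)" using p by (intro powr_less_mono2) auto
      then show "\<exists>y. (g has_real_derivative y) (at x) \<and> 0 < y"
        using d[of x] x p by (intro exI[of _ "p * (x powr (p - 1) - 1)"]) auto
    qed (auto intro: continuous_on_subset[OF c])
  qed
  then show ?thesis by (simp add: g_def algebra_simps)
qed

lemma powr_ge_tangent:
  fixes p m x :: real
  assumes p: "1 < p" and m: "0 < m" and x: "0 \<le> x"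
  shows "m powr p + p * m powr (p - 1) * (x - m) \<le> x powr p"
proof -
  have "1 + p * (x / m - 1) \<le> (x / m) powr p"
    using powr_gt_tangent[OF p, of "x / m"] m x by (cases "x / m = 1") auto
  then have "m powr p * (1 + p * (x / m - 1)) \<le> m powr p * (x / m) powr p"
    by (rule mult_left_mono) simp
  also have "m powr p * (x / m) powr p = x powr p" using m x by (simp add: powr_mult[symmetric])
  also have "m powr p * (1 + p * (x / m - 1)) = m powr p + p * m powr (p - 1) * (x - m)"
    using m by (simp add: powr_diff field_simps)
  finally show ?thesis .
qed

text \<open>Add the strict tangent inequalities at 2 t and at 2 (1 - t); the linear terms
  cancel.\<close>

lemma powr_midpoint_strict:
  fixes p t :: real
  assumes p: "1 < p" and t: "0 \<le> t" "t \<le> 1" "t \<noteq> 1/2"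
  shows "(1/2) powr p < (t powr p + (1 - t) powr p) / 2"
proof -
  have "1 + p * (2 * t - 1) < (2 * t) powr p" "1 + p * (2 * (1 - t) - 1) < (2 * (1 - t)) powr p"
    using t by (intro powr_gt_tangent[OF p]; simp)+
  then have "2 < (2 * t) powr p + (2 * (1 - t)) powr p" by (simp add: algebra_simps)
  also have "(2 * t) powr p = 2 powr p * t powr p" using t by (subst powr_mult) auto
  also have "(2 * (1 - t)) powr p = 2 powr p * (1 - t) powr p" using t by (subst powr_mult) auto
  also have "2 powr p * t powr p + 2 powr p * (1 - t) powr p = 2 powr p * (t powr p + (1 - t) powr p)"
    by (simp add: distrib_left)
  finally have "2 < 2 powr p * (t powr p + (1 - t) powr p)" .
  then show ?thesis by (simp add: powr_divide field_simps)
qed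

text \<open>A uniform convexity estimate that avoids the case distinction of Clarkson's inequalities;
  it follows from strict convexity by homogeneity and compactness.\<close>

lemma powr_uniformly_convex:
  fixes p e :: real
  assumes p: "1 < p" and e: "0 < e"
  shows "\<exists>C>0. \<forall>a\<ge>0. \<forall>b\<ge>0. \<bar>a - b\<bar> powr p \<le> e * (a powr p + b powr p)
    + C * ((a powr p + b powr p) / 2 - ((a + b) / 2) powr p)"
proof -
  define \<psi> where "\<psi> = (\<lambda>t::real. t powr p + (1 - t) powr p)"
  define \<phi> where "\<phi> = (\<lambda>t::real. \<psi> t / 2 - (1/2) powr p)"
  have \<psi>c: "continuous_on {0..1} \<psi>" unfolding \<psi>_def using p
    by (intro continuous_intros continuous_on_powr') auto
  have \<phi>c: "continuous_on {0..1} \<phi>" unfolding \<phi>_def by (intro continuous_intros \<psi>c) auto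
  have \<psi>0: "0 \<le> \<psi> t" for t by (simp add: \<psi>_def)
  have \<phi>0: "0 \<le> \<phi> t" if "0 \<le> t" "t \<le> 1" for t
  proof (cases "t = 1/2")
    case False then show ?thesis using powr_midpoint_strict[OF p that] by (simp add: \<phi>_def \<psi>_def)
  next
    case True then show ?thesis by (simp add: \<phi>_def \<psi>_def True)
  qed
  \<comment> \<open>K collects the parameters at which the first term alone may not suffice. It is
    compact and misses 1/2, the only zero of \<phi> on [0, 1]; so \<phi> has a positive minimum on
    K, and a large C takes over there.\<close>
  define K where "K = {t \<in> {0..1}. e * \<psi> t \<le> \<bar>2 * t - 1\<bar> powr p}"
  have "closed K"
    unfolding K_def using p
    by (intro continuous_on_closed_Collect_le continuous_intros continuous_on_powr' \<psi>c) auto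
  moreover have "K \<subseteq> {0..1}" by (auto simp: K_def)
  ultimately have "compact K" using closed_Int_compact[of K "{0..1}"] by (simp add: Int_absorb2)
  have "\<exists>C>0. \<forall>t\<in>K. 1 \<le> C * \<phi> t"
  proof (cases "K = {}")
    case True then show ?thesis by (auto intro: exI[of _ 1])
  next
    case False
    obtain t0 where t0: "t0 \<in> K" "\<forall>t\<in>K. \<phi> t0 \<le> \<phi> t"
      using continuous_attains_inf[OF \<open>compact K\<close> False continuous_on_subset[OF \<phi>c \<open>K \<subseteq> {0..1}\<close>]] by auto
    have "0 < e * \<psi> (1/2)" using e by (simp add: \<psi>_def)
    moreover have "e * \<psi> t0 \<le> \<bar>2 * t0 - 1\<bar> powr p" using t0(1) by (simp add: K_def)
    ultimately have "t0 \<noteq> 1/2" by (intro notI) simp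
    then have "0 < \<phi> t0" using powr_midpoint_strict[OF p, of t0] t0(1) by (simp add: \<phi>_def \<psi>_def K_def)
    then show ?thesis using t0(2) by (intro exI[of _ "1 / \<phi> t0"]) (auto simp: field_simps)
  qed
  then obtain C where C: "C > 0" "\<And>t. t \<in> K \<Longrightarrow> 1 \<le> C * \<phi> t" by auto
  have *: "\<bar>2 * t - 1\<bar> powr p \<le> e * \<psi> t + C * \<phi> t" if t: "0 \<le> t" "t \<le> 1" for t
  proof (cases "t \<in> K")
    case True
    have "\<bar>2 * t - 1\<bar> powr p \<le> 1" using t p by (intro powr_le1) auto
    then show ?thesis using C(2)[OF True] \<psi>0[of t] e by (smt (verit) mult_nonneg_nonneg)
  next
    case False
    then show ?thesis using t C(1) \<phi>0[OF t] by (auto simp: K_def intro!: add_increasing2)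
  qed
  show ?thesis
  proof (intro exI[of _ C] conjI allI impI C(1))
    fix a b :: real assume ab: "0 \<le> a" "0 \<le> b"
    show "\<bar>a - b\<bar> powr p \<le> e * (a powr p + b powr p) + C * ((a powr p + b powr p) / 2 - ((a + b) / 2) powr p)"
    proof (cases "a + b = 0")
      case True
      then have "a = 0" "b = 0" using ab by auto
      then show ?thesis by simp
    next
      case False
      \<comment> \<open>Homogeneity: after division by a + b only the proportion t matters.\<close>
      define s t where "s = a + b" and "t = a / s"
      have s: "s > 0" using False ab by (simp add: s_def)
      have t: "0 \<le> t" "t \<le> 1" using ab s by (auto simp: t_def s_def)
      have a: "a = s * t" and b: "b = s * (1 - t)" using s by (auto simp: t_def s_def field_simps)
      have "a - b = s * (2 * t - 1)" by (simp add: a b algebra_simps)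
      then have 1: "\<bar>a - b\<bar> powr p = s powr p * \<bar>2 * t - 1\<bar> powr p" using s by (simp add: abs_mult powr_mult)
      have 2: "a powr p + b powr p = s powr p * \<psi> t"
        using s t by (simp add: a b \<psi>_def powr_mult distrib_left)
      have "(a + b) / 2 = s * (1/2)" by (simp add: s_def)
      then have "((a + b) / 2) powr p = s powr p * (1/2) powr p" using s by (simp add: powr_mult del: times_divide_eq_right mult_1_right)
      then have 3: "(a powr p + b powr p) / 2 - ((a + b) / 2) powr p = s powr p * \<phi> t"
        unfolding 2 \<phi>_def by (simp add: algebra_simps)
      have "s powr p * \<bar>2 * t - 1\<bar> powr p \<le> e * (s powr p * \<psi> t) + C * (s powr p * \<phi> t)"
        using mult_left_mono[OF *[OF t], of "s powr p"] by (simp add: algebra_simps)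
      then show ?thesis by (simp only: 1 3) (simp only: 2)
    qed
  qed
qed

section \<open>Nearly minimal convex combinations of a bounded sequence\<close>

text \<open>Restricting the indices to n \<ge> j lets an estimate that holds for all large n pass to
  the combination.\<close>

definition tail_combinations :: "(nat \<Rightarrow> 'a \<Rightarrow> real) \<Rightarrow> nat \<Rightarrow> ('a \<Rightarrow> real) set" where
  "tail_combinations G j = {\<lambda>x. \<Sum>n\<in>I. w n * G n x | I w.
     finite I \<and> I \<subseteq> {j..} \<and> (\<forall>n. 0 \<le> w n) \<and> (\<Sum>n\<in>I. w n) = (1::real)}"

lemma tail_combinations_mono: "i \<le> j \<Longrightarrow> tail_combinations G j \<subseteq> tail_combinations G i"
  unfolding tail_combinations_def by (fastforce)

lemma tail_combinations_self: "G j \<in> tail_combinations G j"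
  unfolding tail_combinations_def by (auto intro!: exI[of _ "{j}"] exI[of _ "\<lambda>_. 1"])

lemma tail_combinations_midpoint:
  assumes "g \<in> tail_combinations G j" "h \<in> tail_combinations G j"
  shows "(\<lambda>x. (g x + h x) / 2) \<in> tail_combinations G j"
proof -
  obtain I v where I: "g = (\<lambda>x. \<Sum>n\<in>I. v n * G n x)" "finite I" "I \<subseteq> {j..}" "\<forall>n. 0 \<le> v n" "(\<Sum>n\<in>I. v n) = 1"
    using assms(1) unfolding tail_combinations_def by auto
  obtain J w where J: "h = (\<lambda>x. \<Sum>n\<in>J. w n * G n x)" "finite J" "J \<subseteq> {j..}" "\<forall>n. 0 \<le> w n" "(\<Sum>n\<in>J. w n) = 1"
    using assms(2) unfolding tail_combinations_def by auto
  define u where "u = (\<lambda>n. ((if n \<in> I then v n else 0) + (if n \<in> J then w n else 0)) / 2)"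
  have u: "(\<Sum>n\<in>I \<union> J. u n * F n) = ((\<Sum>n\<in>I. v n * F n) + (\<Sum>n\<in>J. w n * F n)) / 2" for F :: "nat \<Rightarrow> real"
  proof -
    have "(\<Sum>n\<in>I \<union> J. u n * F n) = (\<Sum>n\<in>I \<union> J. ((if n \<in> I then v n * F n else 0) + (if n \<in> J then w n * F n else 0)) / 2)"
      by (intro sum.cong) (auto simp: u_def algebra_simps)
    also have "\<dots> = ((\<Sum>n\<in>I \<union> J. if n \<in> I then v n * F n else 0) + (\<Sum>n\<in>I \<union> J. if n \<in> J then w n * F n else 0)) / 2"
      by (simp only: sum_divide_distrib[symmetric] sum.distrib)
    also have "(\<Sum>n\<in>I \<union> J. if n \<in> I then v n * F n else 0) = (\<Sum>n\<in>I. v n * F n)"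
      using I J by (subst sum.inter_restrict[symmetric]) (auto simp: Int_absorb1)
    also have "(\<Sum>n\<in>I \<union> J. if n \<in> J then w n * F n else 0) = (\<Sum>n\<in>J. w n * F n)"
      using I J by (subst sum.inter_restrict[symmetric]) (auto simp: Int_absorb1)
    finally show ?thesis .
  qed
  show ?thesis
    unfolding tail_combinations_def
  proof (intro CollectI exI[of _ "I \<union> J"] exI[of _ u] conjI)
    show "(\<lambda>x. (g x + h x) / 2) = (\<lambda>x. \<Sum>n\<in>I \<union> J. u n * G n x)"
      using u I J by auto
    show "(\<Sum>n\<in>I \<union> J. u n) = 1" using u[of "\<lambda>_. 1"] I J by simp
  qed (use I J in \<open>auto simp: u_def\<close>)
qed

lemma tail_combinations_measurable:
  assumes "\<And>n. G n \<in> borel_measurable M" "h \<in> tail_combinations G j"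
  shows "h \<in> borel_measurable M"
  using assms unfolding tail_combinations_def by auto

lemma tail_combinations_nonneg:
  assumes "\<And>n x. 0 \<le> G n x" "h \<in> tail_combinations G j"
  shows "0 \<le> h x"
  using assms unfolding tail_combinations_def by (auto intro!: sum_nonneg mult_nonneg_nonneg)


text \<open>The infimum of the p-th power integral over combinations of the tail from j increases
  with j to some d. Two nearly minimal members of a late tail have their midpoint in the same tail,
  where the integral is at least d up to a small error; uniform convexity then forces them to be
  close.\<close>

lemma tail_combinations_cauchy:
  assumes p: "1 < p" and G: "\<And>n. G n \<in> borel_measurable M" "\<And>n x. 0 \<le> G n x"
    and A: "0 \<le> A" "\<And>n. (\<integral>\<^sup>+x. ennreal (G n x powr p) \<partial>M) \<le> ennreal A"
  shows "\<exists>d. 0 \<le> d \<and> d \<le> A \<and>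
    (\<forall>\<tau>>0. \<exists>J. \<exists>\<eta>>0. \<forall>g\<in>tail_combinations G J. \<forall>h\<in>tail_combinations G J.
       (\<integral>\<^sup>+x. ennreal (g x powr p) \<partial>M) \<le> ennreal (d + \<eta>) \<longrightarrow> (\<integral>\<^sup>+x. ennreal (h x powr p) \<partial>M) \<le> ennreal (d + \<eta>) \<longrightarrow>
       (\<integral>\<^sup>+x. ennreal (\<bar>g x - h x\<bar> powr p) \<partial>M) \<le> ennreal \<tau>) \<and>
    (\<forall>J. \<forall>\<eta>>0. \<exists>h\<in>tail_combinations G J. (\<integral>\<^sup>+x. ennreal (h x powr p) \<partial>M) \<le> ennreal (d + \<eta>))"
proof -
  define \<Phi> where "\<Phi> = (\<lambda>h. \<integral>\<^sup>+x. ennreal (h x powr p) \<partial>M)"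
  define D where "D = (\<lambda>j. INF h\<in>tail_combinations G j. \<Phi> h)"
  have DA: "D j \<le> ennreal A" for j
    unfolding D_def by (rule order_trans[OF INF_lower[OF tail_combinations_self]]) (use A in \<open>simp add: \<Phi>_def\<close>)
  then have SA: "(SUP j. D j) \<le> ennreal A" by (auto intro: SUP_least)
  then obtain d where d: "(SUP j. D j) = ennreal d" "0 \<le> d"
    by (cases "SUP j. D j") (auto simp: top_unique)
  have "d \<le> A" using SA A(1) by (simp add: d(1))
  note d = d this
  have D_le: "D j \<le> ennreal d" for j unfolding d(1)[symmetric] by (auto intro: SUP_upper)
  have 3: "\<exists>h\<in>tail_combinations G J. \<Phi> h \<le> ennreal (d + \<eta>)" if "0 < \<eta>" for J \<eta>
  proof -
    have "D J < ennreal (d + \<eta>)"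
      using that d by (intro le_less_trans[OF D_le]) (simp add: ennreal_less_iff)
    then show ?thesis unfolding D_def INF_less_iff by (auto intro: less_imp_le)
  qed
  have 2: "\<exists>J. \<exists>\<eta>>0. \<forall>g\<in>tail_combinations G J. \<forall>h\<in>tail_combinations G J.
       \<Phi> g \<le> ennreal (d + \<eta>) \<longrightarrow> \<Phi> h \<le> ennreal (d + \<eta>) \<longrightarrow> (\<integral>\<^sup>+x. ennreal (\<bar>g x - h x\<bar> powr p) \<partial>M) \<le> ennreal \<tau>"
    if \<tau>: "0 < \<tau>" for \<tau>
  proof -
    \<comment> \<open>The choices of e here and of \<eta> below make the final errors 2 e (d +
      \<eta>) and 2 C \<eta> at most \<tau> / 2 each.\<close>
    define e where "e = \<tau> / (4 * (d + 1))"
    have e: "0 < e" using \<tau> d by (simp add: e_def)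
    obtain C where C: "0 < C" "\<And>a b. 0 \<le> a \<Longrightarrow> 0 \<le> b \<Longrightarrow> \<bar>a - b\<bar> powr p \<le> e * (a powr p + b powr p)
      + C * ((a powr p + b powr p) / 2 - ((a + b) / 2) powr p)"
      using powr_uniformly_convex[OF p e] by blast
    define \<eta> where "\<eta> = min 1 (\<tau> / (4 * C))"
    have \<eta>: "0 < \<eta>" "\<eta> \<le> 1" "C * \<eta> \<le> \<tau> / 4" using C \<tau> by (auto simp: \<eta>_def min_def field_simps)
    have "\<exists>J. ennreal d \<le> D J + ennreal \<eta>"
    proof (rule ccontr)
      assume "\<not> ?thesis"
      then have "(SUP J. D J + ennreal \<eta>) \<le> ennreal d" by (auto intro!: SUP_least simp: not_le less_imp_le)
      then have "(SUP J. D J) + ennreal \<eta> \<le> ennreal d" by (simp add: ennreal_SUP_add_left)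
      then show False unfolding d(1) using \<eta> d by (simp add: ennreal_plus[symmetric] del: ennreal_plus)
    qed
    then obtain J where J: "ennreal d \<le> D J + ennreal \<eta>" by auto
    show ?thesis
    proof (intro exI[of _ J] exI[of _ \<eta>] conjI \<eta>(1) ballI impI)
      fix g h assume g: "g \<in> tail_combinations G J" "\<Phi> g \<le> ennreal (d + \<eta>)"
        and h: "h \<in> tail_combinations G J" "\<Phi> h \<le> ennreal (d + \<eta>)"
      note [measurable] = tail_combinations_measurable[OF G(1) g(1)] tail_combinations_measurable[OF G(1) h(1)]
      note nn = tail_combinations_nonneg[OF G(2) g(1)] tail_combinations_nonneg[OF G(2) h(1)]
      define m where "m = (\<lambda>x. (g x + h x) / 2)"
      have mJ: "m \<in> tail_combinations G J" unfolding m_def by (rule tail_combinations_midpoint[OF g(1) h(1)])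
      have [measurable]: "m \<in> borel_measurable M" by (simp add: m_def)
      define X where "X = (\<integral>\<^sup>+x. ennreal (\<bar>g x - h x\<bar> powr p) \<partial>M)"
      \<comment> \<open>The convexity estimate is integrated with the midpoint term moved to the
        left, since subtraction in \<open>ennreal\<close> truncates. The same sum then shows that X
        and the midpoint integral are finite.\<close>
      have "X + ennreal C * \<Phi> m = (\<integral>\<^sup>+x. ennreal (\<bar>g x - h x\<bar> powr p + C * m x powr p) \<partial>M)"
        unfolding X_def \<Phi>_def using C(1)
        by (simp add: nn_integral_cmult[symmetric] nn_integral_add[symmetric] ennreal_mult)
      also have "\<dots> \<le> (\<integral>\<^sup>+x. ennreal ((e + C / 2) * (g x powr p + h x powr p)) \<partial>M)"
      proof (intro nn_integral_mono ennreal_leI)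
        fix x
        show "\<bar>g x - h x\<bar> powr p + C * m x powr p \<le> (e + C / 2) * (g x powr p + h x powr p)"
          using C(2)[OF nn(1)[of x] nn(2)[of x]] by (simp add: m_def algebra_simps add_divide_distrib)
      qed
      also have "\<dots> = ennreal (e + C / 2) * (\<Phi> g + \<Phi> h)"
        unfolding \<Phi>_def using C(1) e
        by (simp add: nn_integral_cmult[symmetric] nn_integral_add[symmetric] ennreal_mult)
      finally have *: "X + ennreal C * \<Phi> m \<le> ennreal (e + C / 2) * (\<Phi> g + \<Phi> h)" .
      obtain a b where ab: "\<Phi> g = ennreal a" "0 \<le> a" "\<Phi> h = ennreal b" "0 \<le> b"
        using g(2) h(2) by (cases "\<Phi> g"; cases "\<Phi> h") (auto simp: top_unique)
      have ab': "a \<le> d + \<eta>" "b \<le> d + \<eta>" using g(2) h(2) ab d \<eta> by (auto simp del: ennreal_plus)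
      have **: "X + ennreal C * \<Phi> m \<le> ennreal ((e + C / 2) * (a + b))"
        using * ab C(1) e by (simp add: ennreal_mult[symmetric] ennreal_plus[symmetric] del: ennreal_plus)
      then have "X + ennreal C * \<Phi> m < \<top>" by (rule le_less_trans) simp
      then have fin: "X < \<top>" "\<Phi> m < \<top>" using C(1) by (auto simp: ennreal_mult_less_top ennreal_add_less_top)
      then obtain x \<mu> where xm: "X = ennreal x" "0 \<le> x" "\<Phi> m = ennreal \<mu>" "0 \<le> \<mu>"
        by (cases X; cases "\<Phi> m") auto
      have "D J \<le> \<Phi> m" unfolding D_def using mJ by (rule INF_lower)
      then have "ennreal d \<le> ennreal (\<mu> + \<eta>)"
        using J xm \<eta> by (simp add: order_trans[OF _ add_right_mono])
      then have dm: "d \<le> \<mu> + \<eta>" using xm \<eta> by (simp del: ennreal_plus)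
      have "x + C * \<mu> \<le> (e + C / 2) * (a + b)"
        using ** xm C(1) e ab by (simp add: ennreal_mult[symmetric] ennreal_plus[symmetric] del: ennreal_plus)
      also have "\<dots> \<le> (e + C / 2) * (2 * (d + \<eta>))"
        using ab' e C(1) by (intro mult_left_mono) auto
      finally have "x + C * \<mu> \<le> (e + C / 2) * (2 * (d + \<eta>))" .
      moreover have "C * d \<le> C * (\<mu> + \<eta>)" using dm C(1) by (intro mult_left_mono) auto
      ultimately have "x \<le> 2 * e * (d + \<eta>) + 2 * (C * \<eta>)" by (simp add: algebra_simps)
      also have "\<dots> \<le> 2 * e * (d + 1) + 2 * (\<tau> / 4)"
        using \<eta> e by (intro add_mono mult_left_mono) auto
      also have "2 * e * (d + 1) = \<tau> / 2" using d by (simp add: e_def field_simps)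
      finally show "(\<integral>\<^sup>+x. ennreal (\<bar>g x - h x\<bar> powr p) \<partial>M) \<le> ennreal \<tau>"
        using xm unfolding X_def by (simp add: ennreal_leI)
    qed
  qed
  show ?thesis using d 2 3 unfolding \<Phi>_def by blast
qed

text \<open>A substitute for weak compactness: the convex combinations form a Cauchy sequence so fast that
  their supremum is still controlled.\<close>

lemma dominated_convex_combinations:
  assumes p: "1 < p" and G: "\<And>n. G n \<in> borel_measurable M" "\<And>n x. 0 \<le> G n x"
    and A: "0 < A" "\<And>n. (\<integral>\<^sup>+x. ennreal (G n x powr p) \<partial>M) \<le> ennreal A"
  shows "\<exists>H \<in> borel_measurable M. (\<integral>\<^sup>+x. epowr (H x) p \<partial>M) \<le> ennreal (3 * 2 powr p * A) \<and>
    (\<forall>j. \<exists>h \<in> tail_combinations G j. \<forall>x. ennreal (h x) \<le> H x)"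
proof -
  obtain d where d: "0 \<le> d" "d \<le> A"
    and cauchy: "\<And>\<tau>. 0 < \<tau> \<Longrightarrow> \<exists>J. \<exists>\<eta>>0. \<forall>g\<in>tail_combinations G J. \<forall>h\<in>tail_combinations G J.
       (\<integral>\<^sup>+x. ennreal (g x powr p) \<partial>M) \<le> ennreal (d + \<eta>) \<longrightarrow> (\<integral>\<^sup>+x. ennreal (h x powr p) \<partial>M) \<le> ennreal (d + \<eta>) \<longrightarrow>
       (\<integral>\<^sup>+x. ennreal (\<bar>g x - h x\<bar> powr p) \<partial>M) \<le> ennreal \<tau>"
    and ex: "\<And>J \<eta>. 0 < \<eta> \<Longrightarrow> \<exists>h\<in>tail_combinations G J. (\<integral>\<^sup>+x. ennreal (h x powr p) \<partial>M) \<le> ennreal (d + \<eta>)"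
    using tail_combinations_cauchy[where G = G, OF p G less_imp_le[OF A(1)] A(2)]
    by (elim exE conjE) (rule that, assumption, assumption, drule spec, drule (1) mp, assumption, drule spec, drule spec, drule (1) mp, assumption)
  \<comment> \<open>The reciprocals 1 / c j sum to one, so a common bound for all c j |h (j + 1) - h
    j| bounds every h j - h 0. The tolerances \<tau> j make the weighted p-th powers integrate to at
    most A / c j, and these sum to A.\<close>
  define c where "c = (\<lambda>j::nat. 2 ^ Suc j :: real)"
  have c0: "c j > 0" for j by (simp add: c_def)
  define \<tau> where "\<tau> = (\<lambda>j. A / (c j powr p * c j))"
  have \<tau>: "\<tau> j > 0" for j unfolding \<tau>_def using A(1) c0[of j] by (intro divide_pos_pos mult_pos_pos) auto
  define P where "P = (\<lambda>j J \<eta>. \<forall>g\<in>tail_combinations G J. \<forall>h\<in>tail_combinations G J.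
       (\<integral>\<^sup>+x. ennreal (g x powr p) \<partial>M) \<le> ennreal (d + \<eta>) \<longrightarrow> (\<integral>\<^sup>+x. ennreal (h x powr p) \<partial>M) \<le> ennreal (d + \<eta>) \<longrightarrow>
       (\<integral>\<^sup>+x. ennreal (\<bar>g x - h x\<bar> powr p) \<partial>M) \<le> ennreal (\<tau> j))"
  have "\<exists>J \<eta>. 0 < \<eta> \<and> P j J \<eta>" for j
    using cauchy[OF \<tau>[of j]] unfolding P_def by (elim exE conjE) (intro exI conjI)
  then obtain J \<eta> where \<eta>: "\<And>j. 0 < \<eta> j" and Pj: "\<And>j. P j (J j) (\<eta> j)" by metis
  have J\<eta>: "(\<integral>\<^sup>+x. ennreal (\<bar>g x - h x\<bar> powr p) \<partial>M) \<le> ennreal (\<tau> j)"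
    if "g \<in> tail_combinations G (J j)" "h \<in> tail_combinations G (J j)"
       "(\<integral>\<^sup>+x. ennreal (g x powr p) \<partial>M) \<le> ennreal (d + \<eta> j)" "(\<integral>\<^sup>+x. ennreal (h x powr p) \<partial>M) \<le> ennreal (d + \<eta> j)"
    for g h j
    using Pj[of j, unfolded P_def, THEN bspec, OF that(1), THEN bspec, OF that(2)] that(3,4) by simp
  \<comment> \<open>Maxima and minima over the earlier indices make both h j and h (j + 1)
    admissible at stage j. The extra entry j gives the tail condition, the extra entry A bounds the
    integral at stage 0 by 2 A.\<close>
  define J' where "J' = (\<lambda>j. Max (insert j (J ` {..j})))"
  define \<eta>' where "\<eta>' = (\<lambda>j. Min (insert A (\<eta> ` {..j})))"
  have J': "j \<le> J' j" "i \<le> j \<Longrightarrow> J i \<le> J' j" for i j unfolding J'_def by (intro Max_ge; auto)+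
  have \<eta>': "0 < \<eta>' j" "\<eta>' j \<le> A" "i \<le> j \<Longrightarrow> \<eta>' j \<le> \<eta> i" for i j
  proof -
    show "0 < \<eta>' j" unfolding \<eta>'_def using A(1) \<eta> by (subst Min_gr_iff) auto
  qed (unfold \<eta>'_def; intro Min_le; auto)+
  have "\<forall>j. \<exists>h. h \<in> tail_combinations G (J' j) \<and> (\<integral>\<^sup>+x. ennreal (h x powr p) \<partial>M) \<le> ennreal (d + \<eta>' j)"
  proof
    fix j show "\<exists>h. h \<in> tail_combinations G (J' j) \<and> (\<integral>\<^sup>+x. ennreal (h x powr p) \<partial>M) \<le> ennreal (d + \<eta>' j)"
      using ex[OF \<eta>'(1)[of j], of "J' j"] unfolding Bex_def .
  qed
  from choice[OF this] obtain h where
    "\<forall>j. h j \<in> tail_combinations G (J' j) \<and> (\<integral>\<^sup>+x. ennreal (h j x powr p) \<partial>M) \<le> ennreal (d + \<eta>' j)" ..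
  then have h: "\<And>j. h j \<in> tail_combinations G (J' j)" "\<And>j. (\<integral>\<^sup>+x. ennreal (h j x powr p) \<partial>M) \<le> ennreal (d + \<eta>' j)"
    by simp_all
  note hm [measurable] = tail_combinations_measurable[OF G(1) h(1)]
  note h0 = tail_combinations_nonneg[OF G(2) h(1)]
  have hJ: "h j \<in> tail_combinations G (J i)" if "i \<le> j" for i j
    using h(1)[of j] tail_combinations_mono[OF J'(2)[OF that]] by auto
  have h\<eta>: "(\<integral>\<^sup>+x. ennreal (h j x powr p) \<partial>M) \<le> ennreal (d + \<eta> i)" if "i \<le> j" for i j
    using h(2)[of j] \<eta>'(3)[OF that] by (meson add_left_mono ennreal_leI order_trans)
  have diff: "(\<integral>\<^sup>+x. ennreal (\<bar>h (Suc j) x - h j x\<bar> powr p) \<partial>M) \<le> ennreal (\<tau> j)" for j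
    using J\<eta>[of "h (Suc j)" j "h j", OF hJ[of j "Suc j"] hJ[of j j] h\<eta>[of j "Suc j"] h\<eta>[of j j]] by simp
  define T where "T = (\<lambda>x. \<Sum>j. ennreal (c j powr p * \<bar>h (Suc j) x - h j x\<bar> powr p))"
  have [measurable]: "T \<in> borel_measurable M" unfolding T_def by measurable
  \<comment> \<open>The p-norm over j of the weighted increments dominates each of them, so S
    controls the whole telescoping sum.\<close>
  define S where "S = (\<lambda>x. epowr (T x) (1 / p))"
  have [measurable]: "S \<in> borel_measurable M" unfolding S_def by measurable
  define H where "H = (\<lambda>x. ennreal (h 0 x) + S x)"
  have [measurable]: "H \<in> borel_measurable M" unfolding H_def by measurable
  have step: "ennreal \<bar>h (Suc j) x - h j x\<bar> \<le> ennreal (1 / c j) * S x" for j x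
  proof -
    define F where "F = (\<lambda>j. ennreal (c j powr p * \<bar>h (Suc j) x - h j x\<bar> powr p))"
    have "sum F {j} \<le> suminf F" by (rule sum_le_suminf) auto
    then have "F j \<le> suminf F" by simp
    then have "ennreal (c j powr p * \<bar>h (Suc j) x - h j x\<bar> powr p) \<le> T x"
      by (simp only: F_def T_def)
    then have "epowr (ennreal (c j powr p * \<bar>h (Suc j) x - h j x\<bar> powr p)) (1 / p) \<le> S x"
      unfolding S_def using p by (intro epowr_mono) auto
    also have "epowr (ennreal (c j powr p * \<bar>h (Suc j) x - h j x\<bar> powr p)) (1 / p) = ennreal (c j * \<bar>h (Suc j) x - h j x\<bar>)"
      using p c0[of j] by (simp add: powr_mult powr_powr)
    finally have "ennreal (1 / c j) * ennreal (c j * \<bar>h (Suc j) x - h j x\<bar>) \<le> ennreal (1 / c j) * S x"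
      by (rule mult_left_mono) simp
    then show ?thesis using c0[of j] by (simp add: ennreal_mult[symmetric])
  qed
  have bound: "ennreal (h j x) \<le> ennreal (h 0 x) + ennreal (1 - 1 / 2 ^ j) * S x" for j x
  proof (induction j)
    case (Suc j)
    have 1: "(1 - 1 / 2 ^ j) + 1 / c j = 1 - 1 / 2 ^ Suc j" "0 \<le> 1 - 1 / (2::real) ^ j" by (auto simp: c_def field_simps)
    have "ennreal (h (Suc j) x) \<le> ennreal (h j x + \<bar>h (Suc j) x - h j x\<bar>)" by (intro ennreal_leI) auto
    also have "\<dots> = ennreal (h j x) + ennreal \<bar>h (Suc j) x - h j x\<bar>" using h0 by simp
    also have "\<dots> \<le> (ennreal (h 0 x) + ennreal (1 - 1 / 2 ^ j) * S x) + ennreal (1 / c j) * S x"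
      by (intro add_mono Suc.IH step)
    also have "\<dots> = ennreal (h 0 x) + ennreal ((1 - 1 / 2 ^ j) + 1 / c j) * S x"
      using 1(2) c0[of j] by (subst ennreal_plus) (auto simp: distrib_right add.assoc)
    finally show ?case unfolding 1(1) .
  qed simp
  have dom: "ennreal (h j x) \<le> H x" for j x
  proof -
    have "ennreal (1 - 1 / 2 ^ j) * S x \<le> 1 * S x" by (intro mult_right_mono) (auto simp: ennreal_le_1)
    then show ?thesis unfolding H_def using bound[of j x] by (simp add: add_left_mono order_trans)
  qed
  have "(\<integral>\<^sup>+x. epowr (H x) p \<partial>M) \<le> (\<integral>\<^sup>+x. ennreal (2 powr p) * (ennreal (h 0 x powr p) + T x) \<partial>M)"
  \<comment> \<open>The factor 2^p is the cost of splitting the power of h 0 + S; the two integrals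
    are at most 2 A and A, which gives the constant 3 * 2^p * A.\<close>
  proof (rule nn_integral_mono)
    fix x
    show "epowr (H x) p \<le> ennreal (2 powr p) * (ennreal (h 0 x powr p) + T x)"
      unfolding H_def using p epowr_add_le[of p "ennreal (h 0 x)" "S x"] h0[of 0 x] by (simp add: S_def epowr_inverse)
  qed
  also have "\<dots> = ennreal (2 powr p) * ((\<integral>\<^sup>+x. ennreal (h 0 x powr p) \<partial>M) + (\<integral>\<^sup>+x. T x \<partial>M))"
    by (simp add: nn_integral_cmult nn_integral_add)
  also have "(\<integral>\<^sup>+x. T x \<partial>M) \<le> ennreal A"
  proof -
    have "(\<integral>\<^sup>+x. T x \<partial>M) = (\<Sum>j. ennreal (c j powr p) * (\<integral>\<^sup>+x. ennreal (\<bar>h (Suc j) x - h j x\<bar> powr p) \<partial>M))"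
      unfolding T_def by (subst nn_integral_suminf) (auto simp: ennreal_mult nn_integral_cmult)
    also have "\<dots> \<le> (\<Sum>j. ennreal (A * (1/2) ^ Suc j))"
    proof (rule suminf_le)
      fix j
      have "ennreal (c j powr p) * (\<integral>\<^sup>+x. ennreal (\<bar>h (Suc j) x - h j x\<bar> powr p) \<partial>M) \<le> ennreal (c j powr p) * ennreal (\<tau> j)"
        by (intro mult_left_mono diff) simp
      also have "\<dots> = ennreal (A / c j)" using c0[of j] A by (simp add: \<tau>_def ennreal_mult[symmetric])
      also have "A / c j = A * (1/2) ^ Suc j" by (simp add: c_def power_divide)
      finally show "ennreal (c j powr p) * (\<integral>\<^sup>+x. ennreal (\<bar>h (Suc j) x - h j x\<bar> powr p) \<partial>M) \<le> ennreal (A * (1/2) ^ Suc j)" .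
    qed auto
    also have "\<dots> = ennreal A"
    proof -
      have "(\<lambda>j. A * (1/2) ^ Suc j) sums (A * 1)" by (intro sums_mult power_half_series)
      then show ?thesis using A by (intro suminf_ennreal_eq) auto
    qed
    finally show ?thesis .
  qed
  also have "(\<integral>\<^sup>+x. ennreal (h 0 x powr p) \<partial>M) \<le> ennreal (2 * A)"
    using h(2)[of 0] \<eta>'(2)[of 0] d by (auto elim!: order_trans intro!: ennreal_leI)
  finally have "(\<integral>\<^sup>+x. epowr (H x) p \<partial>M) \<le> ennreal (2 powr p) * (ennreal (2 * A) + ennreal A)"
    by (simp add: mult_left_mono add_mono)
  also have "\<dots> = ennreal (3 * 2 powr p * A)" using A by (simp add: ennreal_mult[symmetric] ennreal_plus[symmetric] del: ennreal_plus)
  finally have "(\<integral>\<^sup>+x. epowr (H x) p \<partial>M) \<le> ennreal (3 * 2 powr p * A)" .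
  moreover have "\<exists>h \<in> tail_combinations G j. \<forall>x. ennreal (h x) \<le> H x" for j
    using h(1)[of j] tail_combinations_mono[OF J'(1)[of j]] dom by blast
  ultimately show ?thesis by (intro bexI[of _ H]) auto
qed

section \<open>Test plans and minimal weak upper gradients\<close>

lemma mspace_curve: "mspace curve_metric = {c. c \<in> extensional {0..1} \<and> continuous_on {0..1} c}"
proof -
  have "bounded (c ` {0..1})" if "continuous_on {0..1} c" for c :: "real \<Rightarrow> 'a"
    using compact_continuous_image[OF that] by (simp add: compact_imp_bounded)
  then show ?thesis by (auto simp: curve_metric_def)
qed

lemma space_curve_borel [simp]: "space curve_borel = mspace curve_metric"
  by (simp add: curve_borel_def space_measure_of_conv)

lemma openin_curve_subset:
  "{U. openin (mtopology_of curve_metric) U} \<subseteq> Pow (mspace curve_metric)"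
  using openin_subset[of "mtopology_of curve_metric"] by auto

text \<open>Openness for the supremum distance, phrased with pointwise distances only: curves in the
  ball of radius r are pointwise closer than r.\<close>

lemma sets_curve_borelI:
  fixes A :: "(real \<Rightarrow> 'a::metric_space) set"
  assumes "A \<subseteq> mspace curve_metric"
    and "\<And>c. c \<in> A \<Longrightarrow> \<exists>r>0. \<forall>c'\<in>mspace curve_metric. (\<forall>t\<in>{0..1}. dist (c t) (c' t) < r) \<longrightarrow> c' \<in> A"
  shows "A \<in> sets curve_borel"
proof -
  interpret C: Metric_space "mspace curve_metric" "mdist (curve_metric :: (real \<Rightarrow> 'a) metric)"
    by (rule Metric_space_mspace_mdist)
  have "openin (mtopology_of curve_metric) A"
    unfolding mtopology_of_def C.openin_mtopology
  proof (intro conjI ballI allI impI assms(1))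
    fix c assume c: "c \<in> A"
    then obtain r where r: "r > 0" "\<forall>c'\<in>mspace curve_metric. (\<forall>t\<in>{0..1}. dist (c t) (c' t) < r) \<longrightarrow> c' \<in> A"
      using assms(2) by blast
    have "C.mball c r \<subseteq> A"
    proof
      fix c' assume "c' \<in> C.mball c r"
      then have c': "c \<in> mspace curve_metric" "c' \<in> mspace curve_metric" "mdist curve_metric c c' < r" by auto
      have "dist (c t) (c' t) \<le> mdist curve_metric c c'" if "t \<in> {0..1}" for t
        using mdist_cfunspace_imp_mdist_le[of c "top_of_set {0..1}" euclidean_metric c' _ t] c' that
        by (simp add: curve_metric_def)
      then show "c' \<in> A" using r c' by force
    qed
    then show "\<exists>r>0. C.mball c r \<subseteq> A" using r by blast
  qed
  then show ?thesis
    unfolding curve_borel_def sets_measure_of[OF openin_curve_subset] by (intro sigma_sets.Basic) simp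
qed

lemma measurable_curve_eval:
  fixes t :: real
  assumes "t \<in> {0..1}"
  shows "(\<lambda>c. c t) \<in> borel_measurable (curve_borel :: (real \<Rightarrow> 'a::metric_space) measure)"
proof (rule borel_measurableI)
  fix S :: "'a set" assume S: "open S"
  show "(\<lambda>c. c t) -` S \<inter> space curve_borel \<in> sets curve_borel"
  proof (rule sets_curve_borelI)
    fix c assume "c \<in> (\<lambda>c. c t) -` S \<inter> space curve_borel"
    then obtain r where "r > 0" "ball (c t) r \<subseteq> S" using S by (auto simp: open_contains_ball)
    then show "\<exists>r>0. \<forall>c'\<in>mspace curve_metric. (\<forall>t\<in>{0..1}. dist (c t) (c' t) < r) \<longrightarrow> c' \<in> (\<lambda>c. c t) -` S \<inter> space curve_borel"
      using assms by (intro exI[of _ r]) auto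
  qed auto
qed

lemma measurable_curve_dist:
  fixes s t :: real
  assumes st: "s \<in> {0..1}" "t \<in> {0..1}"
  shows "(\<lambda>c. dist (c s) (c t)) \<in> borel_measurable (curve_borel :: (real \<Rightarrow> 'a::metric_space) measure)"
proof (rule borel_measurableI)
  fix S :: "real set" assume S: "open S"
  show "(\<lambda>c. dist (c s) (c t)) -` S \<inter> space curve_borel \<in> sets (curve_borel :: (real \<Rightarrow> 'a) measure)"
  proof (rule sets_curve_borelI)
    fix c :: "real \<Rightarrow> 'a" assume "c \<in> (\<lambda>c. dist (c s) (c t)) -` S \<inter> space curve_borel"
    then obtain r where r: "r > 0" "ball (dist (c s) (c t)) r \<subseteq> S" using S by (auto simp: open_contains_ball)
    have "dist (c' s) (c' t) \<in> S" if "\<forall>t\<in>{0..1}. dist (c t) (c' t) < r/2" for c'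
    proof -
      have 1: "dist (c s) (c' s) < r/2" "dist (c t) (c' t) < r/2" using that st by auto
      have "\<bar>dist (c s) (c t) - dist (c' s) (c' t)\<bar> \<le> dist (c s) (c' s) + dist (c t) (c' t)"
        using dist_triangle[of "c s" "c t" "c' s"] dist_triangle[of "c' s" "c t" "c' t"]
          dist_triangle[of "c' s" "c' t" "c s"] dist_triangle[of "c s" "c' t" "c t"]
        by (simp add: dist_commute abs_le_iff)
      then have "dist (c' s) (c' t) \<in> ball (dist (c s) (c t)) r" using 1 by (simp add: dist_real_def)
      then show ?thesis using r by blast
    qed
    then show "\<exists>r>0. \<forall>c'\<in>mspace curve_metric. (\<forall>t\<in>{0..1}. dist (c t) (c' t) < r) \<longrightarrow> c' \<in> (\<lambda>c. dist (c s) (c t)) -` S \<inter> space curve_borel"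
      using r(1) by (intro exI[of _ "r/2"]) auto
  qed auto
qed

text \<open>Curves carry no information outside the unit interval; composing with this retraction
  gives maps that are measurable on the whole line.\<close>

definition clip :: "real \<Rightarrow> real" where "clip t = max 0 (min 1 t)"

lemma clip_in [simp]: "clip t \<in> {0..1}" and clip_bounds [simp]: "0 \<le> clip t" "clip t \<le> 1"
  and clip_id [simp]: "0 \<le> t \<Longrightarrow> t \<le> 1 \<Longrightarrow> clip t = t"
  by (auto simp: clip_def)

lemma clip_measurable [measurable]: "clip \<in> borel_measurable borel"
  unfolding clip_def by measurable

lemma measurable_curve_clip:
  fixes c :: "real \<Rightarrow> 'a::metric_space"
  assumes "c \<in> mspace curve_metric"
  shows "(\<lambda>t. c (clip t)) \<in> borel_measurable borel"
proof -
  have "continuous_on UNIV (\<lambda>t. c (clip t))"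
    by (rule continuous_on_compose2[OF AC_curves_continuous[OF assms]]) (auto simp: clip_def intro!: continuous_intros)
  then show ?thesis by (rule borel_measurable_continuous_onI)
qed

text \<open>Rounding the time down to a grid leaves countably many evaluation maps, each measurable;
  continuity of the curves gives the limit as the grid is refined.\<close>

lemma measurable_curve_eval_pair [measurable]:
  "(\<lambda>x. (fst x) (clip (snd x))) \<in> borel_measurable ((curve_borel :: (real \<Rightarrow> 'a::metric_space) measure) \<Otimes>\<^sub>M lborel)"
proof (rule borel_measurable_LIMSEQ_metric)
  fix n :: nat
  have "(\<lambda>x. (\<lambda>k x. (fst x) (clip (real k / real (Suc n)))) (nat \<lfloor>clip (snd x) * real (Suc n)\<rfloor>) x)
     \<in> borel_measurable ((curve_borel :: (real \<Rightarrow> 'a) measure) \<Otimes>\<^sub>M lborel)"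
    by (rule measurable_compose_countable) (auto intro: measurable_compose[OF measurable_fst measurable_curve_eval])
  then show "(\<lambda>x. (fst x) (clip (grid n (clip (snd x))))) \<in> borel_measurable ((curve_borel :: (real \<Rightarrow> 'a) measure) \<Otimes>\<^sub>M lborel)"
    by simp
next
  fix x :: "(real \<Rightarrow> 'a) \<times> real" assume "x \<in> space (curve_borel \<Otimes>\<^sub>M lborel)"
  then have c: "continuous_on {0..1} (fst x)" by (auto simp: space_pair_measure AC_curves_continuous)
  have g: "grid n (clip (snd x)) \<in> {0..1}" for n by (rule grid_in_unit) auto
  have "(\<lambda>n. fst x (grid n (clip (snd x)))) \<longlonglongrightarrow> fst x (clip (snd x))"
    using g by (intro continuous_on_tendsto_compose[OF c grid_tendsto]) auto
  moreover have "clip (grid n (clip (snd x))) = grid n (clip (snd x))" for n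
    using clip_id[of "grid n (clip (snd x))"] g[of n] unfolding atLeastAtMost_iff by blast
  ultimately show "(\<lambda>n. fst x (clip (grid n (clip (snd x))))) \<longlonglongrightarrow> fst x (clip (snd x))" by simp
qed

section \<open>Restriction of curves to subintervals\<close>

definition subcurve :: "real \<Rightarrow> real \<Rightarrow> (real \<Rightarrow> 'a) \<Rightarrow> real \<Rightarrow> 'a" where
  "subcurve s t c = restrict (\<lambda>u. c (s + u * (t - s))) {0..1}"

lemma affine_in_unit:
  fixes s t u :: real
  assumes "0 \<le> s" "s \<le> t" "t \<le> 1" "u \<in> {0..1}"
  shows "s + u * (t - s) \<in> {0..1}"
proof -
  have "u * (t - s) \<le> 1 * (t - s)" by (rule mult_right_mono) (use assms in auto)
  then have "u * (t - s) \<le> t - s" by (simp only: mult_1_left)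
  moreover have "0 \<le> u * (t - s)" using assms by auto
  ultimately have "0 \<le> s + u * (t - s)" "s + u * (t - s) \<le> 1" using assms(1-3) by linarith+
  then show ?thesis by simp
qed

lemma affine_in_interval:
  fixes s t u :: real
  assumes "s < t" "u \<in> {0<..<1}"
  shows "s + (t - s) * u \<in> {s<..<t}"
proof -
  have "(t - s) * u < (t - s) * 1" by (rule mult_strict_left_mono) (use assms in auto)
  then have "(t - s) * u < t - s" by (simp only: mult_1_right)
  moreover have "0 < (t - s) * u" by (rule mult_pos_pos) (use assms in auto)
  ultimately have "s < s + (t - s) * u" "s + (t - s) * u < t" by linarith+
  then show ?thesis by simp
qed

lemma subcurve_mspace:
  assumes "0 \<le> s" "s \<le> t" "t \<le> 1" "c \<in> mspace curve_metric"
  shows "subcurve s t c \<in> mspace curve_metric"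
proof -
  have "continuous_on {0..1} (\<lambda>u. c (s + u * (t - s)))"
    using assms affine_in_unit[OF assms(1-3)]
    by (intro continuous_on_compose2[OF AC_curves_continuous[OF assms(4)]] continuous_intros) auto
  then have "continuous_on {0..1} (subcurve s t c)"
    by (rule continuous_on_eq) (auto simp: subcurve_def)
  then show ?thesis by (auto simp: mspace_curve subcurve_def)
qed

lemma measurable_subcurve [measurable]:
  assumes st: "0 \<le> s" "s \<le> t" "t \<le> 1"
  shows "subcurve s t \<in> measurable (curve_borel :: (real \<Rightarrow> 'a::metric_space) measure) curve_borel"
proof -
  interpret C: Metric_space "mspace curve_metric" "mdist (curve_metric :: (real \<Rightarrow> 'a) metric)"
    by (rule Metric_space_mspace_mdist)
  have "subcurve s t \<in> measurable (curve_borel :: (real \<Rightarrow> 'a) measure) (sigma (mspace curve_metric) {U. openin (mtopology_of curve_metric) U})"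
  proof (rule measurable_measure_of)
    fix U :: "(real \<Rightarrow> 'a) set" assume "U \<in> {U. openin (mtopology_of curve_metric) U}"
    then have U: "openin C.mtopology U" by (simp add: mtopology_of_def)
    show "subcurve s t -` U \<inter> space curve_borel \<in> sets curve_borel"
    proof (rule sets_curve_borelI)
      fix c assume c: "c \<in> subcurve s t -` U \<inter> space curve_borel"
      then obtain r where r: "r > 0" "C.mball (subcurve s t c) r \<subseteq> U"
        using U unfolding C.openin_mtopology by auto
      have "subcurve s t c' \<in> U" if c': "c' \<in> mspace curve_metric" "\<forall>t\<in>{0..1}. dist (c t) (c' t) < r/2" for c'
      proof -
        have m: "subcurve s t c \<in> mspace curve_metric" "subcurve s t c' \<in> mspace curve_metric"
          using c c' st by (auto intro: subcurve_mspace)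
        have "mdist curve_metric (subcurve s t c) (subcurve s t c') \<le> r/2"
          unfolding curve_metric_def
          using r c' affine_in_unit[OF st]
          by (intro mdist_cfunspace_le) (auto simp: subcurve_def intro!: less_imp_le)
        then have "subcurve s t c' \<in> C.mball (subcurve s t c) r" using m r by simp
        then show ?thesis using r by blast
      qed
      then show "\<exists>r>0. \<forall>c'\<in>mspace curve_metric. (\<forall>t\<in>{0..1}. dist (c t) (c' t) < r) \<longrightarrow> c' \<in> subcurve s t -` U \<inter> space curve_borel"
        using r(1) by (intro exI[of _ "r/2"]) auto
    qed auto
  qed (rule openin_curve_subset, auto intro: subcurve_mspace st)
  then show ?thesis by (simp only: curve_borel_def[symmetric])
qed

text \<open>An affine change of variables turns the rescaled speed into an admissible bound for the
  restricted curve; minimality of the metric speed gives the estimate.\<close>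

lemma subcurve_speed:
  fixes c :: "real \<Rightarrow> 'a::metric_space"
  assumes c: "c \<in> AC_curves" and st: "0 \<le> s" "s < t" "t \<le> 1"
  shows "subcurve s t c \<in> AC_curves"
    and "AE u in lborel. u \<in> {0<..<1} \<longrightarrow> metric_speed (subcurve s t c) u \<le> (t - s) * metric_speed c (s + u * (t - s))"
proof -
  define v where "v = metric_speed c"
  have v: "speed_bound c v" unfolding v_def by (rule speed_bound_metric_speed[OF c])
  then have vi: "set_integrable lborel {0<..<1} v" by (simp add: speed_bound_def)
  have ne: "t - s \<noteq> 0" using st by simp
  have aff: "set_integrable lborel {a<..<b} (\<lambda>u. (t - s) * v (s + u * (t - s)))"
     "(LINT u:{a<..<b}|lborel. (t - s) * v (s + u * (t - s))) = (LINT u:{s + a * (t - s)<..<s + b * (t - s)}|lborel. v u)"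
    if ab: "0 \<le> a" "a \<le> b" "b \<le> 1" for a b
  proof -
    have in1: "0 \<le> s + a * (t - s)" "s + a * (t - s) \<le> s + b * (t - s)" "s + b * (t - s) \<le> 1"
      using affine_in_unit[of s t a] affine_in_unit[of s t b] st ab by (auto intro!: mult_right_mono)
    define k where "k = (\<lambda>w. indicator {s + a * (t - s)<..<s + b * (t - s)} w * v w)"
    have k: "integrable lborel k"
      using set_integral_open_closed(1)[OF vi in1] by (simp add: set_integrable_def k_def)
    have e: "indicator {a<..<b} u * v (s + u * (t - s)) = k (s + (t - s) * u)" for u
      using st by (auto simp: k_def indicator_def mult.commute[of _ u])
    have "integrable lborel (\<lambda>u. k (s + (t - s) * u))"
      using lborel_integrable_real_affine[OF k ne, of s] .
    then have "integrable lborel (\<lambda>u. (t - s) * k (s + (t - s) * u))" by simp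
    then show "set_integrable lborel {a<..<b} (\<lambda>u. (t - s) * v (s + u * (t - s)))"
      unfolding set_integrable_def e[symmetric] by (simp add: mult.left_commute)
    have "(LINT u|lborel. k u) = (t - s) * (LINT u|lborel. k (s + (t - s) * u))"
      using lborel_integral_real_affine[OF ne, of k s] st by simp
    then show "(LINT u:{a<..<b}|lborel. (t - s) * v (s + u * (t - s))) = (LINT u:{s + a * (t - s)<..<s + b * (t - s)}|lborel. v u)"
      unfolding set_lebesgue_integral_def k_def[symmetric] e[symmetric]
      by (simp add: k_def mult.left_commute)
  qed
  have sb: "speed_bound (subcurve s t c) (\<lambda>u. (t - s) * v (s + u * (t - s)))"
    unfolding speed_bound_def
  proof (intro conjI allI impI)
    show "set_integrable lborel {0<..<1} (\<lambda>u. (t - s) * v (s + u * (t - s)))" using aff(1)[of 0 1] by simp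
    fix a b :: real assume ab: "0 \<le> a \<and> a < b \<and> b \<le> 1"
    have in1: "0 \<le> s + a * (t - s)" "s + a * (t - s) \<le> s + b * (t - s)" "s + b * (t - s) \<le> 1"
      using affine_in_unit[of s t a] affine_in_unit[of s t b] st ab by (auto intro!: mult_right_mono)
    have "dist (subcurve s t c a) (subcurve s t c b) = dist (c (s + a * (t - s))) (c (s + b * (t - s)))"
      using ab by (simp add: subcurve_def)
    also have "\<dots> \<le> (LINT u:{a<..<b}|lborel. (t - s) * v (s + u * (t - s)))"
      using speed_bound_le[OF v in1] aff(2)[of a b] ab by simp
    finally show "dist (subcurve s t c a) (subcurve s t c b) \<le> (LINT u:{a<..<b}|lborel. (t - s) * v (s + u * (t - s)))" .
  qed
  then show AC: "subcurve s t c \<in> AC_curves"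
    using c st by (auto simp: AC_curves_def intro!: subcurve_mspace)
  show "AE u in lborel. u \<in> {0<..<1} \<longrightarrow> metric_speed (subcurve s t c) u \<le> (t - s) * metric_speed c (s + u * (t - s))"
    using metric_speed_le[OF AC sb] by (simp add: v_def)
qed

lemma curve_weight_measurable:
  fixes c :: "real \<Rightarrow> 'a::metric_space"
  assumes c: "c \<in> AC_curves" and g: "g \<in> borel_measurable borel"
  shows "(\<lambda>u. g (c u) * ennreal (metric_speed c u) * indicator {0<..<1} u) \<in> borel_measurable borel"
proof -
  note [measurable] = metric_speed_measurable[OF c] g
  have [measurable]: "(\<lambda>t. c (clip t)) \<in> borel_measurable borel"
    using c by (intro measurable_curve_clip) (simp add: AC_curves_def)
  have "(\<lambda>u. g (c (clip u)) * ennreal (indicator {0<..<1} u * metric_speed c u)) \<in> borel_measurable borel"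
    by measurable
  also have "(\<lambda>u. g (c (clip u)) * ennreal (indicator {0<..<1} u * metric_speed c u))
     = (\<lambda>u. g (c u) * ennreal (metric_speed c u) * indicator {0<..<1} u)"
    by (auto simp: indicator_def)
  finally show ?thesis .
qed

lemma subcurve_integral_le:
  fixes c :: "real \<Rightarrow> 'a::metric_space"
  assumes c: "c \<in> AC_curves" and st: "0 \<le> s" "s < t" "t \<le> 1" and g: "g \<in> borel_measurable borel"
  shows "curve_integral (subcurve s t c) g \<le> (\<integral>\<^sup>+u\<in>{s<..<t}. g (c u) * ennreal (metric_speed c u) \<partial>lborel)"
proof -
  define F where "F = (\<lambda>u. g (c u) * ennreal (metric_speed c u) * indicator {s<..<t} u)"
  have "F = (\<lambda>u. (g (c u) * ennreal (metric_speed c u) * indicator {0<..<1} u) * indicator {s<..<t} u)"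
    using st by (auto simp: F_def indicator_def)
  then have [measurable]: "F \<in> borel_measurable borel"
    using curve_weight_measurable[OF c g] by simp
  have "curve_integral (subcurve s t c) g \<le> (\<integral>\<^sup>+u. ennreal (t - s) * F (s + (t - s) * u) \<partial>lborel)"
    unfolding curve_integral_def
  proof (rule nn_integral_mono_AE)
    show "AE u in lborel. g (subcurve s t c u) * ennreal (metric_speed (subcurve s t c) u) * indicator {0<..<1} u
      \<le> ennreal (t - s) * F (s + (t - s) * u)"
      using subcurve_speed(2)[OF c st]
    proof eventually_elim
      case (elim u)
      show ?case
      proof (cases "u \<in> {0<..<1}")
        case True
        have in1: "s + (t - s) * u \<in> {s<..<t}"
          using affine_in_interval[OF st(2) True] st by auto
        have "ennreal (metric_speed (subcurve s t c) u) \<le> ennreal ((t - s) * metric_speed c (s + (t - s) * u))"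
          using elim True by (intro ennreal_leI) (simp add: mult.commute)
        also have "\<dots> = ennreal (t - s) * ennreal (metric_speed c (s + (t - s) * u))"
          using st by (simp add: ennreal_mult')
        finally have "g (c (s + (t - s) * u)) * ennreal (metric_speed (subcurve s t c) u)
            \<le> g (c (s + (t - s) * u)) * (ennreal (t - s) * ennreal (metric_speed c (s + (t - s) * u)))"
          by (rule mult_left_mono) simp
        then show ?thesis using True in1 by (simp add: F_def subcurve_def mult.commute mult.left_commute)
      qed simp
    qed
  qed
  also have "\<dots> = ennreal (t - s) * (\<integral>\<^sup>+u. F (s + (t - s) * u) \<partial>lborel)" by (rule nn_integral_cmult) measurable
  also have "\<dots> = (\<integral>\<^sup>+u. F u \<partial>lborel)"
    using nn_integral_real_affine[of F "t - s" s] st by simp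
  finally show ?thesis by (simp add: F_def)
qed

text \<open>The factor is (t - s)^(q - 1): the speed contributes (t - s)^q, and the substitution
  contributes 1 / (t - s).\<close>

lemma subcurve_energy_le:
  fixes c :: "real \<Rightarrow> 'a::metric_space"
  assumes c: "c \<in> AC_curves" and st: "0 \<le> s" "s < t" "t \<le> 1" and q: "0 < q"
  shows "speed_energy q (subcurve s t c) \<le> ennreal ((t - s) powr q / (t - s)) * speed_energy q c"
proof -
  define F where "F = (\<lambda>u. ennreal (\<bar>indicator {0<..<1} u * metric_speed c u\<bar> powr q))"
  have [measurable]: "F \<in> borel_measurable borel"
    using metric_speed_measurable[OF c] unfolding F_def by measurable
  have AC: "subcurve s t c \<in> AC_curves" by (rule subcurve_speed(1)[OF c st])
  have "speed_energy q (subcurve s t c) \<le> (\<integral>\<^sup>+u. ennreal ((t - s) powr q) * F (s + (t - s) * u) \<partial>lborel)"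
    unfolding speed_energy_def
  proof (rule nn_integral_mono_AE)
    show "AE u in lborel. ennreal (\<bar>metric_speed (subcurve s t c) u\<bar> powr q) * indicator {0<..<1} u
      \<le> ennreal ((t - s) powr q) * F (s + (t - s) * u)"
      using subcurve_speed(2)[OF c st] metric_speed_nonneg[OF AC]
    proof eventually_elim
      case (elim u)
      show ?case
      proof (cases "u \<in> {0<..<1}")
        case True
        have in1: "s + (t - s) * u \<in> {0<..<1}"
          using affine_in_interval[OF st(2) True] st by auto
        have "\<bar>metric_speed (subcurve s t c) u\<bar> \<le> (t - s) * \<bar>metric_speed c (s + (t - s) * u)\<bar>"
        proof -
          have "(t - s) * metric_speed c (s + (t - s) * u) \<le> (t - s) * \<bar>metric_speed c (s + (t - s) * u)\<bar>"
            using st by (intro mult_left_mono) auto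
          then show ?thesis using elim True by (simp add: mult.commute[of u])
        qed
        then have "\<bar>metric_speed (subcurve s t c) u\<bar> powr q \<le> ((t - s) * \<bar>metric_speed c (s + (t - s) * u)\<bar>) powr q"
          using q by (intro powr_mono2) auto
        also have "\<dots> = (t - s) powr q * \<bar>metric_speed c (s + (t - s) * u)\<bar> powr q"
          by (rule powr_mult)
        finally show ?thesis using True in1 by (simp add: F_def ennreal_mult[symmetric] ennreal_leI)
      qed simp
    qed
  qed
  also have "\<dots> = ennreal ((t - s) powr q) * (\<integral>\<^sup>+u. F (s + (t - s) * u) \<partial>lborel)" by (rule nn_integral_cmult) measurable
  also have "(\<integral>\<^sup>+u. F (s + (t - s) * u) \<partial>lborel) = ennreal (1 / (t - s)) * (\<integral>\<^sup>+u. F u \<partial>lborel)"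
    using nn_integral_real_affine[of F "t - s" s] st by (simp add: mult.assoc[symmetric] ennreal_mult[symmetric])
  also have "ennreal ((t - s) powr q) * (ennreal (1 / (t - s)) * (\<integral>\<^sup>+u. F u \<partial>lborel))
      = ennreal ((t - s) powr q / (t - s)) * (\<integral>\<^sup>+u. F u \<partial>lborel)"
    using st by (simp add: mult.assoc[symmetric] ennreal_mult[symmetric])
  also have "(\<integral>\<^sup>+u. F u \<partial>lborel) = speed_energy q c"
    unfolding speed_energy_def F_def by (rule nn_integral_cong) (auto simp: indicator_def)
  finally show ?thesis .
qed

section \<open>Discrete energies and measurability of AC^q\<close>

text \<open>The q-energy of the step function whose value on each cell is the mean speed, n + 1
  times the chord; the cell length 1 / (n + 1) reduces the exponent to q - 1.\<close>

definition discrete_energy :: "real \<Rightarrow> (real \<Rightarrow> 'a::metric_space) \<Rightarrow> nat \<Rightarrow> real" where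
  "discrete_energy q c n = (\<Sum>i<Suc n. dist (c (real i / real (Suc n))) (c (real (Suc i) / real (Suc n))) powr q * real (Suc n) powr (q - 1))"

text \<open>Jensen's inequality, by integrating the tangent of x^q at the mean a = d / (t - s).
  Nonnegative integrals admit an infinite right side, and the summand cancelled at the end is
  finite.\<close>

lemma power_mean_le:
  fixes h :: "real \<Rightarrow> real"
  assumes q: "1 < q" and st: "s < t" and h: "set_integrable lborel {s<..<t} h"
    and d: "0 \<le> d" "d \<le> (LINT u:{s<..<t}|lborel. h u)"
  shows "ennreal (d powr q * (1 / (t - s)) powr (q - 1)) \<le> (\<integral>\<^sup>+u\<in>{s<..<t}. ennreal (\<bar>h u\<bar> powr q) \<partial>lborel)"
proof (cases "d = 0")
  case False
  define L a where "L = t - s" and "a = d / L"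
  have L: "0 < L" and a: "0 < a" using st d False by (auto simp: L_def a_def)
  define k where "k = (\<lambda>u. indicator {s<..<t} u * h u)"
  have k: "integrable lborel k" using h by (simp add: set_integrable_def k_def)
  then have [measurable]: "k \<in> borel_measurable borel" by (auto dest: borel_measurable_integrable)
  define X where "X = (\<integral>\<^sup>+u\<in>{s<..<t}. ennreal (\<bar>h u\<bar> powr q) \<partial>lborel)"
  have X: "X = (\<integral>\<^sup>+u. ennreal (\<bar>k u\<bar> powr q) \<partial>lborel)"
    unfolding X_def by (rule nn_integral_cong) (auto simp: k_def indicator_def)
  have "d \<le> (LINT u|lborel. k u)" using d(2) by (simp add: set_lebesgue_integral_def k_def)
  then have "d \<le> (LINT u|lborel. \<bar>k u\<bar>)" using integral_abs_bound[of lborel k] by linarith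
  then have dk: "ennreal d \<le> (\<integral>\<^sup>+u. ennreal \<bar>k u\<bar> \<partial>lborel)"
    using k by (intro order_trans[OF ennreal_leI ennreal_integral_le_nn_integral]) auto
  have lb: "(\<integral>\<^sup>+u. ennreal c * indicator {s<..<t} u \<partial>lborel) = ennreal (c * L)" if "0 \<le> c" for c
    using that st by (simp add: nn_integral_cmult_indicator L_def ennreal_mult[symmetric])
  have "ennreal (a powr q * L) + ennreal (q * a powr (q - 1)) * ennreal d
     \<le> (\<integral>\<^sup>+u. ennreal (a powr q) * indicator {s<..<t} u \<partial>lborel) + ennreal (q * a powr (q - 1)) * (\<integral>\<^sup>+u. ennreal \<bar>k u\<bar> \<partial>lborel)"
    by (subst lb) (auto intro!: add_left_mono mult_left_mono dk)
  also have "\<dots> = (\<integral>\<^sup>+u. ennreal (a powr q) * indicator {s<..<t} u + ennreal (q * a powr (q - 1)) * ennreal \<bar>k u\<bar> \<partial>lborel)"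
    by (simp add: nn_integral_add nn_integral_cmult)
  also have "\<dots> \<le> (\<integral>\<^sup>+u. ennreal (\<bar>k u\<bar> powr q) + ennreal (q * a powr q) * indicator {s<..<t} u \<partial>lborel)"
  proof (rule nn_integral_mono)
    fix u
    have "a powr q + q * a powr (q - 1) * (\<bar>h u\<bar> - a) \<le> \<bar>h u\<bar> powr q" by (rule powr_ge_tangent[OF q a]) simp
    moreover have "q * a powr (q - 1) * (\<bar>h u\<bar> - a) = q * a powr (q - 1) * \<bar>h u\<bar> - q * (a powr (q - 1) * a)"
      by (simp add: algebra_simps)
    moreover have "a powr (q - 1) * a = a powr q" using a by (simp add: powr_diff)
    ultimately have "a powr q + q * a powr (q - 1) * \<bar>h u\<bar> \<le> \<bar>h u\<bar> powr q + q * a powr q" by simp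
    then have "ennreal (a powr q) + ennreal (q * a powr (q - 1)) * ennreal \<bar>h u\<bar> \<le> ennreal (\<bar>h u\<bar> powr q) + ennreal (q * a powr q)"
      using q by (simp add: ennreal_mult[symmetric] ennreal_plus[symmetric] ennreal_leI del: ennreal_plus)
    then show "ennreal (a powr q) * indicator {s<..<t} u + ennreal (q * a powr (q - 1)) * ennreal \<bar>k u\<bar>
      \<le> ennreal (\<bar>k u\<bar> powr q) + ennreal (q * a powr q) * indicator {s<..<t} u"
      by (auto simp: k_def indicator_def)
  qed
  also have "\<dots> = X + ennreal (q * a powr q * L)"
    unfolding X using q by (subst nn_integral_add) (auto simp: lb)
  also have "ennreal (q * a powr (q - 1)) * ennreal d = ennreal (q * a powr q * L)"
  proof -
    have "d = a * L" using L by (simp add: a_def)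
    moreover have "a powr (q - 1) * a = a powr q" using a by (simp add: powr_diff)
    ultimately have e: "q * a powr (q - 1) * d = q * a powr q * L" by (metis mult.assoc)
    show ?thesis unfolding e[symmetric] using q d by (simp add: ennreal_mult[symmetric])
  qed
  finally have "ennreal (a powr q * L) + ennreal (q * a powr q * L) \<le> X + ennreal (q * a powr q * L)" .
  then have "ennreal (q * a powr q * L) + ennreal (a powr q * L) \<le> ennreal (q * a powr q * L) + X"
    by (simp only: add.commute)
  then have "ennreal (a powr q * L) \<le> X" unfolding ennreal_add_left_cancel_le by simp
  also have "a powr q * L = d powr q * (1 / (t - s)) powr (q - 1)"
  proof -
    have "a powr q * L = d powr q / L powr q * L" using L d by (simp add: a_def powr_divide)
    moreover have "(1 / L) powr (q - 1) = L / L powr q" using L by (simp add: powr_divide powr_diff)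
    ultimately show ?thesis by (simp add: L_def)
  qed
  finally show ?thesis by (simp add: X_def)
qed simp

text \<open>Jensen's inequality on every cell; the cells are disjoint, so the pieces add up to at
  most the full energy.\<close>

lemma discrete_energy_le:
  fixes c :: "real \<Rightarrow> 'a::metric_space"
  assumes c: "c \<in> AC_curves" and q: "1 < q"
  shows "ennreal (discrete_energy q c n) \<le> speed_energy q c"
proof -
  define N where "N = Suc n"
  define v where "v = metric_speed c"
  define J where "J = (\<lambda>i. {real i / real N<..<real (Suc i) / real N})"
  have J: "disjoint_family_on J {..<N}" "\<And>i. i < N \<Longrightarrow> J i \<subseteq> {0<..<1}"
    using grid_intervals[of N] by (auto simp: J_def N_def)
  define D where "D = density lborel (\<lambda>u. ennreal (\<bar>indicator {0<..<1} u * v u\<bar> powr q))"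
  have [measurable]: "(\<lambda>u. indicator {0<..<1} u * v u) \<in> borel_measurable borel"
    unfolding v_def by (rule metric_speed_measurable[OF c])
  have [simp]: "sets D = sets borel" by (simp add: D_def)
  have DJ: "emeasure D S = (\<integral>\<^sup>+u\<in>S. ennreal (\<bar>v u\<bar> powr q) \<partial>lborel)" if "S \<subseteq> {0<..<1}" "S \<in> sets borel" for S
  proof -
    have "emeasure D S = (\<integral>\<^sup>+u. ennreal (\<bar>indicator {0<..<1} u * v u\<bar> powr q) * indicator S u \<partial>lborel)"
      unfolding D_def by (rule emeasure_density) (auto simp: that)
    also have "\<dots> = (\<integral>\<^sup>+u\<in>S. ennreal (\<bar>v u\<bar> powr q) \<partial>lborel)"
    proof (rule nn_integral_cong)
      fix u
      have "u \<in> S \<Longrightarrow> u \<in> {0<..<1}" using that(1) by blast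
      then show "ennreal (\<bar>indicator {0<..<1} u * v u\<bar> powr q) * indicator S u = ennreal (\<bar>v u\<bar> powr q) * indicator S u"
        by (cases "u \<in> S") simp_all
    qed
    finally show ?thesis .
  qed
  have v: "speed_bound c v" unfolding v_def by (rule speed_bound_metric_speed[OF c])
  then have vi: "set_integrable lborel {0<..<1} v" by (simp add: speed_bound_def)
  define b where "b = (\<lambda>i. dist (c (real i / real N)) (c (real (Suc i) / real N)) powr q * real N powr (q - 1))"
  have "ennreal (discrete_energy q c n) = ennreal (\<Sum>i<N. b i)"
    by (simp only: discrete_energy_def N_def b_def)
  also have "\<dots> = (\<Sum>i<N. ennreal (b i))"
    by (rule sum_ennreal[symmetric]) (simp add: b_def)
  also have "\<dots> \<le> (\<Sum>i<N. emeasure D (J i))"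
  proof (rule sum_mono)
    fix i assume "i \<in> {..<N}"
    then have i: "i < N" by simp
    have 1: "0 \<le> real i / real N" "real i / real N \<le> real (Suc i) / real N" "real (Suc i) / real N \<le> 1"
      "real i / real N < real (Suc i) / real N"
      using i by (auto simp: field_simps)
    have 2: "1 / (real (Suc i) / real N - real i / real N) = real N"
      by (simp add: diff_divide_distrib[symmetric])
    have "ennreal (dist (c (real i / real N)) (c (real (Suc i) / real N)) powr q * (1 / (real (Suc i) / real N - real i / real N)) powr (q - 1))
      \<le> (\<integral>\<^sup>+u\<in>J i. ennreal (\<bar>v u\<bar> powr q) \<partial>lborel)"
      unfolding J_def
      by (rule power_mean_le[OF q 1(4) set_integral_open_closed(1)[OF vi 1(1-3)] _ speed_bound_le[OF v 1(1-3)]]) simp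
    then show "ennreal (b i) \<le> emeasure D (J i)"
      unfolding 2 b_def using DJ[OF J(2)[OF i]] by (simp add: J_def)
  qed
  also have "\<dots> = emeasure D (\<Union>i<N. J i)" using J by (intro sum_emeasure) (auto simp: J_def)
  also have "\<dots> \<le> emeasure D {0<..<1}" using J(2) by (intro emeasure_mono UN_least) auto
  also have "\<dots> = speed_energy q c" by (subst DJ) (auto simp: speed_energy_def v_def)
  finally show ?thesis .
qed

lemma sum_indicator_disjoint:
  fixes a :: "nat \<Rightarrow> real"
  assumes "disjoint_family_on J {..<N}" "i < N" "u \<in> J i"
  shows "(\<Sum>j<N. a j * indicator (J j) u) = a i"
proof -
  have "indicator (J j) u = (0::real)" if "j < N" "j \<noteq> i" for j
    using assms that by (auto simp: disjoint_family_on_def indicator_def)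
  then have "(\<Sum>j<N. a j * indicator (J j) u) = (\<Sum>j<N. if j = i then a j else 0)"
    using assms by (intro sum.cong) auto
  then show ?thesis using assms by simp
qed

lemma ennreal_sum_indicator:
  assumes "\<And>i. 0 \<le> F i"
  shows "ennreal (\<Sum>i\<in>A. F i * indicator (J i) u) = (\<Sum>i\<in>A. ennreal (F i) * indicator (J i) u)"
proof -
  have "(\<Sum>i\<in>A. ennreal (F i) * indicator (J i) u) = (\<Sum>i\<in>A. ennreal (F i * indicator (J i) u))"
    by (intro sum.cong) (auto simp: indicator_def)
  also have "\<dots> = ennreal (\<Sum>i\<in>A. F i * indicator (J i) u)"
    by (rule sum_ennreal) (simp add: assms)
  finally show ?thesis ..
qed

text \<open>The discrete speeds are bounded in \<open>L\<^sup>q\<close>; a dominated sequence of convex combinations of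
  them yields a speed bound in \<open>L\<^sup>q\<close>.\<close>

lemma ACq_if_discrete_energy_bounded:
  fixes c :: "real \<Rightarrow> 'a::metric_space"
  assumes c: "c \<in> mspace curve_metric" and q: "1 < q" and B: "0 < B" "\<And>n. discrete_energy q c n \<le> B"
  shows "c \<in> ACq_curves q"
proof -
  define a where "a = (\<lambda>n i. real (Suc n) * dist (c (real i / real (Suc n))) (c (real (Suc i) / real (Suc n))))"
  define J where "J = (\<lambda>n i. {real i / real (Suc n)<..<real (Suc i) / real (Suc n)})"
  have J: "disjoint_family_on (J n) {..<Suc n}" for n unfolding J_def by (rule grid_intervals) simp
  have Jl: "emeasure lborel (J n i) = ennreal (1 / real (Suc n))" for n i
    unfolding J_def by (subst emeasure_lborel_Ioo) (auto simp: divide_right_mono diff_divide_distrib[symmetric])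
  have [measurable]: "J n i \<in> sets borel" for n i by (simp add: J_def)
  have a0: "0 \<le> a n i" for n i by (simp add: a_def)
  define h where "h = (\<lambda>n u. \<Sum>i<Suc n. a n i * indicator (J n i) u)"
  have h0: "0 \<le> h n u" for n u unfolding h_def by (rule sum_nonneg) (simp add: a0)
  have [measurable]: "h n \<in> borel_measurable lborel" for n unfolding h_def by measurable
  have hq: "h n u powr q = (\<Sum>i<Suc n. a n i powr q * indicator (J n i) u)" for n u
  proof (cases "\<exists>i<Suc n. u \<in> J n i")
    case True
    then obtain i where i: "i < Suc n" "u \<in> J n i" by blast
    show ?thesis unfolding h_def sum_indicator_disjoint[OF J i] ..
  next
    case False
    then have z: "(\<Sum>i<Suc n. F i * indicator (J n i) u) = 0" for F :: "nat \<Rightarrow> real"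
      by (intro sum.neutral) (auto simp: indicator_def)
    show ?thesis unfolding h_def z using q by simp
  qed
  have int_h: "(\<integral>\<^sup>+u. ennreal (h n u powr q) \<partial>lborel) \<le> ennreal B" for n
  proof -
    have "(\<integral>\<^sup>+u. ennreal (h n u powr q) \<partial>lborel) = (\<integral>\<^sup>+u. (\<Sum>i<Suc n. ennreal (a n i powr q) * indicator (J n i) u) \<partial>lborel)"
      unfolding hq by (intro nn_integral_cong ennreal_sum_indicator) simp
    also have "\<dots> = (\<Sum>i<Suc n. ennreal (a n i powr q) * emeasure lborel (J n i))"
      by (subst nn_integral_sum) (auto simp: nn_integral_cmult_indicator)
    also have "\<dots> = (\<Sum>i<Suc n. ennreal (dist (c (real i / real (Suc n))) (c (real (Suc i) / real (Suc n))) powr q * real (Suc n) powr (q - 1)))"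
      unfolding Jl by (intro sum.cong refl) (auto simp: ennreal_mult[symmetric] a_def powr_mult powr_diff)
    also have "\<dots> = ennreal (discrete_energy q c n)"
      unfolding discrete_energy_def by (rule sum_ennreal) simp
    finally show ?thesis using B(2)[of n] by (simp add: ennreal_leI)
  qed
  obtain H where H [measurable]: "H \<in> borel_measurable lborel" and intH: "(\<integral>\<^sup>+u. epowr (H u) q \<partial>lborel) \<le> ennreal (3 * 2 powr q * B)"
    and comb: "\<forall>j. \<exists>g \<in> tail_combinations h j. \<forall>u. ennreal (g u) \<le> H u"
    using dominated_convex_combinations[where G = h and M = lborel and p = q and A = B, OF q _ h0 B(1) int_h] by auto
  have finH: "(\<integral>\<^sup>+u. epowr (H u) q \<partial>lborel) < \<infinity>" using intH by (rule le_less_trans) simp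
  \<comment> \<open>The start is moved from s to s' > s: rounding s' down then stays beyond s for
    large n, so all cells used lie inside the open interval. Rounding t down stays below t
    anyway.\<close>
  have step: "ennreal (dist (c s') (c t)) \<le> (\<integral>\<^sup>+u\<in>{s<..<t}. H u \<partial>lborel)" if st: "0 \<le> s" "s < s'" "s' < t" "t \<le> 1" for s s' t
  proof (rule ennreal_le_epsilon)
    fix e :: real assume e: "0 < e"
    define d where "d = dist (c s') (c t)"
    have cc: "continuous_on {0..1} c" by (rule AC_curves_continuous[OF c])
    have lim: "(\<lambda>n. c (grid n u)) \<longlonglongrightarrow> c u" if "0 \<le> u" "u \<le> 1" for u
      using that grid_in_unit[of u]
      by (intro continuous_on_tendsto_compose[OF cc grid_tendsto]) auto
    have "(\<lambda>n. dist (c (grid n s')) (c (grid n t))) \<longlonglongrightarrow> d"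
      unfolding d_def using st by (intro tendsto_dist lim) auto
    then have "\<forall>\<^sub>F n in sequentially. d - e < dist (c (grid n s')) (c (grid n t))"
      by (rule order_tendstoD) (use e in auto)
    moreover have "\<forall>\<^sub>F n in sequentially. s < grid n s'"
      by (rule order_tendstoD(1)[OF grid_tendsto]) (use st in auto)
    ultimately have "\<forall>\<^sub>F n in sequentially. d - e < dist (c (grid n s')) (c (grid n t)) \<and> s < grid n s'"
      by (rule eventually_conj)
    then obtain j where j: "\<And>n. j \<le> n \<Longrightarrow> d - e < dist (c (grid n s')) (c (grid n t)) \<and> s < grid n s'"
      unfolding eventually_sequentially by blast
    have hn: "ennreal (d - e) \<le> (\<integral>\<^sup>+u\<in>{s<..<t}. ennreal (h n u) \<partial>lborel)" if "j \<le> n" for n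
    proof -
      let ?j = "nat \<lfloor>s' * real (Suc n)\<rfloor>" and ?m = "nat \<lfloor>t * real (Suc n)\<rfloor>"
      have jm: "?j \<le> ?m" using st by (intro nat_mono floor_mono mult_right_mono) auto
      have gt: "grid n t \<le> t" using st by (intro grid_bounds) auto
      have "grid n t \<le> 1" using gt st by linarith
      then have "real ?m \<le> real (Suc n)" by (subst (asm) divide_le_eq_1_pos) auto
      then have m: "?m \<le> Suc n" by (simp only: of_nat_le_iff)
      have sub: "J n i \<subseteq> {s<..<t}" if "i \<in> {?j..<?m}" for i
      proof -
        have "grid n s' \<le> real i / real (Suc n)" "real (Suc i) / real (Suc n) \<le> grid n t"
          using that by (auto intro!: divide_right_mono simp del: of_nat_Suc)
        then have "s \<le> real i / real (Suc n)" "real (Suc i) / real (Suc n) \<le> t"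
          using j[OF \<open>j \<le> n\<close>] gt by linarith+
        then show ?thesis unfolding J_def by auto
      qed
      have "d - e \<le> (\<Sum>i=?j..<?m. dist (c (real i / real (Suc n))) (c (real (Suc i) / real (Suc n))))"
        using j[OF that] dist_le_sum_dist[OF jm, of "\<lambda>i. c (real i / real (Suc n))"] by linarith
      then have "ennreal (d - e) \<le> (\<Sum>i=?j..<?m. ennreal (dist (c (real i / real (Suc n))) (c (real (Suc i) / real (Suc n)))))"
        by (subst sum_ennreal) (auto intro: ennreal_leI)
      also have "\<dots> = (\<Sum>i=?j..<?m. \<integral>\<^sup>+u. ennreal (a n i) * indicator (J n i) u \<partial>lborel)"
        by (intro sum.cong refl) (auto simp: nn_integral_cmult_indicator Jl a_def ennreal_mult[symmetric])
      also have "\<dots> = (\<integral>\<^sup>+u. (\<Sum>i=?j..<?m. ennreal (a n i) * indicator (J n i) u) \<partial>lborel)"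
        by (rule nn_integral_sum[symmetric]) auto
      also have "\<dots> \<le> (\<integral>\<^sup>+u\<in>{s<..<t}. ennreal (h n u) \<partial>lborel)"
      proof (rule nn_integral_mono)
        fix u
        have "(\<Sum>i=?j..<?m. ennreal (a n i) * indicator (J n i) u) = (\<Sum>i=?j..<?m. ennreal (a n i) * indicator (J n i) u) * indicator {s<..<t} u"
        proof (cases "u \<in> {s<..<t}")
          case False
          then have "u \<notin> J n i" if "i \<in> {?j..<?m}" for i using sub[OF that] by blast
          then show ?thesis using False by simp
        qed simp
        also have "\<dots> \<le> (\<Sum>i<Suc n. ennreal (a n i) * indicator (J n i) u) * indicator {s<..<t} u"
          using m by (intro mult_right_mono sum_mono2) auto
        also have "(\<Sum>i<Suc n. ennreal (a n i) * indicator (J n i) u) = ennreal (h n u)"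
          unfolding h_def by (rule ennreal_sum_indicator[symmetric]) (rule a0)
        finally show "(\<Sum>i=?j..<?m. ennreal (a n i) * indicator (J n i) u) \<le> ennreal (h n u) * indicator {s<..<t} u" .
      qed
      finally show ?thesis .
    qed
    obtain g where g: "g \<in> tail_combinations h j" "\<And>u. ennreal (g u) \<le> H u" using comb by blast
    then obtain I w where I: "g = (\<lambda>x. \<Sum>n\<in>I. w n * h n x)" "finite I" "I \<subseteq> {j..}" "\<forall>n. 0 \<le> w n" "(\<Sum>n\<in>I. w n) = 1"
      unfolding tail_combinations_def by auto
    \<comment> \<open>The weights sum to one, so the bound valid for every h n with n \<ge> j passes
      to the combination, which H dominates.\<close>
    have "ennreal (d - e) = (\<Sum>n\<in>I. ennreal (w n)) * ennreal (d - e)" using I by (simp add: sum_ennreal)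
    also have "\<dots> = (\<Sum>n\<in>I. ennreal (w n) * ennreal (d - e))" by (rule sum_distrib_right)
    also have "\<dots> \<le> (\<Sum>n\<in>I. ennreal (w n) * (\<integral>\<^sup>+u\<in>{s<..<t}. ennreal (h n u) \<partial>lborel))"
      using I by (intro sum_mono mult_left_mono hn) auto
    also have "\<dots> = (\<integral>\<^sup>+u. (\<Sum>n\<in>I. ennreal (w n) * (ennreal (h n u) * indicator {s<..<t} u)) \<partial>lborel)"
      by (simp add: nn_integral_sum nn_integral_cmult)
    also have "\<dots> \<le> (\<integral>\<^sup>+u\<in>{s<..<t}. H u \<partial>lborel)"
    proof (rule nn_integral_mono)
      fix u
      have "(\<Sum>n\<in>I. ennreal (w n) * (ennreal (h n u) * indicator {s<..<t} u)) = ennreal (g u) * indicator {s<..<t} u"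
        unfolding I(1) using I(4) h0 by (simp add: sum_ennreal[symmetric] ennreal_mult sum_distrib_right mult.assoc del: sum_ennreal)
      then show "(\<Sum>n\<in>I. ennreal (w n) * (ennreal (h n u) * indicator {s<..<t} u)) \<le> H u * indicator {s<..<t} u"
        using g(2)[of u] by (simp add: mult_right_mono)
    qed
    finally have 1: "ennreal (d - e) \<le> (\<integral>\<^sup>+u\<in>{s<..<t}. H u \<partial>lborel)" .
    have "ennreal d \<le> ennreal (d - e) + ennreal e"
    proof (cases "d \<le> e")
      case True then show ?thesis by (intro order_trans[OF ennreal_leI[OF True]]) simp
    qed (use e in \<open>simp add: ennreal_plus[symmetric] del: ennreal_plus\<close>)
    also have "\<dots> \<le> (\<integral>\<^sup>+u\<in>{s<..<t}. H u \<partial>lborel) + ennreal e" using 1 by (rule add_right_mono)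
    finally show "ennreal (dist (c s') (c t)) \<le> (\<integral>\<^sup>+u\<in>{s<..<t}. H u \<partial>lborel) + ennreal e" by (simp add: d_def)
  qed
  have H1: "(\<integral>\<^sup>+u\<in>{0<..<1}. H u \<partial>lborel) < \<infinity>"
  proof -
    have "(\<integral>\<^sup>+u\<in>{0<..<1}. H u \<partial>lborel) \<le> (\<integral>\<^sup>+u. indicator {0<..<1} u + epowr (H u) q \<partial>lborel)"
    proof (rule nn_integral_mono)
      fix u :: real
      \<comment> \<open>On an interval of finite length this turns integrability of the q-th power
        into integrability.\<close>
      have "H u \<le> 1 + epowr (H u) q"
      proof (cases "H u")
        case (real r)
        have "r \<le> 1 + r powr q"
        proof (cases "r \<le> 1")
          case False
          then have "r powr 1 \<le> r powr q" using q by (intro powr_mono) auto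
          then show ?thesis using False by simp
        qed (simp add: add_increasing2)
        then have "ennreal r \<le> ennreal (1 + r powr q)" by (rule ennreal_leI)
        then show ?thesis using real by simp
      qed simp
      then show "H u * indicator {0<..<1} u \<le> indicator {0<..<1} u + epowr (H u) q" by (auto simp: indicator_def)
    qed
    also have "\<dots> = 1 + (\<integral>\<^sup>+u. epowr (H u) q \<partial>lborel)" by (subst nn_integral_add) auto
    also have "\<dots> < \<infinity>" using finH by (simp add: less_top)
    finally show ?thesis .
  qed
  define S where "S = (\<lambda>u. enn2real (H u))"
  have [measurable]: "S \<in> borel_measurable borel" unfolding S_def using H by simp
  have "AE u in lborel. epowr (H u) q \<noteq> \<infinity>" using finH by (intro nn_integral_PInf_AE) auto
  then have HS: "AE u in lborel. H u = ennreal (S u)"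
  proof eventually_elim
    case (elim u)
    then have "H u \<noteq> \<top>" by auto
    then show ?case by (simp add: S_def less_top)
  qed
  have S0: "0 \<le> S u" for u by (simp add: S_def)
  have Si: "set_integrable lborel {0<..<1} S"
    unfolding set_integrable_def
  proof (rule integrableI_nonneg)
    have "(\<integral>\<^sup>+u. ennreal (indicator {0<..<1} u *\<^sub>R S u) \<partial>lborel) = (\<integral>\<^sup>+u\<in>{0<..<1}. H u \<partial>lborel)"
      using HS by (intro nn_integral_cong_AE; eventually_elim) (auto simp: indicator_def)
    then show "(\<integral>\<^sup>+u. ennreal (indicator {0<..<1} u *\<^sub>R S u) \<partial>lborel) < \<infinity>" using H1 by simp
  qed (auto simp: S0)
  have sb: "speed_bound c S"
    unfolding speed_bound_def
  proof (intro conjI allI impI Si)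
    fix s t :: real assume "0 \<le> s \<and> s < t \<and> t \<le> 1"
    then have st: "0 \<le> s" "s < t" "t \<le> 1" by auto
    have Sst: "integrable lborel (\<lambda>u. indicator {s<..<t} u * S u)"
      using set_integral_open_closed(1)[OF Si st(1) less_imp_le[OF st(2)] st(3)] by (simp add: set_integrable_def)
    have "(\<integral>\<^sup>+u\<in>{s<..<t}. H u \<partial>lborel) = (\<integral>\<^sup>+u. ennreal (indicator {s<..<t} u * S u) \<partial>lborel)"
      using HS by (intro nn_integral_cong_AE; eventually_elim) (auto simp: indicator_def)
    also have "\<dots> = ennreal (LINT u:{s<..<t}|lborel. S u)"
      unfolding set_lebesgue_integral_def using Sst S0 by (subst nn_integral_eq_integral) auto
    finally have HI: "(\<integral>\<^sup>+u\<in>{s<..<t}. H u \<partial>lborel) = ennreal (LINT u:{s<..<t}|lborel. S u)" .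
    have nn: "0 \<le> (LINT u:{s<..<t}|lborel. S u)"
      unfolding set_lebesgue_integral_def by (rule Bochner_Integration.integral_nonneg) (simp add: S0)
    \<comment> \<open>Times decreasing to s undo the shift of the start; the denominator k + 2 keeps
      already the first of them below t.\<close>
    define x where "x = (\<lambda>k. s + (t - s) * inverse (real (Suc (Suc k))))"
    have xin: "x k \<in> {s<..<t}" for k unfolding x_def
      by (rule affine_in_interval[OF st(2)]) (auto simp: field_simps)
    have "(\<lambda>k. s + (t - s) * inverse (real (Suc (Suc k)))) \<longlonglongrightarrow> s + (t - s) * 0"
      by (intro tendsto_intros LIMSEQ_Suc[OF LIMSEQ_inverse_real_of_nat])
    then have "x \<longlonglongrightarrow> s" by (simp add: x_def)
    then have "(\<lambda>k. c (x k)) \<longlonglongrightarrow> c s"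
      using xin st by (intro continuous_on_tendsto_compose[OF AC_curves_continuous[OF c]])
         (auto intro!: always_eventually less_imp_le order_less_le_trans[of _ t 1] order_le_less_trans[of 0 s])
    then have "(\<lambda>k. dist (c (x k)) (c t)) \<longlonglongrightarrow> dist (c s) (c t)" by (intro tendsto_intros)
    then show "dist (c s) (c t) \<le> (LINT u:{s<..<t}|lborel. S u)"
    proof (rule LIMSEQ_le_const2)
      show "\<exists>N. \<forall>n\<ge>N. dist (c (x n)) (c t) \<le> (LINT u:{s<..<t}|lborel. S u)"
        using step[of s "x _" t] xin st HI nn by (auto simp: greaterThanLessThan_iff)
    qed
  qed
  have AC: "c \<in> AC_curves" using c sb by (auto simp: AC_curves_def)
  have "speed_energy q c \<le> (\<integral>\<^sup>+u. epowr (H u) q \<partial>lborel)"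
    unfolding speed_energy_def
  proof (rule nn_integral_mono_AE)
    show "AE u in lborel. ennreal (\<bar>metric_speed c u\<bar> powr q) * indicator {0<..<1} u \<le> epowr (H u) q"
      using metric_speed_le[OF AC sb] metric_speed_nonneg[OF AC] HS
    proof eventually_elim
      case (elim u)
      show ?case
      proof (cases "u \<in> {0<..<1}")
        case True
        then have "\<bar>metric_speed c u\<bar> powr q \<le> S u powr q" using elim q by (intro powr_mono2) auto
        then show ?thesis using True elim S0[of u] by (simp add: ennreal_leI)
      qed simp
    qed
  qed
  then show ?thesis using AC finH by (auto simp: ACq_curves_def elim: le_less_trans)
qed

text \<open>Boundedness of the discrete energies is a countable condition on continuous functionals
  of the curve, whereas the defining condition quantifies over speeds. The bound is
  \<open>Suc B\<close> so that it is positive.\<close>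

lemma ACq_curves_eq:
  assumes q: "1 < q"
  shows "ACq_curves q = {c \<in> space (curve_borel :: (real \<Rightarrow> 'a::metric_space) measure). \<exists>B::nat. \<forall>n. discrete_energy q c n \<le> real (Suc B)}"
proof (intro equalityI subsetI CollectI conjI)
  fix c :: "real \<Rightarrow> 'a" assume c: "c \<in> ACq_curves q"
  then show "c \<in> space curve_borel" by (simp add: ACq_curves_def AC_curves_def)
  have fin: "speed_energy q c < \<infinity>" and AC: "c \<in> AC_curves" using c by (auto simp: ACq_curves_def)
  then obtain E where E: "0 \<le> E" "speed_energy q c = ennreal E" by (cases "speed_energy q c") auto
  obtain B :: nat where "E \<le> real B" using real_arch_simple by blast
  moreover have "discrete_energy q c n \<le> E" for n using discrete_energy_le[OF AC q, of n] E by simp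
  ultimately show "\<exists>B::nat. \<forall>n. discrete_energy q c n \<le> real (Suc B)" by (intro exI[of _ B]) (smt (verit) of_nat_Suc)
next
  fix c :: "real \<Rightarrow> 'a" assume "c \<in> {c \<in> space curve_borel. \<exists>B::nat. \<forall>n. discrete_energy q c n \<le> real (Suc B)}"
  then obtain B :: nat where "c \<in> mspace curve_metric" "\<And>n. discrete_energy q c n \<le> real (Suc B)" by auto
  then show "c \<in> ACq_curves q" using ACq_if_discrete_energy_bounded[OF _ q, of c "real (Suc B)"] by simp
qed

lemma ACq_curves_sets:
  assumes q: "1 < q"
  shows "(ACq_curves q :: (real \<Rightarrow> 'a::metric_space) set) \<in> sets curve_borel"
proof -
  have [measurable]: "(\<lambda>c. discrete_energy q c n) \<in> borel_measurable (curve_borel :: (real \<Rightarrow> 'a) measure)" for n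
    unfolding discrete_energy_def
  proof (rule borel_measurable_sum)
    fix i assume "i \<in> {..<Suc n}"
    then have "real i / real (Suc n) \<in> {0..1}" "real (Suc i) / real (Suc n) \<in> {0..1}" by (auto simp: field_simps)
    note [measurable] = measurable_curve_dist[OF this]
    show "(\<lambda>c. dist (c (real i / real (Suc n))) (c (real (Suc i) / real (Suc n))) powr q * real (Suc n) powr (q - 1))
      \<in> borel_measurable (curve_borel :: (real \<Rightarrow> 'a) measure)"
      by measurable
  qed
  show ?thesis unfolding ACq_curves_eq[OF q] by measurable
qed

section \<open>Test plans and negligible families under restriction\<close>

text \<open>No measurability of f is assumed: the simple functions below f on the image are
  measurable and can be transported, which yields one inequality. It is applied to the energy of
  curves.\<close>

lemma nn_integral_distr_le:
  assumes T: "T \<in> measurable M N"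
  shows "(\<integral>\<^sup>+x. f x \<partial>distr M N T) \<le> (\<integral>\<^sup>+x. f (T x) \<partial>M)"
  unfolding nn_integral_def[of "distr M N T"]
proof (intro SUP_least)
  fix g assume "g \<in> {g. simple_function (distr M N T) g \<and> g \<le> f}"
  then have g: "simple_function (distr M N T) g" "g \<le> f" by auto
  then have gm: "g \<in> borel_measurable N" using borel_measurable_simple_function[OF g(1)] by simp
  have "integral\<^sup>S (distr M N T) g = (\<integral>\<^sup>+x. g x \<partial>distr M N T)" using g(1) by (rule nn_integral_eq_simple_integral[symmetric])
  also have "\<dots> = (\<integral>\<^sup>+x. g (T x) \<partial>M)" using gm by (intro nn_integral_distr[OF T]) simp
  also have "\<dots> \<le> (\<integral>\<^sup>+x. f (T x) \<partial>M)" using g(2) by (intro nn_integral_mono) (auto simp: le_fun_def)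
  finally show "integral\<^sup>S (distr M N T) g \<le> (\<integral>\<^sup>+x. f (T x) \<partial>M)" .
qed

text \<open>The marginal of the restricted plan at time u is the marginal of the original plan at
  time s + u (t - s), so the compression constant is unchanged; the energy only picks up a
  factor.\<close>

lemma test_plan_subcurve:
  fixes M :: "'a::metric_space measure"
  assumes q: "1 < q" and st: "0 \<le> s" "s < t" "t \<le> 1" and \<pi>: "test_plan M q \<pi>"
  shows "test_plan M q (distr \<pi> curve_borel (subcurve s t))"
proof -
  have sets [measurable_cong]: "sets \<pi> = sets curve_borel" and "prob_space \<pi>"
    and AEq: "AE c in \<pi>. c \<in> ACq_curves q" and E: "(\<integral>\<^sup>+ c. speed_energy q c \<partial>\<pi>) < \<infinity>"
    using \<pi> by (auto simp: test_plan_def)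
  obtain C where C: "C \<ge> 0" "\<And>t A. t \<in> {0..1} \<Longrightarrow> A \<in> sets borel \<Longrightarrow> emeasure \<pi> {c \<in> space \<pi>. c t \<in> A} \<le> ennreal C * emeasure M A"
    using \<pi> by (auto simp: test_plan_def)
  have sp: "space \<pi> = mspace curve_metric" using sets_eq_imp_space_eq[OF sets] by simp
  interpret prob_space \<pi> by fact
  have st': "s \<le> t" using st by simp
  have T: "subcurve s t \<in> measurable \<pi> curve_borel"
    using measurable_subcurve[OF st(1) st' st(3)] by measurable
  have qs: "ACq_curves q \<in> sets (curve_borel :: (real \<Rightarrow> 'a) measure)" by (rule ACq_curves_sets[OF q])
  have sub: "subcurve s t c \<in> ACq_curves q" if "c \<in> ACq_curves q" for c :: "real \<Rightarrow> 'a"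
  proof -
    have AC: "c \<in> AC_curves" and fin: "speed_energy q c < \<infinity>" using that by (auto simp: ACq_curves_def)
    have "speed_energy q (subcurve s t c) \<le> ennreal ((t - s) powr q / (t - s)) * speed_energy q c"
      using q by (intro subcurve_energy_le[OF AC st]) auto
    also have "\<dots> < \<infinity>" using fin by (simp add: ennreal_mult_less_top)
    finally show ?thesis using subcurve_speed(1)[OF AC st] by (simp add: ACq_curves_def)
  qed
  show ?thesis
    unfolding test_plan_def
  proof (intro conjI exI[of _ C] ballI C(1))
    show "prob_space (distr \<pi> curve_borel (subcurve s t))" by (rule prob_space_distr[OF T])
    fix u :: real and A :: "'a set" assume u: "u \<in> {0..1}" and A: "A \<in> sets borel"
    have u': "s + u * (t - s) \<in> {0..1}" by (rule affine_in_unit[OF st(1) st' st(3) u])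
    have m: "{c \<in> space curve_borel. c u \<in> A} \<in> sets curve_borel"
      using measurable_sets[OF measurable_curve_eval[OF u] A] by (simp add: vimage_def Int_def conj_commute)
    have "emeasure (distr \<pi> curve_borel (subcurve s t)) {c \<in> space (distr \<pi> curve_borel (subcurve s t)). c u \<in> A}
       = emeasure \<pi> (subcurve s t -` {c \<in> space curve_borel. c u \<in> A} \<inter> space \<pi>)"
      using emeasure_distr[OF T m] by simp
    also have "subcurve s t -` {c \<in> space curve_borel. c u \<in> A} \<inter> space \<pi> = {c \<in> space \<pi>. c (s + u * (t - s)) \<in> A}"
      using u measurable_space[OF T] by (auto simp: subcurve_def)
    also have "emeasure \<pi> \<dots> \<le> ennreal C * emeasure M A" by (rule C(2)[OF u' A])
    finally show "emeasure (distr \<pi> curve_borel (subcurve s t)) {c \<in> space (distr \<pi> curve_borel (subcurve s t)). c u \<in> A} \<le> ennreal C * emeasure M A" .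
  next
    show "AE c in distr \<pi> curve_borel (subcurve s t). c \<in> ACq_curves q"
    proof (subst AE_distr_iff[OF T])
      have "{c \<in> space curve_borel. c \<in> ACq_curves q} = (ACq_curves q :: (real \<Rightarrow> 'a) set)"
        using sets.sets_into_space[OF qs] by auto
      then show "{c \<in> space curve_borel. c \<in> ACq_curves q} \<in> sets (curve_borel :: (real \<Rightarrow> 'a) measure)" using qs by simp
      show "AE c in \<pi>. subcurve s t c \<in> ACq_curves q" using AEq by eventually_elim (rule sub)
    qed
    have "(\<integral>\<^sup>+ c. speed_energy q c \<partial>distr \<pi> curve_borel (subcurve s t)) \<le> (\<integral>\<^sup>+ c. speed_energy q (subcurve s t c) \<partial>\<pi>)"
      by (rule nn_integral_distr_le[OF T])
    also have "\<dots> \<le> (\<integral>\<^sup>+ c. ennreal ((t - s) powr q / (t - s)) * speed_energy q c \<partial>\<pi>)"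
      using AEq
    proof (intro nn_integral_mono_AE, eventually_elim)
      case (elim c)
      then have AC: "c \<in> AC_curves" by (simp add: ACq_curves_def)
      show ?case using q by (intro subcurve_energy_le[OF AC st]) auto
    qed
    also have "\<dots> \<le> ennreal ((t - s) powr q / (t - s)) * (\<integral>\<^sup>+ c. speed_energy q c \<partial>\<pi>)"
    proof (cases "(t - s) powr q / (t - s) = 0")
      case False
      \<comment> \<open>The constant is pulled out of the integral through simple functions, because
        the energy is not known to be measurable.\<close>
      define K where "K = (t - s) powr q / (t - s)"
      have K: "0 < K" using st by (simp add: K_def)
      have "(\<integral>\<^sup>+ c. ennreal K * speed_energy q c \<partial>\<pi>) \<le> ennreal K * (\<integral>\<^sup>+ c. speed_energy q c \<partial>\<pi>)"
        unfolding nn_integral_def[of \<pi> "\<lambda>c. ennreal K * speed_energy q c"]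
      proof (intro SUP_least)
        fix g assume "g \<in> {g. simple_function \<pi> g \<and> g \<le> (\<lambda>c. ennreal K * speed_energy q c)}"
        then have g: "simple_function \<pi> g" "\<And>c. g c \<le> ennreal K * speed_energy q c" by (auto simp: le_fun_def)
        have gm: "g \<in> borel_measurable \<pi>" using borel_measurable_simple_function[OF g(1)] .
        have "integral\<^sup>S \<pi> g = (\<integral>\<^sup>+c. ennreal K * (ennreal (1 / K) * g c) \<partial>\<pi>)"
          using K g(1) by (subst nn_integral_eq_simple_integral[symmetric]) (auto simp: mult.assoc[symmetric] ennreal_mult[symmetric])
        also have "\<dots> = ennreal K * (\<integral>\<^sup>+c. ennreal (1 / K) * g c \<partial>\<pi>)" using gm by (intro nn_integral_cmult) auto
        also have "\<dots> \<le> ennreal K * (\<integral>\<^sup>+c. speed_energy q c \<partial>\<pi>)"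
        proof (intro mult_left_mono nn_integral_mono)
          fix c
          have "ennreal (1 / K) * g c \<le> ennreal (1 / K) * (ennreal K * speed_energy q c)"
            using g(2)[of c] by (rule mult_left_mono) simp
          also have "\<dots> = speed_energy q c" using K by (simp add: mult.assoc[symmetric] ennreal_mult[symmetric])
          finally show "ennreal (1 / K) * g c \<le> speed_energy q c" .
        qed simp
        finally show "integral\<^sup>S \<pi> g \<le> ennreal K * (\<integral>\<^sup>+c. speed_energy q c \<partial>\<pi>)" .
      qed
      then show ?thesis by (simp add: K_def)
    qed simp
    also have "\<dots> < \<infinity>" using E by (simp add: ennreal_mult_less_top)
    finally show "(\<integral>\<^sup>+ c. speed_energy q c \<partial>distr \<pi> curve_borel (subcurve s t)) < \<infinity>" .
  qed simp
qed

lemma negligible_curves_UN: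
  assumes "\<And>i::nat. negligible_curves M p (\<Gamma> i)"
  shows "negligible_curves M p (\<Union>i. \<Gamma> i)"
proof -
  have "emeasure \<pi> (\<Union>i. \<Gamma> i) = 0" if \<pi>: "test_plan M (p / (p - 1)) \<pi>" for \<pi>
  proof -
    have "sets \<pi> = sets curve_borel" using \<pi> by (simp add: test_plan_def)
    then have "\<Gamma> i \<in> null_sets \<pi>" for i using assms[of i] \<pi> by (auto simp: negligible_curves_def)
    then have "(\<Union>i. \<Gamma> i) \<in> null_sets \<pi>" by auto
    then show ?thesis by auto
  qed
  then show ?thesis using assms by (auto simp: negligible_curves_def)
qed

lemma negligible_curves_Un:
  assumes "negligible_curves M p A" "negligible_curves M p B"
  shows "negligible_curves M p (A \<union> B)"
proof -
  have "A \<union> B = (\<Union>i::nat. if i = 0 then A else B)" by auto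
  then show ?thesis using negligible_curves_UN[of M p "\<lambda>i. if i = 0 then A else B"] assms by simp
qed

text \<open>The pushforward of a test plan under restriction is again a test plan, so it does not
  charge \<Gamma>.\<close>

lemma negligible_curves_subcurve:
  fixes M :: "'a::metric_space measure"
  assumes p: "1 < p" and st: "0 \<le> s" "s < t" "t \<le> 1" and \<Gamma>: "negligible_curves M p \<Gamma>"
  shows "negligible_curves M p (subcurve s t -` \<Gamma> \<inter> space curve_borel)"
  unfolding negligible_curves_def
proof (intro conjI allI impI)
  have G: "\<Gamma> \<in> sets curve_borel" using \<Gamma> by (simp add: negligible_curves_def)
  have T0: "subcurve s t \<in> measurable (curve_borel :: (real \<Rightarrow> 'a) measure) curve_borel"
    using st by (intro measurable_subcurve) auto
  show "subcurve s t -` \<Gamma> \<inter> space curve_borel \<in> sets curve_borel" by (rule measurable_sets[OF T0 G])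
  fix \<pi> assume \<pi>: "test_plan M (p / (p - 1)) \<pi>"
  have [measurable_cong]: "sets \<pi> = sets curve_borel" using \<pi> by (simp add: test_plan_def)
  have T: "subcurve s t \<in> measurable \<pi> curve_borel" using T0 by measurable
  have "1 < p / (p - 1)" using p by simp
  then have "emeasure (distr \<pi> curve_borel (subcurve s t)) \<Gamma> = 0"
    using test_plan_subcurve[OF _ st \<pi>] \<Gamma> by (auto simp: negligible_curves_def)
  then show "emeasure \<pi> (subcurve s t -` \<Gamma> \<inter> space curve_borel) = 0"
    using emeasure_distr[OF T G] sets_eq_imp_space_eq[of \<pi> curve_borel] \<open>sets \<pi> = _\<close> by simp
qed

section \<open>Minima, decreasing limits and minimality of weak upper gradients\<close>

text \<open>Young's inequality with constants one: if |v| \<le> a^(p - 1), the first term alone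
  dominates the product, otherwise the second does.\<close>

lemma ennreal_young:
  fixes x :: ennreal and v :: real
  assumes p: "1 < p"
  shows "x * ennreal v \<le> epowr x p + ennreal (\<bar>v\<bar> powr (p / (p - 1)))"
proof (cases x)
  case (real a)
  have "a * \<bar>v\<bar> \<le> a powr p + \<bar>v\<bar> powr (p / (p - 1))"
  proof (cases "a = 0 \<or> v = 0")
    case False
    then have av: "0 < a" "0 < \<bar>v\<bar>" using real by auto
    show ?thesis
    proof (cases "\<bar>v\<bar> \<le> a powr (p - 1)")
      case True
      then have "a * \<bar>v\<bar> \<le> a * a powr (p - 1)" using av by (intro mult_left_mono) auto
      also have "\<dots> = a powr p" using av by (simp add: powr_diff)
      finally show ?thesis by (simp add: add_increasing2)
    next
      case False
      then have "(a powr (p - 1)) powr (1 / (p - 1)) \<le> \<bar>v\<bar> powr (1 / (p - 1))" using p by (intro powr_mono2) auto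
      then have "a \<le> \<bar>v\<bar> powr (1 / (p - 1))" using p av by (simp add: powr_powr)
      then have "a * \<bar>v\<bar> \<le> \<bar>v\<bar> powr (1 / (p - 1)) * \<bar>v\<bar>" by (rule mult_right_mono) simp
      also have "\<dots> = \<bar>v\<bar> powr (1 / (p - 1) + 1)" using av by (simp add: powr_add)
      also have "1 / (p - 1) + 1 = p / (p - 1)" using p by (simp add: field_simps)
      finally show ?thesis by (simp add: add_increasing)
    qed
  qed auto
  then have "ennreal (a * \<bar>v\<bar>) \<le> ennreal (a powr p + \<bar>v\<bar> powr (p / (p - 1)))" by (rule ennreal_leI)
  moreover have "x * ennreal v \<le> ennreal (a * \<bar>v\<bar>)"
    using real by (simp add: ennreal_mult mult_left_mono ennreal_leI)
  ultimately show ?thesis using real by simp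
qed simp

lemma Lp_norm_finite_iff:
  assumes "0 < p" shows "Lp_norm M p g < \<infinity> \<longleftrightarrow> (\<integral>\<^sup>+x. epowr (g x) p \<partial>M) < \<infinity>"
  unfolding Lp_norm_def using assms
  by (cases "\<integral>\<^sup>+x. epowr (g x) p \<partial>M") auto

lemma Lp_weak_upper_gradientsD:
  assumes "1 < p" "g \<in> Lp_weak_upper_gradients M p f"
  shows "g \<in> borel_measurable borel" "(\<integral>\<^sup>+x. epowr (g x) p \<partial>M) < \<infinity>"
  using assms Lp_norm_finite_iff[of p M g]
  by (auto simp: Lp_weak_upper_gradients_def weak_upper_gradient_def)

text \<open>Outside a negligible family, the curve lies in \<open>AC\<^sup>q\<close> and \<open>g\<close> is \<open>p\<close>-integrable in time.
  By Young's inequality this makes the curve integral finite, without any measurability of the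
  metric speed in the curve.\<close>

lemma curve_integral_finite_outside_negligible:
  fixes M :: "'a::metric_space measure"
  assumes p: "1 < p" and sM: "sets M = sets borel"
    and g: "g \<in> borel_measurable borel" and fin: "(\<integral>\<^sup>+x. epowr (g x) p \<partial>M) < \<infinity>"
  shows "\<exists>\<Gamma>. negligible_curves M p \<Gamma> \<and> (\<forall>c\<in>AC_curves - \<Gamma>. curve_integral c g < \<infinity>)"
proof -
  define q where "q = p / (p - 1)"
  have q: "1 < q" using p by (simp add: q_def)
  note [measurable] = g
  define F where "F = (\<lambda>(c :: real \<Rightarrow> 'a) u. epowr (g (c (clip u))) p * indicator {0<..<1} u)"
  have Fm [measurable]: "(\<lambda>(c, u). F c u) \<in> borel_measurable (curve_borel \<Otimes>\<^sub>M lborel)"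
    unfolding F_def split_beta by measurable
  have Im [measurable]: "(\<lambda>c. \<integral>\<^sup>+u. F c u \<partial>lborel) \<in> borel_measurable curve_borel"
    using Fm by (rule lborel.borel_measurable_nn_integral)
  define \<Gamma> where "\<Gamma> = (space curve_borel - ACq_curves q) \<union> {c \<in> space curve_borel. (\<integral>\<^sup>+u. F c u \<partial>lborel) = \<infinity>}"
  have \<Gamma>s: "\<Gamma> \<in> sets curve_borel"
    unfolding \<Gamma>_def using ACq_curves_sets[OF q] by measurable
  have "emeasure \<pi> \<Gamma> = 0" if \<pi>: "test_plan M (p / (p - 1)) \<pi>" for \<pi>
  proof -
    have sets [measurable_cong]: "sets \<pi> = sets curve_borel" and "prob_space \<pi>"
      and AEq: "AE c in \<pi>. c \<in> ACq_curves q"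
      using \<pi> by (auto simp: test_plan_def q_def)
    obtain C where C: "C \<ge> 0" "\<And>t A. t \<in> {0..1} \<Longrightarrow> A \<in> sets borel \<Longrightarrow> emeasure \<pi> {c \<in> space \<pi>. c t \<in> A} \<le> ennreal C * emeasure M A"
      using \<pi> by (auto simp: test_plan_def)
    have sp: "space \<pi> = space curve_borel" using sets_eq_imp_space_eq[OF sets] .
    interpret prob_space \<pi> by fact
    interpret P: pair_sigma_finite \<pi> "lborel :: real measure" ..
    have Fm' [measurable]: "(\<lambda>(c, u). F c u) \<in> borel_measurable (\<pi> \<Otimes>\<^sub>M lborel)"
      using Fm by measurable
    \<comment> \<open>The compression bound dominates the marginal at time u by C times the
      reference measure, uniformly in u.\<close>
    have time: "(\<integral>\<^sup>+c. epowr (g (c u)) p \<partial>\<pi>) \<le> ennreal C * (\<integral>\<^sup>+x. epowr (g x) p \<partial>M)" if u: "u \<in> {0..1}" for u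
    proof -
      have ev: "(\<lambda>c. c u) \<in> measurable \<pi> M"
        using measurable_curve_eval[OF u] by (simp add: measurable_cong_sets[OF sets sM])
      have gp: "(\<lambda>x. epowr (g x) p) \<in> borel_measurable M"
        using g by (simp add: measurable_cong_sets[OF sM refl])
      have le: "distr \<pi> M (\<lambda>c. c u) \<le> scale_measure (ennreal C) M"
      proof (subst le_measure)
        show "\<forall>A\<in>sets (distr \<pi> M (\<lambda>c. c u)). emeasure (distr \<pi> M (\<lambda>c. c u)) A \<le> emeasure (scale_measure (ennreal C) M) A"
        proof
          fix A assume "A \<in> sets (distr \<pi> M (\<lambda>c. c u))"
          then have A: "A \<in> sets M" "A \<in> sets borel" using sM by auto
          have "(\<lambda>c. c u) -` A \<inter> space \<pi> = {c \<in> space \<pi>. c u \<in> A}" by auto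
          then show "emeasure (distr \<pi> M (\<lambda>c. c u)) A \<le> emeasure (scale_measure (ennreal C) M) A"
            using C(2)[OF u A(2)] emeasure_distr[OF ev A(1)] by (simp add: emeasure_scale_measure)
        qed
      qed simp
      have "(\<integral>\<^sup>+c. epowr (g (c u)) p \<partial>\<pi>) = (\<integral>\<^sup>+x. epowr (g x) p \<partial>distr \<pi> M (\<lambda>c. c u))"
        using gp by (intro nn_integral_distr[OF ev, symmetric]) simp
      also have "\<dots> \<le> (\<integral>\<^sup>+x. epowr (g x) p \<partial>scale_measure (ennreal C) M)"
        using le by (intro nn_integral_mono_measure) auto
      also have "\<dots> = ennreal C * (\<integral>\<^sup>+x. epowr (g x) p \<partial>M)" using gp by (rule nn_integral_scale_measure)
      finally show ?thesis .
    qed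
    have "(\<integral>\<^sup>+c. (\<integral>\<^sup>+u. F c u \<partial>lborel) \<partial>\<pi>) = (\<integral>\<^sup>+u. (\<integral>\<^sup>+c. F c u \<partial>\<pi>) \<partial>lborel)"
      by (rule P.Fubini'[OF Fm', symmetric])
    also have "\<dots> \<le> (\<integral>\<^sup>+u. (ennreal C * (\<integral>\<^sup>+x. epowr (g x) p \<partial>M)) * indicator {0<..<1::real} u \<partial>lborel)"
    proof (rule nn_integral_mono)
      fix u :: real
      show "(\<integral>\<^sup>+c. F c u \<partial>\<pi>) \<le> (ennreal C * (\<integral>\<^sup>+x. epowr (g x) p \<partial>M)) * indicator {0<..<1} u"
        using time[of u] by (cases "u \<in> {0<..<1}") (auto simp: F_def)
    qed
    also have "\<dots> = ennreal C * (\<integral>\<^sup>+x. epowr (g x) p \<partial>M)" by (subst nn_integral_cmult_indicator) auto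
    also have "\<dots> < \<infinity>" using fin by (simp add: ennreal_mult_less_top)
    finally have "AE c in \<pi>. (\<integral>\<^sup>+u. F c u \<partial>lborel) \<noteq> \<infinity>"
      using Im by (intro nn_integral_PInf_AE) (auto simp: measurable_cong_sets[OF sets refl])
    then have "AE c in \<pi>. c \<notin> \<Gamma>" using AEq by eventually_elim (auto simp: \<Gamma>_def)
    then show ?thesis using \<Gamma>s sets AE_iff_null_sets[of \<Gamma> \<pi>] by auto
  qed
  then have "negligible_curves M p \<Gamma>" using \<Gamma>s by (simp add: negligible_curves_def)
  moreover have "curve_integral c g < \<infinity>" if c: "c \<in> AC_curves - \<Gamma>" for c
  proof -
    have "c \<in> space curve_borel" using c by (simp add: AC_curves_def)
    then have cq: "c \<in> ACq_curves q" and F: "(\<integral>\<^sup>+u. F c u \<partial>lborel) \<noteq> \<infinity>" using c by (auto simp: \<Gamma>_def)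
    then have AC: "c \<in> AC_curves" "speed_energy q c < \<infinity>" by (auto simp: ACq_curves_def)
    have [measurable]: "(\<lambda>t. c (clip t)) \<in> borel_measurable borel"
      using AC by (intro measurable_curve_clip) (simp add: AC_curves_def)
    note [measurable] = metric_speed_measurable[OF AC(1)]
    have "curve_integral c g \<le> (\<integral>\<^sup>+u. F c u + ennreal (\<bar>indicator {0<..<1} u * metric_speed c u\<bar> powr q) \<partial>lborel)"
      unfolding curve_integral_def
    proof (rule nn_integral_mono)
      fix u :: real
      show "g (c u) * ennreal (metric_speed c u) * indicator {0<..<1} u
         \<le> F c u + ennreal (\<bar>indicator {0<..<1} u * metric_speed c u\<bar> powr q)"
        using ennreal_young[OF p, of "g (c u)" "metric_speed c u"]
        by (cases "u \<in> {0<..<1}") (auto simp: F_def q_def)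
    qed
    also have "\<dots> = (\<integral>\<^sup>+u. F c u \<partial>lborel) + (\<integral>\<^sup>+u. ennreal (\<bar>indicator {0<..<1} u * metric_speed c u\<bar> powr q) \<partial>lborel)"
      unfolding F_def by (rule nn_integral_add) measurable
    also have "(\<integral>\<^sup>+u. ennreal (\<bar>indicator {0<..<1} u * metric_speed c u\<bar> powr q) \<partial>lborel) = speed_energy q c"
      unfolding speed_energy_def by (rule nn_integral_cong) (auto simp: indicator_def)
    also have "(\<integral>\<^sup>+u. F c u \<partial>lborel) + speed_energy q c < \<infinity>" using F AC by (simp add: less_top)
    finally show ?thesis .
  qed
  ultimately show ?thesis by blast
qed

text \<open>The inequality on subintervals is obtained by applying the endpoint inequality to
  restricted curves. Rational endpoints leave countably many families to discard, each negligible as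
  a preimage under restriction.\<close>

lemma weak_upper_gradient_subcurves:
  fixes M :: "'a::metric_space measure"
  assumes p: "1 < p" and sM: "sets M = sets borel" and g: "g \<in> Lp_weak_upper_gradients M p f"
  shows "\<exists>\<Gamma>. negligible_curves M p \<Gamma> \<and> (\<forall>c\<in>AC_curves - \<Gamma>. curve_integral c g < \<infinity> \<and>
    (\<forall>s\<in>\<rat>. \<forall>t\<in>\<rat>. 0 \<le> s \<longrightarrow> s < t \<longrightarrow> t \<le> 1 \<longrightarrow>
       ennreal \<bar>f (c t) - f (c s)\<bar> \<le> (\<integral>\<^sup>+u\<in>{s<..<t}. g (c u) * ennreal (metric_speed c u) \<partial>lborel)))"
proof -
  have gm: "g \<in> borel_measurable borel" and gfin: "(\<integral>\<^sup>+x. epowr (g x) p \<partial>M) < \<infinity>"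
    using Lp_weak_upper_gradientsD[OF p g] by auto
  obtain \<Gamma> where \<Gamma>: "negligible_curves M p \<Gamma>"
    "\<And>c. c \<in> AC_curves - \<Gamma> \<Longrightarrow> ennreal \<bar>f (c 1) - f (c 0)\<bar> \<le> curve_integral c g"
    using g by (auto simp: Lp_weak_upper_gradients_def weak_upper_gradient_def)
  obtain \<Gamma>' where \<Gamma>': "negligible_curves M p \<Gamma>'" "\<And>c. c \<in> AC_curves - \<Gamma>' \<Longrightarrow> curve_integral c g < \<infinity>"
    using curve_integral_finite_outside_negligible[OF p sM gm gfin] by blast
  define I where "I = {(s, t). s \<in> \<rat> \<and> t \<in> \<rat> \<and> 0 \<le> s \<and> s < t \<and> t \<le> (1::real)}"
  have "countable I" by (rule countable_subset[of _ "\<rat> \<times> \<rat>"]) (auto simp: I_def countable_rat)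
  moreover have "(0, 1) \<in> I" by (auto simp: I_def)
  ultimately have rI: "range (from_nat_into I) = I" by (intro range_from_nat_into) auto
  define \<Gamma>s where "\<Gamma>s = (\<lambda>i. subcurve (fst (from_nat_into I i)) (snd (from_nat_into I i)) -` \<Gamma> \<inter> space curve_borel)"
  have "negligible_curves M p (\<Gamma>s i)" for i
  proof -
    have "from_nat_into I i \<in> I" using rI by blast
    then show ?thesis unfolding \<Gamma>s_def I_def
      by (intro negligible_curves_subcurve[OF p _ _ _ \<Gamma>(1)]) auto
  qed
  then have neg: "negligible_curves M p (\<Gamma>' \<union> (\<Union>i. \<Gamma>s i))"
    by (intro negligible_curves_Un negligible_curves_UN \<Gamma>')
  have "ennreal \<bar>f (c t) - f (c s)\<bar> \<le> (\<integral>\<^sup>+u\<in>{s<..<t}. g (c u) * ennreal (metric_speed c u) \<partial>lborel)"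
    if c: "c \<in> AC_curves - (\<Gamma>' \<union> (\<Union>i. \<Gamma>s i))" and st: "s \<in> \<rat>" "t \<in> \<rat>" "0 \<le> s" "s < t" "t \<le> 1" for c s t
  proof -
    have "(s, t) \<in> range (from_nat_into I)" using st rI by (auto simp: I_def)
    then obtain i where "from_nat_into I i = (s, t)" by (metis imageE)
    moreover have "c \<notin> \<Gamma>s i" using c by blast
    ultimately have "c \<notin> subcurve s t -` \<Gamma> \<inter> space curve_borel" by (simp add: \<Gamma>s_def)
    moreover have AC: "c \<in> AC_curves" "c \<in> space curve_borel" using c by (auto simp: AC_curves_def)
    ultimately have "subcurve s t c \<in> AC_curves - \<Gamma>" using subcurve_speed(1)[OF AC(1) st(3-5)] by auto
    then have "ennreal \<bar>f (subcurve s t c 1) - f (subcurve s t c 0)\<bar> \<le> curve_integral (subcurve s t c) g" by (rule \<Gamma>(2))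
    also have "\<dots> \<le> (\<integral>\<^sup>+u\<in>{s<..<t}. g (c u) * ennreal (metric_speed c u) \<partial>lborel)"
      by (rule subcurve_integral_le[OF AC(1) st(3-5) gm])
    finally show ?thesis by (simp add: subcurve_def)
  qed
  then show ?thesis using neg \<Gamma>'(2) by (intro exI[of _ "\<Gamma>' \<union> (\<Union>i. \<Gamma>s i)"]) auto
qed

text \<open>On each cell of a rational grid the increment of f is bounded by the integral of either
  gradient; choosing one of them cell by cell gives the minimum in the limit, by
  \<open>chain_bound_min\<close>. That argument requires both curve integrals to be finite.\<close>

lemma Lp_weak_upper_gradients_min:
  fixes M :: "'a::metric_space measure"
  assumes p: "1 < p" and sM: "sets M = sets borel"
    and g1: "g1 \<in> Lp_weak_upper_gradients M p f" and g2: "g2 \<in> Lp_weak_upper_gradients M p f"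
  shows "(\<lambda>x. min (g1 x) (g2 x)) \<in> Lp_weak_upper_gradients M p f"
proof -
  have gm [measurable]: "g1 \<in> borel_measurable borel" "g2 \<in> borel_measurable borel" and gfin: "(\<integral>\<^sup>+x. epowr (g1 x) p \<partial>M) < \<infinity>"
    using Lp_weak_upper_gradientsD[OF p g1] Lp_weak_upper_gradientsD[OF p g2] by auto
  define E where "E = (\<lambda>g \<Gamma>. \<forall>c\<in>AC_curves - \<Gamma>. curve_integral c g < \<infinity> \<and>
    (\<forall>s\<in>\<rat>. \<forall>t\<in>\<rat>. 0 \<le> s \<longrightarrow> s < t \<longrightarrow> t \<le> 1 \<longrightarrow>
       ennreal \<bar>f (c t) - f (c s)\<bar> \<le> (\<integral>\<^sup>+u\<in>{s<..<t}. g (c u) * ennreal (metric_speed c u) \<partial>lborel)))"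
  have Efin: "curve_integral c g < \<infinity>" if "E g \<Gamma>" "c \<in> AC_curves - \<Gamma>" for g \<Gamma> c
    using that(1)[unfolded E_def, THEN bspec, OF that(2)] by (rule conjunct1)
  have Ele: "ennreal \<bar>f (c t) - f (c s)\<bar> \<le> (\<integral>\<^sup>+u\<in>{s<..<t}. g (c u) * ennreal (metric_speed c u) \<partial>lborel)"
    if "E g \<Gamma>" "c \<in> AC_curves - \<Gamma>" and st: "s \<in> \<rat>" "t \<in> \<rat>" "0 \<le> s" "s < t" "t \<le> 1" for g \<Gamma> c s t
    using that(1)[unfolded E_def, THEN bspec, OF that(2), THEN conjunct2, THEN bspec, OF st(1), THEN bspec, OF st(2)] st(3-5) by simp
  have "\<exists>\<Gamma>. negligible_curves M p \<Gamma> \<and> E g \<Gamma>" if "g \<in> Lp_weak_upper_gradients M p f" for g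
    unfolding E_def by (rule weak_upper_gradient_subcurves[OF p sM that])
  then obtain \<Gamma>1 \<Gamma>2 where n1: "negligible_curves M p \<Gamma>1" and E1: "E g1 \<Gamma>1"
    and n2: "negligible_curves M p \<Gamma>2" and E2: "E g2 \<Gamma>2"
    using g1 g2 by blast
  have "ennreal \<bar>f (c 1) - f (c 0)\<bar> \<le> curve_integral c (\<lambda>x. min (g1 x) (g2 x))" if c: "c \<in> AC_curves - (\<Gamma>1 \<union> \<Gamma>2)" for c
  proof -
    have AC: "c \<in> AC_curves" and c1: "c \<in> AC_curves - \<Gamma>1" and c2: "c \<in> AC_curves - \<Gamma>2" using c by auto
    define G where "G = (\<lambda>g u. g (c u) * ennreal (metric_speed c u) * indicator {0<..<1} u)"
    have Gm: "G g \<in> borel_measurable borel" if "g \<in> borel_measurable borel" for g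
      unfolding G_def by (rule curve_weight_measurable[OF AC that])
    have G01: "(\<integral>\<^sup>+u\<in>{0<..<1}. G g u \<partial>lborel) = curve_integral c g" for g
      unfolding curve_integral_def G_def by (rule nn_integral_cong) (auto simp: indicator_def)
    have Gst: "(\<integral>\<^sup>+u\<in>{s<..<t}. g (c u) * ennreal (metric_speed c u) \<partial>lborel) = (\<integral>\<^sup>+u\<in>{s<..<t}. G g u \<partial>lborel)"
      if "0 \<le> s" "t \<le> 1" for s t g
      unfolding G_def using that by (intro nn_integral_cong) (auto simp: indicator_def)
    have cell: "real i / real n \<in> \<rat>" "real (Suc i) / real n \<in> \<rat>" "0 \<le> real i / real n"
      "real i / real n < real (Suc i) / real n" "real (Suc i) / real n \<le> 1" if "i < n" for i n
      using that by (auto simp: field_simps intro!: Rats_divide)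
    have "ennreal \<bar>f (c 1) - f (c 0)\<bar> \<le> (\<integral>\<^sup>+u\<in>{0<..<1}. min (G g1 u) (G g2 u) \<partial>lborel)"
    proof (rule chain_bound_min[of "G g1" "G g2" "\<lambda>s t. ennreal \<bar>f (c t) - f (c s)\<bar>"])
      fix n :: nat assume n: "0 < n"
      have "f (c 1) - f (c 0) = (\<Sum>i<n. f (c (real (Suc i) / real n)) - f (c (real i / real n)))"
        using n by (subst sum_lessThan_telescope[of "\<lambda>i. f (c (real i / real n))"]) simp
      then have "\<bar>f (c 1) - f (c 0)\<bar> \<le> (\<Sum>i<n. \<bar>f (c (real (Suc i) / real n)) - f (c (real i / real n))\<bar>)"
        by (simp only: sum_abs)
      then have "ennreal \<bar>f (c 1) - f (c 0)\<bar> \<le> ennreal (\<Sum>i<n. \<bar>f (c (real (Suc i) / real n)) - f (c (real i / real n))\<bar>)"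
        by (rule ennreal_leI)
      also have "\<dots> = (\<Sum>i<n. ennreal \<bar>f (c (real (Suc i) / real n)) - f (c (real i / real n))\<bar>)"
        by (rule sum_ennreal[symmetric]) simp
      finally show "ennreal \<bar>f (c 1) - f (c 0)\<bar> \<le> (\<Sum>i<n. ennreal \<bar>f (c (real (Suc i) / real n)) - f (c (real i / real n))\<bar>)" .
    next
      fix n i :: nat assume i: "i < n"
      note * = cell[OF i]
      show "ennreal \<bar>f (c (real (Suc i) / real n)) - f (c (real i / real n))\<bar> \<le> (\<integral>\<^sup>+u\<in>{real i / real n<..<real (Suc i) / real n}. G g1 u \<partial>lborel)"
        using Ele[OF E1 c1 *] unfolding Gst[OF *(3,5)] .
      show "ennreal \<bar>f (c (real (Suc i) / real n)) - f (c (real i / real n))\<bar> \<le> (\<integral>\<^sup>+u\<in>{real i / real n<..<real (Suc i) / real n}. G g2 u \<partial>lborel)"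
        using Ele[OF E2 c2 *] unfolding Gst[OF *(3,5)] .
    qed (use Gm gm G01 Efin[OF E1 c1] Efin[OF E2 c2] in auto)
    also have "\<dots> = curve_integral c (\<lambda>x. min (g1 x) (g2 x))"
      unfolding curve_integral_def
    proof (rule nn_integral_cong)
      fix u :: real
      have "min (a * v) (b * v) = min a b * v" for a b v :: ennreal
        by (auto simp: min_def mult_right_mono intro: antisym)
      then show "min (G g1 u) (G g2 u) * indicator {0<..<1} u = min (g1 (c u)) (g2 (c u)) * ennreal (metric_speed c u) * indicator {0<..<1} u"
        by (auto simp: G_def indicator_def)
    qed
    finally show ?thesis .
  qed
  moreover have "(\<integral>\<^sup>+x. epowr (min (g1 x) (g2 x)) p \<partial>M) \<le> (\<integral>\<^sup>+x. epowr (g1 x) p \<partial>M)"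
    using p by (intro nn_integral_mono epowr_mono) auto
  ultimately show ?thesis
    using gfin negligible_curves_Un[OF n1 n2] p
    unfolding Lp_weak_upper_gradients_def weak_upper_gradient_def Lp_norm_finite_iff[OF order.strict_trans[OF zero_less_one p]]
    by (intro CollectI conjI exI[of _ "\<Gamma>1 \<union> \<Gamma>2"]) auto
qed

text \<open>Monotone convergence from above along a curve requires one finite integral; the first
  gradient provides it outside a negligible family.\<close>

lemma Lp_weak_upper_gradients_INF:
  fixes M :: "'a::metric_space measure"
  assumes p: "1 < p" and sM: "sets M = sets borel"
    and h: "\<And>n::nat. h n \<in> Lp_weak_upper_gradients M p f" and dec: "\<And>x. decseq (\<lambda>n. h n x)"
  shows "(\<lambda>x. INF n. h n x) \<in> Lp_weak_upper_gradients M p f"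
proof -
  have hm [measurable]: "h n \<in> borel_measurable borel" and hfin: "(\<integral>\<^sup>+x. epowr (h n x) p \<partial>M) < \<infinity>" for n
    using Lp_weak_upper_gradientsD[OF p h] by auto
  have "\<forall>n. \<exists>\<Gamma>. negligible_curves M p \<Gamma> \<and> (\<forall>c\<in>AC_curves - \<Gamma>. ennreal \<bar>f (c 1) - f (c 0)\<bar> \<le> curve_integral c (h n))"
    using h by (auto simp: Lp_weak_upper_gradients_def weak_upper_gradient_def)
  then obtain \<Gamma> where \<Gamma>: "\<And>n. negligible_curves M p (\<Gamma> n)"
    "\<And>n c. c \<in> AC_curves - \<Gamma> n \<Longrightarrow> ennreal \<bar>f (c 1) - f (c 0)\<bar> \<le> curve_integral c (h n)" by metis
  obtain \<Gamma>' where \<Gamma>': "negligible_curves M p \<Gamma>'" "\<And>c. c \<in> AC_curves - \<Gamma>' \<Longrightarrow> curve_integral c (h 0) < \<infinity>"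
    using curve_integral_finite_outside_negligible[OF p sM hm hfin] by blast
  have "ennreal \<bar>f (c 1) - f (c 0)\<bar> \<le> curve_integral c (\<lambda>x. INF n. h n x)" if c: "c \<in> AC_curves - (\<Gamma>' \<union> (\<Union>n. \<Gamma> n))" for c
  proof -
    have AC: "c \<in> AC_curves" using c by auto
    have "ennreal \<bar>f (c 1) - f (c 0)\<bar> \<le> (INF n. curve_integral c (h n))"
      using c by (intro INF_greatest \<Gamma>(2)) auto
    also have "\<dots> = (\<integral>\<^sup>+u. (INF n. h n (c u) * ennreal (metric_speed c u) * indicator {0<..<1} u) \<partial>lborel)"
      unfolding curve_integral_def
    proof (rule nn_integral_monotone_convergence_INF_decseq[symmetric])
      show "decseq (\<lambda>n u. h n (c u) * ennreal (metric_speed c u) * indicator {0<..<1} u)"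
        using dec by (auto simp: monotone_def le_fun_def intro!: mult_right_mono)
      show "(\<lambda>u. h n (c u) * ennreal (metric_speed c u) * indicator {0<..<1} u) \<in> borel_measurable lborel" for n
        using curve_weight_measurable[OF AC hm[of n]] by simp
      show "(\<integral>\<^sup>+u. h 0 (c u) * ennreal (metric_speed c u) * indicator {0<..<1} u \<partial>lborel) < \<infinity>"
        using \<Gamma>'(2)[of c] c by (auto simp: curve_integral_def)
    qed
    also have "\<dots> \<le> curve_integral c (\<lambda>x. INF n. h n x)"
      unfolding curve_integral_def
    proof (rule nn_integral_mono)
      fix u :: real
      \<comment> \<open>The speed factor is finite, so multiplication by it commutes with the
        decreasing limit.\<close>
      define v where "v = ennreal (metric_speed c u) * indicator {0<..<1} u"
      have v: "v < \<top>" by (auto simp: v_def indicator_def ennreal_mult_less_top)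
      have "(INF n. h n (c u) * v) = (INF n. h n (c u)) * v"
      proof (cases "v = 0")
        case False
        have "(\<lambda>n. h n (c u)) \<longlonglongrightarrow> (INF n. h n (c u))" by (rule LIMSEQ_INF[OF dec])
        from ennreal_tendsto_cmult[OF v this] have "(\<lambda>n. h n (c u) * v) \<longlonglongrightarrow> (INF n. h n (c u)) * v"
          by (simp add: mult.commute)
        moreover have "(\<lambda>n. h n (c u) * v) \<longlonglongrightarrow> (INF n. h n (c u) * v)"
          using dec by (intro LIMSEQ_INF) (auto simp: decseq_def intro!: mult_right_mono)
        ultimately show ?thesis by (intro LIMSEQ_unique)
      qed simp
      then show "(INF n. h n (c u) * ennreal (metric_speed c u) * indicator {0<..<1} u)
         \<le> (INF n. h n (c u)) * ennreal (metric_speed c u) * indicator {0<..<1} u"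
        by (simp add: v_def mult.assoc)
    qed
    finally show ?thesis .
  qed
  moreover have "(\<integral>\<^sup>+x. epowr (INF n. h n x) p \<partial>M) \<le> (\<integral>\<^sup>+x. epowr (h 0 x) p \<partial>M)"
    using p by (intro nn_integral_mono epowr_mono) (auto intro: INF_lower)
  ultimately show ?thesis
    using hfin[of 0] negligible_curves_Un[OF \<Gamma>'(1) negligible_curves_UN[OF \<Gamma>(1)]] p
    unfolding Lp_weak_upper_gradients_def weak_upper_gradient_def Lp_norm_finite_iff[OF order.strict_trans[OF zero_less_one p]]
    by (intro CollectI conjI exI[of _ "\<Gamma>' \<union> (\<Union>n. \<Gamma> n)"]) (auto intro!: borel_measurable_INF hm)
qed

text \<open>The p-th power integral is minimised: running minima of a minimising sequence decrease
  to a gradient H with the least integral. The minimum of H with any other gradient has no smaller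
  integral, hence equals H almost everywhere.\<close>

lemma minimal_weak_upper_gradient_exists:
  fixes M :: "'a::metric_space measure"
  assumes p: "1 < p" and sM: "sets M = sets borel" and ne: "Lp_weak_upper_gradients M p f \<noteq> {}"
  shows "\<exists>g \<in> Lp_weak_upper_gradients M p f. \<forall>g' \<in> Lp_weak_upper_gradients M p f. AE x in M. g x \<le> g' x"
proof -
  define S where "S = Lp_weak_upper_gradients M p f"
  define I where "I = (\<lambda>g. \<integral>\<^sup>+x. epowr (g x) p \<partial>M)"
  have Sm: "g \<in> borel_measurable M" and SI: "I g < \<infinity>" if "g \<in> S" for g
    using Lp_weak_upper_gradientsD[OF p, of g M f] that by (auto simp: S_def I_def measurable_cong_sets[OF sM refl])
  define d where "d = (INF g\<in>S. I g)"
  have d_le: "d \<le> I g" if "g \<in> S" for g unfolding d_def using that by (rule INF_lower)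
  obtain g0 where "g0 \<in> S" using ne by (auto simp: S_def)
  then have dfin: "d < \<infinity>" using d_le SI by (meson le_less_trans)
  have "\<exists>g\<in>S. I g \<le> d + ennreal (1 / real (Suc n))" for n
  proof -
    have "d < d + ennreal (1 / real (Suc n))" using dfin by (simp add: ennreal_add_left_cancel_less less_top)
    then obtain g where "g \<in> S" "I g < d + ennreal (1 / real (Suc n))" unfolding d_def INF_less_iff by auto
    then show ?thesis by (auto intro: less_imp_le)
  qed
  then obtain g where g: "\<And>n. g n \<in> S" "\<And>n. I (g n) \<le> d + ennreal (1 / real (Suc n))" by metis
  define h where "h = (\<lambda>n x. Min ((\<lambda>i. g i x) ` {..n}))"
  have h_Suc: "h (Suc n) x = min (g (Suc n) x) (h n x)" for n x
    unfolding h_def by (simp add: atMost_Suc)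
  have hS: "h n \<in> S" for n
  proof (induction n)
    case 0 have "h 0 = g 0" by (auto simp: h_def) then show ?case using g by simp
  next
    case (Suc n)
    have "h (Suc n) = (\<lambda>x. min (g (Suc n) x) (h n x))" using h_Suc by auto
    then show ?case using Lp_weak_upper_gradients_min[OF p sM] g(1) Suc unfolding S_def by metis
  qed
  have dec: "decseq (\<lambda>n. h n x)" for x unfolding decseq_Suc_iff by (simp add: h_Suc)
  define H where "H = (\<lambda>x. INF n. h n x)"
  have HS: "H \<in> S" unfolding H_def S_def
    by (rule Lp_weak_upper_gradients_INF[OF p sM _ dec]) (use hS in \<open>simp add: S_def\<close>)
  have IH: "I H \<le> d"
  proof (rule ennreal_le_epsilon)
    fix e :: real assume "0 < e"
    then obtain n where n: "1 / real (Suc n) < e" using nat_approx_posE by blast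
    have "H x \<le> g n x" for x
    proof -
      have "H x \<le> h n x" unfolding H_def by (rule INF_lower) simp
      also have "h n x \<le> g n x" unfolding h_def by (rule Min_le) auto
      finally show ?thesis .
    qed
    then have "I H \<le> I (g n)" unfolding I_def using p by (intro nn_integral_mono epowr_mono) auto
    also have "\<dots> \<le> d + ennreal e" using g(2)[of n] n by (meson add_left_mono ennreal_leI less_imp_le order_trans)
    finally show "I H \<le> d + ennreal e" .
  qed
  have "AE x in M. H x \<le> g' x" if g': "g' \<in> S" for g'
  proof -
    define m where "m = (\<lambda>x. min (H x) (g' x))"
    have mS: "m \<in> S" unfolding m_def using Lp_weak_upper_gradients_min[OF p sM] HS g' unfolding S_def by metis
    note [measurable] = Sm[OF mS] Sm[OF HS]
    have fin: "AE x in M. epowr (H x) p \<noteq> \<infinity>" using SI[OF HS] unfolding I_def by (intro nn_integral_PInf_AE) auto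
    have mH: "epowr (m x) p \<le> epowr (H x) p" for x unfolding m_def using p by (intro epowr_mono) auto
    have "(\<integral>\<^sup>+x. epowr (H x) p - epowr (m x) p \<partial>M) = I H - I m"
      unfolding I_def using SI[OF mS] mH by (intro nn_integral_diff) (auto simp: I_def)
    also have "\<dots> = 0"
      using order_trans[OF IH d_le[OF mS]] SI[OF HS] by (intro diff_eq_0_ennreal) auto
    finally have "AE x in M. epowr (H x) p - epowr (m x) p = 0"
      by (subst (asm) nn_integral_0_iff_AE) auto
    then show ?thesis using fin
    proof eventually_elim
      case (elim x)
      have "epowr (H x) p \<le> epowr (m x) p" using elim diff_eq_0_iff_ennreal by blast
      then have "epowr (epowr (H x) p) (1/p) \<le> epowr (epowr (m x) p) (1/p)" by (rule epowr_mono[rotated]) (use p in auto)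
      then have "H x \<le> m x" unfolding epowr_inverse(1)[OF less_trans[OF zero_less_one p]] .
      then show ?case by (simp add: m_def)
    qed
  qed
  then show ?thesis using HS unfolding S_def by blast
qed

lemma Lp_norm_mono_AE:
  assumes "0 < p" "AE x in M. g x \<le> h x" shows "Lp_norm M p g \<le> Lp_norm M p h"
  unfolding Lp_norm_def using assms
  by (intro epowr_mono nn_integral_mono_AE) (auto elim!: eventually_mono intro: epowr_mono)

text \<open>Since a minimal gradient exists, the one picked by the choice operator lies below g
  almost everywhere.\<close>

lemma Sobolev_norm_le:
  fixes M :: "'a::metric_space measure"
  assumes p: "1 < p" and sM: "sets M = sets borel" and g: "g \<in> Lp_weak_upper_gradients M p f"
  shows "Sobolev_norm M p f \<le> Lp_norm M p g"
proof -
  have ne: "Lp_weak_upper_gradients M p f \<noteq> {}" using g by auto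
  have "\<exists>g. g \<in> Lp_weak_upper_gradients M p f \<and> (\<forall>g'\<in>Lp_weak_upper_gradients M p f. AE x in M. g x \<le> g' x)"
    using minimal_weak_upper_gradient_exists[OF p sM ne] by blast
  from someI_ex[OF this] have "AE x in M. min_weak_upper_gradient M p f x \<le> g x"
    unfolding min_weak_upper_gradient_def using g by blast
  then show ?thesis unfolding Sobolev_norm_def using ne p by (auto intro!: Lp_norm_mono_AE)
qed

section \<open>Doubling spaces\<close>

locale doubling_space =
  fixes M :: "'a::metric_space measure" and D :: real
  assumes sets_M [simp, measurable_cong]: "sets M = sets borel"
    and D_ge_1: "1 \<le> D"
    and emeasure_ball_pos: "0 < r \<Longrightarrow> 0 < emeasure M (ball x r)"
    and emeasure_ball_finite: "emeasure M (ball x r) < \<infinity>"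
    and doubling_ball: "0 < r \<Longrightarrow> measure M (ball x (2 * r)) \<le> D * measure M (ball x r)"
begin

abbreviation V :: "'a \<Rightarrow> real \<Rightarrow> real" where "V x r \<equiv> measure M (ball x r)"

lemma space_M [simp]: "space M = UNIV"
  using sets_eq_imp_space_eq[OF sets_M] by simp

lemma emeasure_ball: "emeasure M (ball x r) = ennreal (V x r)"
  using emeasure_ball_finite[of x r] by (simp add: emeasure_eq_ennreal_measure)

lemma V_pos: "0 < r \<Longrightarrow> 0 < V x r"
  using emeasure_ball_pos[of r x] by (simp add: emeasure_ball)

lemma V_mono: "ball x r \<subseteq> ball y s \<Longrightarrow> V x r \<le> V y s"
  using emeasure_mono[of "ball x r" "ball y s" M] by (simp add: emeasure_ball)

lemma D_pos: "0 < D" using D_ge_1 by simp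

lemma V_power: "0 < r \<Longrightarrow> V x (2 ^ n * r) \<le> D ^ n * V x r"
proof (induction n)
  case (Suc n)
  have "V x (2 * (2 ^ n * r)) \<le> D * V x (2 ^ n * r)" using Suc by (intro doubling_ball) auto
  also have "\<dots> \<le> D * (D ^ n * V x r)" using Suc D_pos by (intro mult_left_mono) auto
  finally show ?case by (simp add: mult.assoc)
qed simp

text \<open>Finitely many doublings reach the dilation factor K, so one constant serves all balls
  inside the K-fold dilate, whatever their centres.\<close>

lemma V_scale:
  "\<exists>C\<ge>1. \<forall>x y r s. 0 < r \<longrightarrow> ball y s \<subseteq> ball x (K * r) \<longrightarrow> V y s \<le> C * V x r"
proof -
  obtain n where n: "K < 2 ^ n" using real_arch_pow[of 2 K] by auto
  have "V y s \<le> D ^ n * V x r" if r: "0 < r" "ball y s \<subseteq> ball x (K * r)" for x y r s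
  proof -
    have "V y s \<le> V x (2 ^ n * r)" using r n by (intro V_mono order_trans[OF r(2)] subset_ball mult_right_mono) auto
    also have "\<dots> \<le> D ^ n * V x r" by (rule V_power[OF r(1)])
    finally show ?thesis .
  qed
  then show ?thesis using one_le_power[OF D_ge_1] by blast
qed

lemma subset_ball_dist: "dist x y + s \<le> r \<Longrightarrow> ball y s \<subseteq> ball x r"
  for x y :: 'a
proof
  fix z assume "dist x y + s \<le> r" "z \<in> ball y s"
  then show "z \<in> ball x r" using dist_triangle[of x z y] by auto
qed

sublocale sigma_finite_measure M
proof
  fix x0 :: 'a
  show "\<exists>A. countable A \<and> A \<subseteq> sets M \<and> \<Union>A = space M \<and> (\<forall>a\<in>A. emeasure M a \<noteq> \<infinity>)"
  proof (intro exI[of _ "range (\<lambda>n::nat. ball undefined (real n))"] conjI ballI)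
    show "\<Union>(range (\<lambda>n::nat. ball undefined (real n))) = space M"
      using reals_Archimedean2 by auto
  qed (auto simp: emeasure_ball)
qed

section \<open>Separability and joint measurability\<close>

text \<open>A separated set of maximal cardinality is a net. The balls of radius e / 2 about the
  points of a separated set are disjoint, lie in one fixed ball and have volumes comparable to it,
  which bounds their number.\<close>

lemma finite_net:
  fixes x0 :: 'a
  assumes e: "0 < e" and R: "0 < R"
  shows "\<exists>F. finite F \<and> (\<forall>x\<in>ball x0 R. \<exists>d\<in>F. dist x d < e)"
proof -
  \<comment> \<open>At radius e / 2 this dilation factor gives the radius 2 R + e, large enough for
    a ball about any point of \<open>ball x0 R\<close> to contain
    \<open>ball x0 (R + e)\<close>.\<close>
  obtain C where C: "1 \<le> C" "\<And>x y r s. 0 < r \<Longrightarrow> ball y s \<subseteq> ball x ((2 * R + e) / (e / 2) * r) \<Longrightarrow> V y s \<le> C * V x r"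
    using V_scale[of "(2 * R + e) / (e / 2)"] by blast
  define sep where "sep = (\<lambda>F. finite F \<and> F \<subseteq> ball x0 R \<and> (\<forall>x\<in>F. \<forall>y\<in>F. x \<noteq> y \<longrightarrow> e \<le> dist x y))"
  have bnd: "real (card F) \<le> C" if F: "sep F" for F
  proof -
    have dj: "disjoint_family_on (\<lambda>x. ball x (e / 2)) F"
      unfolding disjoint_family_on_def
    proof (intro ballI impI equals0I)
      fix x y z assume xy: "x \<in> F" "y \<in> F" "x \<noteq> y" and z: "z \<in> ball x (e / 2) \<inter> ball y (e / 2)"
      have "e \<le> dist x y" using F xy by (auto simp: sep_def)
      then show False using z dist_triangle[of x y z] by (auto simp: dist_commute)
    qed
    have "ennreal (real (card F) * (V x0 (R + e) / C)) = (\<Sum>x\<in>F. ennreal (V x0 (R + e) / C))"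
      using C(1) by (simp add: ennreal_mult[symmetric] ennreal_of_nat_eq_real_of_nat)
    also have "\<dots> \<le> (\<Sum>x\<in>F. emeasure M (ball x (e / 2)))"
    proof (rule sum_mono)
      fix x assume "x \<in> F"
      then have "dist x x0 < R" using F by (auto simp: sep_def dist_commute)
      then have "ball x0 (R + e) \<subseteq> ball x ((2 * R + e) / (e / 2) * (e / 2))"
        using e by (intro subset_ball_dist) simp
      then have "V x0 (R + e) \<le> C * V x (e / 2)" using e by (intro C(2)) auto
      then show "ennreal (V x0 (R + e) / C) \<le> emeasure M (ball x (e / 2))"
        unfolding emeasure_ball using C(1) by (intro ennreal_leI) (simp add: field_simps)
    qed
    also have "\<dots> = emeasure M (\<Union>x\<in>F. ball x (e / 2))" using F dj by (intro sum_emeasure) (auto simp: sep_def)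
    also have "\<dots> \<le> emeasure M (ball x0 (R + e))"
    proof (rule emeasure_mono)
      show "(\<Union>x\<in>F. ball x (e / 2)) \<subseteq> ball x0 (R + e)"
        using F e by (intro UN_least subset_ball_dist) (auto simp: sep_def)
    qed simp
    finally have "real (card F) * (V x0 (R + e) / C) \<le> V x0 (R + e)"
      by (simp add: emeasure_ball)
    then have "V x0 (R + e) * real (card F) \<le> V x0 (R + e) * C" using C(1) by (simp add: field_simps)
    then show ?thesis using V_pos[of "R + e" x0] e R by (simp add: mult_le_cancel_left_pos)
  qed
  define P where "P = (\<lambda>n. \<exists>F. sep F \<and> card F = n)"
  have "P 0" unfolding P_def by (auto intro!: exI[of _ "{}"] simp: sep_def)
  moreover have "n \<le> nat \<lceil>C\<rceil>" if n: "P n" for n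
  proof -
    obtain F where "sep F" "card F = n" using n by (auto simp: P_def)
    then have "real n \<le> C" using bnd by auto
    then show ?thesis by linarith
  qed
  ultimately have "P (Greatest P)" and gr: "\<And>n. P n \<Longrightarrow> n \<le> Greatest P"
    by (auto intro: GreatestI_nat Greatest_le_nat)
  then obtain F where F: "sep F" "card F = Greatest P" by (auto simp: P_def)
  have "\<exists>d\<in>F. dist x d < e" if x: "x \<in> ball x0 R" for x
  proof (rule ccontr)
    assume *: "\<not> ?thesis"
    then have xF: "x \<notin> F" using e by auto
    have "sep (insert x F)" using F(1) x * by (auto simp: sep_def dist_commute not_less)
    then have "P (card (insert x F))" unfolding P_def by blast
    then have "card (insert x F) \<le> Greatest P" by (rule gr)
    moreover have "finite F" using F(1) by (simp add: sep_def)
    ultimately show False using F(2) xF by simp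
  qed
  then show ?thesis using F(1) by (auto simp: sep_def)
qed

lemma countable_dense: "\<exists>Q :: 'a set. countable Q \<and> (\<forall>x. \<forall>e>0. \<exists>d\<in>Q. dist x d < e)"
proof -
  define x0 :: 'a where "x0 = undefined"
  have "\<forall>k::nat. \<forall>n::nat. \<exists>F. finite F \<and> (\<forall>x\<in>ball x0 (real (Suc n)). \<exists>d\<in>F. dist x d < 1 / real (Suc k))"
    by (intro allI finite_net) auto
  then obtain F where F: "\<And>k n::nat. finite (F k n)" "\<And>k n x. x \<in> ball x0 (real (Suc n)) \<Longrightarrow> \<exists>d\<in>F k n. dist x d < 1 / real (Suc k)"
    by metis
  show ?thesis
  proof (intro exI[of _ "\<Union>k n. F k n"] conjI allI impI)
    show "countable (\<Union>k n. F k n)" by (intro countable_UN) (auto intro: countable_finite[OF F(1)])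
    fix x :: 'a and e :: real assume "0 < e"
    then obtain k where k: "1 / real (Suc k) < e" using nat_approx_posE by blast
    obtain n :: nat where "dist x0 x < real n" using reals_Archimedean2 by blast
    then have "x \<in> ball x0 (real (Suc n))" by simp
    from F(2)[OF this, of k] obtain d where "d \<in> F k n" "dist x d < 1 / real (Suc k)" by blast
    then show "\<exists>d\<in>(\<Union>k n. F k n). dist x d < e" using k by (auto intro: less_trans)
  qed
qed

text \<open>Doubling makes the space separable, so a sublevel set of the distance is a countable
  union of products of balls, with a common centre in a dense set and radii s and r - s for rational
  s.\<close>

lemma measurable_dist_pair: "(\<lambda>z. dist (fst z) (snd z)) \<in> borel_measurable (M \<Otimes>\<^sub>M M)"
proof (rule borel_measurableI_less)
  fix r :: real
  obtain Q :: "'a set" where Q: "countable Q" "\<And>x e. 0 < e \<Longrightarrow> \<exists>d\<in>Q. dist x d < e"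
    using countable_dense by blast
  have "{z \<in> space (M \<Otimes>\<^sub>M M). dist (fst z) (snd z) < r} = (\<Union>q\<in>Q. \<Union>s\<in>\<rat>. ball q s \<times> ball q (r - s))"
  proof (intro equalityI subsetI)
    fix z assume "z \<in> {z \<in> space (M \<Otimes>\<^sub>M M). dist (fst z) (snd z) < r}"
    then have z: "dist (fst z) (snd z) < r" by simp
    define d where "d = (r - dist (fst z) (snd z)) / 3"
    have d: "0 < d" using z by (simp add: d_def)
    obtain q where q: "q \<in> Q" "dist (fst z) q < d" using Q(2)[OF d] by blast
    obtain s where s: "s \<in> \<rat>" "d < s" "s < 2 * d" using Rats_dense_in_real[of d "2 * d"] d by auto
    have "dist q (snd z) \<le> dist (fst z) q + dist (fst z) (snd z)" by (metis dist_triangle dist_commute)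
    also have "\<dots> < d + dist (fst z) (snd z)" using q by simp
    also have "\<dots> = r - 2 * d" by (simp add: d_def field_simps)
    finally have "snd z \<in> ball q (r - s)" using s by simp
    moreover have "fst z \<in> ball q s" using q s by (simp add: dist_commute)
    ultimately show "z \<in> (\<Union>q\<in>Q. \<Union>s\<in>\<rat>. ball q s \<times> ball q (r - s))"
      using q s by (intro UN_I[of q] UN_I[of s]) (auto simp: mem_Times_iff)
  next
    fix z assume "z \<in> (\<Union>q\<in>Q. \<Union>s\<in>\<rat>. ball q s \<times> ball q (r - s))"
    then obtain q s where "fst z \<in> ball q s" "snd z \<in> ball q (r - s)" by auto
    then have "dist (fst z) (snd z) < r" using dist_triangle[of "fst z" "snd z" q] by (simp add: dist_commute)
    then show "z \<in> {z \<in> space (M \<Otimes>\<^sub>M M). dist (fst z) (snd z) < r}" by (simp add: space_pair_measure)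
  qed
  also have "\<dots> \<in> sets (M \<Otimes>\<^sub>M M)"
    by (intro sets.countable_UN''[OF Q(1)] sets.countable_UN''[OF countable_rat] pair_measureI) auto
  finally show "{z \<in> space (M \<Otimes>\<^sub>M M). dist (fst z) (snd z) < r} \<in> sets (M \<Otimes>\<^sub>M M)" .
qed

lemma measurable_dist [measurable (raw)]:
  assumes "f \<in> measurable N M" "g \<in> measurable N M"
  shows "(\<lambda>z. dist (f z) (g z)) \<in> borel_measurable N"
  using measurable_compose[OF measurable_Pair[OF assms] measurable_dist_pair] by simp

lemma measurable_in_ball [measurable (raw)]:
  assumes [measurable]: "f \<in> measurable N M" "r \<in> borel_measurable N" "g \<in> measurable N M"
  shows "Measurable.pred N (\<lambda>z. g z \<in> ball (f z) (r z))"
  unfolding mem_ball by measurable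

lemma measurable_V [measurable (raw)]:
  assumes [measurable]: "f \<in> measurable N M" "r \<in> borel_measurable N"
  shows "(\<lambda>z. V (f z) (r z)) \<in> borel_measurable N"
proof -
  have "emeasure M (ball (f z) (r z)) = (\<integral>\<^sup>+y. indicator {y. dist (f z) y < r z} y \<partial>M)" for z
    by (subst nn_integral_indicator) (auto simp: ball_def)
  moreover have "(\<lambda>z. \<integral>\<^sup>+y. indicator {y. dist (f z) y < r z} y \<partial>M) \<in> borel_measurable N"
    by (rule borel_measurable_nn_integral) (simp add: indicator_def, measurable)
  ultimately show ?thesis unfolding measure_def by simp
qed

lemma measurable_average:
  assumes [measurable]: "f \<in> measurable N M" "r \<in> borel_measurable N" "case_prod F \<in> borel_measurable (N \<Otimes>\<^sub>M M)"
  shows "(\<lambda>z. average M (ball (f z) (r z)) (F z)) \<in> borel_measurable N"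
proof -
  have "(\<lambda>z. LINT y|M. (if y \<in> ball (f z) (r z) then F z y else 0)) \<in> borel_measurable N"
    by (rule borel_measurable_lebesgue_integral) measurable
  also have "(\<lambda>z. LINT y|M. (if y \<in> ball (f z) (r z) then F z y else 0)) = (\<lambda>z. LINT y:ball (f z) (r z)|M. F z y)"
    unfolding set_lebesgue_integral_def by (intro ext Bochner_Integration.integral_cong) (auto simp: indicator_def)
  finally show ?thesis unfolding average_def by measurable
qed

lemma measurable_mean_osc [measurable (raw)]:
  assumes [measurable]: "f \<in> measurable N M" "r \<in> borel_measurable N" and F [measurable]: "F \<in> borel_measurable M"
  shows "(\<lambda>z. mean_osc M F (f z) (r z)) \<in> borel_measurable N"
proof -
  have [measurable]: "(\<lambda>z. average M (ball (f z) (r z)) F) \<in> borel_measurable N"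
    by (rule measurable_average) measurable
  show ?thesis unfolding mean_osc_def by (rule measurable_average) measurable
qed

section \<open>Averages and oscillations over balls\<close>

lemma L1_locD:
  assumes "f \<in> L1_loc M"
  shows "f \<in> borel_measurable M" "set_integrable M (ball x r) f"
proof -
  show "f \<in> borel_measurable M" using assms by (simp add: L1_loc_def)
  show "set_integrable M (ball x r) f"
    using assms by (cases "0 < r") (auto simp: L1_loc_def set_integrable_def not_less ball_empty)
qed

lemma integrable_const_ball: "set_integrable M (ball x r) (\<lambda>_. c::real)"
  unfolding set_integrable_def using emeasure_ball_finite[of x r] by (simp add: integrable_mult_left_iff integrable_indicator_iff)

lemma integral_ball_const: "(LINT y:ball x r|M. c::real) = V x r * c"
  unfolding set_lebesgue_integral_def by simp

text \<open>Multiplying by the volume avoids a quotient of extended reals. The constant c is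
  arbitrary, so the bound also compares averages over different balls.\<close>

lemma average_diff_le:
  assumes f: "f \<in> L1_loc M" and r: "0 < r"
  shows "ennreal \<bar>average M (ball x r) f - c\<bar> * ennreal (V x r) \<le> (\<integral>\<^sup>+y\<in>ball x r. ennreal \<bar>f y - c\<bar> \<partial>M)"
proof -
  note fm [measurable] = L1_locD(1)[OF f]
  have i: "set_integrable M (ball x r) (\<lambda>y. f y - c)"
    by (intro set_integral_diff(1) L1_locD(2)[OF f] integrable_const_ball)
  have "(LINT y:ball x r|M. f y - c) = (LINT y:ball x r|M. f y) - V x r * c"
    using set_integral_diff(2)[OF L1_locD(2)[OF f] integrable_const_ball] by (simp add: integral_ball_const)
  also have "\<dots> = (average M (ball x r) f - c) * V x r"
    using V_pos[OF r, of x] by (simp add: average_def field_simps)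
  finally have "\<bar>average M (ball x r) f - c\<bar> * V x r = \<bar>LINT y:ball x r|M. f y - c\<bar>"
    using V_pos[OF r, of x] by (simp add: abs_mult)
  also have "\<dots> \<le> (LINT y|M. \<bar>indicator (ball x r) y * (f y - c)\<bar>)"
    unfolding set_lebesgue_integral_def using integral_abs_bound[of M "\<lambda>y. indicator (ball x r) y *\<^sub>R (f y - c)"] by simp
  finally have "ennreal (\<bar>average M (ball x r) f - c\<bar> * V x r) \<le> (\<integral>\<^sup>+y. ennreal \<bar>indicator (ball x r) y * (f y - c)\<bar> \<partial>M)"
    using i unfolding set_integrable_def
    by (intro order_trans[OF ennreal_leI ennreal_integral_le_nn_integral]) auto
  also have "\<dots> = (\<integral>\<^sup>+y\<in>ball x r. ennreal \<bar>f y - c\<bar> \<partial>M)"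
    by (rule nn_integral_cong) (auto simp: indicator_def)
  finally show ?thesis by (simp add: ennreal_mult)
qed

lemma mean_osc_nn_integral:
  assumes f: "f \<in> L1_loc M" and r: "0 < r"
  shows "ennreal (mean_osc M f x r) * ennreal (V x r) = (\<integral>\<^sup>+y\<in>ball x r. ennreal \<bar>f y - average M (ball x r) f\<bar> \<partial>M)"
    and "0 \<le> mean_osc M f x r"
proof -
  define c where "c = average M (ball x r) f"
  note fm [measurable] = L1_locD(1)[OF f]
  have "set_integrable M (ball x r) (\<lambda>y. f y - c)"
    by (intro set_integral_diff(1) L1_locD(2)[OF f] integrable_const_ball)
  then have i: "integrable M (\<lambda>y. indicator (ball x r) y * \<bar>f y - c\<bar>)"
    using set_integrable_abs[of M "ball x r" "\<lambda>y. f y - c"] by (simp add: set_integrable_def)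
  have m: "mean_osc M f x r * V x r = (LINT y|M. indicator (ball x r) y * \<bar>f y - c\<bar>)"
    using V_pos[OF r, of x] unfolding mean_osc_def average_def[of M "ball x r" "\<lambda>y. \<bar>f y - average M (ball x r) f\<bar>"] c_def
    by (simp add: set_lebesgue_integral_def)
  have "0 \<le> (LINT y|M. indicator (ball x r) y * \<bar>f y - c\<bar>)"
    by (rule Bochner_Integration.integral_nonneg) auto
  then show nn: "0 \<le> mean_osc M f x r"
    unfolding m[symmetric] using V_pos[OF r, of x] by (simp add: zero_le_mult_iff)
  have "ennreal (mean_osc M f x r) * ennreal (V x r) = ennreal (mean_osc M f x r * V x r)"
    using nn by (simp add: ennreal_mult)
  also have "\<dots> = (\<integral>\<^sup>+y. ennreal (indicator (ball x r) y * \<bar>f y - c\<bar>) \<partial>M)"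
    unfolding m using i by (intro nn_integral_eq_integral[symmetric]) auto
  also have "\<dots> = (\<integral>\<^sup>+y\<in>ball x r. ennreal \<bar>f y - c\<bar> \<partial>M)"
    by (rule nn_integral_cong) (auto simp: indicator_def)
  finally show "ennreal (mean_osc M f x r) * ennreal (V x r) = (\<integral>\<^sup>+y\<in>ball x r. ennreal \<bar>f y - average M (ball x r) f\<bar> \<partial>M)"
    by (simp add: c_def)
qed

end

section \<open>Weak type estimates for gauges\<close>

text \<open>Besides measurability and positivity, the upper bound uses only
  \<open>gauge_layer\<close> about \<phi>. Once Tonelli's theorem has fixed z, the kernel
  V(x,y)^(-2) is integrated over the pairs whose ball contains z and whose \<phi> lies in a layer of
  ratio \<theta>; the integral is bounded independently of the layer.\<close>

locale gauge = doubling_space M D for M :: "'a::metric_space measure" and D :: real +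
  fixes \<phi> :: "'a \<Rightarrow> 'a \<Rightarrow> real"
  assumes gauge_measurable: "(\<lambda>z. \<phi> (fst z) (snd z)) \<in> borel_measurable (M \<Otimes>\<^sub>M M)"
    and gauge_pos: "x \<noteq> y \<Longrightarrow> 0 < \<phi> x y"
    and gauge_layer: "\<exists>C\<ge>0. \<forall>u>0. \<forall>z. (\<integral>\<^sup>+x. (\<integral>\<^sup>+y. (if dist x z < dist x y \<and> u \<le> \<phi> x y \<and> \<phi> x y \<le> \<theta> * u
        then ennreal (1 / (vol M x y)\<^sup>2) else 0) \<partial>M) \<partial>M) \<le> ennreal C"
begin

lemma measurable_gauge [measurable (raw)]:
  assumes "f \<in> measurable N M" "g \<in> measurable N M"
  shows "(\<lambda>z. \<phi> (f z) (g z)) \<in> borel_measurable N"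
  using measurable_compose[OF measurable_Pair[OF assms] gauge_measurable] by simp

end

context doubling_space begin

lemma measurable_vol [measurable (raw)]:
  assumes [measurable]: "f \<in> measurable N M" "g \<in> measurable N M"
  shows "(\<lambda>z. vol M (f z) (g z)) \<in> borel_measurable N"
  unfolding vol_def by measurable

lemma vol_pos: "x \<noteq> y \<Longrightarrow> 0 < vol M x y"
  unfolding vol_def by (rule V_pos) simp

section \<open>The distance and the volume as gauges\<close>

text \<open>Continuity from below: rational radii make the union countable, and running maxima make
  it increasing. The radii may be unbounded, in which case the union is the whole space.\<close>

lemma emeasure_Union_balls_le:
  assumes s: "0 \<le> s"
  shows "emeasure M (\<Union>r\<in>{r. 0 < r \<and> V z r \<le> s}. ball z r) \<le> ennreal s"
proof -
  define A where "A = {r. 0 < r \<and> V z r \<le> s}"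
  define B where "B = A \<inter> \<rat>"
  have down: "q \<in> A" if "r \<in> A" "0 < q" "q \<le> r" for q r
    using that V_mono[of z q z r] by (auto simp: A_def subset_ball)
  have eq: "(\<Union>r\<in>A. ball z r) = (\<Union>r\<in>B. ball z r)"
  proof (intro equalityI subsetI)
    fix y assume "y \<in> (\<Union>r\<in>A. ball z r)"
    then obtain r where r: "r \<in> A" "dist z y < r" by auto
    then obtain q where q: "q \<in> \<rat>" "dist z y < q" "q < r" using Rats_dense_in_real by blast
    have "0 < q" using q(2) zero_le_dist[of z y] by linarith
    then have "q \<in> B" using down[OF r(1), of q] q by (simp add: B_def)
    then show "y \<in> (\<Union>r\<in>B. ball z r)" using q by auto
  qed (auto simp: B_def)
  show ?thesis
  proof (cases "B = {}")
    case True
    then have e: "(\<Union>r\<in>A. ball z r) = {}" using eq by simp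
    show ?thesis unfolding A_def[symmetric] e by simp
  next
    case False
    have cB: "countable B" unfolding B_def by (intro countable_Int2 countable_rat)
    define q where "q = from_nat_into B"
    have qB: "range q = B" unfolding q_def by (rule range_from_nat_into[OF False cB])
    define R where "R = (\<lambda>n. Max (q ` {..n}))"
    have RA: "R n \<in> A" for n
    proof -
      have "R n \<in> q ` {..n}" unfolding R_def by (rule Max_in) auto
      then show ?thesis using qB by (auto simp: B_def)
    qed
    have "incseq R" unfolding R_def by (intro incseq_SucI Max_mono) auto
    then have inc: "incseq (\<lambda>n. ball z (R n))" by (auto simp: incseq_def intro!: subset_ball)
    have "(\<Union>r\<in>B. ball z r) \<subseteq> (\<Union>n. ball z (R n))"
    proof (rule UN_least)
      fix r assume "r \<in> B"
      then obtain n where "r = q n" using qB by auto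
      then have "r \<le> R n" unfolding R_def by (intro Max_ge) auto
      then show "ball z r \<subseteq> (\<Union>n. ball z (R n))" using subset_ball by blast
    qed
    then have "emeasure M (\<Union>r\<in>A. ball z r) \<le> emeasure M (\<Union>n. ball z (R n))"
      unfolding eq by (intro emeasure_mono) auto
    also have "\<dots> = (SUP n. emeasure M (ball z (R n)))"
      using inc by (intro SUP_emeasure_incseq[symmetric]) auto
    also have "\<dots> \<le> ennreal s"
    proof (rule SUP_least)
      fix n show "emeasure M (ball z (R n)) \<le> ennreal s"
        using RA[of n] by (simp add: emeasure_ball A_def ennreal_leI)
    qed
    finally show ?thesis by (simp add: A_def)
  qed
qed

lemma open_Union_balls: "(\<Union>r\<in>{r. 0 < r \<and> V z r \<le> s}. ball z r) \<in> sets M"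
proof -
  have "open (\<Union>r\<in>{r. 0 < r \<and> V z r \<le> s}. ball z r)" by blast
  then show ?thesis by simp
qed

text \<open>With \<rho> between u and \<theta> u the inner integral is at most V(x,Ku) / V(x,u)^2,
  hence at most a multiple of 1 / V(z,Ku); as x is confined to B(z,Ku), this volume cancels.\<close>

lemma gauge_dist: "gauge M D dist"
proof unfold_locales
  show "(\<lambda>z. dist (fst z) (snd z)) \<in> borel_measurable (M \<Otimes>\<^sub>M M)" by (rule measurable_dist_pair)
  fix \<theta> :: real
  \<comment> \<open>The factor 2 makes K exceed \<theta> strictly, because points at distance up to
    \<theta> u have to lie in an open ball of radius K u.\<close>
  define K where "K = 2 * max 1 \<theta>"
  have K: "1 \<le> K" "\<theta> < K" by (auto simp: K_def)
  obtain C1 where C1: "1 \<le> C1" "\<And>x y r s. 0 < r \<Longrightarrow> ball y s \<subseteq> ball x (K * r) \<Longrightarrow> V y s \<le> C1 * V x r"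
    using V_scale[of K] by blast
  obtain C2 where C2: "1 \<le> C2" "\<And>x y r s. 0 < r \<Longrightarrow> ball y s \<subseteq> ball x (2 * K * r) \<Longrightarrow> V y s \<le> C2 * V x r"
    using V_scale[of "2 * K"] by blast
  have bound: "(\<integral>\<^sup>+x. (\<integral>\<^sup>+y. (if dist x z < dist x y \<and> u \<le> dist x y \<and> dist x y \<le> \<theta> * u
        then ennreal (1 / (vol M x y)\<^sup>2) else 0) \<partial>M) \<partial>M) \<le> ennreal (C1 * C2)" if u: "0 < u" for u z
  proof -
    have V0: "0 < V z (K * u)" using K u by (intro V_pos) auto
    have inner: "(\<integral>\<^sup>+y. (if dist x z < dist x y \<and> u \<le> dist x y \<and> dist x y \<le> \<theta> * u
        then ennreal (1 / (vol M x y)\<^sup>2) else 0) \<partial>M) \<le> ennreal (C1 * C2 / V z (K * u)) * indicator (ball z (K * u)) x" for x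
    proof (cases "dist x z < K * u")
      case True
      have Vx: "0 < V x u" using V_pos[OF u] .
      have "V z (K * u) \<le> C2 * V x u"
        using True u by (intro C2(2) subset_ball_dist) auto
      then have Vz: "1 / V x u \<le> C2 / V z (K * u)" using Vx V0 by (simp add: field_simps)
      have "(\<integral>\<^sup>+y. (if dist x z < dist x y \<and> u \<le> dist x y \<and> dist x y \<le> \<theta> * u
        then ennreal (1 / (vol M x y)\<^sup>2) else 0) \<partial>M) \<le> (\<integral>\<^sup>+y. ennreal (1 / (V x u)\<^sup>2) * indicator (ball x (K * u)) y \<partial>M)"
      proof (rule nn_integral_mono)
        fix y
        show "(if dist x z < dist x y \<and> u \<le> dist x y \<and> dist x y \<le> \<theta> * u
          then ennreal (1 / (vol M x y)\<^sup>2) else 0) \<le> ennreal (1 / (V x u)\<^sup>2) * indicator (ball x (K * u)) y"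
        proof (cases "u \<le> dist x y \<and> dist x y \<le> \<theta> * u")
          case True
          then have "dist x y < K * u" using K u by (meson le_less_trans mult_strict_right_mono)
          moreover have "V x u \<le> vol M x y" unfolding vol_def using True by (intro V_mono subset_ball) auto
          then have "1 / (vol M x y)\<^sup>2 \<le> 1 / (V x u)\<^sup>2" using Vx by (intro divide_left_mono power_mono) auto
          ultimately show ?thesis by (auto intro: ennreal_leI)
        qed auto
      qed
      also have "\<dots> = ennreal (1 / (V x u)\<^sup>2) * ennreal (V x (K * u))"
        by (simp add: nn_integral_cmult_indicator emeasure_ball)
      also have "\<dots> = ennreal (V x (K * u) / (V x u)\<^sup>2)" by (simp add: ennreal_mult[symmetric])
      also have "V x (K * u) / (V x u)\<^sup>2 \<le> C1 * V x u / (V x u)\<^sup>2"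
        using C1(2)[OF u, of x "K * u" x] by (intro divide_right_mono) auto
      also have "\<dots> = C1 * (1 / V x u)" using Vx by (simp add: power2_eq_square)
      also have "\<dots> \<le> C1 * (C2 / V z (K * u))" using Vz C1(1) by (intro mult_left_mono) auto
      finally show ?thesis using True by (simp add: dist_commute ennreal_leI)
    next
      case False
      have none: "\<not> (dist x z < dist x y \<and> u \<le> dist x y \<and> dist x y \<le> \<theta> * u)" for y
      proof
        assume *: "dist x z < dist x y \<and> u \<le> dist x y \<and> dist x y \<le> \<theta> * u"
        have "\<theta> * u \<le> K * u" using K u by (intro mult_right_mono) auto
        then show False using * False by linarith
      qed
      show ?thesis unfolding if_not_P[OF none] by simp
    qed
    have "(\<integral>\<^sup>+x. (\<integral>\<^sup>+y. (if dist x z < dist x y \<and> u \<le> dist x y \<and> dist x y \<le> \<theta> * u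
        then ennreal (1 / (vol M x y)\<^sup>2) else 0) \<partial>M) \<partial>M) \<le> (\<integral>\<^sup>+x. ennreal (C1 * C2 / V z (K * u)) * indicator (ball z (K * u)) x \<partial>M)"
      by (rule nn_integral_mono) (rule inner)
    also have "\<dots> = ennreal (C1 * C2 / V z (K * u)) * ennreal (V z (K * u))"
      by (simp add: nn_integral_cmult_indicator emeasure_ball)
    also have "\<dots> = ennreal (C1 * C2)" using V0 C1 C2 by (simp add: ennreal_mult[symmetric])
    finally show ?thesis .
  qed
  then show "\<exists>C\<ge>0. \<forall>u>0. \<forall>z. (\<integral>\<^sup>+x. (\<integral>\<^sup>+y. (if dist x z < dist x y \<and> u \<le> dist x y \<and> dist x y \<le> \<theta> * u
        then ennreal (1 / (vol M x y)\<^sup>2) else 0) \<partial>M) \<partial>M) \<le> ennreal C"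
    using C1(1) C2(1) by (intro exI[of _ "C1 * C2"]) auto
qed auto

text \<open>In the layer, y belongs to a union of balls about x, and x to a union of balls about z,
  each of measure at most K u. Together they contribute (K u)^2, against the kernel bound
  u^(-2).\<close>

lemma gauge_vol: "gauge M D (vol M)"
proof unfold_locales
  show "(\<lambda>z. vol M (fst z) (snd z)) \<in> borel_measurable (M \<Otimes>\<^sub>M M)" by measurable
  show "0 < vol M x y" if "x \<noteq> y" for x y using that by (rule vol_pos)
  fix \<theta> :: real
  define S where "S = (\<lambda>z s. \<Union>r\<in>{r. 0 < r \<and> V z r \<le> s}. ball z r)"
  \<comment> \<open>D pays for doubling the radius: the ball about x of radius 2 \<rho>(x,y)
    contains y and, as \<rho>(x,z) < \<rho>(x,y), also the ball about z of radius
    \<rho>(x,y).\<close>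
  define K where "K = D * max 1 \<theta>"
  have K: "1 \<le> K" "0 \<le> K" unfolding K_def using D_ge_1 mult_mono[of 1 D 1 "max 1 \<theta>"] by auto
  have S: "S z s \<in> sets M" "0 \<le> s \<Longrightarrow> emeasure M (S z s) \<le> ennreal s" for z s
    unfolding S_def by (rule open_Union_balls, rule emeasure_Union_balls_le)
  have V2: "V x (2 * dist x y) \<le> K * u" if "x \<noteq> y" "vol M x y \<le> \<theta> * u" "0 < u" for x y u
  proof -
    have "V x (2 * dist x y) \<le> D * vol M x y" unfolding vol_def using that by (intro doubling_ball) auto
    also have "\<dots> \<le> D * (max 1 \<theta> * u)" using D_pos that by (intro mult_left_mono order_trans[OF that(2)] mult_right_mono) auto
    finally show ?thesis by (simp add: K_def mult.assoc)
  qed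
  have bound: "(\<integral>\<^sup>+x. (\<integral>\<^sup>+y. (if dist x z < dist x y \<and> u \<le> vol M x y \<and> vol M x y \<le> \<theta> * u
        then ennreal (1 / (vol M x y)\<^sup>2) else 0) \<partial>M) \<partial>M) \<le> ennreal (K * K)" if u: "0 < u" for u z
  proof -
    have Ku: "0 \<le> K * u" using K u by simp
    have inner: "(\<integral>\<^sup>+y. (if dist x z < dist x y \<and> u \<le> vol M x y \<and> vol M x y \<le> \<theta> * u
        then ennreal (1 / (vol M x y)\<^sup>2) else 0) \<partial>M) \<le> ennreal (K / u) * indicator (S z (K * u)) x" for x
    proof (cases "x \<in> S z (K * u)")
      case True
      have "(\<integral>\<^sup>+y. (if dist x z < dist x y \<and> u \<le> vol M x y \<and> vol M x y \<le> \<theta> * u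
        then ennreal (1 / (vol M x y)\<^sup>2) else 0) \<partial>M) \<le> (\<integral>\<^sup>+y. ennreal (1 / u\<^sup>2) * indicator (S x (K * u)) y \<partial>M)"
      proof (rule nn_integral_mono)
        fix y
        show "(if dist x z < dist x y \<and> u \<le> vol M x y \<and> vol M x y \<le> \<theta> * u
          then ennreal (1 / (vol M x y)\<^sup>2) else 0) \<le> ennreal (1 / u\<^sup>2) * indicator (S x (K * u)) y"
        proof (cases "dist x z < dist x y \<and> u \<le> vol M x y \<and> vol M x y \<le> \<theta> * u")
          case True
          then have ne: "x \<noteq> y" by auto
          then have "y \<in> S x (K * u)" unfolding S_def using V2[OF ne _ u] True
            by (intro UN_I[of "2 * dist x y"]) auto
          moreover have "1 / (vol M x y)\<^sup>2 \<le> 1 / u\<^sup>2" using True u by (intro divide_left_mono power_mono) auto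
          ultimately show ?thesis using True by (auto intro: ennreal_leI)
        qed auto
      qed
      also have "\<dots> = ennreal (1 / u\<^sup>2) * emeasure M (S x (K * u))" using S(1) by (simp add: nn_integral_cmult_indicator)
      also have "\<dots> \<le> ennreal (1 / u\<^sup>2) * ennreal (K * u)" by (intro mult_left_mono S(2) Ku) auto
      also have "\<dots> = ennreal (K / u)" using u K by (simp add: ennreal_mult[symmetric] power2_eq_square)
      finally show ?thesis using True by simp
    next
      case False
      have none: "\<not> (dist x z < dist x y \<and> u \<le> vol M x y \<and> vol M x y \<le> \<theta> * u)" for y
      proof
        assume *: "dist x z < dist x y \<and> u \<le> vol M x y \<and> vol M x y \<le> \<theta> * u"
        then have ne: "x \<noteq> y" by auto
        have "V z (dist x y) \<le> V x (2 * dist x y)" using * by (intro V_mono subset_ball_dist) auto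
        also have "\<dots> \<le> K * u" using V2[OF ne _ u] * by auto
        finally have "x \<in> S z (K * u)" unfolding S_def using * ne
          by (intro UN_I[of "dist x y"]) (auto simp: dist_commute)
        then show False using False by simp
      qed
      show ?thesis unfolding if_not_P[OF none] by simp
    qed
    have "(\<integral>\<^sup>+x. (\<integral>\<^sup>+y. (if dist x z < dist x y \<and> u \<le> vol M x y \<and> vol M x y \<le> \<theta> * u
        then ennreal (1 / (vol M x y)\<^sup>2) else 0) \<partial>M) \<partial>M) \<le> (\<integral>\<^sup>+x. ennreal (K / u) * indicator (S z (K * u)) x \<partial>M)"
      by (rule nn_integral_mono) (rule inner)
    also have "\<dots> = ennreal (K / u) * emeasure M (S z (K * u))" using S(1) by (simp add: nn_integral_cmult_indicator)
    also have "\<dots> \<le> ennreal (K / u) * ennreal (K * u)" by (intro mult_left_mono S(2) Ku) auto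
    also have "\<dots> = ennreal (K * K)" using u K by (simp add: ennreal_mult[symmetric])
    finally show ?thesis .
  qed
  then show "\<exists>C\<ge>0. \<forall>u>0. \<forall>z. (\<integral>\<^sup>+x. (\<integral>\<^sup>+y. (if dist x z < dist x y \<and> u \<le> vol M x y \<and> vol M x y \<le> \<theta> * u
        then ennreal (1 / (vol M x y)\<^sup>2) else 0) \<partial>M) \<partial>M) \<le> ennreal C"
    using K by (intro exI[of _ "K * K"]) auto
qed

section \<open>From Hajlasz gradients to the weak norm\<close>

text \<open>Points of the ball are closer than 2 r to each other. Integrating 2 r (h(y) + h(z)) over
  both points gives 4 r times the integral of h times the volume, and the volume, being positive and
  finite, is cancelled.\<close>

lemma mean_osc_le_Hajlasz:
  assumes f: "f \<in> L1_loc M" and h: "Hajlasz_gradient M f h" and r: "0 < r"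
  shows "ennreal (mean_osc M f x r) * ennreal (V x r) \<le> ennreal (4 * r) * (\<integral>\<^sup>+y\<in>ball x r. h y \<partial>M)"
proof -
  note fm [measurable] = L1_locD(1)[OF f]
  have hm [measurable]: "h \<in> borel_measurable M" using h by (simp add: Hajlasz_gradient_def)
  obtain N where N: "N \<in> null_sets M" "\<And>x y. x \<notin> N \<Longrightarrow> y \<notin> N \<Longrightarrow> ennreal \<bar>f x - f y\<bar> \<le> ennreal (dist x y) * (h x + h y)"
    using h by (auto simp: Hajlasz_gradient_def)
  have AEN: "AE y in M. y \<notin> N" using N(1) by (rule AE_not_in)
  define a where "a = average M (ball x r) f"
  define I where "I = (\<integral>\<^sup>+y\<in>ball x r. h y \<partial>M)"
  define v where "v = ennreal (V x r)"
  have v: "v \<noteq> 0" "v \<noteq> \<top>" using V_pos[OF r, of x] by (auto simp: v_def)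
  have pt: "ennreal \<bar>f y - a\<bar> * v \<le> ennreal (2 * r) * (h y * v + I)" if y: "y \<in> ball x r" "y \<notin> N" for y
  proof -
    have "ennreal \<bar>f y - a\<bar> * v \<le> (\<integral>\<^sup>+z\<in>ball x r. ennreal \<bar>f z - f y\<bar> \<partial>M)"
      using average_diff_le[OF f r, of x "f y"] by (simp add: a_def v_def abs_minus_commute)
    also have "\<dots> \<le> (\<integral>\<^sup>+z. ennreal (2 * r) * (h y * indicator (ball x r) z + h z * indicator (ball x r) z) \<partial>M)"
      using AEN
    proof (intro nn_integral_mono_AE, eventually_elim)
      case (elim z)
      show ?case
      proof (cases "z \<in> ball x r")
        case True
        have "dist z y \<le> 2 * r" using True y dist_triangle[of z y x] by (simp add: dist_commute)
        then have "ennreal (dist z y) * (h z + h y) \<le> ennreal (2 * r) * (h z + h y)"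
          by (intro mult_right_mono ennreal_leI) auto
        then show ?thesis using N(2)[OF elim(2) y(2)] True by (simp add: add.commute)
      qed simp
    qed
    also have "\<dots> = ennreal (2 * r) * (h y * v + I)"
      by (simp add: nn_integral_cmult nn_integral_add nn_integral_cmult_indicator v_def emeasure_ball I_def)
    finally show ?thesis .
  qed
  have "(\<integral>\<^sup>+y\<in>ball x r. ennreal \<bar>f y - a\<bar> \<partial>M) * v = (\<integral>\<^sup>+y. ennreal \<bar>f y - a\<bar> * indicator (ball x r) y * v \<partial>M)"
    by (rule nn_integral_multc[symmetric]) measurable
  also have "\<dots> \<le> (\<integral>\<^sup>+y. ennreal (2 * r) * (h y * indicator (ball x r) y * v + I * indicator (ball x r) y) \<partial>M)"
    using AEN
  proof (intro nn_integral_mono_AE, eventually_elim)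
    case (elim y)
    show ?case using pt[OF _ elim(2)] by (cases "y \<in> ball x r") auto
  qed
  also have "\<dots> = ennreal (2 * r) * (I * v + I * v)"
    by (simp add: nn_integral_cmult nn_integral_add nn_integral_multc nn_integral_cmult_indicator v_def emeasure_ball I_def)
  also have "\<dots> = (ennreal (4 * r) * I) * v"
    using r by (simp add: distrib_left distrib_right[symmetric] mult.assoc[symmetric] ennreal_plus[symmetric] del: ennreal_plus)
  finally have "(\<integral>\<^sup>+y\<in>ball x r. ennreal \<bar>f y - a\<bar> \<partial>M) * v \<le> (ennreal (4 * r) * I) * v" .
  then have "(\<integral>\<^sup>+y\<in>ball x r. ennreal \<bar>f y - a\<bar> \<partial>M) \<le> ennreal (4 * r) * I"
    using v by (simp add: ennreal_mult_le_mult_iff mult.commute[of _ v])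
  then show ?thesis using mean_osc_nn_integral(1)[OF f r, of x] by (simp add: a_def I_def)
qed

end

text \<open>The power 1 / \<gamma> turns a dyadic layer of s^\<gamma> into a layer of s with ratio
  2^(1 / |\<gamma>|). For negative \<gamma> the ends change places, so that u comes from the upper
  end \<tau>.\<close>

lemma powr_layer_ratio:
  fixes \<gamma> \<tau> :: real
  assumes \<gamma>: "\<gamma> \<noteq> 0" and \<tau>: "0 < \<tau>"
  shows "\<exists>u>0. \<forall>s>0. \<tau> / 2 \<le> s powr \<gamma> \<longrightarrow> s powr \<gamma> \<le> \<tau> \<longrightarrow> u \<le> s \<and> s \<le> 2 powr (1 / \<bar>\<gamma>\<bar>) * u"
proof -
  have s: "s = (s powr \<gamma>) powr (1 / \<gamma>)" if "0 < s" for s using that \<gamma> by (simp add: powr_powr)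
  show ?thesis
  proof (cases "0 < \<gamma>")
    case True
    have e: "\<tau> powr (1 / \<gamma>) = 2 powr (1 / \<gamma>) * (\<tau> / 2) powr (1 / \<gamma>)" using \<tau> by (simp add: powr_mult[symmetric])
    show ?thesis
    proof (intro exI[of _ "(\<tau> / 2) powr (1 / \<gamma>)"] conjI allI impI)
      fix t :: real assume t: "0 < t" "\<tau> / 2 \<le> t powr \<gamma>" "t powr \<gamma> \<le> \<tau>"
      show "(\<tau> / 2) powr (1 / \<gamma>) \<le> t" by (subst s[OF t(1)]) (use t \<tau> True in \<open>intro powr_mono2; simp\<close>)
      have "t \<le> \<tau> powr (1 / \<gamma>)" by (subst s[OF t(1)]) (use t \<tau> True in \<open>intro powr_mono2; simp\<close>)
      then show "t \<le> 2 powr (1 / \<bar>\<gamma>\<bar>) * (\<tau> / 2) powr (1 / \<gamma>)" using e True by simp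
    qed (use \<tau> in simp)
  next
    case False
    then have g: "\<gamma> < 0" using \<gamma> by simp
    have "(\<tau> / 2) powr (1 / \<gamma>) = \<tau> powr (1 / \<gamma>) * (1 / 2) powr (1 / \<gamma>)" using \<tau> by (simp add: powr_mult[symmetric])
    also have "(1 / 2) powr (1 / \<gamma>) = 2 powr (1 / \<bar>\<gamma>\<bar>)" using g by (simp add: powr_divide powr_minus_divide[symmetric])
    finally have e: "(\<tau> / 2) powr (1 / \<gamma>) = 2 powr (1 / \<bar>\<gamma>\<bar>) * \<tau> powr (1 / \<gamma>)" by simp
    have "1 / \<gamma> \<le> 0" using g by simp
    show ?thesis
    proof (intro exI[of _ "\<tau> powr (1 / \<gamma>)"] conjI allI impI)
      fix t :: real assume t: "0 < t" "\<tau> / 2 \<le> t powr \<gamma>" "t powr \<gamma> \<le> \<tau>"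
      show "\<tau> powr (1 / \<gamma>) \<le> t" by (subst s[OF t(1)]) (use t \<tau> \<open>1 / \<gamma> \<le> 0\<close> in \<open>intro powr_mono2'; simp\<close>)
      have "t \<le> (\<tau> / 2) powr (1 / \<gamma>)" by (subst s[OF t(1)]) (use t \<tau> \<open>1 / \<gamma> \<le> 0\<close> in \<open>intro powr_mono2'; simp\<close>)
      then show "t \<le> 2 powr (1 / \<bar>\<gamma>\<bar>) * \<tau> powr (1 / \<gamma>)" using e by simp
    qed (use \<tau> in simp)
  qed
qed

lemma dyadic_layer:
  fixes s T :: real
  assumes "0 < s" "s < T"
  shows "\<exists>k::nat. T * (1/2) ^ k / 2 \<le> s \<and> s \<le> T * (1/2) ^ k"
proof -
  have "\<exists>k::nat. T * (1/2) ^ k \<le> s"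
  proof -
    obtain k :: nat where "(1/2) ^ k < s / T" using real_arch_pow_inv[of "s / T" "1/2"] assms by auto
    then show ?thesis using assms by (intro exI[of _ k]) (simp add: field_simps)
  qed
  define k where "k = (LEAST k::nat. T * (1/2) ^ k \<le> s)"
  have k: "T * (1/2) ^ k \<le> s" unfolding k_def by (rule LeastI_ex) fact
  have "k \<noteq> 0" using k assms by (intro notI) simp
  then obtain j where j: "k = Suc j" by (cases k) auto
  have "\<not> T * (1/2) ^ j \<le> s" using not_less_Least[of j "\<lambda>k. T * (1/2) ^ k \<le> s"] j by (simp add: k_def)
  then show ?thesis using k j by (intro exI[of _ j]) auto
qed

context gauge begin

text \<open>The region \<phi>^\<gamma> < T is cut into layers where \<phi>^\<gamma> is about T
  2^(-k). Each contributes at most C0 (T 2^(-k))^a, a convergent geometric series because a >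
  0.\<close>

lemma gauge_superlevel:
  assumes \<gamma>: "\<gamma> \<noteq> 0" and a: "0 < a"
  shows "\<exists>C>0. \<forall>T>0. \<forall>z. (\<integral>\<^sup>+x. (\<integral>\<^sup>+y. (if dist x z < dist x y \<and> \<phi> x y powr \<gamma> < T
     then ennreal (\<phi> x y powr (\<gamma> * a) / (vol M x y)\<^sup>2) else 0) \<partial>M) \<partial>M) \<le> ennreal (C * T powr a)"
proof -
  define \<theta> where "\<theta> = (2::real) powr (1 / \<bar>\<gamma>\<bar>)"
  obtain C0 where C0: "0 \<le> C0" "\<And>u z. 0 < u \<Longrightarrow> (\<integral>\<^sup>+x. (\<integral>\<^sup>+y. (if dist x z < dist x y \<and> u \<le> \<phi> x y \<and> \<phi> x y \<le> \<theta> * u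
        then ennreal (1 / (vol M x y)\<^sup>2) else 0) \<partial>M) \<partial>M) \<le> ennreal C0"
    using gauge_layer[of \<theta>] by auto
  define \<rho> where "\<rho> = (1/2::real) powr a"
  have \<rho>: "0 < \<rho>" "\<rho> < 1" using a powr_less_mono2[of a "1/2" 1] by (auto simp: \<rho>_def)
  define C where "C = (C0 + 1) / (1 - \<rho>)"
  have "0 < C" using C0 \<rho> by (simp add: C_def)
  moreover have "(\<integral>\<^sup>+x. (\<integral>\<^sup>+y. (if dist x z < dist x y \<and> \<phi> x y powr \<gamma> < T
     then ennreal (\<phi> x y powr (\<gamma> * a) / (vol M x y)\<^sup>2) else 0) \<partial>M) \<partial>M) \<le> ennreal (C * T powr a)"
    if T: "0 < T" for T z
  proof -
    define \<tau> where "\<tau> = (\<lambda>k::nat. T * (1/2) ^ k)"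
    have \<tau>: "0 < \<tau> k" for k using T by (simp add: \<tau>_def)
    have "\<forall>k. \<exists>u>0. \<forall>s>0. \<tau> k / 2 \<le> s powr \<gamma> \<longrightarrow> s powr \<gamma> \<le> \<tau> k \<longrightarrow> u \<le> s \<and> s \<le> \<theta> * u"
      unfolding \<theta>_def using powr_layer_ratio[OF \<gamma> \<tau>] by blast
    then obtain u where u: "\<And>k. 0 < u k" "\<And>k s. 0 < s \<Longrightarrow> \<tau> k / 2 \<le> s powr \<gamma> \<Longrightarrow> s powr \<gamma> \<le> \<tau> k \<Longrightarrow> u k \<le> s \<and> s \<le> \<theta> * u k"
      by metis
    define L where "L = (\<lambda>k x y. if dist x z < dist x y \<and> u k \<le> \<phi> x y \<and> \<phi> x y \<le> \<theta> * u k then ennreal (1 / (vol M x y)\<^sup>2) else 0)"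
    have Lm [measurable]: "(\<lambda>(x, y). L k x y) \<in> borel_measurable (M \<Otimes>\<^sub>M M)" for k
      unfolding L_def split_beta by measurable
    have "(\<integral>\<^sup>+x. (\<integral>\<^sup>+y. (if dist x z < dist x y \<and> \<phi> x y powr \<gamma> < T
     then ennreal (\<phi> x y powr (\<gamma> * a) / (vol M x y)\<^sup>2) else 0) \<partial>M) \<partial>M)
       \<le> (\<integral>\<^sup>+x. (\<integral>\<^sup>+y. (\<Sum>k. ennreal (\<tau> k powr a) * L k x y) \<partial>M) \<partial>M)"
    proof (intro nn_integral_mono)
      fix x y
      show "(if dist x z < dist x y \<and> \<phi> x y powr \<gamma> < T then ennreal (\<phi> x y powr (\<gamma> * a) / (vol M x y)\<^sup>2) else 0)
        \<le> (\<Sum>k. ennreal (\<tau> k powr a) * L k x y)"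
      proof (cases "dist x z < dist x y \<and> \<phi> x y powr \<gamma> < T")
        case True
        then have ne: "x \<noteq> y" by auto
        have \<phi>: "0 < \<phi> x y" by (rule gauge_pos[OF ne])
        then obtain k where k: "\<tau> k / 2 \<le> \<phi> x y powr \<gamma>" "\<phi> x y powr \<gamma> \<le> \<tau> k"
          using dyadic_layer[of "\<phi> x y powr \<gamma>" T] True by (auto simp: \<tau>_def)
        have "\<phi> x y powr (\<gamma> * a) = (\<phi> x y powr \<gamma>) powr a" by (simp add: powr_powr)
        also have "\<dots> \<le> \<tau> k powr a" using k a by (intro powr_mono2) auto
        finally have "\<phi> x y powr (\<gamma> * a) / (vol M x y)\<^sup>2 \<le> \<tau> k powr a * (1 / (vol M x y)\<^sup>2)" by (simp add: divide_right_mono)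
        then have "ennreal (\<phi> x y powr (\<gamma> * a) / (vol M x y)\<^sup>2) \<le> ennreal (\<tau> k powr a) * L k x y"
          using True u(2)[OF \<phi> k] by (simp add: L_def ennreal_mult[symmetric] ennreal_leI)
        also have "\<dots> \<le> (\<Sum>k. ennreal (\<tau> k powr a) * L k x y)"
        proof -
          define F where "F = (\<lambda>k. ennreal (\<tau> k powr a) * L k x y)"
          have "sum F {k} \<le> suminf F" by (rule sum_le_suminf) auto
          then show ?thesis by (simp add: F_def)
        qed
        finally show ?thesis using True by simp
      next
        case False
        show ?thesis unfolding if_not_P[OF False] by simp
      qed
    qed
    also have "\<dots> = (\<integral>\<^sup>+x. (\<Sum>k. ennreal (\<tau> k powr a) * (\<integral>\<^sup>+y. L k x y \<partial>M)) \<partial>M)"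
      by (simp add: nn_integral_suminf nn_integral_cmult)
    also have "\<dots> = (\<Sum>k. ennreal (\<tau> k powr a) * (\<integral>\<^sup>+x. (\<integral>\<^sup>+y. L k x y \<partial>M) \<partial>M))"
      by (subst nn_integral_suminf) (auto simp: nn_integral_cmult)
    also have "\<dots> \<le> (\<Sum>k. ennreal (C0 * T powr a * \<rho> ^ k))"
    proof (rule suminf_le)
      fix k
      have "ennreal (\<tau> k powr a) * (\<integral>\<^sup>+x. (\<integral>\<^sup>+y. L k x y \<partial>M) \<partial>M) \<le> ennreal (\<tau> k powr a) * ennreal C0"
        unfolding L_def using C0(2)[OF u(1)] by (intro mult_left_mono) auto
      also have "\<dots> = ennreal (C0 * T powr a * \<rho> ^ k)"
      proof -
        have "((1/2::real) ^ k) powr a = \<rho> ^ k" unfolding \<rho>_def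
          by (simp add: powr_realpow[symmetric] powr_powr mult.commute)
        moreover have "0 \<le> \<rho> ^ k" using \<rho> by simp
        ultimately show ?thesis using C0(1) T by (simp add: \<tau>_def powr_mult ennreal_mult[symmetric] mult_ac)
      qed
      finally show "ennreal (\<tau> k powr a) * (\<integral>\<^sup>+x. (\<integral>\<^sup>+y. L k x y \<partial>M) \<partial>M) \<le> ennreal (C0 * T powr a * \<rho> ^ k)" .
    qed auto
    also have "\<dots> = ennreal (C0 * T powr a * (1 / (1 - \<rho>)))"
    proof (rule suminf_ennreal_eq)
      show "(\<lambda>k. C0 * T powr a * \<rho> ^ k) sums (C0 * T powr a * (1 / (1 - \<rho>)))"
        using \<rho> by (intro sums_mult geometric_sums) auto
    qed (use C0 \<rho> in auto)
    also have "\<dots> \<le> ennreal (C * T powr a)"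
    proof -
      have "C0 / (1 - \<rho>) \<le> C" unfolding C_def using \<rho> by (intro divide_right_mono) auto
      then have "C0 / (1 - \<rho>) * T powr a \<le> C * T powr a" by (rule mult_right_mono) simp
      then show ?thesis by (intro ennreal_leI) simp
    qed
    finally show ?thesis .
  qed
  ultimately show ?thesis by blast
qed

text \<open>Where the quotient exceeds l, the mean of h over the ball is at least l \<phi>^\<gamma>
  / 4, and values of h up to l \<phi>^\<gamma> / 8 account for at most half of it. For fixed z the
  surviving pairs satisfy \<phi>^\<gamma> < 8 h(z) / l, so \<open>gauge_superlevel\<close> with
  exponent p - 1 > 0 yields a multiple of h(z)^(p - 1); the remaining factor h(z) completes the p-th
  power.\<close>

lemma weak_norm_le_Hajlasz:
  assumes p: "1 < p" and \<gamma>: "\<gamma> \<noteq> 0"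
  shows "\<exists>C>0. \<forall>f\<in>L1_loc M. weak_Lp_norm M p (\<lambda>x y. \<phi> x y powr (\<gamma> * p) / vol M x y)
     (\<lambda>x y. mean_osc M f x (dist x y) / (dist x y * \<phi> x y powr \<gamma>)) \<le> ennreal C * Hajlasz_norm M p f"
proof -
  have "0 < p - 1" using p by simp
  from gauge_superlevel[OF \<gamma> this] obtain C where C: "0 < C"
    "\<And>T z. 0 < T \<Longrightarrow> (\<integral>\<^sup>+x. (\<integral>\<^sup>+y. (if dist x z < dist x y \<and> \<phi> x y powr \<gamma> < T
     then ennreal (\<phi> x y powr (\<gamma> * (p - 1)) / (vol M x y)\<^sup>2) else 0) \<partial>M) \<partial>M) \<le> ennreal (C * T powr (p - 1))"
    by blast
  define C' where "C' = C powr (1 / p) * 8"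
  have C': "0 < C'" using C(1) by (simp add: C'_def)
  have main: "ennreal l * epowr (\<integral>\<^sup>+ x. (\<integral>\<^sup>+ y. ennreal (\<phi> x y powr (\<gamma> * p) / vol M x y) *
       indicator {y. y \<noteq> x \<and> \<bar>mean_osc M f x (dist x y) / (dist x y * \<phi> x y powr \<gamma>)\<bar> > l} y \<partial>M) \<partial>M) (1 / p)
     \<le> ennreal C' * Lp_norm M p h"
    if f: "f \<in> L1_loc M" and h: "Hajlasz_gradient M f h" and l: "0 < l" for f h l
  proof -
    have hm [measurable]: "h \<in> borel_measurable M" using h by (simp add: Hajlasz_gradient_def)
    define P where "P = (\<integral>\<^sup>+x. epowr (h x) p \<partial>M)"
    \<comment> \<open>The factors are chosen so that (8 / l) \<phi>^(\<gamma> (p - 1)) / V^2 times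
      the lower bound l \<phi>^\<gamma> V / 8 is exactly the weight \<phi>^(\<gamma> p) / V.\<close>
    define W where "W = (\<lambda>x y z. if dist x z < dist x y \<and> ennreal (l * \<phi> x y powr \<gamma> / 8) < h z
       then ennreal (8 / l) * ennreal (\<phi> x y powr (\<gamma> * (p - 1)) / (vol M x y)\<^sup>2) * h z else 0)"
    have Wm [measurable]: "(\<lambda>t. W (f1 t) (f2 t) (f3 t)) \<in> borel_measurable N"
      if [measurable]: "f1 \<in> measurable N M" "f2 \<in> measurable N M" "f3 \<in> measurable N M" for f1 f2 f3 and N :: "'d measure"
      unfolding W_def by measurable
    have pt: "ennreal (\<phi> x y powr (\<gamma> * p) / vol M x y) *
       indicator {y. y \<noteq> x \<and> \<bar>mean_osc M f x (dist x y) / (dist x y * \<phi> x y powr \<gamma>)\<bar> > l} y \<le> (\<integral>\<^sup>+z. W x y z \<partial>M)" for x y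
    proof (cases "y \<noteq> x \<and> \<bar>mean_osc M f x (dist x y) / (dist x y * \<phi> x y powr \<gamma>)\<bar> > l")
      case True
      define r v \<psi> where "r = dist x y" and "v = vol M x y" and "\<psi> = \<phi> x y powr \<gamma>"
      have ne: "x \<noteq> y" using conjunct1[OF True] by (rule not_sym)
      have r: "0 < r" using ne by (simp add: r_def)
      have v: "0 < v" unfolding v_def by (rule vol_pos[OF ne])
      have \<phi>0: "0 < \<phi> x y" by (rule gauge_pos[OF ne])
      then have \<psi>: "0 < \<psi>" by (simp add: \<psi>_def)
      have vV: "V x r = v" by (simp add: v_def vol_def r_def)
      have "l * (r * \<psi>) < mean_osc M f x r"
        using True mean_osc_nn_integral(2)[OF f r, of x] r \<psi> by (simp add: r_def[symmetric] \<psi>_def[symmetric] pos_less_divide_eq)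
      then have "ennreal (l * (r * \<psi>) * v) \<le> ennreal (mean_osc M f x r * v)"
        using v by (intro ennreal_leI mult_right_mono) auto
      also have "\<dots> \<le> ennreal (4 * r) * (\<integral>\<^sup>+z\<in>ball x r. h z \<partial>M)"
        using mean_osc_le_Hajlasz[OF f h r, of x] mean_osc_nn_integral(2)[OF f r, of x] v by (simp add: vV ennreal_mult)
      finally have "ennreal (1 / (4 * r)) * ennreal (l * (r * \<psi>) * v) \<le> ennreal (1 / (4 * r)) * (ennreal (4 * r) * (\<integral>\<^sup>+z\<in>ball x r. h z \<partial>M))"
        by (rule mult_left_mono) simp
      then have low: "ennreal (l * \<psi> / 4 * v) \<le> (\<integral>\<^sup>+z\<in>ball x r. h z \<partial>M)"
        using r l \<psi> v by (simp add: mult.assoc[symmetric] ennreal_mult[symmetric])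
      have "(\<integral>\<^sup>+z\<in>ball x r. h z \<partial>M) \<le> (\<integral>\<^sup>+z. ennreal (l * \<psi> / 8) * indicator (ball x r) z +
          (if dist x z < r \<and> ennreal (l * \<psi> / 8) < h z then h z else 0) \<partial>M)"
        by (intro nn_integral_mono) (auto simp: indicator_def not_less)
      also have "\<dots> = ennreal (l * \<psi> / 8 * v) + (\<integral>\<^sup>+z. (if dist x z < r \<and> ennreal (l * \<psi> / 8) < h z then h z else 0) \<partial>M)"
        using l \<psi> v by (subst nn_integral_add) (auto simp: nn_integral_cmult_indicator emeasure_ball vV ennreal_mult[symmetric])
      finally have up: "(\<integral>\<^sup>+z\<in>ball x r. h z \<partial>M) \<le>
         ennreal (l * \<psi> / 8 * v) + (\<integral>\<^sup>+z. (if dist x z < r \<and> ennreal (l * \<psi> / 8) < h z then h z else 0) \<partial>M)" .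
      have e: "ennreal (l * \<psi> / 8 * v) + ennreal (l * \<psi> / 8 * v) = ennreal (l * \<psi> / 4 * v)"
        using l \<psi> v by (simp add: ennreal_plus[symmetric] del: ennreal_plus)
      have "ennreal (l * \<psi> / 8 * v) + ennreal (l * \<psi> / 8 * v) \<le>
         ennreal (l * \<psi> / 8 * v) + (\<integral>\<^sup>+z. (if dist x z < r \<and> ennreal (l * \<psi> / 8) < h z then h z else 0) \<partial>M)"
        unfolding e using low up by (rule order_trans)
      then have half: "ennreal (l * \<psi> / 8 * v) \<le> (\<integral>\<^sup>+z. (if dist x z < r \<and> ennreal (l * \<psi> / 8) < h z then h z else 0) \<partial>M)"
        unfolding ennreal_add_left_cancel_le by simp
      define \<kappa> where "\<kappa> = 8 / l * (\<phi> x y powr (\<gamma> * (p - 1)) / v\<^sup>2)"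
      have \<kappa>0: "0 \<le> \<kappa>" using l by (simp add: \<kappa>_def)
      have "\<phi> x y powr (\<gamma> * p) = \<phi> x y powr (\<gamma> * (p - 1)) * \<psi>"
        using \<phi>0 by (simp add: \<psi>_def powr_add[symmetric] algebra_simps)
      then have "\<phi> x y powr (\<gamma> * p) / v = \<kappa> * (l * \<psi> / 8 * v)"
        using l v by (simp add: \<kappa>_def power2_eq_square)
      then have "ennreal (\<phi> x y powr (\<gamma> * p) / v) = ennreal \<kappa> * ennreal (l * \<psi> / 8 * v)"
        using \<kappa>0 l \<psi> v by (simp add: ennreal_mult[symmetric])
      also have "\<dots> \<le> ennreal \<kappa> * (\<integral>\<^sup>+z. (if dist x z < r \<and> ennreal (l * \<psi> / 8) < h z then h z else 0) \<partial>M)"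
        using half by (rule mult_left_mono) simp
      also have "\<dots> = (\<integral>\<^sup>+z. ennreal \<kappa> * (if dist x z < r \<and> ennreal (l * \<psi> / 8) < h z then h z else 0) \<partial>M)"
        by (rule nn_integral_cmult[symmetric]) measurable
      also have "\<dots> = (\<integral>\<^sup>+z. W x y z \<partial>M)"
      proof (rule nn_integral_cong)
        fix z
        have "ennreal \<kappa> = ennreal (8 / l) * ennreal (\<phi> x y powr (\<gamma> * (p - 1)) / (vol M x y)\<^sup>2)"
          unfolding \<kappa>_def v_def using l by (intro ennreal_mult) auto
        then show "ennreal \<kappa> * (if dist x z < r \<and> ennreal (l * \<psi> / 8) < h z then h z else 0) = W x y z"
          by (simp add: W_def r_def \<psi>_def)
      qed
      finally show ?thesis using True by (simp add: v_def)
    qed simp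
    have layer: "(\<integral>\<^sup>+x. (\<integral>\<^sup>+y. W x y z \<partial>M) \<partial>M) \<le> ennreal (C * (8 / l) powr p) * epowr (h z) p" for z
    proof (cases "h z")
      case (real b)
      show ?thesis
      proof (cases "b = 0")
        case True then show ?thesis using real by (simp add: W_def)
      next
        case False
        define T where "T = 8 * b / l"
        have b: "0 < b" and T: "0 < T" using False real l by (auto simp: T_def)
        have W: "W x y z = ennreal (8 / l * b) * (if dist x z < dist x y \<and> \<phi> x y powr \<gamma> < T
            then ennreal (\<phi> x y powr (\<gamma> * (p - 1)) / (vol M x y)\<^sup>2) else 0)" for x y
        proof -
          have iff: "ennreal (l * \<phi> x y powr \<gamma> / 8) < h z \<longleftrightarrow> \<phi> x y powr \<gamma> < T"
            using real l b by (auto simp: T_def ennreal_less_iff field_simps)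
          have e: "ennreal (8 / l * b) = ennreal (8 / l) * h z"
            using real l b by (simp add: ennreal_mult[symmetric])
          show ?thesis
          proof (cases "dist x z < dist x y \<and> \<phi> x y powr \<gamma> < T")
            case True
            show ?thesis unfolding W_def iff e if_P[OF True] by (simp only: mult_ac)
          next
            case False
            show ?thesis unfolding W_def iff if_not_P[OF False] by simp
          qed
        qed
        have "(\<integral>\<^sup>+x. (\<integral>\<^sup>+y. W x y z \<partial>M) \<partial>M) = ennreal (8 / l * b) * (\<integral>\<^sup>+x. (\<integral>\<^sup>+y. (if dist x z < dist x y \<and> \<phi> x y powr \<gamma> < T
            then ennreal (\<phi> x y powr (\<gamma> * (p - 1)) / (vol M x y)\<^sup>2) else 0) \<partial>M) \<partial>M)"
          unfolding W by (simp add: nn_integral_cmult)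
        also have "\<dots> \<le> ennreal (8 / l * b) * ennreal (C * T powr (p - 1))"
          by (intro mult_left_mono C(2) T) simp
        also have "\<dots> = ennreal (C * (8 / l) powr p * b powr p)"
        proof -
          have Tb: "T = (8 / l) * b" by (simp add: T_def)
          have "8 / l * b * (C * T powr (p - 1)) = T * (C * T powr (p - 1))" by (simp only: Tb[symmetric])
          also have "\<dots> = C * (T powr 1 * T powr (p - 1))" using T by (simp add: mult.left_commute)
          also have "T powr 1 * T powr (p - 1) = T powr p" by (subst powr_add[symmetric]) simp
          also have "T powr p = (8 / l) powr p * b powr p" unfolding Tb by (rule powr_mult)
          finally have e: "8 / l * b * (C * T powr (p - 1)) = C * ((8 / l) powr p * b powr p)" .
          have "ennreal (8 / l * b) * ennreal (C * T powr (p - 1)) = ennreal (8 / l * b * (C * T powr (p - 1)))"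
            by (rule ennreal_mult[symmetric]) (use l b C(1) in auto)
          also have "\<dots> = ennreal (C * (8 / l) powr p * b powr p)" unfolding e by (simp only: mult.assoc)
          finally show ?thesis .
        qed
        also have "\<dots> = ennreal (C * (8 / l) powr p) * epowr (h z) p"
          using real C(1) by (simp add: ennreal_mult)
        finally show ?thesis .
      qed
    next
      case top
      then show ?thesis using C(1) l by (simp add: ennreal_mult_top)
    qed
    interpret PP: pair_sigma_finite M M ..
    have "(\<integral>\<^sup>+ x. (\<integral>\<^sup>+ y. ennreal (\<phi> x y powr (\<gamma> * p) / vol M x y) *
       indicator {y. y \<noteq> x \<and> \<bar>mean_osc M f x (dist x y) / (dist x y * \<phi> x y powr \<gamma>)\<bar> > l} y \<partial>M) \<partial>M)
      \<le> (\<integral>\<^sup>+x. (\<integral>\<^sup>+y. (\<integral>\<^sup>+z. W x y z \<partial>M) \<partial>M) \<partial>M)"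
      by (intro nn_integral_mono pt)
    also have "\<dots> = (\<integral>\<^sup>+x. (\<integral>\<^sup>+z. (\<integral>\<^sup>+y. W x y z \<partial>M) \<partial>M) \<partial>M)"
      by (intro nn_integral_cong PP.Fubini') (simp add: split_beta)
    also have "\<dots> = (\<integral>\<^sup>+z. (\<integral>\<^sup>+x. (\<integral>\<^sup>+y. W x y z \<partial>M) \<partial>M) \<partial>M)"
      by (intro PP.Fubini') (simp add: split_beta)
    also have "\<dots> \<le> (\<integral>\<^sup>+z. ennreal (C * (8 / l) powr p) * epowr (h z) p \<partial>M)"
      by (intro nn_integral_mono layer)
    also have "\<dots> = ennreal (C * (8 / l) powr p) * P" unfolding P_def by (rule nn_integral_cmult) measurable
    finally have "epowr (\<integral>\<^sup>+ x. (\<integral>\<^sup>+ y. ennreal (\<phi> x y powr (\<gamma> * p) / vol M x y) *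
       indicator {y. y \<noteq> x \<and> \<bar>mean_osc M f x (dist x y) / (dist x y * \<phi> x y powr \<gamma>)\<bar> > l} y \<partial>M) \<partial>M) (1 / p)
       \<le> epowr (ennreal (C * (8 / l) powr p) * P) (1 / p)"
      using p by (intro epowr_mono) auto
    also have "\<dots> = ennreal (C powr (1 / p) * (8 / l)) * epowr P (1 / p)"
      using C(1) l p by (simp add: epowr_mult powr_mult powr_powr)
    finally have "ennreal l * epowr (\<integral>\<^sup>+ x. (\<integral>\<^sup>+ y. ennreal (\<phi> x y powr (\<gamma> * p) / vol M x y) *
       indicator {y. y \<noteq> x \<and> \<bar>mean_osc M f x (dist x y) / (dist x y * \<phi> x y powr \<gamma>)\<bar> > l} y \<partial>M) \<partial>M) (1 / p)
       \<le> ennreal l * (ennreal (C powr (1 / p) * (8 / l)) * epowr P (1 / p))"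
      by (rule mult_left_mono) simp
    also have "\<dots> = ennreal C' * Lp_norm M p h"
      using l by (simp add: C'_def Lp_norm_def P_def mult.assoc[symmetric] ennreal_mult[symmetric])
    finally show ?thesis .
  qed
  show ?thesis
  proof (intro exI[of _ C'] conjI C' ballI)
    fix f assume f: "f \<in> L1_loc M"
    let ?N = "weak_Lp_norm M p (\<lambda>x y. \<phi> x y powr (\<gamma> * p) / vol M x y)
     (\<lambda>x y. mean_osc M f x (dist x y) / (dist x y * \<phi> x y powr \<gamma>))"
    \<comment> \<open>With the constant on the left, the left side is a lower bound for the norms of
      all Hajlasz gradients, hence for their infimum.\<close>
    have "ennreal (1 / C') * ?N \<le> Lp_norm M p h" if h: "Hajlasz_gradient M f h" for h
    proof -
      have "?N \<le> ennreal C' * Lp_norm M p h"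
        unfolding weak_Lp_norm_def by (intro SUP_least) (use main[OF f h] in auto)
      then have "ennreal (1 / C') * ?N \<le> ennreal (1 / C') * (ennreal C' * Lp_norm M p h)"
        by (rule mult_left_mono) simp
      then show ?thesis using C' by (simp add: mult.assoc[symmetric] ennreal_mult[symmetric])
    qed
    then have "ennreal (1 / C') * ?N \<le> Hajlasz_norm M p f"
      unfolding Hajlasz_norm_def by (intro INF_greatest) auto
    then have "ennreal C' * (ennreal (1 / C') * ?N) \<le> ennreal C' * Hajlasz_norm M p f"
      by (rule mult_left_mono) simp
    then show "?N \<le> ennreal C' * Hajlasz_norm M p f" using C' by (simp add: mult.assoc[symmetric] ennreal_mult[symmetric])
  qed
qed

end

section \<open>Increments along curves and the choice of scales\<close>

context doubling_space begin

section \<open>Oscillation on nested balls and of truncated functions\<close>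

text \<open>The deviation from the average over the large ball, integrated over the small one, costs
  the volume ratio K; replacing that average by the one over the small ball costs the further factor
  2.\<close>

lemma mean_osc_mono:
  assumes f: "f \<in> L1_loc M" and r: "0 < r" "0 < s" and sub: "ball x r \<subseteq> ball z s" and V: "V z s \<le> K * V x r"
  shows "mean_osc M f x r \<le> 2 * K * mean_osc M f z s"
    and "\<bar>average M (ball x r) f - average M (ball z s) f\<bar> \<le> K * mean_osc M f z s"
proof -
  note fm [measurable] = L1_locD(1)[OF f]
  define a b where "a = average M (ball x r) f" and "b = average M (ball z s) f"
  define I where "I = (\<integral>\<^sup>+y\<in>ball x r. ennreal \<bar>f y - b\<bar> \<partial>M)"
  have Vx: "0 < V x r" by (rule V_pos[OF r(1)])
  note o = mean_osc_nn_integral(2)[OF f r(1), of x] mean_osc_nn_integral(2)[OF f r(2), of z]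
  have "I \<le> (\<integral>\<^sup>+y\<in>ball z s. ennreal \<bar>f y - b\<bar> \<partial>M)"
    unfolding I_def using sub by (intro nn_integral_mono) (auto simp: indicator_def)
  also have "\<dots> = ennreal (mean_osc M f z s * V z s)"
    using mean_osc_nn_integral(1)[OF f r(2), of z] o by (simp add: b_def ennreal_mult)
  also have "\<dots> \<le> ennreal (mean_osc M f z s * (K * V x r))"
    using V o by (intro ennreal_leI mult_left_mono) auto
  finally have I: "I \<le> ennreal (mean_osc M f z s * (K * V x r))" .
  have rhs: "0 \<le> mean_osc M f z s * (K * V x r)"
    using o(2) order_trans[OF measure_nonneg V] by (rule mult_nonneg_nonneg)
  have ab: "ennreal (\<bar>a - b\<bar> * V x r) \<le> I"
    unfolding I_def a_def using average_diff_le[OF f r(1), of x b] by (simp add: ennreal_mult)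
  then have "ennreal (\<bar>a - b\<bar> * V x r) \<le> ennreal (mean_osc M f z s * (K * V x r))" using I by (rule order_trans)
  then have "\<bar>a - b\<bar> * V x r \<le> (K * mean_osc M f z s) * V x r" using rhs by (simp add: mult_ac)
  then show "\<bar>average M (ball x r) f - average M (ball z s) f\<bar> \<le> K * mean_osc M f z s"
    using Vx by (simp add: a_def b_def)
  have "ennreal (mean_osc M f x r * V x r) = (\<integral>\<^sup>+y\<in>ball x r. ennreal \<bar>f y - a\<bar> \<partial>M)"
    using mean_osc_nn_integral(1)[OF f r(1), of x] o by (simp add: a_def ennreal_mult)
  also have "\<dots> \<le> (\<integral>\<^sup>+y. ennreal \<bar>f y - b\<bar> * indicator (ball x r) y + ennreal \<bar>a - b\<bar> * indicator (ball x r) y \<partial>M)"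
  proof (rule nn_integral_mono)
    fix y
    have "ennreal \<bar>f y - a\<bar> \<le> ennreal (\<bar>f y - b\<bar> + \<bar>a - b\<bar>)" by (intro ennreal_leI) auto
    then show "ennreal \<bar>f y - a\<bar> * indicator (ball x r) y \<le> ennreal \<bar>f y - b\<bar> * indicator (ball x r) y + ennreal \<bar>a - b\<bar> * indicator (ball x r) y"
      by (auto simp: indicator_def)
  qed
  also have "\<dots> = I + ennreal (\<bar>a - b\<bar> * V x r)"
    unfolding I_def by (subst nn_integral_add) (auto simp: nn_integral_cmult_indicator emeasure_ball ennreal_mult)
  also have "\<dots> \<le> ennreal (mean_osc M f z s * (K * V x r)) + ennreal (mean_osc M f z s * (K * V x r))"
    using I ab by (intro add_mono order_trans[OF ab]) auto
  also have "\<dots> = ennreal (2 * K * mean_osc M f z s * V x r)"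
    using rhs by (simp add: ennreal_plus[symmetric] mult_ac del: ennreal_plus)
  finally have "mean_osc M f x r * V x r \<le> 2 * K * mean_osc M f z s * V x r"
    using rhs by (subst (asm) ennreal_le_iff) (auto simp: mult_ac)
  then show "mean_osc M f x r \<le> 2 * K * mean_osc M f z s" using Vx by simp
qed

lemma L1_loc_bounded:
  assumes "g \<in> borel_measurable M" "\<And>x. \<bar>g x\<bar> \<le> B"
  shows "g \<in> L1_loc M"
proof -
  have "integrable M (\<lambda>y. indicator (ball x r) y * g y)" for x r
  proof (rule Bochner_Integration.integrable_bound[of M "\<lambda>y. indicator (ball x r) y * B"])
    show "integrable M (\<lambda>y. indicator (ball x r) y * B)"
      using integrable_const_ball[of x r B] by (simp add: set_integrable_def)
    show "AE y in M. norm (indicator (ball x r) y * g y) \<le> norm (indicator (ball x r) y * B)"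
    proof (rule AE_I2)
      fix y show "norm (indicator (ball x r) y * g y) \<le> norm (indicator (ball x r) y * B)"
        using assms(2)[of y] by (auto simp: indicator_def)
    qed
  qed (use assms(1) in measurable)
  then show ?thesis using assms(1) by (auto simp: L1_loc_def set_integrable_def)
qed

text \<open>Cutting at height B bounds the oscillation quotient at scale s by 2 B / s; this is the
  upper limit on the heights that occur at a given scale.\<close>

definition truncate :: "real \<Rightarrow> ('a \<Rightarrow> real) \<Rightarrow> 'a \<Rightarrow> real" where
  "truncate B f x = max (- B) (min B (f x))"

lemma truncate_bounded: "0 \<le> B \<Longrightarrow> \<bar>truncate B f x\<bar> \<le> B"
  unfolding truncate_def by auto

lemma truncate_measurable:
  assumes [measurable]: "f \<in> borel_measurable M"
  shows "truncate B f \<in> borel_measurable M"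
proof -
  have "(\<lambda>x. max (- B) (min B (f x))) \<in> borel_measurable M" by measurable
  then show ?thesis unfolding truncate_def[abs_def] .
qed

lemma two_times_ennreal: "2 * ennreal X = ennreal (2 * X)"
  by (simp add: ennreal_mult')

lemma mean_osc_le_any_constant:
  assumes f: "f \<in> L1_loc M" and r: "0 < r"
  shows "ennreal (mean_osc M f x r * V x r) \<le> 2 * (\<integral>\<^sup>+y\<in>ball x r. ennreal \<bar>f y - b\<bar> \<partial>M)"
proof -
  note fm [measurable] = L1_locD(1)[OF f]
  define a where "a = average M (ball x r) f"
  define I where "I = (\<integral>\<^sup>+y\<in>ball x r. ennreal \<bar>f y - b\<bar> \<partial>M)"
  have ab: "ennreal (\<bar>a - b\<bar> * V x r) \<le> I"
    unfolding I_def a_def using average_diff_le[OF f r, of x b] by (simp add: ennreal_mult)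
  have "ennreal (mean_osc M f x r * V x r) = (\<integral>\<^sup>+y\<in>ball x r. ennreal \<bar>f y - a\<bar> \<partial>M)"
    using mean_osc_nn_integral[OF f r, of x] by (simp add: a_def ennreal_mult)
  also have "\<dots> \<le> (\<integral>\<^sup>+y. ennreal \<bar>f y - b\<bar> * indicator (ball x r) y + ennreal \<bar>a - b\<bar> * indicator (ball x r) y \<partial>M)"
  proof (rule nn_integral_mono)
    fix y
    have "ennreal \<bar>f y - a\<bar> \<le> ennreal (\<bar>f y - b\<bar> + \<bar>a - b\<bar>)" by (intro ennreal_leI) auto
    then show "ennreal \<bar>f y - a\<bar> * indicator (ball x r) y \<le> ennreal \<bar>f y - b\<bar> * indicator (ball x r) y + ennreal \<bar>a - b\<bar> * indicator (ball x r) y"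
      by (auto simp: indicator_def)
  qed
  also have "\<dots> = I + ennreal (\<bar>a - b\<bar> * V x r)"
    unfolding I_def by (subst nn_integral_add) (auto simp: nn_integral_cmult_indicator emeasure_ball ennreal_mult)
  also have "\<dots> \<le> 2 * I" using ab by (simp add: mult_2 add_left_mono)
  finally show ?thesis by (simp add: I_def)
qed

text \<open>Truncation is a contraction of the line, so the truncated average is a good comparison
  constant for the truncated function; the factor 2 is the cost of a constant other than its own
  average. The second bound compares with 0.\<close>

lemma mean_osc_truncate:
  assumes f: "f \<in> L1_loc M" and r: "0 < r" and B: "0 \<le> B"
  shows "mean_osc M (truncate B f) x r \<le> 2 * mean_osc M f x r" and "mean_osc M (truncate B f) x r \<le> 2 * B"
proof -
  note fm [measurable] = L1_locD(1)[OF f]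
  have t: "truncate B f \<in> L1_loc M"
    using truncate_measurable[OF fm] truncate_bounded[OF B] by (rule L1_loc_bounded)
  have Vx: "0 < V x r" by (rule V_pos[OF r])
  note o = mean_osc_nn_integral(2)[OF f r, of x] mean_osc_nn_integral(2)[OF t r, of x]
  define a where "a = average M (ball x r) f"
  define b where "b = max (- B) (min B a)"
  have "ennreal (mean_osc M (truncate B f) x r * V x r) \<le> 2 * (\<integral>\<^sup>+y\<in>ball x r. ennreal \<bar>truncate B f y - b\<bar> \<partial>M)"
    by (rule mean_osc_le_any_constant[OF t r])
  also have "\<dots> \<le> 2 * (\<integral>\<^sup>+y\<in>ball x r. ennreal \<bar>f y - a\<bar> \<partial>M)"
  proof (intro mult_left_mono nn_integral_mono mult_right_mono ennreal_leI)
    fix y show "\<bar>truncate B f y - b\<bar> \<le> \<bar>f y - a\<bar>" unfolding truncate_def b_def by (auto simp: max_def min_def)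
  qed auto
  also have "(\<integral>\<^sup>+y\<in>ball x r. ennreal \<bar>f y - a\<bar> \<partial>M) = ennreal (mean_osc M f x r * V x r)"
    using mean_osc_nn_integral(1)[OF f r, of x] o by (simp add: a_def ennreal_mult)
  also have "2 * ennreal (mean_osc M f x r * V x r) = ennreal (2 * mean_osc M f x r * V x r)"
    unfolding two_times_ennreal by (simp only: mult.assoc)
  finally have "mean_osc M (truncate B f) x r * V x r \<le> 2 * mean_osc M f x r * V x r"
    using o Vx by (subst (asm) ennreal_le_iff) auto
  then show "mean_osc M (truncate B f) x r \<le> 2 * mean_osc M f x r" using Vx by simp
  have "ennreal (mean_osc M (truncate B f) x r * V x r) \<le> 2 * (\<integral>\<^sup>+y\<in>ball x r. ennreal \<bar>truncate B f y - 0\<bar> \<partial>M)"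
    by (rule mean_osc_le_any_constant[OF t r])
  also have "\<dots> \<le> 2 * (\<integral>\<^sup>+y\<in>ball x r. ennreal B \<partial>M)"
    using truncate_bounded[OF B] by (intro mult_left_mono nn_integral_mono mult_right_mono ennreal_leI) auto
  also have "(\<integral>\<^sup>+y\<in>ball x r. ennreal B \<partial>M) = ennreal (B * V x r)"
    using B by (simp add: nn_integral_cmult_indicator emeasure_ball ennreal_mult)
  also have "2 * ennreal (B * V x r) = ennreal (2 * B * V x r)"
    unfolding two_times_ennreal by (simp only: mult.assoc)
  finally have "mean_osc M (truncate B f) x r * V x r \<le> 2 * B * V x r"
    using B Vx by (subst (asm) ennreal_le_iff) auto
  then show "mean_osc M (truncate B f) x r \<le> 2 * B" using Vx by simp
qed

lemma average_ball_measurable: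
  assumes [measurable]: "f \<in> borel_measurable M"
  shows "(\<lambda>x. average M (ball x r) f) \<in> borel_measurable M"
  by (rule measurable_average) measurable

lemma average_diff_mean_osc:
  assumes f: "f \<in> L1_loc M" and r: "0 < r" and z: "dist z x \<le> 2 * r"
  shows "\<bar>average M (ball x r) f - average M (ball z (3 * r)) f\<bar> \<le> D ^ 3 * mean_osc M f z (3 * r)"
proof (rule mean_osc_mono(2)[OF f r])
  show "ball x r \<subseteq> ball z (3 * r)" using z by (intro subset_ball_dist) auto
  have "V z (3 * r) \<le> V x (2 ^ 3 * r)" using z r by (intro V_mono subset_ball_dist) (auto simp: dist_commute)
  also have "\<dots> \<le> D ^ 3 * V x r" by (rule V_power[OF r])
  finally show "V z (3 * r) \<le> D ^ 3 * V x r" .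
qed (use r in simp)

section \<open>Ball averages: approximation and increments along curves\<close>

text \<open>For w in B(x,r) the average over B(w,3r) is inserted between f(x) and the average over
  B(x,r). Averaging over w and exchanging the integrals leaves the oscillation at w. Being linear in
  the oscillation, the bound gains a factor r when the quotients are controlled, which later makes
  the errors summable.\<close>

lemma average_approximation:
  assumes f: "f \<in> L1_loc M" and r: "0 < r" "r \<le> 1"
  shows "(\<integral>\<^sup>+x\<in>ball x0 R. ennreal \<bar>f x - average M (ball x r) f\<bar> \<partial>M)
    \<le> ennreal (D ^ 3 + D ^ 4) * (\<integral>\<^sup>+w\<in>ball x0 (R + 1). ennreal (mean_osc M f w (3 * r)) \<partial>M)"
proof -
  note fm [measurable] = L1_locD(1)[OF f]
  have [measurable]: "(\<lambda>x. average M (ball x (3 * r)) f) \<in> borel_measurable M" for r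
    by (rule average_ball_measurable[OF fm])
  have [measurable]: "(\<lambda>x. average M (ball x r) f) \<in> borel_measurable M"
    by (rule average_ball_measurable[OF fm])
  define m where "m = (\<lambda>w. mean_osc M f w (3 * r))"
  define A where "A = (\<lambda>w. average M (ball w (3 * r)) f)"
  have [measurable]: "A \<in> borel_measurable M" unfolding A_def by measurable
  have m0: "0 \<le> m w" for w unfolding m_def using r by (intro mean_osc_nn_integral(2)[OF f]) auto
  have [measurable]: "m \<in> borel_measurable M" unfolding m_def by measurable
  define U where "U = (\<lambda>x w. if dist x w < r \<and> dist x0 x < R then ennreal (1 / V x r) * (ennreal \<bar>f x - A w\<bar> + ennreal (D ^ 3 * m w)) else 0)"
  have [measurable]: "(\<lambda>(x, w). U x w) \<in> borel_measurable (M \<Otimes>\<^sub>M M)" unfolding U_def split_beta by measurable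
  interpret PP: pair_sigma_finite M M ..
  have 1: "ennreal \<bar>f x - average M (ball x r) f\<bar> * indicator (ball x0 R) x \<le> (\<integral>\<^sup>+w. U x w \<partial>M)" for x
  proof (cases "x \<in> ball x0 R")
    case True
    have Vx: "0 < V x r" by (rule V_pos[OF r(1)])
    have "ennreal \<bar>f x - average M (ball x r) f\<bar> = (\<integral>\<^sup>+w. (ennreal \<bar>f x - average M (ball x r) f\<bar> * ennreal (1 / V x r)) * indicator (ball x r) w \<partial>M)"
      using Vx by (simp add: nn_integral_cmult_indicator emeasure_ball mult.assoc ennreal_mult[symmetric])
    also have "\<dots> \<le> (\<integral>\<^sup>+w. U x w \<partial>M)"
    proof (rule nn_integral_mono)
      fix w
      show "(ennreal \<bar>f x - average M (ball x r) f\<bar> * ennreal (1 / V x r)) * indicator (ball x r) w \<le> U x w"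
      proof (cases "w \<in> ball x r")
        case w: True
        have "\<bar>average M (ball x r) f - A w\<bar> \<le> D ^ 3 * m w"
          unfolding A_def m_def using w r by (intro average_diff_mean_osc[OF f r(1)]) (auto simp: dist_commute)
        then have "ennreal \<bar>f x - average M (ball x r) f\<bar> \<le> ennreal (\<bar>f x - A w\<bar> + D ^ 3 * m w)"
          by (intro ennreal_leI) auto
        also have "\<dots> = ennreal \<bar>f x - A w\<bar> + ennreal (D ^ 3 * m w)" using m0 D_pos by (intro ennreal_plus) auto
        finally show ?thesis using w True by (simp add: U_def mult.commute mult_left_mono)
      qed simp
    qed
    finally show ?thesis using True by simp
  qed simp
  have 2: "(\<integral>\<^sup>+x. U x w \<partial>M) \<le> ennreal (D ^ 3 + D ^ 4) * (ennreal (m w) * indicator (ball x0 (R + 1)) w)" for w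
  proof (cases "w \<in> ball x0 (R + 1)")
    case True
    have Vw: "0 < V w r" "0 < V w (3 * r)" using r by (auto intro: V_pos)
    \<comment> \<open>Doubling exchanges the centre x for w; the cube of D arises because B(w,3r)
      lies in B(x,8r).\<close>
    have Vxw: "1 / V x r \<le> D ^ 3 / V w (3 * r)" "1 / V x r \<le> D / V w r" if "dist x w < r" for x
    proof -
      have Vx: "0 < V x r" by (rule V_pos[OF r(1)])
      have "V w (3 * r) \<le> V x (2 ^ 3 * r)" using that r by (intro V_mono subset_ball_dist) auto
      also have "\<dots> \<le> D ^ 3 * V x r" by (rule V_power[OF r(1)])
      finally show "1 / V x r \<le> D ^ 3 / V w (3 * r)" using Vx Vw by (simp add: field_simps)
      have "V w r \<le> V x (2 * r)" using that r by (intro V_mono subset_ball_dist) auto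
      also have "\<dots> \<le> D * V x r" by (rule doubling_ball[OF r(1)])
      finally show "1 / V x r \<le> D / V w r" using Vx Vw by (simp add: field_simps)
    qed
    have "(\<integral>\<^sup>+x. U x w \<partial>M) \<le> (\<integral>\<^sup>+x. ennreal (D ^ 3 / V w (3 * r)) * (ennreal \<bar>f x - A w\<bar> * indicator (ball w (3 * r)) x)
        + ennreal (D / V w r * (D ^ 3 * m w)) * indicator (ball w r) x \<partial>M)"
    proof (rule nn_integral_mono)
      fix x
      show "U x w \<le> ennreal (D ^ 3 / V w (3 * r)) * (ennreal \<bar>f x - A w\<bar> * indicator (ball w (3 * r)) x)
        + ennreal (D / V w r * (D ^ 3 * m w)) * indicator (ball w r) x"
      proof (cases "dist x w < r")
        case xw: True
        then have ind: "x \<in> ball w r" "x \<in> ball w (3 * r)" using r by (auto simp: dist_commute)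
        have "U x w \<le> ennreal (1 / V x r) * ennreal \<bar>f x - A w\<bar> + ennreal (1 / V x r) * ennreal (D ^ 3 * m w)"
          unfolding U_def by (auto simp: distrib_left)
        also have "\<dots> \<le> ennreal (D ^ 3 / V w (3 * r)) * ennreal \<bar>f x - A w\<bar> + ennreal (D / V w r) * ennreal (D ^ 3 * m w)"
          using Vxw[OF xw] by (intro add_mono mult_right_mono ennreal_leI) auto
        also have "ennreal (D / V w r) * ennreal (D ^ 3 * m w) = ennreal (D / V w r * (D ^ 3 * m w))"
          using D_pos Vw m0 by (intro ennreal_mult[symmetric]) auto
        finally show ?thesis using ind by simp
      qed (simp add: U_def)
    qed
    also have "\<dots> = ennreal (D ^ 3 / V w (3 * r)) * (\<integral>\<^sup>+x\<in>ball w (3 * r). ennreal \<bar>f x - A w\<bar> \<partial>M) + ennreal (D / V w r * (D ^ 3 * m w)) * ennreal (V w r)"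
      by (simp add: nn_integral_add nn_integral_cmult nn_integral_cmult_indicator emeasure_ball)
    also have "(\<integral>\<^sup>+x\<in>ball w (3 * r). ennreal \<bar>f x - A w\<bar> \<partial>M) = ennreal (m w) * ennreal (V w (3 * r))"
      using mean_osc_nn_integral(1)[OF f, of "3 * r" w] r by (simp add: m_def A_def)
    also have "ennreal (D ^ 3 / V w (3 * r)) * (ennreal (m w) * ennreal (V w (3 * r))) = ennreal (D ^ 3 * m w)"
      using D_pos Vw m0 by (simp add: ennreal_mult[symmetric])
    also have "ennreal (D / V w r * (D ^ 3 * m w)) * ennreal (V w r) = ennreal (D ^ 4 * m w)"
    proof -
      have "D / V w r * (D ^ 3 * m w) * V w r = D ^ 4 * m w" using Vw by (simp add: power_Suc numeral_eq_Suc)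
      then show ?thesis using D_pos Vw m0 by (simp add: ennreal_mult[symmetric])
    qed
    also have "ennreal (D ^ 3 * m w) + ennreal (D ^ 4 * m w) = ennreal (D ^ 3 + D ^ 4) * ennreal (m w)"
      using D_pos m0 by (simp add: ennreal_mult[symmetric] ennreal_plus[symmetric] distrib_right del: ennreal_plus)
    finally show ?thesis using True by simp
  next
    case False
    have "\<not> (dist x w < r \<and> dist x0 x < R)" for x
    proof
      assume "dist x w < r \<and> dist x0 x < R"
      then have "dist x0 w < R + 1" using dist_triangle[of x0 w x] r by linarith
      then show False using False by simp
    qed
    then have "U x w = 0" for x unfolding U_def by (simp only: if_False)
    then show ?thesis by simp
  qed
  have "(\<integral>\<^sup>+x\<in>ball x0 R. ennreal \<bar>f x - average M (ball x r) f\<bar> \<partial>M) \<le> (\<integral>\<^sup>+x. (\<integral>\<^sup>+w. U x w \<partial>M) \<partial>M)"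
    by (intro nn_integral_mono 1)
  also have "\<dots> = (\<integral>\<^sup>+w. (\<integral>\<^sup>+x. U x w \<partial>M) \<partial>M)" by (intro PP.Fubini'[symmetric]) simp
  also have "\<dots> \<le> (\<integral>\<^sup>+w. ennreal (D ^ 3 + D ^ 4) * (ennreal (m w) * indicator (ball x0 (R + 1)) w) \<partial>M)"
    by (intro nn_integral_mono 2)
  also have "\<dots> = ennreal (D ^ 3 + D ^ 4) * (\<integral>\<^sup>+w\<in>ball x0 (R + 1). ennreal (m w) \<partial>M)"
    by (rule nn_integral_cmult) measurable
  finally show ?thesis by (simp add: m_def)
qed

text \<open>The curve is cut into pieces of equal length in \<open>[r, 2 r)\<close>; on each piece the increment of
  the ball averages is bounded by the oscillation at every point of the piece.\<close>

lemma average_along_curve: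
  fixes c :: "real \<Rightarrow> 'a"
  assumes f: "f \<in> L1_loc M" and r: "0 < r" and c: "c \<in> AC_curves"
    and len: "r \<le> (LINT u:{0<..<1}|lborel. metric_speed c u)"
  shows "ennreal \<bar>average M (ball (c 1) r) f - average M (ball (c 0) r) f\<bar>
    \<le> ennreal (2 * D ^ 3 / r) * curve_integral c (\<lambda>z. ennreal (mean_osc M f z (3 * r)))"
proof -
  note fm [measurable] = L1_locD(1)[OF f]
  define v where "v = metric_speed c"
  define u where "u = (\<lambda>x. average M (ball x r) f)"
  define m where "m = (\<lambda>z. mean_osc M f z (3 * r))"
  have mm: "(\<lambda>z. ennreal (m z)) \<in> borel_measurable borel"
    unfolding m_def using measurable_mean_osc[OF measurable_ident_sets[OF refl] _ fm, of "\<lambda>_. 3 * r"]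
    by (simp add: measurable_cong_sets[OF sets_M refl])
  have m0: "0 \<le> m z" for z unfolding m_def using r by (intro mean_osc_nn_integral(2)[OF f]) auto
  have sb: "speed_bound c v" unfolding v_def by (rule speed_bound_metric_speed[OF c])
  have vi: "set_integrable lborel {0<..<1} v" using sb by (simp add: speed_bound_def)
  have v0: "AE u in lborel. u \<in> {0<..<1} \<longrightarrow> 0 \<le> v u" unfolding v_def by (rule metric_speed_nonneg[OF c])
  define H where "H = (\<lambda>t. integral {0..t} (\<lambda>u. indicator {0<..<1} u * v u))"
  have H: "(LINT u:{s<..<t}|lborel. v u) = H t - H s" if "0 \<le> s" "s \<le> t" "t \<le> 1" for s t
    unfolding H_def by (rule set_integral_open_closed(3)[OF vi that])
  have Hc: "continuous_on {0..1} H" unfolding H_def by (rule indefinite_integral_speed_continuous[OF sb])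
  have H0: "H 0 = 0" by (simp add: H_def)
  have Hmono: "H s \<le> H t" if "0 \<le> s" "s \<le> t" "t \<le> 1" for s t
    using speed_bound_le[OF sb that] H[OF that] zero_le_dist[of "c s" "c t"] by linarith
  define \<Lambda> where "\<Lambda> = H 1"
  have \<Lambda>: "r \<le> \<Lambda>" using len H[of 0 1] H0 by (simp add: \<Lambda>_def v_def)
  define n where "n = nat \<lfloor>\<Lambda> / r\<rfloor>"
  have fl: "1 \<le> \<lfloor>\<Lambda> / r\<rfloor>" using \<Lambda> r by (simp add: le_floor_iff)
  have n: "1 \<le> n" "real n = of_int \<lfloor>\<Lambda> / r\<rfloor>" unfolding n_def using fl by linarith+
  have nr: "real n * r \<le> \<Lambda>" "\<Lambda> < (real n + 1) * r"
    unfolding n(2) pos_le_divide_eq[OF r, symmetric] pos_divide_less_eq[OF r, symmetric] by linarith+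
  define w where "w = \<Lambda> / real n"
  have w: "r \<le> w" "w \<le> 2 * r"
  proof -
    show "r \<le> w" using nr n(1) by (simp add: w_def field_simps)
    have "(real n + 1) * r \<le> (2 * real n) * r" using n(1) r by (intro mult_right_mono) auto
    then have "\<Lambda> \<le> 2 * r * real n" using nr by (simp add: mult_ac)
    then show "w \<le> 2 * r" using n(1) by (simp add: w_def field_simps)
  qed
  have "\<exists>t. 0 \<le> t \<and> t \<le> 1 \<and> H t = real i * w" if "i \<le> n" for i
  proof -
    have "real i * w \<le> real n * w" using that w r by (intro mult_right_mono) auto
    also have "\<dots> = \<Lambda>" using n(1) by (simp add: w_def)
    finally have "H 0 \<le> real i * w" "real i * w \<le> H 1" using H0 w r by (auto simp: \<Lambda>_def)
    from IVT'[OF this _ Hc] show ?thesis by auto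
  qed
  then obtain t0 where t0: "\<And>i. i \<le> n \<Longrightarrow> 0 \<le> t0 i \<and> t0 i \<le> 1 \<and> H (t0 i) = real i * w" by metis
  \<comment> \<open>The first and last times are prescribed: the curve may rest near its ends, so an
    intermediate value argument need not return 0 and 1.\<close>
  define t where "t = (\<lambda>i. if i = 0 then 0 else if i = n then 1 else t0 i)"
  have t: "0 \<le> t i" "t i \<le> 1" "H (t i) = real i * w" if "i \<le> n" for i
    using t0[OF that] that H0 n(1) by (auto simp: t_def \<Lambda>_def[symmetric] w_def)
  have tmono: "t i \<le> t (Suc i)" if "i < n" for i
  proof (rule ccontr)
    assume "\<not> t i \<le> t (Suc i)"
    then have "H (t (Suc i)) \<le> H (t i)" using t[of i] t[of "Suc i"] that by (intro Hmono) auto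
    then have "real (Suc i) * w \<le> real i * w" using t(3)[of i] t(3)[of "Suc i"] that by simp
    then show False using w r by (simp add: algebra_simps)
  qed
  have near: "dist (c s) (c s') \<le> 2 * r" if i: "i < n" and s: "t i \<le> s" "s \<le> s'" "s' \<le> t (Suc i)" for i s s'
  proof -
    have b: "0 \<le> t i" "t (Suc i) \<le> 1" using t[of i] t[of "Suc i"] i by auto
    have "dist (c s) (c s') \<le> H s' - H s" using speed_bound_le[OF sb, of s s'] H[of s s'] s b by auto
    also have "\<dots> \<le> H (t (Suc i)) - H (t i)" using s b by (intro diff_mono Hmono) auto
    also have "\<dots> = w" using t(3)[of i] t(3)[of "Suc i"] i by (simp add: algebra_simps)
    finally show ?thesis using w by simp
  qed
  \<comment> \<open>Both ends of the piece are within 2 r of c s, so their balls of radius r lie in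
    the ball of radius 3 r about c s.\<close>
  have inc: "\<bar>u (c (t (Suc i))) - u (c (t i))\<bar> \<le> 2 * D ^ 3 * m (c s)" if i: "i < n" and s: "t i \<le> s" "s \<le> t (Suc i)" for i s
  proof -
    have "\<bar>u (c (t i)) - average M (ball (c s) (3 * r)) f\<bar> \<le> D ^ 3 * m (c s)"
      unfolding u_def m_def using near[OF i order_refl s] by (intro average_diff_mean_osc[OF f r]) (simp add: dist_commute)
    moreover have "\<bar>u (c (t (Suc i))) - average M (ball (c s) (3 * r)) f\<bar> \<le> D ^ 3 * m (c s)"
      unfolding u_def m_def using near[OF i s order_refl] by (intro average_diff_mean_osc[OF f r])
    ultimately show ?thesis by linarith
  qed
  define G where "G = (\<lambda>s. ennreal (m (c s)) * ennreal (v s) * indicator {0<..<1} s)"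
  have [measurable]: "G \<in> borel_measurable borel"
    unfolding G_def v_def by (rule curve_weight_measurable[OF c mm])
  \<comment> \<open>The length of the piece is at least r, so r times the increment is at most the
    integral of the pointwise bound over the piece.\<close>
  have piece: "ennreal (r * \<bar>u (c (t (Suc i))) - u (c (t i))\<bar>) \<le> ennreal (2 * D ^ 3) * (\<integral>\<^sup>+s\<in>{t i<..<t (Suc i)}. G s \<partial>lborel)" if i: "i < n" for i
  proof -
    define d where "d = \<bar>u (c (t (Suc i))) - u (c (t i))\<bar>"
    have b: "0 \<le> t i" "t i \<le> t (Suc i)" "t (Suc i) \<le> 1" using t[of i] t[of "Suc i"] tmono[OF i] i by auto
    have "(LINT u:{t i<..<t (Suc i)}|lborel. v u) = w"
      using H[OF b] t(3)[of i] t(3)[of "Suc i"] i by (simp add: algebra_simps)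
    then have "ennreal r \<le> ennreal (LINT s|lborel. indicator {t i<..<t (Suc i)} s * v s)"
      using w by (intro ennreal_leI) (simp add: set_lebesgue_integral_def)
    also have "\<dots> \<le> (\<integral>\<^sup>+s. ennreal (indicator {t i<..<t (Suc i)} s * v s) \<partial>lborel)"
      using set_integral_open_closed(1)[OF vi b] by (intro ennreal_integral_le_nn_integral) (simp add: set_integrable_def)
    finally have vr: "ennreal r \<le> (\<integral>\<^sup>+s. ennreal (indicator {t i<..<t (Suc i)} s * v s) \<partial>lborel)" .
    have "(\<lambda>s. indicator {t i<..<t (Suc i)} s * v s) \<in> borel_measurable lborel"
      using set_integral_open_closed(1)[OF vi b] by (auto simp: set_integrable_def dest: borel_measurable_integrable)
    then have mv [measurable]: "(\<lambda>s. ennreal (indicator {t i<..<t (Suc i)} s * v s)) \<in> borel_measurable lborel" by measurable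
    have "ennreal (r * d) = ennreal d * ennreal r" using r by (simp add: d_def ennreal_mult mult.commute)
    also have "\<dots> \<le> ennreal d * (\<integral>\<^sup>+s. ennreal (indicator {t i<..<t (Suc i)} s * v s) \<partial>lborel)"
      using vr by (rule mult_left_mono) simp
    also have "\<dots> = (\<integral>\<^sup>+s. ennreal d * ennreal (indicator {t i<..<t (Suc i)} s * v s) \<partial>lborel)"
      by (rule nn_integral_cmult[symmetric]) (rule mv)
    also have "\<dots> \<le> (\<integral>\<^sup>+s. ennreal (2 * D ^ 3) * (G s * indicator {t i<..<t (Suc i)} s) \<partial>lborel)"
    proof (rule nn_integral_mono)
      fix s :: real
      show "ennreal d * ennreal (indicator {t i<..<t (Suc i)} s * v s) \<le> ennreal (2 * D ^ 3) * (G s * indicator {t i<..<t (Suc i)} s)"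
      proof (cases "s \<in> {t i<..<t (Suc i)}")
        case True
        then have s01: "s \<in> {0<..<1}" using b by auto
        have "d \<le> 2 * D ^ 3 * m (c s)" unfolding d_def using True by (intro inc[OF i]) auto
        then have "ennreal d \<le> ennreal (2 * D ^ 3 * m (c s))" by (rule ennreal_leI)
        also have "\<dots> = ennreal (2 * D ^ 3) * ennreal (m (c s))" using m0 D_pos by (simp add: ennreal_mult)
        finally have "ennreal d * ennreal (v s) \<le> ennreal (2 * D ^ 3) * ennreal (m (c s)) * ennreal (v s)"
          by (rule mult_right_mono) simp
        then show ?thesis using True s01 by (simp add: G_def mult.assoc)
      qed simp
    qed
    also have "\<dots> = ennreal (2 * D ^ 3) * (\<integral>\<^sup>+s\<in>{t i<..<t (Suc i)}. G s \<partial>lborel)"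
      by (rule nn_integral_cmult) measurable
    finally show ?thesis by (simp add: d_def)
  qed
  have disj: "disjoint_family_on (\<lambda>i. {t i<..<t (Suc i)}) {..<n}"
    unfolding disjoint_family_on_def
  proof (intro ballI impI)
    have lt: "t (Suc i) \<le> t j" if "i < j" "j < n" for i j
    proof -
      have "Suc i \<le> j" using that by simp
      then have "j \<le> n \<longrightarrow> t (Suc i) \<le> t j"
      proof (induction j rule: dec_induct)
        case (step k)
        then show ?case using tmono[of k] by auto
      qed simp
      then show ?thesis using that by simp
    qed
    fix i j assume ij: "i \<in> {..<n}" "j \<in> {..<n}" "i \<noteq> j"
    then consider "i < j" | "j < i" by linarith
    then show "{t i<..<t (Suc i)} \<inter> {t j<..<t (Suc j)} = {}"
      using lt[of i j] lt[of j i] ij by cases fastforce+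
  qed
  have "u (c 1) - u (c 0) = (\<Sum>i<n. u (c (t (Suc i))) - u (c (t i)))"
    using n(1) by (subst sum_lessThan_telescope[of "\<lambda>i. u (c (t i))"]) (simp add: t_def)
  then have "\<bar>u (c 1) - u (c 0)\<bar> \<le> (\<Sum>i<n. \<bar>u (c (t (Suc i))) - u (c (t i))\<bar>)"
    by (simp only: sum_abs)
  then have "ennreal (r * \<bar>u (c 1) - u (c 0)\<bar>) \<le> ennreal (\<Sum>i<n. r * \<bar>u (c (t (Suc i))) - u (c (t i))\<bar>)"
    unfolding sum_distrib_left[symmetric] using r by (intro ennreal_leI mult_left_mono) auto
  also have "\<dots> = (\<Sum>i<n. ennreal (r * \<bar>u (c (t (Suc i))) - u (c (t i))\<bar>))"
    using r by (intro sum_ennreal[symmetric]) auto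
  also have "\<dots> \<le> (\<Sum>i<n. ennreal (2 * D ^ 3) * (\<integral>\<^sup>+s\<in>{t i<..<t (Suc i)}. G s \<partial>lborel))"
    by (intro sum_mono piece) auto
  also have "\<dots> = ennreal (2 * D ^ 3) * (\<Sum>i<n. emeasure (density lborel G) {t i<..<t (Suc i)})"
    by (simp add: sum_distrib_left emeasure_density)
  also have "(\<Sum>i<n. emeasure (density lborel G) {t i<..<t (Suc i)}) = emeasure (density lborel G) (\<Union>i<n. {t i<..<t (Suc i)})"
    by (rule sum_emeasure) (use disj in auto)
  also have "\<dots> \<le> emeasure (density lborel G) UNIV" by (rule emeasure_mono) auto
  also have "emeasure (density lborel G) UNIV = curve_integral c (\<lambda>z. ennreal (m z))"
  proof -
    have "emeasure (density lborel G) UNIV = (\<integral>\<^sup>+s. G s * indicator UNIV s \<partial>lborel)"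
      by (rule emeasure_density) auto
    then show ?thesis by (simp add: curve_integral_def G_def v_def)
  qed
  finally have "ennreal (1 / r) * ennreal (r * \<bar>u (c 1) - u (c 0)\<bar>) \<le> ennreal (1 / r) * (ennreal (2 * D ^ 3) * curve_integral c (\<lambda>z. ennreal (m z)))"
    by (simp add: mult_left_mono)
  then show ?thesis
    using r D_pos by (simp add: u_def m_def mult.assoc[symmetric] ennreal_mult[symmetric])
qed

end

section \<open>Gauges on geometric annuli\<close>

text \<open>\<open>\<Phi> k x\<close> is the size of \<phi> on the annulus about x between the radii
  a^(-k) and a^(1 - k): it is a^(-k) for the distance and V(x,a^(-k)) for the volume. The annulus
  estimate starts at k0 because reverse doubling concerns radii below a fraction of the diameter.
  The exponential bounds, uniform on balls, let the number of relevant heights grow only linearly in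
  k.\<close>

locale scaled_gauge = gauge M D \<phi> for M :: "'a::metric_space measure" and D :: real and \<phi> :: "'a \<Rightarrow> 'a \<Rightarrow> real" +
  fixes a B C0 :: real and k0 :: nat and \<Phi> :: "nat \<Rightarrow> 'a \<Rightarrow> real"
  assumes a: "1 < a" and B: "1 \<le> B" and C0: "1 < C0"
    and annulus: "k0 \<le> k \<Longrightarrow> C0 * measure M (ball x ((1 / a) ^ k)) \<le> measure M (ball x (a * (1 / a) ^ k))"
    and \<Phi>_measurable [measurable]: "\<Phi> k \<in> borel_measurable M"
    and \<Phi>_pos: "0 < \<Phi> k x"
    and \<Phi>_compare: "(1 / a) ^ k \<le> dist x y \<Longrightarrow> dist x y < a * (1 / a) ^ k \<Longrightarrow> \<Phi> k x \<le> \<phi> x y \<and> \<phi> x y \<le> B * \<Phi> k x"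
    and \<Phi>_bounds: "\<exists>c>0. \<forall>x\<in>ball x0 R. \<forall>k. c * (1 / B) ^ k \<le> \<Phi> k x \<and> \<Phi> k x \<le> 1 / c"
begin

definition scale :: "nat \<Rightarrow> real" where "scale k = (1 / a) ^ k"

lemma scale_pos: "0 < scale k" using a by (simp add: scale_def)

lemma powr_compare:
  assumes "0 < w" "w \<le> t" "t \<le> B * w"
  shows "t powr e \<le> B powr \<bar>e\<bar> * w powr e" and "B powr - \<bar>e\<bar> * w powr e \<le> t powr e"
proof -
  have "1 \<le> B powr \<bar>e\<bar>" using B ge_one_powr_ge_zero[of B "\<bar>e\<bar>"] by simp
  then have B1: "1 \<le> B powr \<bar>e\<bar>" "B powr - \<bar>e\<bar> \<le> 1" by (auto simp: powr_minus divide_simps)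
  have *: "t powr e \<le> B powr \<bar>e\<bar> * w powr e \<and> B powr - \<bar>e\<bar> * w powr e \<le> t powr e"
  proof (cases "0 \<le> e")
    case True
    have "t powr e \<le> (B * w) powr e" using assms True by (intro powr_mono2) auto
    also have "\<dots> = B powr \<bar>e\<bar> * w powr e" using assms B True by (simp add: powr_mult)
    finally have 1: "t powr e \<le> B powr \<bar>e\<bar> * w powr e" .
    have "B powr - \<bar>e\<bar> * w powr e \<le> 1 * w powr e" using B1 by (intro mult_right_mono) auto
    also have "\<dots> \<le> t powr e" using assms True by (simp add: powr_mono2)
    finally show ?thesis using 1 by simp
  next
    case False
    then have e: "e \<le> 0" "\<bar>e\<bar> = - e" by auto
    have "t powr e \<le> w powr e" using assms e by (intro powr_mono2') auto
    also have "\<dots> \<le> B powr \<bar>e\<bar> * w powr e" using B1 mult_right_mono[of 1 "B powr \<bar>e\<bar>" "w powr e"] by simp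
    finally have 1: "t powr e \<le> B powr \<bar>e\<bar> * w powr e" .
    have "B powr - \<bar>e\<bar> * w powr e = (B * w) powr e" using assms B e by (simp add: powr_mult)
    also have "\<dots> \<le> t powr e" using assms e by (intro powr_mono2') auto
    finally show ?thesis using 1 by simp
  qed
  then show "t powr e \<le> B powr \<bar>e\<bar> * w powr e" "B powr - \<bar>e\<bar> * w powr e \<le> t powr e" by auto
qed

text \<open>The part of the weak norm over the annulus at scale \<open>k\<close> controls a superlevel set of the
  oscillation at that scale, and these annuli are disjoint.\<close>

lemma annuli_le_weak_norm:
  assumes p: "1 < p"
  shows "\<exists>K1>0. \<exists>K2>0. \<forall>f\<in>L1_loc M. \<forall>l>0. \<forall>I. finite I \<longrightarrow> I \<subseteq> {k0..} \<longrightarrow>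
    (\<Sum>k\<in>I. (\<integral>\<^sup>+x. (if K1 * (l * \<Phi> k x powr \<gamma>) < mean_osc M f x (scale k) / scale k
        then ennreal ((l * \<Phi> k x powr \<gamma>) powr p) else 0) \<partial>M))
    \<le> ennreal K2 * epowr (weak_Lp_norm M p (\<lambda>x y. \<phi> x y powr (\<gamma> * p) / vol M x y)
         (\<lambda>x y. mean_osc M f x (dist x y) / (dist x y * \<phi> x y powr \<gamma>))) p"
proof -
  obtain Ba where Ba: "1 \<le> Ba" "\<And>x y r s. 0 < r \<Longrightarrow> ball y s \<subseteq> ball x (a * r) \<Longrightarrow> V y s \<le> Ba * V x r"
    using V_scale[of a] by blast
  define B\<gamma> where "B\<gamma> = B powr \<bar>\<gamma>\<bar>"
  \<comment> \<open>One factor for each loss in passing from the scale s to a radius r in the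
    annulus: r < a s, then \<phi>^\<gamma> \<le> B\<gamma> \<Phi>^\<gamma>, and 2 Ba for the
    oscillation on the larger ball.\<close>
  define K1 where "K1 = a * B\<gamma> * (2 * Ba)"
  \<comment> \<open>1 - 1 / C0 is the least share of the annulus in its outer ball; the power of B
    compares the weights.\<close>
  define \<kappa> where "\<kappa> = B powr - \<bar>\<gamma> * p\<bar> * (1 - 1 / C0)"
  have B\<gamma>: "0 < B\<gamma>" using B by (simp add: B\<gamma>_def)
  have K1: "0 < K1" using a Ba B\<gamma> by (simp add: K1_def)
  have \<kappa>: "0 < \<kappa>" using B C0 by (simp add: \<kappa>_def)
  have main: "(\<Sum>k\<in>I. (\<integral>\<^sup>+x. (if K1 * (l * \<Phi> k x powr \<gamma>) < mean_osc M f x (scale k) / scale k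
        then ennreal ((l * \<Phi> k x powr \<gamma>) powr p) else 0) \<partial>M))
    \<le> ennreal (1 / \<kappa>) * epowr (weak_Lp_norm M p (\<lambda>x y. \<phi> x y powr (\<gamma> * p) / vol M x y)
         (\<lambda>x y. mean_osc M f x (dist x y) / (dist x y * \<phi> x y powr \<gamma>))) p"
    if f: "f \<in> L1_loc M" and l: "0 < l" and I: "finite I" "I \<subseteq> {k0..}" for f l I
  proof -
    note fm [measurable] = L1_locD(1)[OF f]
    define N where "N = weak_Lp_norm M p (\<lambda>x y. \<phi> x y powr (\<gamma> * p) / vol M x y)
         (\<lambda>x y. mean_osc M f x (dist x y) / (dist x y * \<phi> x y powr \<gamma>))"
    define E where "E = (\<lambda>x y. y \<noteq> x \<and> l < \<bar>mean_osc M f x (dist x y) / (dist x y * \<phi> x y powr \<gamma>)\<bar>)"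
    define Q where "Q = (\<integral>\<^sup>+x. (\<integral>\<^sup>+y. ennreal (\<phi> x y powr (\<gamma> * p) / vol M x y) * indicator {y. E x y} y \<partial>M) \<partial>M)"
    have "ennreal l * epowr Q (1 / p) \<le> N"
      unfolding N_def weak_Lp_norm_def Q_def E_def by (rule SUP_upper) (use l in simp)
    then have "epowr (ennreal l * epowr Q (1 / p)) p \<le> epowr N p" using p by (intro epowr_mono) auto
    then have QN: "ennreal (l powr p) * Q \<le> epowr N p"
      using l p by (simp add: epowr_mult epowr_inverse)
    define A where "A = (\<lambda>k (x :: 'a). {y. scale k \<le> dist x y \<and> dist x y < a * scale k})"
    define T where "T = (\<lambda>k x. if K1 * (l * \<Phi> k x powr \<gamma>) < mean_osc M f x (scale k) / scale k
        then ennreal ((l * \<Phi> k x powr \<gamma>) powr p) else 0)"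
    have [measurable]: "T k \<in> borel_measurable M" for k unfolding T_def by measurable
    have As: "A k x \<in> sets M" for k x
    proof -
      have "A k x = ball x (a * scale k) - ball x (scale k)" by (auto simp: A_def)
      then show ?thesis by simp
    qed
    have AV: "emeasure M (A k x) = ennreal (V x (a * scale k) - V x (scale k))" if "k \<in> I" for k x
    proof -
      have sub: "ball x (scale k) \<subseteq> ball x (a * scale k)" using a scale_pos[of k] by (intro subset_ball) auto
      have "A k x = ball x (a * scale k) - ball x (scale k)" by (auto simp: A_def)
      then have "emeasure M (A k x) = emeasure M (ball x (a * scale k)) - emeasure M (ball x (scale k))"
        using sub emeasure_ball_finite[of x "scale k"] by (simp add: emeasure_Diff)
      then show ?thesis by (simp add: emeasure_ball ennreal_minus)
    qed
    have disj: "A j x \<inter> A k x = {}" if "j \<noteq> k" for j k x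
    proof -
      have lt: "A j x \<inter> A k x = {}" if "j < k" for j k
      proof -
        have "a * scale k \<le> scale j"
        proof -
          obtain m where m: "k = Suc (j + m)" using \<open>j < k\<close> less_iff_Suc_add by auto
          have "a * scale k = (1 / a) ^ j * (1 / a) ^ m" using a by (simp add: scale_def m power_add)
          also have "\<dots> \<le> (1 / a) ^ j * 1" using a by (intro mult_left_mono power_le_one) auto
          finally show ?thesis by (simp add: scale_def)
        qed
        then show ?thesis by (auto simp: A_def)
      qed
      show ?thesis using lt[of j k] lt[of k j] that by (cases "j < k") auto
    qed
    have pt: "ennreal \<kappa> * T k x \<le> ennreal (l powr p) * (\<integral>\<^sup>+y. ennreal (\<phi> x y powr (\<gamma> * p) / vol M x y) * indicator {y. E x y} y * indicator (A k x) y \<partial>M)"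
      if k: "k \<in> I" for k x
    proof (cases "K1 * (l * \<Phi> k x powr \<gamma>) < mean_osc M f x (scale k) / scale k")
      case True
      define s W where "s = scale k" and "W = \<Phi> k x powr \<gamma>"
      have s: "0 < s" unfolding s_def by (rule scale_pos)
      have W: "0 < W" unfolding W_def using \<Phi>_pos[of k x] by simp
      have Vs: "0 < V x s" "0 < V x (a * s)" using s a by (auto intro: V_pos)
      \<comment> \<open>A large oscillation at scale s forces a large one at every radius of the
        annulus, so the whole annulus lies in the superlevel set.\<close>
      have inA: "E x y \<and> B powr - \<bar>\<gamma> * p\<bar> * W powr p / V x (a * s) \<le> \<phi> x y powr (\<gamma> * p) / vol M x y" if y: "y \<in> A k x" for y
      proof -
        have d: "s \<le> dist x y" "dist x y < a * s" using y by (auto simp: A_def s_def)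
        then have ne: "x \<noteq> y" using s by auto
        have cmp: "\<Phi> k x \<le> \<phi> x y" "\<phi> x y \<le> B * \<Phi> k x" using \<Phi>_compare[of k x y] d by (auto simp: s_def scale_def)
        define r where "r = dist x y"
        have r: "0 < r" "s \<le> r" "r < a * s" using d s by (auto simp: r_def)
        have "V x r \<le> Ba * V x s" using r s by (intro Ba(2) subset_ball) auto
        then have "mean_osc M f x s \<le> 2 * Ba * mean_osc M f x r"
          using r s by (intro mean_osc_mono(1)[OF f] subset_ball) auto
        moreover have "K1 * (l * W) * s < mean_osc M f x s"
          using True s by (simp add: s_def[symmetric] W_def[symmetric] pos_less_divide_eq)
        ultimately have "(2 * Ba) * (a * B\<gamma> * (l * W) * s) < (2 * Ba) * mean_osc M f x r"
          by (simp add: K1_def mult_ac)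
        then have o: "a * B\<gamma> * (l * W) * s < mean_osc M f x r" using Ba(1) by simp
        have "\<phi> x y powr \<gamma> \<le> B\<gamma> * W" unfolding B\<gamma>_def W_def by (rule powr_compare(1)[OF \<Phi>_pos cmp])
        then have "r * \<phi> x y powr \<gamma> \<le> (a * s) * (B\<gamma> * W)" using r B\<gamma> W s by (intro mult_mono) auto
        then have "l * (r * \<phi> x y powr \<gamma>) \<le> l * ((a * s) * (B\<gamma> * W))" using l by (intro mult_left_mono) auto
        also have "\<dots> < mean_osc M f x r" using o by (simp add: mult_ac)
        finally have "l < mean_osc M f x r / (r * \<phi> x y powr \<gamma>)"
          using r gauge_pos[OF ne] by (subst pos_less_divide_eq) auto
        then have "l < \<bar>mean_osc M f x r / (r * \<phi> x y powr \<gamma>)\<bar>" by (rule less_le_trans[OF _ abs_ge_self])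
        then have "E x y" using ne unfolding E_def r_def by blast
        moreover have "B powr - \<bar>\<gamma> * p\<bar> * W powr p / V x (a * s) \<le> \<phi> x y powr (\<gamma> * p) / vol M x y"
        proof (rule frac_le)
          have "B powr - \<bar>\<gamma> * p\<bar> * \<Phi> k x powr (\<gamma> * p) \<le> \<phi> x y powr (\<gamma> * p)" by (rule powr_compare(2)[OF \<Phi>_pos cmp])
          then show "B powr - \<bar>\<gamma> * p\<bar> * W powr p \<le> \<phi> x y powr (\<gamma> * p)" by (simp add: W_def powr_powr)
          show "0 < vol M x y" by (rule vol_pos[OF ne])
          show "vol M x y \<le> V x (a * s)" unfolding vol_def using r by (intro V_mono subset_ball) (simp add: r_def)
        qed simp
        ultimately show ?thesis by simp
      qed
      have "k0 \<le> k" using k I by auto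
      then have "C0 * V x s \<le> V x (a * s)" using annulus[of k x] by (simp add: s_def scale_def)
      then have "V x s / V x (a * s) \<le> 1 / C0" using Vs C0 by (simp add: field_simps)
      then have "1 - 1 / C0 \<le> (V x (a * s) - V x s) / V x (a * s)" using Vs by (simp add: diff_divide_distrib)
      then have "\<kappa> * W powr p \<le> B powr - \<bar>\<gamma> * p\<bar> * ((V x (a * s) - V x s) / V x (a * s)) * W powr p"
        unfolding \<kappa>_def by (intro mult_right_mono mult_left_mono) auto
      also have "\<dots> = B powr - \<bar>\<gamma> * p\<bar> * W powr p / V x (a * s) * (V x (a * s) - V x s)" by simp
      finally have "ennreal (\<kappa> * W powr p) \<le> ennreal (B powr - \<bar>\<gamma> * p\<bar> * W powr p / V x (a * s) * (V x (a * s) - V x s))"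
        by (rule ennreal_leI)
      also have "\<dots> = ennreal (B powr - \<bar>\<gamma> * p\<bar> * W powr p / V x (a * s)) * emeasure M (A k x)"
        unfolding AV[OF k] s_def[symmetric] using Vs by (intro ennreal_mult') auto
      also have "\<dots> = (\<integral>\<^sup>+y. ennreal (B powr - \<bar>\<gamma> * p\<bar> * W powr p / V x (a * s)) * indicator (A k x) y \<partial>M)"
        using As by (simp add: nn_integral_cmult_indicator)
      also have "\<dots> \<le> (\<integral>\<^sup>+y. ennreal (\<phi> x y powr (\<gamma> * p) / vol M x y) * indicator {y. E x y} y * indicator (A k x) y \<partial>M)"
      proof (rule nn_integral_mono)
        fix y
        show "ennreal (B powr - \<bar>\<gamma> * p\<bar> * W powr p / V x (a * s)) * indicator (A k x) y
          \<le> ennreal (\<phi> x y powr (\<gamma> * p) / vol M x y) * indicator {y. E x y} y * indicator (A k x) y"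
          using inA[of y] by (cases "y \<in> A k x") (auto intro: ennreal_leI)
      qed
      finally have "ennreal (l powr p) * ennreal (\<kappa> * W powr p) \<le> ennreal (l powr p) * (\<integral>\<^sup>+y. ennreal (\<phi> x y powr (\<gamma> * p) / vol M x y) * indicator {y. E x y} y * indicator (A k x) y \<partial>M)"
        by (rule mult_left_mono) simp
      moreover have "ennreal \<kappa> * T k x = ennreal (l powr p) * ennreal (\<kappa> * W powr p)"
        using True \<kappa> by (simp add: T_def W_def powr_mult ennreal_mult[symmetric] mult_ac)
      ultimately show ?thesis by simp
    qed (simp add: T_def)
    have Em [measurable]: "(\<lambda>y. ennreal (\<phi> x y powr (\<gamma> * p) / vol M x y) * indicator {y. E x y} y) \<in> borel_measurable M" for x
    proof -
      have "(\<lambda>y. if 0 < dist x y \<and> l < \<bar>mean_osc M f x (dist x y) / (dist x y * \<phi> x y powr \<gamma>)\<bar>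
         then ennreal (\<phi> x y powr (\<gamma> * p) / vol M x y) else 0) \<in> borel_measurable M" by measurable
      also have "(\<lambda>y. if 0 < dist x y \<and> l < \<bar>mean_osc M f x (dist x y) / (dist x y * \<phi> x y powr \<gamma>)\<bar>
         then ennreal (\<phi> x y powr (\<gamma> * p) / vol M x y) else 0) = (\<lambda>y. ennreal (\<phi> x y powr (\<gamma> * p) / vol M x y) * indicator {y. E x y} y)"
        by (intro ext) (auto simp: E_def)
      finally show ?thesis .
    qed
    have "ennreal \<kappa> * (\<Sum>k\<in>I. (\<integral>\<^sup>+x. T k x \<partial>M)) = (\<integral>\<^sup>+x. (\<Sum>k\<in>I. ennreal \<kappa> * T k x) \<partial>M)"
      by (simp add: nn_integral_sum nn_integral_cmult sum_distrib_left)
    also have "\<dots> \<le> (\<integral>\<^sup>+x. ennreal (l powr p) * (\<integral>\<^sup>+y. ennreal (\<phi> x y powr (\<gamma> * p) / vol M x y) * indicator {y. E x y} y \<partial>M) \<partial>M)"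
    proof (rule nn_integral_mono)
      fix x
      have "(\<Sum>k\<in>I. ennreal \<kappa> * T k x) \<le> (\<Sum>k\<in>I. ennreal (l powr p) * (\<integral>\<^sup>+y. ennreal (\<phi> x y powr (\<gamma> * p) / vol M x y) * indicator {y. E x y} y * indicator (A k x) y \<partial>M))"
        by (intro sum_mono pt)
      also have "\<dots> = ennreal (l powr p) * (\<integral>\<^sup>+y. (\<Sum>k\<in>I. ennreal (\<phi> x y powr (\<gamma> * p) / vol M x y) * indicator {y. E x y} y * indicator (A k x) y) \<partial>M)"
        using As by (simp add: nn_integral_sum sum_distrib_left)
      also have "\<dots> \<le> ennreal (l powr p) * (\<integral>\<^sup>+y. ennreal (\<phi> x y powr (\<gamma> * p) / vol M x y) * indicator {y. E x y} y \<partial>M)"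
      proof (intro mult_left_mono nn_integral_mono)
        fix y
        \<comment> \<open>The annuli about x are disjoint, so summing over all scales costs no more
          than one superlevel set.\<close>
        have "(\<Sum>k\<in>I. indicator (A k x) y :: ennreal) = indicator (\<Union>k\<in>I. A k x) y"
          using disj I(1) by (intro indicator_UN_disjoint[symmetric]) (auto simp: disjoint_family_on_def)
        also have "\<dots> \<le> 1" by (auto simp: indicator_def)
        finally show "(\<Sum>k\<in>I. ennreal (\<phi> x y powr (\<gamma> * p) / vol M x y) * indicator {y. E x y} y * indicator (A k x) y)
          \<le> ennreal (\<phi> x y powr (\<gamma> * p) / vol M x y) * indicator {y. E x y} y"
          unfolding sum_distrib_left[symmetric] by (rule mult_left_le) simp
      qed simp
      finally show "(\<Sum>k\<in>I. ennreal \<kappa> * T k x) \<le> ennreal (l powr p) * (\<integral>\<^sup>+y. ennreal (\<phi> x y powr (\<gamma> * p) / vol M x y) * indicator {y. E x y} y \<partial>M)" .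
    qed
    also have "\<dots> \<le> ennreal (l powr p) * Q"
    proof -
      have "(\<lambda>x. \<integral>\<^sup>+y. (if 0 < dist x y \<and> l < \<bar>mean_osc M f x (dist x y) / (dist x y * \<phi> x y powr \<gamma>)\<bar>
         then ennreal (\<phi> x y powr (\<gamma> * p) / vol M x y) else 0) \<partial>M) \<in> borel_measurable M" by measurable
      also have "(\<lambda>x. \<integral>\<^sup>+y. (if 0 < dist x y \<and> l < \<bar>mean_osc M f x (dist x y) / (dist x y * \<phi> x y powr \<gamma>)\<bar>
         then ennreal (\<phi> x y powr (\<gamma> * p) / vol M x y) else 0) \<partial>M) = (\<lambda>x. \<integral>\<^sup>+y. ennreal (\<phi> x y powr (\<gamma> * p) / vol M x y) * indicator {y. E x y} y \<partial>M)"
        by (intro ext nn_integral_cong) (auto simp: E_def)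
      finally show ?thesis unfolding Q_def by (simp add: nn_integral_cmult)
    qed
    also have "\<dots> \<le> epowr N p" by (rule QN)
    finally have "ennreal (1 / \<kappa>) * (ennreal \<kappa> * (\<Sum>k\<in>I. (\<integral>\<^sup>+x. T k x \<partial>M))) \<le> ennreal (1 / \<kappa>) * epowr N p"
      by (rule mult_left_mono) simp
    then have "(\<Sum>k\<in>I. (\<integral>\<^sup>+x. T k x \<partial>M)) \<le> ennreal (1 / \<kappa>) * epowr N p"
      using \<kappa> by (simp add: mult.assoc[symmetric] ennreal_mult[symmetric])
    then show ?thesis unfolding N_def T_def .
  qed
  have "0 < 1 / \<kappa>" using \<kappa> by simp
  with K1 show ?thesis using main by blast
qed

text \<open>Averaging over the scales \<open>L, \<dots>, 2 L - 1\<close> and over the levels \<open>2\<^sup>j\<close>, whose number is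
  proportional to \<open>L\<close>, produces a scale at which the difference quotient of the truncated function
  is bounded in \<open>L\<^sup>p\<close> away from its small values.\<close>

lemma good_scale:
  assumes p: "1 < p"
  shows "\<exists>K3>0. \<exists>K2>0. \<forall>f\<in>L1_loc M. \<forall>A>0. \<forall>n>0. \<forall>\<delta>>0. \<forall>R. \<forall>L0::nat.
    ennreal K2 * epowr (weak_Lp_norm M p (\<lambda>x y. \<phi> x y powr (\<gamma> * p) / vol M x y)
         (\<lambda>x y. mean_osc M f x (dist x y) / (dist x y * \<phi> x y powr \<gamma>))) p \<le> ennreal A \<longrightarrow>
    (\<exists>k\<ge>L0. (\<integral>\<^sup>+x. (if dist x0 x < R \<and> \<delta> < mean_osc M (truncate n f) x (scale k) / scale k
        then ennreal ((mean_osc M (truncate n f) x (scale k) / scale k) powr p) else 0) \<partial>M) \<le> ennreal (K3 * A))"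
proof -
  obtain K1 K2 where K1: "0 < K1" and K2: "0 < K2" and K: "\<And>f l I. f \<in> L1_loc M \<Longrightarrow> 0 < l \<Longrightarrow> finite I \<Longrightarrow> I \<subseteq> {k0..} \<Longrightarrow>
    (\<Sum>k\<in>I. (\<integral>\<^sup>+x. (if K1 * (l * \<Phi> k x powr \<gamma>) < mean_osc M f x (scale k) / scale k
        then ennreal ((l * \<Phi> k x powr \<gamma>) powr p) else 0) \<partial>M))
    \<le> ennreal K2 * epowr (weak_Lp_norm M p (\<lambda>x y. \<phi> x y powr (\<gamma> * p) / vol M x y)
         (\<lambda>x y. mean_osc M f x (dist x y) / (dist x y * \<phi> x y powr \<gamma>))) p"
    using annuli_le_weak_norm[OF p, of \<gamma>] by (elim exE conjE bexE) (rule that; blast)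
  \<comment> \<open>Growth per scale of the logarithm of the relevant height: log a from the
    quotient and |\<gamma>| log B from \<Phi>^\<gamma>.\<close>
  define \<alpha> where "\<alpha> = log 2 a + \<bar>\<gamma>\<bar> * log 2 B"
  have \<alpha>: "0 \<le> \<alpha>" using a B by (simp add: \<alpha>_def)
  \<comment> \<open>Scales below 2 L contribute at most 2 L \<alpha>, and one further L absorbs the
    terms independent of the scale; this gives |j| \<le> m L.\<close>
  define m where "m = nat \<lceil>2 * \<alpha> + 1\<rceil>"
  have m: "2 * \<alpha> + 1 \<le> real m" unfolding m_def using \<alpha> by linarith
  define K3 where "K3 = (4 * K1) powr p * (2 * real m + 1)"
  have K3: "0 < K3" using K1 by (simp add: K3_def)
  have main: "\<exists>k\<ge>L0. (\<integral>\<^sup>+x. (if dist x0 x < R \<and> \<delta> < mean_osc M (truncate n f) x (scale k) / scale k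
        then ennreal ((mean_osc M (truncate n f) x (scale k) / scale k) powr p) else 0) \<partial>M) \<le> ennreal (K3 * A)"
    if f: "f \<in> L1_loc M" and A: "0 < A" and n: "0 < n" and \<delta>: "0 < \<delta>"
      and NA: "ennreal K2 * epowr (weak_Lp_norm M p (\<lambda>x y. \<phi> x y powr (\<gamma> * p) / vol M x y)
         (\<lambda>x y. mean_osc M f x (dist x y) / (dist x y * \<phi> x y powr \<gamma>))) p \<le> ennreal A"
    for f A n \<delta> R and L0 :: nat
  proof -
    note fm [measurable] = L1_locD(1)[OF f]
    have [measurable]: "truncate n f \<in> borel_measurable M" by (rule truncate_measurable[OF fm])
    have n0: "0 \<le> n" using n by simp
    have tf: "truncate n f \<in> L1_loc M"
      using truncate_measurable[OF fm] truncate_bounded[OF n0] by (rule L1_loc_bounded)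
    obtain c where c: "0 < c" "\<And>x k. dist x0 x < R \<Longrightarrow> c * (1 / B) ^ k \<le> \<Phi> k x \<and> \<Phi> k x \<le> 1 / c"
      using \<Phi>_bounds[of x0 R] by auto
    \<comment> \<open>The terms independent of the scale, to be absorbed by L; the final 1 pays for
      rounding the logarithm to the integer j.\<close>
    define E where "E = \<bar>log 2 \<delta>\<bar> + \<bar>log 2 (2 * n)\<bar> + \<bar>log 2 (2 * K1)\<bar> + \<bar>\<gamma>\<bar> * \<bar>log 2 c\<bar> + 1"
    define L where "L = Max {L0, k0, nat \<lceil>E\<rceil>, 1}"
    have L: "L0 \<le> L" "k0 \<le> L" "E \<le> real L" "1 \<le> L"
    proof -
      have "nat \<lceil>E\<rceil> \<le> L" unfolding L_def by (rule Max_ge) auto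
      then show "E \<le> real L" by linarith
    qed (unfold L_def; intro Max_ge; auto)+
    define g where "g = (\<lambda>k x. mean_osc M (truncate n f) x (scale k) / scale k)"
    have [measurable]: "g k \<in> borel_measurable M" for k unfolding g_def by measurable
    define F where "F = (\<lambda>k x. if dist x0 x < R \<and> \<delta> < g k x then ennreal (g k x powr p) else 0)"
    define J where "J = {- int (m * L) .. int (m * L)}"
    define T where "T = (\<lambda>j k x. if K1 * (2 powr real_of_int j * \<Phi> k x powr \<gamma>) < mean_osc M f x (scale k) / scale k
        then ennreal ((2 powr real_of_int j * \<Phi> k x powr \<gamma>) powr p) else 0)"
    have [measurable]: "T j k \<in> borel_measurable M" for j k unfolding T_def by measurable
    have FT: "F k x \<le> ennreal ((4 * K1) powr p) * (\<Sum>j\<in>J. T j k x)" if k: "k \<in> {L..<2 * L}" for k x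
    proof (cases "dist x0 x < R \<and> \<delta> < g k x")
      case True
      \<comment> \<open>j is the integer with 2^j < X \<le> 2^(j + 1). The 2 inside X pays for the
        truncation, which may double the oscillation; the further 2 in 4 K1 pays for rounding to a
        power of two.\<close>
      define W X j where "W = \<Phi> k x powr \<gamma>" and "X = g k x / (2 * K1 * W)" and "j = \<lceil>log 2 X\<rceil> - 1"
      have \<Phi>0: "0 < \<Phi> k x" by (rule \<Phi>_pos)
      then have W: "0 < W" by (simp add: W_def)
      have gk: "0 < g k x" using True \<delta> by linarith
      then have X: "0 < X" using K1 W by (simp add: X_def)
      have j: "real_of_int j < log 2 X" "log 2 X \<le> real_of_int j + 1" unfolding j_def by linarith+
      have jX: "2 powr real_of_int j < X" using j(1) X by (simp add: less_log_iff)
      have Xj: "X \<le> 2 * 2 powr real_of_int j"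
      proof -
        have "X \<le> 2 powr (real_of_int j + 1)" using j(2) X by (simp add: log_le_iff)
        then show ?thesis by (simp add: powr_add)
      qed
      have "g k x \<le> 2 * (mean_osc M f x (scale k) / scale k)"
        unfolding g_def using mean_osc_truncate(1)[OF f scale_pos n0, of x k] scale_pos[of k] by (simp add: divide_right_mono)
      moreover have "K1 * (2 powr real_of_int j * W) < g k x / 2"
      proof -
        have "2 * K1 * W * 2 powr real_of_int j < 2 * K1 * W * X" using jX K1 W by (intro mult_strict_left_mono) auto
        also have "\<dots> = g k x" using K1 W by (simp add: X_def)
        finally show ?thesis by (simp add: mult_ac)
      qed
      ultimately have T: "T j k x = ennreal ((2 powr real_of_int j * W) powr p)" by (simp add: T_def W_def)
      have "g k x = 2 * K1 * W * X" using K1 W by (simp add: X_def)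
      also have "\<dots> \<le> 2 * K1 * W * (2 * 2 powr real_of_int j)" using Xj K1 W by (intro mult_left_mono) auto
      also have "\<dots> = 4 * K1 * (2 powr real_of_int j * W)" by simp
      finally have "g k x powr p \<le> (4 * K1 * (2 powr real_of_int j * W)) powr p" using gk p by (intro powr_mono2) auto
      also have "\<dots> = (4 * K1) powr p * (2 powr real_of_int j * W) powr p" by (rule powr_mult)
      finally have FTj: "F k x \<le> ennreal ((4 * K1) powr p) * T j k x"
        using True by (simp add: F_def T ennreal_mult[symmetric] ennreal_leI)
      have "j \<in> J"
      proof -
        have logX: "log 2 X = log 2 (g k x) - log 2 (2 * K1) - \<gamma> * log 2 (\<Phi> k x)"
          using gk K1 W \<Phi>0 by (simp add: X_def W_def log_divide log_mult log_powr)
        have "g k x \<le> 2 * n / scale k"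
          unfolding g_def using mean_osc_truncate(2)[OF f scale_pos n0, of x k] scale_pos[of k] by (simp add: divide_right_mono)
        also have "\<dots> = 2 * n * a ^ k" by (simp add: scale_def power_divide)
        finally have "log 2 (g k x) \<le> log 2 (2 * n * a ^ k)" using gk by simp
        also have "\<dots> = log 2 (2 * n) + real k * log 2 a" using n a by (simp add: log_mult log_nat_power)
        finally have g1: "log 2 (g k x) \<le> log 2 (2 * n) + real k * log 2 a" .
        have g2: "log 2 \<delta> \<le> log 2 (g k x)" using True \<delta> gk by simp
        have la: "0 \<le> real k * log 2 a" "0 \<le> real k * log 2 B" using a B by auto
        have lg: "\<bar>log 2 (g k x)\<bar> \<le> \<bar>log 2 \<delta>\<bar> + \<bar>log 2 (2 * n)\<bar> + real k * log 2 a" using g1 g2 la by linarith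
        have \<Phi>b: "c * (1 / B) ^ k \<le> \<Phi> k x" "\<Phi> k x \<le> 1 / c" using c(2)[of x k] True by auto
        have "log 2 (c * (1 / B) ^ k) \<le> log 2 (\<Phi> k x)" using \<Phi>b(1) c B \<Phi>0 by simp
        moreover have "log 2 (c * (1 / B) ^ k) = log 2 c - real k * log 2 B"
          using c B by (simp add: log_mult log_nat_power log_divide)
        moreover have "log 2 (\<Phi> k x) \<le> log 2 (1 / c)" using \<Phi>b(2) c \<Phi>0 by simp
        moreover have "log 2 (1 / c) = - log 2 c" using c by (simp add: log_divide)
        ultimately have l\<Phi>: "\<bar>log 2 (\<Phi> k x)\<bar> \<le> \<bar>log 2 c\<bar> + real k * log 2 B" using la by linarith
        have "\<bar>\<gamma> * log 2 (\<Phi> k x)\<bar> \<le> \<bar>\<gamma>\<bar> * (\<bar>log 2 c\<bar> + real k * log 2 B)"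
          unfolding abs_mult using l\<Phi> by (rule mult_left_mono) simp
        then have "\<bar>\<gamma> * log 2 (\<Phi> k x)\<bar> \<le> \<bar>\<gamma>\<bar> * \<bar>log 2 c\<bar> + real k * (\<bar>\<gamma>\<bar> * log 2 B)"
          by (simp add: distrib_left mult_ac)
        then have "\<bar>log 2 X\<bar> \<le> (E - 1) + (real k * log 2 a + real k * (\<bar>\<gamma>\<bar> * log 2 B))"
          unfolding logX E_def using lg by linarith
        also have "real k * log 2 a + real k * (\<bar>\<gamma>\<bar> * log 2 B) = real k * \<alpha>" by (simp add: \<alpha>_def distrib_left)
        also have "real k * \<alpha> \<le> (2 * real L) * \<alpha>" using k \<alpha> by (intro mult_right_mono) auto
        finally have "\<bar>log 2 X\<bar> + 1 \<le> E + (2 * real L) * \<alpha>" by simp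
        also have "\<dots> \<le> real L * 1 + real L * (2 * \<alpha>)" using L(3) by (simp add: mult_ac)
        also have "\<dots> = real L * (2 * \<alpha> + 1)" by (simp add: distrib_left)
        also have "\<dots> \<le> real L * real m" using m by (intro mult_left_mono) auto
        finally have "\<bar>log 2 X\<bar> + 1 \<le> real (m * L)" by (simp add: mult.commute)
        then have "real_of_int \<bar>j\<bar> \<le> real (m * L)" using j by linarith
        then have "\<bar>j\<bar> \<le> int (m * L)" by linarith
        then show ?thesis by (auto simp: J_def)
      qed
      then have "T j k x \<le> (\<Sum>j\<in>J. T j k x)" by (intro member_le_sum) (auto simp: J_def)
      then have "ennreal ((4 * K1) powr p) * T j k x \<le> ennreal ((4 * K1) powr p) * (\<Sum>j\<in>J. T j k x)" by (rule mult_left_mono) simp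
      then show ?thesis using FTj by (rule order_trans[rotated])
    next
      case False
      show ?thesis unfolding F_def if_not_P[OF False] by simp
    qed
    have cardJ: "real (card J) \<le> real L * (2 * real m + 1)"
    proof -
      have "card J = nat (2 * int (m * L) + 1)" by (simp add: J_def mult.commute)
      then have "real (card J) = 2 * real (m * L) + 1" by simp
      also have "\<dots> \<le> 2 * real (m * L) + real L" using L(4) by simp
      also have "\<dots> = real L * (2 * real m + 1)" by (simp add: distrib_left mult_ac)
      finally show ?thesis .
    qed
    have "(\<Sum>k\<in>{L..<2 * L}. (\<integral>\<^sup>+x. F k x \<partial>M)) \<le> (\<Sum>k\<in>{L..<2 * L}. (\<integral>\<^sup>+x. ennreal ((4 * K1) powr p) * (\<Sum>j\<in>J. T j k x) \<partial>M))"
      by (intro sum_mono nn_integral_mono FT)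
    also have "\<dots> = ennreal ((4 * K1) powr p) * (\<Sum>k\<in>{L..<2 * L}. \<Sum>j\<in>J. (\<integral>\<^sup>+x. T j k x \<partial>M))"
      by (simp add: nn_integral_cmult nn_integral_sum sum_distrib_left)
    also have "\<dots> = ennreal ((4 * K1) powr p) * (\<Sum>j\<in>J. \<Sum>k\<in>{L..<2 * L}. (\<integral>\<^sup>+x. T j k x \<partial>M))"
      by (subst sum.swap) simp
    also have "\<dots> \<le> ennreal ((4 * K1) powr p) * (\<Sum>j\<in>J. ennreal A)"
    proof (intro mult_left_mono sum_mono)
      fix j
      show "(\<Sum>k\<in>{L..<2 * L}. (\<integral>\<^sup>+x. T j k x \<partial>M)) \<le> ennreal A"
        unfolding T_def using L by (intro order_trans[OF K[OF f] NA]) auto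
    qed simp
    also have "\<dots> = ennreal ((4 * K1) powr p * (real (card J) * A))"
      using A by (simp add: ennreal_mult ennreal_of_nat_eq_real_of_nat)
    also have "\<dots> \<le> ennreal ((4 * K1) powr p * (real L * (2 * real m + 1) * A))"
      using cardJ A by (intro ennreal_leI mult_left_mono mult_right_mono) auto
    also have "(4 * K1) powr p * (real L * (2 * real m + 1) * A) = real L * (K3 * A)" by (simp add: K3_def mult_ac)
    finally have sum: "(\<Sum>k\<in>{L..<2 * L}. (\<integral>\<^sup>+x. F k x \<partial>M)) \<le> ennreal (real L * (K3 * A))" .
    have "\<exists>k\<in>{L..<2 * L}. (\<integral>\<^sup>+x. F k x \<partial>M) \<le> ennreal (K3 * A)"
    proof -
      \<comment> \<open>The least of the L integrals is at most their mean.\<close>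
      define S where "S = (\<lambda>k. \<integral>\<^sup>+x. F k x \<partial>M) ` {L..<2 * L}"
      have "S \<noteq> {}" "finite S" using L(4) by (auto simp: S_def)
      then have "Min S \<in> S" by (rule Min_in[rotated])
      then obtain k where k: "k \<in> {L..<2 * L}" "(\<integral>\<^sup>+x. F k x \<partial>M) = Min S" by (auto simp: S_def)
      have "of_nat (card {L..<2 * L}) * Min S \<le> (\<Sum>k\<in>{L..<2 * L}. (\<integral>\<^sup>+x. F k x \<partial>M))"
        by (intro sum_bounded_below Min_le) (auto simp: S_def)
      then have "ennreal (real L) * Min S \<le> ennreal (real L * (K3 * A))"
        using sum by (simp add: ennreal_of_nat_eq_real_of_nat)
      then have "ennreal (1 / real L) * (ennreal (real L) * Min S) \<le> ennreal (1 / real L) * ennreal (real L * (K3 * A))"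
        by (rule mult_left_mono) simp
      then have "Min S \<le> ennreal (K3 * A)"
        using L(4) K3 A by (simp add: mult.assoc[symmetric] ennreal_mult[symmetric])
      then show ?thesis using k by (intro bexI[of _ k]) auto
    qed
    then obtain k where k: "L \<le> k" "(\<integral>\<^sup>+x. F k x \<partial>M) \<le> ennreal (K3 * A)" by auto
    show ?thesis
      using order_trans[OF L(1) k(1)] k(2)[unfolded F_def g_def] by (rule exI[of _ k, OF conjI])
  qed
  show ?thesis using K3 K2 main by blast
qed

end

section \<open>From good scales to a weak upper gradient\<close>

lemma curve_integral_cmult:
  assumes c: "c \<in> AC_curves" and g: "g \<in> borel_measurable borel"
  shows "curve_integral c (\<lambda>x. b * g x) = b * curve_integral c g"
proof -
  have "curve_integral c (\<lambda>x. b * g x) = (\<integral>\<^sup>+t. b * (g (c t) * ennreal (metric_speed c t) * indicator {0<..<1} t) \<partial>lborel)"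
    unfolding curve_integral_def by (simp add: mult.assoc)
  also have "\<dots> = b * curve_integral c g"
    unfolding curve_integral_def using curve_weight_measurable[OF c g] by (intro nn_integral_cmult) simp
  finally show ?thesis .
qed

lemma curve_integral_sum:
  assumes c: "c \<in> AC_curves" and g: "\<And>i. g i \<in> borel_measurable borel"
  shows "curve_integral c (\<lambda>x. \<Sum>i\<in>I. g i x) = (\<Sum>i\<in>I. curve_integral c (g i))"
proof -
  have "curve_integral c (\<lambda>x. \<Sum>i\<in>I. g i x) = (\<integral>\<^sup>+t. (\<Sum>i\<in>I. g i (c t) * ennreal (metric_speed c t) * indicator {0<..<1} t) \<partial>lborel)"
    unfolding curve_integral_def by (simp only: sum_distrib_right)
  also have "\<dots> = (\<Sum>i\<in>I. curve_integral c (g i))"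
    unfolding curve_integral_def using curve_weight_measurable[OF c g] by (intro nn_integral_sum) simp
  finally show ?thesis .
qed

lemma curve_integral_mono:
  "(\<And>t. t \<in> {0<..<1} \<Longrightarrow> g (c t) \<le> h (c t)) \<Longrightarrow> curve_integral c g \<le> curve_integral c h"
  unfolding curve_integral_def
  by (intro nn_integral_mono) (auto simp: indicator_def intro: mult_right_mono)

lemma nn_integral_speed:
  assumes c: "c \<in> AC_curves"
  shows "(\<integral>\<^sup>+t. ennreal (metric_speed c t) * indicator {0<..<1} t \<partial>lborel) = ennreal (LINT t:{0<..<1}|lborel. metric_speed c t)"
proof -
  have i: "integrable lborel (\<lambda>t. indicator {0<..<1} t * metric_speed c t)"
    using speed_bound_metric_speed[OF c] by (simp add: speed_bound_def set_integrable_def)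
  have "(\<integral>\<^sup>+t. ennreal (metric_speed c t) * indicator {0<..<1} t \<partial>lborel) = (\<integral>\<^sup>+t. ennreal (indicator {0<..<1} t * metric_speed c t) \<partial>lborel)"
    by (rule nn_integral_cong) (auto simp: indicator_def)
  also have "\<dots> = ennreal (LINT t:{0<..<1}|lborel. metric_speed c t)"
    unfolding set_lebesgue_integral_def real_scaleR_def
  proof (rule nn_integral_eq_integral[OF i])
    show "AE t in lborel. 0 \<le> indicator {0<..<1} t * metric_speed c t"
      using metric_speed_nonneg[OF c] by eventually_elim (auto simp: indicator_def)
  qed
  finally show ?thesis .
qed

lemma curve_bounded:
  fixes c :: "real \<Rightarrow> 'a::metric_space"
  assumes "c \<in> AC_curves"
  shows "\<exists>R. \<forall>t\<in>{0..1}. dist x0 (c t) < R"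
proof -
  have "continuous_on {0..1} c" using assms by (intro AC_curves_continuous) (simp add: AC_curves_def)
  then have "bounded (c ` {0..1})" by (intro compact_imp_bounded compact_continuous_image) auto
  then obtain R where "\<forall>y\<in>c ` {0..1}. dist x0 y \<le> R" by (auto simp: bounded_any_center[of _ x0])
  then show ?thesis by (intro exI[of _ "R + 1"]) force
qed

text \<open>Each time marginal of a test plan is at most a multiple of the reference measure, so it
  does not charge N.\<close>

lemma negligible_curves_endpoints:
  fixes M :: "'a::metric_space measure"
  assumes sM: "sets M = sets borel" and N: "N \<in> null_sets M"
  shows "negligible_curves M p {c \<in> space curve_borel. c 0 \<in> N \<or> c 1 \<in> N}"
proof -
  have Nb: "N \<in> sets borel" using N sM by auto
  have m: "{c \<in> space curve_borel. c t \<in> N} \<in> sets curve_borel" if "t \<in> {0..1}" for t :: real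
    using measurable_sets[OF measurable_curve_eval[OF that] Nb] by (simp add: vimage_def Int_def conj_commute)
  have eq: "{c \<in> space curve_borel. c 0 \<in> N \<or> c 1 \<in> N} = {c \<in> space curve_borel. c 0 \<in> N} \<union> {c \<in> space curve_borel. c 1 \<in> N}" by auto
  have "negligible_curves M p {c \<in> space curve_borel. c t \<in> N}" if t: "t \<in> {0..1}" for t
    unfolding negligible_curves_def
  proof (intro conjI allI impI m t)
    fix \<pi> assume \<pi>: "test_plan M (p / (p - 1)) \<pi>"
    then obtain C where "\<forall>t\<in>{0..1}. \<forall>A\<in>sets borel. emeasure \<pi> {c \<in> space \<pi>. c t \<in> A} \<le> ennreal C * emeasure M A"
      unfolding test_plan_def by blast
    then have C: "emeasure \<pi> {c \<in> space \<pi>. c t \<in> N} \<le> ennreal C * emeasure M N" using t Nb by blast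
    have "space \<pi> = space curve_borel" using \<pi> by (intro sets_eq_imp_space_eq) (simp add: test_plan_def)
    then show "emeasure \<pi> {c \<in> space curve_borel. c t \<in> N} = 0" using C null_setsD1[OF N] by simp
  qed
  then show ?thesis unfolding eq by (intro negligible_curves_Un) auto
qed

context scaled_gauge begin

text \<open>Truncation height n + 1, threshold 1 / (n + 1) and radius n + 1 are relaxed together,
  and the scale at stage n is at most a^(-n); all errors then vanish or are summable along the
  sequence.\<close>

lemma gradient_from_good_scales:
  assumes p: "1 < p" and f: "f \<in> L1_loc M" and A: "0 < A"
    and good: "\<And>n \<delta> R. \<And>L0::nat. 0 < n \<Longrightarrow> 0 < \<delta> \<Longrightarrow>
      \<exists>k\<ge>L0. (\<integral>\<^sup>+x. (if dist x0 x < R \<and> \<delta> < mean_osc M (truncate n f) x (scale k) / scale k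
        then ennreal ((mean_osc M (truncate n f) x (scale k) / scale k) powr p) else 0) \<partial>M) \<le> ennreal A"
  shows "\<exists>g\<in>Lp_weak_upper_gradients M p f. Lp_norm M p g \<le> ennreal (6 * D ^ 3 * (3 * 2 powr p * A) powr (1 / p))"
proof -
  note fm [measurable] = L1_locD(1)[OF f]
  \<comment> \<open>The estimate along curves has the factor 2 D^3 / r, and r is a third of the
    scale.\<close>
  define K where "K = 6 * D ^ 3"
  have K: "0 < K" using D_pos by (simp add: K_def)
  define \<delta> where "\<delta> = (\<lambda>n::nat. 1 / real (Suc n))"
  define fn where "fn = (\<lambda>n::nat. truncate (real (Suc n)) f)"
  have fnm [measurable]: "fn n \<in> borel_measurable M" for n unfolding fn_def by (rule truncate_measurable[OF fm])
  have fnL: "fn n \<in> L1_loc M" for n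
    unfolding fn_def using truncate_measurable[OF fm] truncate_bounded[of "real (Suc n)" f] by (intro L1_loc_bounded) auto
  define Z where "Z = (\<lambda>n k. (\<integral>\<^sup>+x. (if dist x0 x < real (Suc n) \<and> \<delta> n < mean_osc M (fn n) x (scale k) / scale k
        then ennreal ((mean_osc M (fn n) x (scale k) / scale k) powr p) else 0) \<partial>M))"
  have "\<exists>k\<ge>n. Z n k \<le> ennreal A" for n
    unfolding Z_def fn_def by (rule good) (auto simp: \<delta>_def)
  then have "\<exists>k. \<forall>n. n \<le> k n \<and> Z n (k n) \<le> ennreal A" by (intro choice allI) blast
  then obtain k where k: "\<And>n. n \<le> k n" "\<And>n. Z n (k n) \<le> ennreal A" by blast
  define s where "s = (\<lambda>n. scale (k n))"
  have s0: "0 < s n" for n unfolding s_def by (rule scale_pos)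
  have sa: "s n \<le> (1 / a) ^ n" for n unfolding s_def scale_def using a k(1)[of n] by (intro power_decreasing) auto
  have s1: "s n \<le> 1" for n
  proof -
    have "(1 / a) ^ n \<le> 1" using a by (intro power_le_one) auto
    then show ?thesis using sa[of n] by linarith
  qed
  define r where "r = (\<lambda>n. s n / 3)"
  have r: "0 < r n" "r n \<le> 1" "3 * r n = s n" for n using s0[of n] s1[of n] by (auto simp: r_def)
  define q where "q = (\<lambda>n x. mean_osc M (fn n) x (s n) / s n)"
  have q0: "0 \<le> q n x" for n x unfolding q_def using mean_osc_nn_integral(2)[OF fnL s0] s0[of n] by simp
  have qm [measurable]: "q n \<in> borel_measurable M" for n unfolding q_def by measurable
  \<comment> \<open>G omits the quotient outside a ball and below the threshold. Inside the ball
    this loses at most \<delta> n, which along a curve integrates to \<delta> n times its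
    length.\<close>
  define G where "G = (\<lambda>n x. if dist x0 x < real (Suc n) \<and> \<delta> n < q n x then q n x else 0)"
  have Gm [measurable]: "G n \<in> borel_measurable M" for n unfolding G_def by measurable
  have G0: "0 \<le> G n x" for n x using q0 by (simp add: G_def)
  have Gp: "(\<integral>\<^sup>+x. ennreal (G n x powr p) \<partial>M) \<le> ennreal A" for n
  proof -
    have "(\<integral>\<^sup>+x. ennreal (G n x powr p) \<partial>M) = (\<integral>\<^sup>+x. (if dist x0 x < real (Suc n) \<and> \<delta> n < mean_osc M (fn n) x (scale (k n)) / scale (k n)
        then ennreal ((mean_osc M (fn n) x (scale (k n)) / scale (k n)) powr p) else 0) \<partial>M)"
      by (rule nn_integral_cong) (simp add: G_def q_def s_def)
    then show ?thesis using k(2)[of n] unfolding Z_def by simp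
  qed
  have qG: "q n x \<le> G n x + \<delta> n" if "dist x0 x < real (Suc n)" for n x
    using that G0[of n x] by (auto simp: G_def \<delta>_def)
  define u where "u = (\<lambda>n x. average M (ball x (r n)) (fn n))"
  have um [measurable]: "u n \<in> borel_measurable M" for n unfolding u_def by (rule average_ball_measurable[OF fnm])

  have conv_ball: "AE x in M. x \<in> ball x0 (real R) \<longrightarrow> (\<lambda>n. u n x) \<longlonglongrightarrow> f x" for R :: nat
  proof -
    \<comment> \<open>The shift by R + 1 ensures that the ball of radius R + 1 lies in the region
      where the quotient is at most G plus the threshold.\<close>
    define w where "w = (\<lambda>n x. \<bar>fn (n + Suc R) x - u (n + Suc R) x\<bar>)"
    define Y where "Y = (D ^ 3 + D ^ 4) * (2 * V x0 (real R + 1) + A)"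
    have Y: "0 \<le> Y" using D_pos A by (auto simp: Y_def intro!: mult_nonneg_nonneg add_nonneg_nonneg)
    have wb: "(\<integral>\<^sup>+x\<in>ball x0 (real R). ennreal (w n x) \<partial>M) \<le> ennreal (Y * (1 / a) ^ n)" for n
    proof -
      define N where "N = n + Suc R"
      have "(\<integral>\<^sup>+x\<in>ball x0 (real R). ennreal (w n x) \<partial>M)
         \<le> ennreal (D ^ 3 + D ^ 4) * (\<integral>\<^sup>+y\<in>ball x0 (real R + 1). ennreal (mean_osc M (fn N) y (3 * r N)) \<partial>M)"
        unfolding w_def u_def N_def[symmetric] by (rule average_approximation[OF fnL r(1,2)])
      also have "(\<integral>\<^sup>+y\<in>ball x0 (real R + 1). ennreal (mean_osc M (fn N) y (3 * r N)) \<partial>M)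
        \<le> (\<integral>\<^sup>+y. ennreal (s N) * (ennreal 2 * indicator (ball x0 (real R + 1)) y + ennreal (G N y powr p)) \<partial>M)"
      proof (rule nn_integral_mono)
        fix y
        show "ennreal (mean_osc M (fn N) y (3 * r N)) * indicator (ball x0 (real R + 1)) y
          \<le> ennreal (s N) * (ennreal 2 * indicator (ball x0 (real R + 1)) y + ennreal (G N y powr p))"
        proof (cases "y \<in> ball x0 (real R + 1)")
          case True
          then have "dist x0 y < real (Suc N)" by (simp add: N_def)
          then have "q N y \<le> G N y + \<delta> N" by (rule qG)
          moreover have "\<delta> N \<le> 1" by (simp add: \<delta>_def)
          \<comment> \<open>Only the integral of the p-th power of G is controlled; on a ball of
            finite measure this suffices for G itself.\<close>
          moreover have "G N y \<le> 1 + G N y powr p"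
          proof (cases "G N y \<le> 1")
            case False
            then have "G N y powr 1 \<le> G N y powr p" using p by (intro powr_mono) auto
            then show ?thesis using False by simp
          qed (simp add: add_increasing2)
          ultimately have "q N y \<le> 2 + G N y powr p" by linarith
          then have "s N * q N y \<le> s N * (2 + G N y powr p)" using s0[of N] by (intro mult_left_mono) auto
          moreover have "s N * q N y = mean_osc M (fn N) y (3 * r N)" using s0[of N] by (simp add: q_def r)
          ultimately have "ennreal (mean_osc M (fn N) y (3 * r N)) \<le> ennreal (s N * (2 + G N y powr p))" by (simp add: ennreal_leI)
          also have "\<dots> = ennreal (s N) * (ennreal 2 + ennreal (G N y powr p))"
            using s0[of N] by (subst ennreal_mult) (auto simp: ennreal_plus)
          finally show ?thesis using True by simp
        qed simp
      qed
      also have "\<dots> = ennreal (s N) * (ennreal 2 * ennreal (V x0 (real R + 1)) + (\<integral>\<^sup>+y. ennreal (G N y powr p) \<partial>M))"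
        by (simp add: nn_integral_cmult nn_integral_add nn_integral_cmult_indicator emeasure_ball del: ennreal_numeral)
      also have "\<dots> \<le> ennreal (s N) * (ennreal 2 * ennreal (V x0 (real R + 1)) + ennreal A)"
        by (intro mult_left_mono add_left_mono Gp) auto
      also have "\<dots> = ennreal (s N * (2 * V x0 (real R + 1) + A))"
        using s0[of N] A by (simp add: ennreal_mult[symmetric] ennreal_plus[symmetric] del: ennreal_plus ennreal_numeral)
      finally have "(\<integral>\<^sup>+x\<in>ball x0 (real R). ennreal (w n x) \<partial>M) \<le> ennreal (D ^ 3 + D ^ 4) * ennreal (s N * (2 * V x0 (real R + 1) + A))"
        by (simp add: mult_left_mono)
      also have "\<dots> = ennreal (Y * s N)"
        using D_pos s0[of N] A by (subst ennreal_mult[symmetric]) (auto simp: Y_def mult_ac intro!: mult_nonneg_nonneg add_nonneg_nonneg)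
      also have "\<dots> \<le> ennreal (Y * (1 / a) ^ n)"
      proof (intro ennreal_leI mult_left_mono Y)
        have "(1 / a) ^ N \<le> (1 / a) ^ n" using a by (intro power_decreasing) (auto simp: N_def)
        then show "s N \<le> (1 / a) ^ n" using sa[of N] by linarith
      qed
      finally show ?thesis .
    qed
    have "(\<integral>\<^sup>+x. (\<Sum>n. ennreal (w n x) * indicator (ball x0 (real R)) x) \<partial>M) = (\<Sum>n. \<integral>\<^sup>+x\<in>ball x0 (real R). ennreal (w n x) \<partial>M)"
      by (rule nn_integral_suminf) (simp add: w_def)
    also have "\<dots> \<le> (\<Sum>n. ennreal (Y * (1 / a) ^ n))" by (intro suminf_le wb) auto
    also have "\<dots> = ennreal (Y * (1 / (1 - 1 / a)))"
      using a Y by (intro suminf_ennreal_eq sums_mult geometric_sums) auto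
    also have "\<dots> < \<infinity>" by simp
    finally have "AE x in M. (\<Sum>n. ennreal (w n x) * indicator (ball x0 (real R)) x) \<noteq> \<infinity>"
      by (intro nn_integral_PInf_AE) (auto simp: w_def)
    then show ?thesis
    proof eventually_elim
      case (elim x)
      show ?case
      proof
        assume x: "x \<in> ball x0 (real R)"
        then have "(\<Sum>n. ennreal (w n x)) \<noteq> \<top>" using elim by simp
        then have "summable (\<lambda>n. w n x)" by (intro summable_suminf_not_top) (auto simp: w_def)
        then have "(\<lambda>n. w n x) \<longlonglongrightarrow> 0" by (rule summable_LIMSEQ_zero)
        then have "(\<lambda>n. fn (n + Suc R) x - u (n + Suc R) x) \<longlonglongrightarrow> 0"
          unfolding w_def by (rule tendsto_rabs_zero_cancel)
        then have d: "(\<lambda>n. fn n x - u n x) \<longlonglongrightarrow> 0" by (rule LIMSEQ_offset)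
        obtain n0 :: nat where n0: "\<bar>f x\<bar> \<le> real n0" using real_arch_simple by blast
        have "(\<lambda>n. fn n x) \<longlonglongrightarrow> f x"
        proof (rule tendsto_eventually)
          show "\<forall>\<^sub>F n in sequentially. fn n x = f x"
            using eventually_ge_at_top[of n0]
          proof eventually_elim
            case (elim n)
            then have "\<bar>f x\<bar> \<le> real (Suc n)" using n0 by simp
            then show ?case by (auto simp: fn_def truncate_def)
          qed
        qed
        from tendsto_diff[OF this d] show "(\<lambda>n. u n x) \<longlonglongrightarrow> f x" by simp
      qed
    qed
  qed
  have "AE x in M. \<forall>R::nat. x \<in> ball x0 (real R) \<longrightarrow> (\<lambda>n. u n x) \<longlonglongrightarrow> f x"
    unfolding AE_all_countable using conv_ball by blast
  then have "AE x in M. (\<lambda>n. u n x) \<longlonglongrightarrow> f x"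
  proof eventually_elim
    case (elim x)
    obtain R :: nat where "dist x0 x < real R" using reals_Archimedean2 by blast
    then show ?case using elim by auto
  qed
  then obtain N0 where N0: "N0 \<in> null_sets M" "\<And>x. x \<notin> N0 \<Longrightarrow> (\<lambda>n. u n x) \<longlonglongrightarrow> f x"
    unfolding eventually_ae_filter by auto

  obtain H where H: "H \<in> borel_measurable M" and intH: "(\<integral>\<^sup>+x. epowr (H x) p \<partial>M) \<le> ennreal (3 * 2 powr p * A)"
    and comb: "\<forall>j. \<exists>h \<in> tail_combinations G j. \<forall>x. ennreal (h x) \<le> H x"
    using dominated_convex_combinations[where G = G and M = M, OF p Gm G0 A Gp] by blast
  have toborel: "g \<in> borel_measurable borel" if "g \<in> borel_measurable M" for g :: "'a \<Rightarrow> ennreal"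
    using that by (simp add: measurable_cong_sets[OF sets_M refl])
  define g where "g = (\<lambda>x. ennreal K * H x)"
  have gM [measurable]: "g \<in> borel_measurable M" unfolding g_def using H by simp
  have ug: "ennreal \<bar>f (c 1) - f (c 0)\<bar> \<le> curve_integral c g"
    if c: "c \<in> AC_curves - {c \<in> space curve_borel. c 0 \<in> N0 \<or> c 1 \<in> N0}" for c
  proof -
    have AC: "c \<in> AC_curves" and cN: "c 0 \<notin> N0" "c 1 \<notin> N0" using c by (auto simp: AC_curves_def)
    define \<Lambda> where "\<Lambda> = (LINT t:{0<..<1}|lborel. metric_speed c t)"
    have d\<Lambda>: "dist (c 0) (c 1) \<le> \<Lambda>"
      unfolding \<Lambda>_def by (rule speed_bound_le[OF speed_bound_metric_speed[OF AC]]) auto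
    show ?thesis
    \<comment> \<open>A curve of zero length has coinciding endpoints. Otherwise the scales
      eventually drop below the length, as the estimate along curves requires.\<close>
    proof (cases "\<Lambda> \<le> 0")
      case True
      then have "dist (c 0) (c 1) \<le> 0" using d\<Lambda> by linarith
      then show ?thesis by simp
    next
      case False
      then have \<Lambda>: "0 < \<Lambda>" by simp
      show ?thesis
      proof (rule ennreal_le_epsilon)
        fix e :: real assume e: "0 < e"
        obtain Rc where Rc: "\<forall>t\<in>{0..1}. dist x0 (c t) < Rc" using curve_bounded[OF AC] by blast
        have "(\<lambda>n. (1 / a) ^ n) \<longlonglongrightarrow> 0" using a by (intro LIMSEQ_power_zero) auto
        then have "\<forall>\<^sub>F n in sequentially. (1 / a) ^ n < \<Lambda>" using \<Lambda> by (rule order_tendstoD(2))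
        moreover have "\<forall>\<^sub>F n in sequentially. Rc < real (Suc n)"
        proof -
          obtain n0 :: nat where "Rc < real n0" using reals_Archimedean2 by blast
          then have "Rc < real (Suc n)" if "n0 \<le> n" for n using that by linarith
          then show ?thesis unfolding eventually_sequentially by blast
        qed
        moreover have "\<forall>\<^sub>F n in sequentially. \<bar>u n (c 0) - f (c 0)\<bar> < e / 3"
          using N0(2)[OF cN(1)] e by (intro order_tendstoD(2)[OF tendsto_rabs_zero]) (auto intro: LIM_zero)
        moreover have "\<forall>\<^sub>F n in sequentially. \<bar>u n (c 1) - f (c 1)\<bar> < e / 3"
          using N0(2)[OF cN(2)] e by (intro order_tendstoD(2)[OF tendsto_rabs_zero]) (auto intro: LIM_zero)
        moreover have "\<forall>\<^sub>F n in sequentially. K * (\<delta> n * \<Lambda>) < e / 3"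
        proof -
          have "(\<lambda>n. K * (inverse (real (Suc n)) * \<Lambda>)) \<longlonglongrightarrow> K * (0 * \<Lambda>)"
            by (intro tendsto_intros LIMSEQ_inverse_real_of_nat)
          then have "(\<lambda>n. K * (\<delta> n * \<Lambda>)) \<longlonglongrightarrow> 0" by (simp add: \<delta>_def inverse_eq_divide)
          then show ?thesis by (rule order_tendstoD(2)) (use e in simp)
        qed
        ultimately have "\<forall>\<^sub>F n in sequentially. (1 / a) ^ n < \<Lambda> \<and> Rc < real (Suc n) \<and> \<bar>u n (c 0) - f (c 0)\<bar> < e / 3 \<and>
            \<bar>u n (c 1) - f (c 1)\<bar> < e / 3 \<and> K * (\<delta> n * \<Lambda>) < e / 3"
          by eventually_elim simp
        then obtain j where j: "\<And>n. j \<le> n \<Longrightarrow> (1 / a) ^ n < \<Lambda> \<and> Rc < real (Suc n) \<and> \<bar>u n (c 0) - f (c 0)\<bar> < e / 3 \<and>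
            \<bar>u n (c 1) - f (c 1)\<bar> < e / 3 \<and> K * (\<delta> n * \<Lambda>) < e / 3"
          unfolding eventually_sequentially by blast
        have est: "ennreal \<bar>f (c 1) - f (c 0)\<bar> \<le> ennreal K * curve_integral c (\<lambda>x. ennreal (G n x)) + ennreal e" if n: "j \<le> n" for n
        proof -
          have Gb: "(\<lambda>x. ennreal (G n x)) \<in> borel_measurable borel" "(\<lambda>x. ennreal (q n x)) \<in> borel_measurable borel"
            by (intro toborel; measurable)+
          have "s n \<le> \<Lambda>" using sa[of n] j[OF n] by linarith
          then have "r n \<le> \<Lambda>" using s0[of n] by (simp add: r_def)
          then have "ennreal \<bar>u n (c 1) - u n (c 0)\<bar> \<le> ennreal (2 * D ^ 3 / r n) * curve_integral c (\<lambda>z. ennreal (mean_osc M (fn n) z (3 * r n)))"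
            unfolding u_def \<Lambda>_def by (rule average_along_curve[OF fnL r(1) AC])
          also have "(\<lambda>z. ennreal (mean_osc M (fn n) z (3 * r n))) = (\<lambda>z. ennreal (s n) * ennreal (q n z))"
            using s0[of n] q0 by (auto simp: q_def r(3) ennreal_mult[symmetric])
          also have "curve_integral c (\<lambda>z. ennreal (s n) * ennreal (q n z)) = ennreal (s n) * curve_integral c (\<lambda>z. ennreal (q n z))"
            by (rule curve_integral_cmult[OF AC Gb(2)])
          also have "ennreal (2 * D ^ 3 / r n) * (ennreal (s n) * curve_integral c (\<lambda>z. ennreal (q n z))) = ennreal K * curve_integral c (\<lambda>z. ennreal (q n z))"
            using s0[of n] D_pos by (simp add: r_def K_def mult.assoc[symmetric] ennreal_mult[symmetric])
          also have "curve_integral c (\<lambda>z. ennreal (q n z)) \<le> curve_integral c (\<lambda>z. ennreal (G n z) + ennreal (\<delta> n))"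
          proof (rule curve_integral_mono)
            fix t :: real assume "t \<in> {0<..<1}"
            then have "dist x0 (c t) < Rc" using Rc by simp
            then have "dist x0 (c t) < real (Suc n)" using j[OF n] by linarith
            then have "ennreal (q n (c t)) \<le> ennreal (G n (c t) + \<delta> n)" by (intro ennreal_leI qG)
            then show "ennreal (q n (c t)) \<le> ennreal (G n (c t)) + ennreal (\<delta> n)"
              using G0 by (simp add: \<delta>_def)
          qed
          also have "curve_integral c (\<lambda>z. ennreal (G n z) + ennreal (\<delta> n)) = curve_integral c (\<lambda>z. ennreal (G n z)) + ennreal (\<delta> n * \<Lambda>)"
          proof -
            have "curve_integral c (\<lambda>z. ennreal (G n z) + ennreal (\<delta> n)) =
              (\<integral>\<^sup>+t. ennreal (G n (c t)) * ennreal (metric_speed c t) * indicator {0<..<1} t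
                 + ennreal (\<delta> n) * ennreal (metric_speed c t) * indicator {0<..<1} t \<partial>lborel)"
              unfolding curve_integral_def by (simp add: distrib_right)
            also have "\<dots> = curve_integral c (\<lambda>z. ennreal (G n z)) + curve_integral c (\<lambda>z. ennreal (\<delta> n) * 1)"
              unfolding curve_integral_def using curve_weight_measurable[OF AC Gb(1)] curve_weight_measurable[OF AC, of "\<lambda>_. ennreal (\<delta> n)"]
              by (subst nn_integral_add) auto
            also have "curve_integral c (\<lambda>z. ennreal (\<delta> n) * 1) = ennreal (\<delta> n) * curve_integral c (\<lambda>z. 1)"
              by (rule curve_integral_cmult[OF AC]) simp
            also have "curve_integral c (\<lambda>z. 1) = ennreal \<Lambda>"
              unfolding curve_integral_def \<Lambda>_def using nn_integral_speed[OF AC] by simp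
            also have "ennreal (\<delta> n) * ennreal \<Lambda> = ennreal (\<delta> n * \<Lambda>)" using \<Lambda> by (simp add: \<delta>_def ennreal_mult[symmetric])
            finally show ?thesis .
          qed
          finally have 1: "ennreal \<bar>u n (c 1) - u n (c 0)\<bar> \<le> ennreal K * (curve_integral c (\<lambda>z. ennreal (G n z)) + ennreal (\<delta> n * \<Lambda>))"
            by (simp add: mult_left_mono)
          also have "\<dots> = ennreal K * curve_integral c (\<lambda>z. ennreal (G n z)) + ennreal (K * (\<delta> n * \<Lambda>))"
          proof -
            have "ennreal (K * (\<delta> n * \<Lambda>)) = ennreal K * ennreal (\<delta> n * \<Lambda>)"
              using K \<Lambda> by (intro ennreal_mult) (auto simp: \<delta>_def)
            then show ?thesis by (simp only: distrib_left)
          qed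
          also have "\<dots> \<le> ennreal K * curve_integral c (\<lambda>z. ennreal (G n z)) + ennreal (e / 3)"
            using j[OF n] by (intro add_left_mono ennreal_leI) auto
          finally have 1: "ennreal \<bar>u n (c 1) - u n (c 0)\<bar> \<le> ennreal K * curve_integral c (\<lambda>z. ennreal (G n z)) + ennreal (e / 3)" .
          have "\<bar>f (c 1) - f (c 0)\<bar> \<le> \<bar>u n (c 1) - u n (c 0)\<bar> + 2 * e / 3" using j[OF n] by linarith
          then have "ennreal \<bar>f (c 1) - f (c 0)\<bar> \<le> ennreal (\<bar>u n (c 1) - u n (c 0)\<bar> + 2 * e / 3)" by (rule ennreal_leI)
          also have "\<dots> = ennreal \<bar>u n (c 1) - u n (c 0)\<bar> + ennreal (2 * e / 3)" using e by (intro ennreal_plus) auto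
          also have "\<dots> \<le> (ennreal K * curve_integral c (\<lambda>z. ennreal (G n z)) + ennreal (e / 3)) + ennreal (2 * e / 3)"
            using 1 by (rule add_right_mono)
          also have "\<dots> = ennreal K * curve_integral c (\<lambda>z. ennreal (G n z)) + ennreal e"
            using e by (simp add: add.assoc ennreal_plus[symmetric] del: ennreal_plus)
          finally show ?thesis .
        qed
        obtain h where h: "h \<in> tail_combinations G j" "\<And>x. ennreal (h x) \<le> H x" using comb by blast
        then obtain I w where I: "h = (\<lambda>x. \<Sum>n\<in>I. w n * G n x)" "finite I" "I \<subseteq> {j..}" "\<forall>n. 0 \<le> w n" "(\<Sum>n\<in>I. w n) = 1"
          unfolding tail_combinations_def by auto
        have hw: "ennreal (h x) = (\<Sum>n\<in>I. ennreal (w n) * ennreal (G n x))" for x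
        proof -
          have "(\<Sum>n\<in>I. ennreal (w n) * ennreal (G n x)) = (\<Sum>n\<in>I. ennreal (w n * G n x))"
            using I(4) G0 by (simp add: ennreal_mult)
          also have "\<dots> = ennreal (\<Sum>n\<in>I. w n * G n x)" using I(4) G0 by (intro sum_ennreal) auto
          finally show ?thesis by (simp add: I(1))
        qed
        have wsum: "(\<Sum>n\<in>I. ennreal (w n)) = 1" using I by (simp add: sum_ennreal)
        have Gb: "(\<lambda>x. ennreal (G n x)) \<in> borel_measurable borel" for n by (intro toborel) measurable
        have CIh: "curve_integral c (\<lambda>x. ennreal (h x)) = (\<Sum>n\<in>I. ennreal (w n) * curve_integral c (\<lambda>x. ennreal (G n x)))"
        proof -
          have "curve_integral c (\<lambda>x. ennreal (h x)) = curve_integral c (\<lambda>x. \<Sum>n\<in>I. ennreal (w n) * ennreal (G n x))"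
            by (simp only: hw)
          also have "\<dots> = (\<Sum>n\<in>I. curve_integral c (\<lambda>x. ennreal (w n) * ennreal (G n x)))"
            using Gb by (intro curve_integral_sum[OF AC]) measurable
          also have "\<dots> = (\<Sum>n\<in>I. ennreal (w n) * curve_integral c (\<lambda>x. ennreal (G n x)))"
            by (intro sum.cong refl curve_integral_cmult[OF AC Gb])
          finally show ?thesis .
        qed
        have "ennreal \<bar>f (c 1) - f (c 0)\<bar> = (\<Sum>n\<in>I. ennreal (w n)) * ennreal \<bar>f (c 1) - f (c 0)\<bar>" by (simp add: wsum)
        also have "\<dots> = (\<Sum>n\<in>I. ennreal (w n) * ennreal \<bar>f (c 1) - f (c 0)\<bar>)" by (rule sum_distrib_right)
        also have "\<dots> \<le> (\<Sum>n\<in>I. ennreal (w n) * (ennreal K * curve_integral c (\<lambda>x. ennreal (G n x)) + ennreal e))"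
          using I(3) by (intro sum_mono mult_left_mono est) auto
        also have "\<dots> = ennreal K * curve_integral c (\<lambda>x. ennreal (h x)) + (\<Sum>n\<in>I. ennreal (w n)) * ennreal e"
          by (simp add: CIh distrib_left sum.distrib sum_distrib_left sum_distrib_right mult_ac)
        also have "\<dots> \<le> ennreal K * curve_integral c H + ennreal e"
          unfolding wsum using h(2) by (intro add_mono mult_left_mono curve_integral_mono) auto
        also have "ennreal K * curve_integral c H = curve_integral c g"
          unfolding g_def by (rule curve_integral_cmult[OF AC toborel[OF H], symmetric])
        finally show "ennreal \<bar>f (c 1) - f (c 0)\<bar> \<le> curve_integral c g + ennreal e" .
      qed
    qed
  qed
  have "(\<integral>\<^sup>+x. epowr (g x) p \<partial>M) = ennreal (K powr p) * (\<integral>\<^sup>+x. epowr (H x) p \<partial>M)"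
    unfolding g_def using K H by (simp add: epowr_mult nn_integral_cmult)
  also have "\<dots> \<le> ennreal (K powr p) * ennreal (3 * 2 powr p * A)" using intH by (rule mult_left_mono) simp
  also have "\<dots> = ennreal (K powr p * (3 * 2 powr p * A))" using A by (simp add: ennreal_mult[symmetric])
  finally have gp: "(\<integral>\<^sup>+x. epowr (g x) p \<partial>M) \<le> ennreal (K powr p * (3 * 2 powr p * A))" .
  then have "Lp_norm M p g \<le> epowr (ennreal (K powr p * (3 * 2 powr p * A))) (1 / p)"
    unfolding Lp_norm_def using p by (intro epowr_mono) auto
  also have "\<dots> = ennreal (K * (3 * 2 powr p * A) powr (1 / p))"
  proof -
    have "(K powr p * (3 * 2 powr p * A)) powr (1 / p) = (K powr p) powr (1 / p) * (3 * 2 powr p * A) powr (1 / p)"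
      by (rule powr_mult)
    then show ?thesis using K A p by (simp add: powr_powr)
  qed
  finally have norm: "Lp_norm M p g \<le> ennreal (K * (3 * 2 powr p * A) powr (1 / p))" .
  then have "Lp_norm M p g < \<infinity>" by (rule le_less_trans) simp
  then have "g \<in> Lp_weak_upper_gradients M p f"
    using ug negligible_curves_endpoints[OF sets_M N0(1), of p] toborel[OF gM]
    unfolding Lp_weak_upper_gradients_def weak_upper_gradient_def by blast
  then show ?thesis using norm unfolding K_def by blast
qed

lemma Sobolev_le_weak_norm:
  assumes p: "1 < p"
  shows "\<exists>C>0. \<forall>f\<in>L1_loc M. Sobolev_norm M p f \<le> ennreal C * weak_Lp_norm M p (\<lambda>x y. \<phi> x y powr (\<gamma> * p) / vol M x y)
         (\<lambda>x y. mean_osc M f x (dist x y) / (dist x y * \<phi> x y powr \<gamma>))"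
proof -
  define x0 :: 'a where "x0 = undefined"
  obtain K3 K2 where K3: "0 < K3" and K2: "0 < K2" and good: "\<forall>f\<in>L1_loc M. \<forall>A>0. \<forall>n>0. \<forall>\<delta>>0. \<forall>R. \<forall>L0::nat.
    ennreal K2 * epowr (weak_Lp_norm M p (\<lambda>x y. \<phi> x y powr (\<gamma> * p) / vol M x y)
         (\<lambda>x y. mean_osc M f x (dist x y) / (dist x y * \<phi> x y powr \<gamma>))) p \<le> ennreal A \<longrightarrow>
    (\<exists>k\<ge>L0. (\<integral>\<^sup>+x. (if dist x0 x < R \<and> \<delta> < mean_osc M (truncate n f) x (scale k) / scale k
        then ennreal ((mean_osc M (truncate n f) x (scale k) / scale k) powr p) else 0) \<partial>M) \<le> ennreal (K3 * A))"
    using good_scale[OF p, of \<gamma> x0] by (elim exE conjE) (rule that)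
  define C where "C = 6 * D ^ 3 * (3 * 2 powr p * (K3 * K2)) powr (1 / p)"
  have C: "0 < C" using D_pos K3 K2 by (simp add: C_def)
  have "Sobolev_norm M p f \<le> ennreal C * weak_Lp_norm M p (\<lambda>x y. \<phi> x y powr (\<gamma> * p) / vol M x y)
         (\<lambda>x y. mean_osc M f x (dist x y) / (dist x y * \<phi> x y powr \<gamma>))" (is "_ \<le> _ * ?N") if f: "f \<in> L1_loc M" for f
  proof (cases ?N)
    case (real n0)
    \<comment> \<open>The bound A has to be positive, so the weak norm is replaced by any t > 0
      above it; when the weak norm vanishes, t tends to zero.\<close>
    have step: "Sobolev_norm M p f \<le> ennreal (C * t)" if t: "0 < t" "n0 \<le> t" for t
    proof -
      define A where "A = K2 * t powr p"
      have A: "0 < A" using K2 t by (simp add: A_def)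
      have "epowr ?N p \<le> ennreal (t powr p)"
        unfolding real(2) using real(1) t p by (simp add: ennreal_leI powr_mono2)
      then have NA: "ennreal K2 * epowr ?N p \<le> ennreal A"
        unfolding A_def using K2 by (simp add: ennreal_mult mult_left_mono)
      have "\<exists>g\<in>Lp_weak_upper_gradients M p f. Lp_norm M p g \<le> ennreal (6 * D ^ 3 * (3 * 2 powr p * (K3 * A)) powr (1 / p))"
      proof (rule gradient_from_good_scales[OF p f, where ?x0.0 = x0])
        show "0 < K3 * A" using K3 A by simp
        show "\<exists>k\<ge>L0. (\<integral>\<^sup>+x. (if dist x0 x < R \<and> \<delta> < mean_osc M (truncate n f) x (scale k) / scale k
          then ennreal ((mean_osc M (truncate n f) x (scale k) / scale k) powr p) else 0) \<partial>M) \<le> ennreal (K3 * A)"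
          if "0 < n" "0 < \<delta>" for n \<delta> R and L0 :: nat
          using good[rule_format, OF f A that NA] .
      qed
      then obtain g where g: "g \<in> Lp_weak_upper_gradients M p f" "Lp_norm M p g \<le> ennreal (6 * D ^ 3 * (3 * 2 powr p * (K3 * A)) powr (1 / p))" by blast
      have "Sobolev_norm M p f \<le> Lp_norm M p g" by (rule Sobolev_norm_le[OF p sets_M g(1)])
      also note g(2)
      also have "6 * D ^ 3 * (3 * 2 powr p * (K3 * A)) powr (1 / p) = C * t"
      proof -
        have "3 * 2 powr p * (K3 * A) = (3 * 2 powr p * (K3 * K2)) * t powr p" by (simp add: A_def)
        then have "(3 * 2 powr p * (K3 * A)) powr (1 / p) = (3 * 2 powr p * (K3 * K2)) powr (1 / p) * (t powr p) powr (1 / p)"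
          by (simp only: powr_mult)
        also have "(t powr p) powr (1 / p) = t" using t p by (simp add: powr_powr)
        finally show ?thesis by (simp add: C_def)
      qed
      finally show ?thesis .
    qed
    show ?thesis
    proof (cases "n0 = 0")
      case True
      have "Sobolev_norm M p f \<le> 0"
      proof (rule ennreal_le_epsilon)
        fix e :: real assume e: "0 < e"
        have "Sobolev_norm M p f \<le> ennreal (C * (e / C))" by (rule step) (use e C True in auto)
        moreover have "C * (e / C) = e" using C by simp
        ultimately show "Sobolev_norm M p f \<le> 0 + ennreal e" by simp
      qed
      then show ?thesis by simp
    next
      case False
      then have "Sobolev_norm M p f \<le> ennreal (C * n0)" by (intro step) (use real(1) in auto)
      also have "\<dots> = ennreal C * ennreal n0" using C real(1) by (intro ennreal_mult) auto
      finally show ?thesis unfolding real(2) .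
    qed
  next
    case top then show ?thesis using C by (simp add: ennreal_mult_top)
  qed
  then show ?thesis using C by blast
qed

end

section \<open>Verification of the abstract assumptions\<close>

lemma doubling_space_of_doubling:
  fixes M :: "'a::metric_space measure"
  assumes "metric_measure M" "doubling M"
  shows "\<exists>D. doubling_space M D"
proof -
  obtain C where C: "1 \<le> C" and d: "\<And>x r. 0 < r \<Longrightarrow> 0 < emeasure M (ball x (2 * r)) \<and>
     emeasure M (ball x (2 * r)) \<le> ennreal C * emeasure M (ball x r) \<and>
     ennreal C * emeasure M (ball x r) < \<infinity>"
    using assms(2) unfolding doubling_def by blast
  have fin: "emeasure M (ball x r) < \<infinity>" for x r
  proof (cases "0 < r")
    case True
    have "1 * emeasure M (ball x r) \<le> ennreal C * emeasure M (ball x r)"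
      using C by (intro mult_right_mono) auto
    then show ?thesis using d[OF True, of x] by (auto intro: le_less_trans)
  next
    case False
    then have "ball x r = {}" by simp
    then show ?thesis by (simp only: emeasure_empty) simp
  qed
  show ?thesis
  proof (intro exI[of _ C] doubling_space.intro C fin)
    show "sets M = sets borel" using assms(1) by (simp add: metric_measure_def)
    fix x :: 'a and r :: real assume r: "0 < r"
    show "0 < emeasure M (ball x r)" using d[of "r / 2" x] r by simp
    have "ennreal (measure M (ball x (2 * r))) \<le> ennreal (C * measure M (ball x r))"
      using d[OF r, of x] fin[of x r] fin[of x "2 * r"] C
      by (simp add: emeasure_eq_ennreal_measure ennreal_mult)
    then show "measure M (ball x (2 * r)) \<le> C * measure M (ball x r)"
      using C by (subst (asm) ennreal_le_iff) auto
  qed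
qed

context doubling_space
begin

lemma scaled_gauge_dist:
  assumes a: "1 < a" and C0: "1 < C0"
    and annulus: "\<And>k x. k0 \<le> k \<Longrightarrow> C0 * V x ((1 / a) ^ k) \<le> V x (a * (1 / a) ^ k)"
  shows "scaled_gauge M D dist a a C0 k0 (\<lambda>k x. (1 / a) ^ k)"
proof -
  interpret gauge M D dist by (rule gauge_dist)
  show ?thesis
  proof
    show "\<exists>c>0. \<forall>x\<in>ball x0 R. \<forall>k. c * (1 / a) ^ k \<le> (1 / a) ^ k \<and> (1 / a) ^ k \<le> 1 / c" for x0 :: 'a and R
      using a by (intro exI[of _ 1]) (auto intro!: power_le_one)
  qed (use assms in auto)
qed

lemma scaled_gauge_vol:
  assumes a: "1 < a" and C0: "1 < C0"
    and annulus: "\<And>k x. k0 \<le> k \<Longrightarrow> C0 * V x ((1 / a) ^ k) \<le> V x (a * (1 / a) ^ k)"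
  shows "\<exists>B. scaled_gauge M D (vol M) a B C0 k0 (\<lambda>k x. V x ((1 / a) ^ k))"
proof -
  interpret gauge M D "vol M" by (rule gauge_vol)
  obtain B where B: "1 \<le> B" "\<And>x y r s. 0 < r \<Longrightarrow> ball y s \<subseteq> ball x (a * r) \<Longrightarrow> V y s \<le> B * V x r"
    using V_scale[of a] by blast
  have s: "0 < (1 / a) ^ k" for k using a by simp
  \<comment> \<open>Iterated doubling: each division of the radius by a divides the volume by at
    most B.\<close>
  have decay: "(1 / B) ^ k * V x 1 \<le> V x ((1 / a) ^ k)" for k x
  proof (induction k)
    case (Suc k)
    have "V x ((1 / a) ^ k) \<le> B * V x ((1 / a) ^ Suc k)" by (rule B(2)[OF s]) (use a in simp)
    then have "(1 / B) ^ k * V x 1 \<le> B * V x ((1 / a) ^ Suc k)" using Suc by linarith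
    then have "1 / B * ((1 / B) ^ k * V x 1) \<le> 1 / B * (B * V x ((1 / a) ^ Suc k))"
      using B(1) by (intro mult_left_mono) auto
    then show ?case using B(1) by (simp add: mult.assoc)
  qed simp
  have "scaled_gauge M D (vol M) a B C0 k0 (\<lambda>k x. V x ((1 / a) ^ k))"
  proof
    show "V x ((1 / a) ^ k) \<le> vol M x y \<and> vol M x y \<le> B * V x ((1 / a) ^ k)"
      if "(1 / a) ^ k \<le> dist x y" "dist x y < a * (1 / a) ^ k" for k x y
      unfolding vol_def using that by (intro conjI V_mono B(2)[OF s] subset_ball) auto
    show "\<exists>c>0. \<forall>x\<in>ball x0 R. \<forall>k. c * (1 / B) ^ k \<le> V x ((1 / a) ^ k) \<and> V x ((1 / a) ^ k) \<le> 1 / c" for x0 R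
    proof (cases "0 < R")
      case R: True
      obtain C where C: "1 \<le> C" "\<And>x y r s. 0 < r \<Longrightarrow> ball y s \<subseteq> ball x (2 * R * r) \<Longrightarrow> V y s \<le> C * V x r"
        using V_scale[of "2 * R"] by blast
      \<comment> \<open>c combines a lower bound for the unit balls about points of
        \<open>ball x0 R\<close> with an upper bound for all balls of radius at most 1 about such
        points.\<close>
      define c where "c = min (V x0 R / C) (1 / V x0 (R + 1))"
      have pos: "0 < V x0 R" "0 < V x0 (R + 1)" using R by (auto intro: V_pos)
      have c: "0 < c" "c \<le> V x0 R / C" "c \<le> 1 / V x0 (R + 1)" using pos C(1) by (auto simp: c_def)
      have "c * (1 / B) ^ k \<le> V x ((1 / a) ^ k) \<and> V x ((1 / a) ^ k) \<le> 1 / c" if x: "x \<in> ball x0 R" for x k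
      proof
        have "ball x0 R \<subseteq> ball x (2 * R * 1)"
        proof
          fix y assume "y \<in> ball x0 R"
          then show "y \<in> ball x (2 * R * 1)" using x dist_triangle3[of x y x0] by simp
        qed
        then have "V x0 R \<le> C * V x 1" by (rule C(2)[rotated]) simp
        then have "V x0 R / C \<le> V x 1" using C(1) by (simp add: divide_le_eq mult.commute)
        then have "c \<le> V x 1" using c(2) by linarith
        then have "c * (1 / B) ^ k \<le> V x 1 * (1 / B) ^ k" using B(1) by (intro mult_right_mono) auto
        also have "\<dots> = (1 / B) ^ k * V x 1" by (rule mult.commute)
        also note decay
        finally show "c * (1 / B) ^ k \<le> V x ((1 / a) ^ k)" .
        have "ball x ((1 / a) ^ k) \<subseteq> ball x0 (R + 1)"
        proof
          fix y assume "y \<in> ball x ((1 / a) ^ k)"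
          moreover have "(1 / a) ^ k \<le> 1" using a by (intro power_le_one) auto
          ultimately show "y \<in> ball x0 (R + 1)" using x dist_triangle[of x0 y x] by simp
        qed
        then have "V x ((1 / a) ^ k) \<le> V x0 (R + 1)" by (rule V_mono)
        also have "\<dots> \<le> 1 / c" using c(1,3) pos(2) by (simp add: field_simps)
        finally show "V x ((1 / a) ^ k) \<le> 1 / c" .
      qed
      then show ?thesis using c(1) by blast
    next
      case False
      then have "ball x0 R = {}" by simp
      then show ?thesis by (simp only: ball_simps) (intro exI[of _ 1], simp)
    qed
  qed (use a B C0 annulus V_pos[OF s] in auto)
  then show ?thesis ..
qed

text \<open>Two distinct points bound the diameter from below, also when it is infinite, so reverse
  doubling applies to all sufficiently small powers of 1 / a.\<close>

lemma small_annuli: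
  assumes "reverse_doubling M" "(u::'a) \<noteq> v"
  shows "\<exists>a>1. \<exists>C0>1. \<exists>k0. \<forall>k\<ge>k0. \<forall>x. C0 * V x ((1 / a) ^ k) \<le> V x (a * (1 / a) ^ k)"
proof -
  obtain a C0 where a: "1 < a" and C0: "1 < C0" and rd: "\<And>(x::'a) r. 0 < r \<Longrightarrow>
     ennreal r < ediam (UNIV :: 'a set) / ennreal a \<Longrightarrow>
     ennreal C0 * emeasure M (ball x r) \<le> emeasure M (ball x (a * r))"
    using assms(1) unfolding reverse_doubling_def by blast
  have "0 < dist u v / a" using assms(2) a by simp
  then obtain k0 where k0: "(1 / a) ^ k0 < dist u v / a" using a real_arch_pow_inv[of "dist u v / a" "1 / a"] by auto
  have diam: "ennreal (dist u v) \<le> ediam (UNIV :: 'a set)"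
    unfolding ediam_def by (rule SUP_upper2[of u], simp, rule SUP_upper) simp
  have "C0 * V x ((1 / a) ^ k) \<le> V x (a * (1 / a) ^ k)" if k: "k0 \<le> k" for k x
  proof -
    have "(1 / a) ^ k \<le> (1 / a) ^ k0" using a k by (intro power_decreasing) auto
    then have "ennreal ((1 / a) ^ k) < ennreal (dist u v / a)" using k0 \<open>0 < dist u v / a\<close> by (intro ennreal_lessI) auto
    also have "\<dots> = ennreal (dist u v) / ennreal a" using a by (simp add: divide_ennreal)
    also have "\<dots> \<le> ediam (UNIV :: 'a set) / ennreal a" using diam by (rule divide_right_mono_ennreal)
    finally have "ennreal C0 * emeasure M (ball x ((1 / a) ^ k)) \<le> emeasure M (ball x (a * (1 / a) ^ k))"
      using a by (intro rd) auto
    then have "ennreal (C0 * V x ((1 / a) ^ k)) \<le> ennreal (V x (a * (1 / a) ^ k))"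
      using C0 by (simp add: emeasure_ball ennreal_mult)
    then show ?thesis by (subst (asm) ennreal_le_iff) auto
  qed
  then show ?thesis using a C0 by blast
qed

end

text \<open>In a one-point space the diameter is zero, reverse doubling is vacuous and no annuli are
  available; but f is constant there, and zero is an upper gradient.\<close>

lemma Sobolev_norm_trivial:
  fixes M :: "'a::metric_space measure"
  assumes p: "1 < p" and "sets M = sets borel" and eq: "\<And>x y::'a. x = y"
  shows "Sobolev_norm M p f = 0"
proof -
  have "(\<lambda>_. 0) \<in> Lp_weak_upper_gradients M p f"
    unfolding Lp_weak_upper_gradients_def weak_upper_gradient_def negligible_curves_def
    by (auto simp: Lp_norm_def intro!: exI[of _ "{}"]) (metis eq abs_zero diff_self ennreal_0 zero_le)
  from Sobolev_norm_le[OF assms(1,2) this] show ?thesis by (simp add: Lp_norm_def)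
qed

theorem corollary6p3:
  fixes M :: "'a::complete_space measure" and p \<gamma> :: real
  assumes "1 < p" and "\<gamma> \<noteq> 0"
    and "metric_measure M" and "doubling M" and "reverse_doubling M"
  shows "\<forall>\<phi>\<in>{dist, vol M}. \<exists>C\<^sub>1>0. \<exists>C\<^sub>2>0. \<forall>f\<in>L1_loc M.
    (let N = weak_Lp_norm M p (\<lambda>x y. \<phi> x y powr (\<gamma> * p) / vol M x y)
               (\<lambda>x y. mean_osc M f x (dist x y) / (dist x y * \<phi> x y powr \<gamma>))
     in Sobolev_norm M p f \<le> ennreal C\<^sub>1 * N \<and> N \<le> ennreal C\<^sub>2 * Hajlasz_norm M p f)"
proof
  fix \<phi> assume \<phi>: "\<phi> \<in> {dist, vol M}"
  obtain D where "doubling_space M D" using doubling_space_of_doubling[OF assms(3,4)] by blast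
  then interpret doubling_space M D .
  let ?N = "\<lambda>f. weak_Lp_norm M p (\<lambda>x y. \<phi> x y powr (\<gamma> * p) / vol M x y)
               (\<lambda>x y. mean_osc M f x (dist x y) / (dist x y * \<phi> x y powr \<gamma>))"
  have "gauge M D \<phi>" using \<phi> gauge_dist gauge_vol by auto
  then obtain C2 where C2: "0 < C2" "\<And>f. f \<in> L1_loc M \<Longrightarrow> ?N f \<le> ennreal C2 * Hajlasz_norm M p f"
    using gauge.weak_norm_le_Hajlasz[OF _ assms(1,2)] by blast
  obtain C1 where C1: "0 < C1" "\<And>f. f \<in> L1_loc M \<Longrightarrow> Sobolev_norm M p f \<le> ennreal C1 * ?N f"
  proof (cases "\<exists>u v::'a. u \<noteq> v")
    case True
    then obtain a C0 k0 where *: "1 < a" "1 < C0" "\<And>k x. k0 \<le> k \<Longrightarrow> C0 * V x ((1 / a) ^ k) \<le> V x (a * (1 / a) ^ k)"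
      using small_annuli[OF assms(5)] by blast
    have "\<exists>B \<Phi>. scaled_gauge M D \<phi> a B C0 k0 \<Phi>"
      using \<phi> scaled_gauge_dist[OF *] scaled_gauge_vol[OF *] by blast
    then obtain B \<Phi> where "scaled_gauge M D \<phi> a B C0 k0 \<Phi>" by blast
    from scaled_gauge.Sobolev_le_weak_norm[OF this assms(1), of \<gamma>] show ?thesis by (elim exE conjE) (rule that; blast)
  next
    case False
    then have "Sobolev_norm M p f = 0" for f by (intro Sobolev_norm_trivial assms(1) sets_M) blast
    then show ?thesis by (intro that[of 1]) auto
  qed
  show "\<exists>C\<^sub>1>0. \<exists>C\<^sub>2>0. \<forall>f\<in>L1_loc M. (let N = ?N f
     in Sobolev_norm M p f \<le> ennreal C\<^sub>1 * N \<and> N \<le> ennreal C\<^sub>2 * Hajlasz_norm M p f)"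
    unfolding Let_def using C1 C2 by blast
qed

end
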